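(* Let $I$ be a homogeneous ideal of a polynomial ring $R=k[x_1,\ldots,x_d]$ with $k$ an infinite field of characteristic zero or larger than any exponent appearing in the generators of the reverse lexicographic generic initial ideal $\operatorname{gin}_{\rm rev}(I)$. Fix an integer $0\le i\le d$. Then there exist nonnegative integers $\delta,e\in\mathbb N$ such that $\operatorname{sreg}_i(I^n)=\delta n+e$ for $n\gg 0$.
   Context: $R$ has the standard grading. Use the graded reverse lexicographic order with $x_1>\cdots>x_d$. For $g=(g_{ij})\in \mathrm{GL}_d(k)$ let $g$ act on $R$ by $x_i\mapsto \sum_j g_{ij}x_j$. There is a nonempty Zariski open subset of $\mathrm{GL}_d(k)$ on which the initial ideal $\operatorname{in}(g\cdot I)$ is constant; this constant value is the reverse lexicographic generic initial ideal $\operatorname{gin}_{\rm rev}(I)$. $\operatorname{reg}$ is Castelnuovo–Mumford regularity over $R$: $\operatorname{reg}(M)=\max\{j-i\mid \operatorname{Tor}_i^R(M,k)_j\ne 0\}$. Sectional regularity of a homogeneous ideal $J$: for $0\le i\le d$, $\operatorname{sreg}_i(J)=\operatorname{reg}(J+(\ell_{i+1},\ldots,\ell_d))$ for sufficiently general linear forms $\ell_{i+1},\ldots,\ell_d$, i.e. the common value for $\ell_m=\sum_j g_{mj}x_j$ with $(g_{mj})$ in a suitable nonempty Zariski open subset of $\mathrm{GL}_d(k)$ (depending on $J$). *)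

theory Defs
  imports
    "HOL-Library.Poly_Mapping"
    "HOL-Computational_Algebra.Computational_Algebra"
    "HOL-Algebra.Ideal_Product"
    "Jordan_Normal_Form.Determinant"
begin

text \<open>
  A monomial in variables indexed by \<open>'v\<close> is its finitely supported exponent vector
  \<open>'v \<Rightarrow>\<^sub>0 nat\<close>; a polynomial over \<open>'k\<close> is a finitely supported map from monomials to
  coefficients, with the convolution product of \<open>Poly_Mapping\<close>.

  Indices start at 0: the variable \<open>x\<^sub>i\<close> of the informal text is the variable with index
  \<open>i - 1\<close> here, and matrices and vectors follow the same convention.
\<close>

type_synonym ('v, 'k) mpol = "('v \<Rightarrow>\<^sub>0 nat) \<Rightarrow>\<^sub>0 'k"

definition mp_vars :: "('v, 'k::zero) mpol \<Rightarrow> 'v set" where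
  "mp_vars p = (\<Union>m\<in>Poly_Mapping.keys p. Poly_Mapping.keys m)"

text \<open>The polynomial ring \<open>k[x\<^sub>0, \<dots>, x\<^sub>d\<^sub>-\<^sub>1]\<close>.\<close>

definition mpr :: "nat \<Rightarrow> (nat, 'k::field) mpol ring" where
  "mpr d = \<lparr>carrier = {p. mp_vars p \<subseteq> {..<d}}, mult = (*), one = 1, zero = 0, add = (+)\<rparr>"

abbreviation mp_mono :: "('v \<Rightarrow>\<^sub>0 nat) \<Rightarrow> ('v, 'k::field) mpol" where
  "mp_mono m \<equiv> Poly_Mapping.single m 1"

abbreviation mp_const :: "'k \<Rightarrow> ('v, 'k::field) mpol" where
  "mp_const c \<equiv> Poly_Mapping.single 0 c"

abbreviation mp_var :: "'v \<Rightarrow> ('v, 'k::field) mpol" where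
  "mp_var v \<equiv> mp_mono (Poly_Mapping.single v 1)"

text \<open>Map the coefficients by \<open>h\<close> and substitute \<open>a v\<close> for each variable \<open>v\<close>.\<close>

definition mp_subst :: "('k \<Rightarrow> 'a) \<Rightarrow> ('v \<Rightarrow> 'a) \<Rightarrow> ('v, 'k::zero) mpol \<Rightarrow> 'a::comm_semiring_1" where
  "mp_subst h a p =
     (\<Sum>m\<in>Poly_Mapping.keys p. h (Poly_Mapping.lookup p m) *
        (\<Prod>v\<in>Poly_Mapping.keys m. a v ^ Poly_Mapping.lookup m v))"

section \<open>Grading\<close>

definition mono_deg :: "('v \<Rightarrow>\<^sub>0 nat) \<Rightarrow> nat" where
  "mono_deg m = (\<Sum>v\<in>Poly_Mapping.keys m. Poly_Mapping.lookup m v)"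

text \<open>The degree is an integer so that the same notion serves for shifted free modules;
  0 is homogeneous of every degree.\<close>

definition homog_of_deg :: "int \<Rightarrow> ('v, 'k::zero) mpol \<Rightarrow> bool" where
  "homog_of_deg j p \<longleftrightarrow> (\<forall>m\<in>Poly_Mapping.keys p. int (mono_deg m) = j)"

definition homog_ideal :: "nat \<Rightarrow> (nat, 'k::field) mpol set \<Rightarrow> bool" where
  "homog_ideal d I \<longleftrightarrow>
     (\<exists>S. S \<subseteq> carrier (mpr d) \<and> (\<forall>p\<in>S. \<exists>j. homog_of_deg j p) \<and> I = Idl\<^bsub>mpr d\<^esub> S)"

abbreviation ideal_power :: "nat \<Rightarrow> (nat, 'k::field) mpol set \<Rightarrow> nat \<Rightarrow> (nat, 'k) mpol set" where
  "ideal_power d I n \<equiv> I [^]\<^bsub>ideals_set (mpr d)\<^esub> n"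

section \<open>Generic initial ideals\<close>

text \<open>Graded reverse lexicographic order with \<open>x\<^sub>0 > x\<^sub>1 > \<dots>\<close>: in equal degrees, the monomial
  with the larger exponent at the last difference is the smaller one.\<close>

definition grevlex_less :: "(nat \<Rightarrow>\<^sub>0 nat) \<Rightarrow> (nat \<Rightarrow>\<^sub>0 nat) \<Rightarrow> bool" where
  "grevlex_less a b \<longleftrightarrow> mono_deg a < mono_deg b \<or>
     mono_deg a = mono_deg b \<and>
     (\<exists>l. Poly_Mapping.lookup b l < Poly_Mapping.lookup a l \<and>
          (\<forall>m>l. Poly_Mapping.lookup a m = Poly_Mapping.lookup b m))"

text \<open>Only meaningful for \<open>p \<noteq> 0\<close>.\<close>

definition lead_mono :: "(nat, 'k::zero) mpol \<Rightarrow> (nat \<Rightarrow>\<^sub>0 nat)" where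
  "lead_mono p = (THE m. m \<in> Poly_Mapping.keys p \<and>
     (\<forall>m'\<in>Poly_Mapping.keys p. m' \<noteq> m \<longrightarrow> grevlex_less m' m))"

definition initial_ideal :: "nat \<Rightarrow> (nat, 'k::field) mpol set \<Rightarrow> (nat, 'k) mpol set" where
  "initial_ideal d I = Idl\<^bsub>mpr d\<^esub> {mp_mono (lead_mono f) | f. f \<in> I \<and> f \<noteq> 0}"

definition GL :: "nat \<Rightarrow> 'k::field mat set" where
  "GL d = {g \<in> carrier_mat d d. invertible_mat g}"

definition row_form :: "nat \<Rightarrow> 'k::field mat \<Rightarrow> nat \<Rightarrow> (nat, 'k) mpol" where
  "row_form d g i = (\<Sum>j<d. mp_const (g $$ (i, j)) * mp_var j)"

definition gl_act :: "nat \<Rightarrow> 'k::field mat \<Rightarrow> (nat, 'k) mpol \<Rightarrow> (nat, 'k) mpol" where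
  "gl_act d g = mp_subst mp_const (row_form d g)"

text \<open>Zariski open subsets of \<open>GL\<^sub>d(k)\<close>: complements in \<open>GL\<^sub>d(k)\<close> of the common zeros of a
  set of polynomials in the matrix entries. Allowing \<open>1 / det\<close> as well would not give any
  further open sets, since denominators can be cleared.\<close>

definition zariski_open_GL :: "nat \<Rightarrow> 'k::field mat set \<Rightarrow> bool" where
  "zariski_open_GL d U \<longleftrightarrow>
     (\<exists>F :: (nat \<times> nat, 'k) mpol set. (\<forall>f\<in>F. mp_vars f \<subseteq> {..<d} \<times> {..<d}) \<and>
        U = {g \<in> GL d. \<exists>f\<in>F. mp_subst (\<lambda>c. c) (\<lambda>ij. g $$ ij) f \<noteq> 0})"

text \<open>The value \<open>v\<close> such that \<open>f g = v\<close> for all \<open>g\<close> in some nonempty Zariski open subset of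
  \<open>GL\<^sub>d(k)\<close>. Over an infinite field it is unique when it exists, as \<open>GL\<^sub>d(k)\<close> is then
  irreducible.\<close>

definition generic_value :: "nat \<Rightarrow> ('k::field mat \<Rightarrow> 'a) \<Rightarrow> 'a" where
  "generic_value d f =
     (THE v. \<exists>U. zariski_open_GL d U \<and> U \<noteq> {} \<and> (\<forall>g\<in>U. f g = v))"

definition gin_rev :: "nat \<Rightarrow> (nat, 'k::field) mpol set \<Rightarrow> (nat, 'k) mpol set" where
  "gin_rev d I = generic_value d (\<lambda>g. initial_ideal d (gl_act d g ` I))"

text \<open>Exponent vectors of the minimal generators of a monomial ideal: the monomials in it that
  are minimal with respect to divisibility.\<close>

definition mono_min_gens :: "(nat, 'k::field) mpol set \<Rightarrow> (nat \<Rightarrow>\<^sub>0 nat) set" where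
  "mono_min_gens G = {m. mp_mono m \<in> G \<and>
     (\<forall>m'. mp_mono m' \<in> G \<and> (\<forall>v. Poly_Mapping.lookup m' v \<le> Poly_Mapping.lookup m v) \<longrightarrow> m' = m)}"

section \<open>Tor and Castelnuovo--Mumford regularity\<close>

text \<open>
  Data of a complex \<open>\<cdots> \<rightarrow> F\<^sub>2 \<rightarrow> F\<^sub>1 \<rightarrow> F\<^sub>0 \<rightarrow> R\<close> of finitely generated graded free modules:
  \<open>F\<^sub>i\<close> is free of rank \<open>rk i\<close>, its \<open>b\<close>-th basis element has degree \<open>dg i b\<close>, the map
  \<open>F\<^sub>i\<^sub>+\<^sub>1 \<rightarrow> F\<^sub>i\<close> is given by the matrix \<open>dif i\<close>, and \<open>F\<^sub>0 \<rightarrow> R\<close> sends the \<open>b\<close>-th basis element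
  to \<open>aug $ b\<close>.
\<close>

record (overloaded) 'k free_cx =
  rk :: "nat \<Rightarrow> nat"
  dg :: "nat \<Rightarrow> nat \<Rightarrow> int"
  aug :: "(nat, 'k) mpol vec"
  dif :: "nat \<Rightarrow> (nat, 'k) mpol mat"

definition cx_mod :: "nat \<Rightarrow> 'k::field free_cx \<Rightarrow> nat \<Rightarrow> (nat, 'k) mpol vec set" where
  "cx_mod d F i = {v \<in> carrier_vec (rk F i). \<forall>b < rk F i. v $ b \<in> carrier (mpr d)}"

definition cx_homog :: "'k::field free_cx \<Rightarrow> nat \<Rightarrow> int \<Rightarrow> (nat, 'k) mpol vec \<Rightarrow> bool" where
  "cx_homog F i j v \<longleftrightarrow> (\<forall>b < rk F i. homog_of_deg (j - dg F i b) (v $ b))"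

text \<open>\<open>F\<close> is a graded free resolution, with maps of degree 0, of the ideal \<open>M\<close> regarded as a
  graded \<open>R\<close>-module. (The columns of \<open>dif i\<close> are the images of the basis elements.)\<close>

definition graded_free_resolution ::
    "nat \<Rightarrow> 'k::field free_cx \<Rightarrow> (nat, 'k) mpol set \<Rightarrow> bool" where
  "graded_free_resolution d F M \<longleftrightarrow>
     aug F \<in> cx_mod d F 0 \<and>
     (\<forall>b < rk F 0. homog_of_deg (dg F 0 b) (aug F $ b)) \<and>
     (\<forall>i. dif F i \<in> carrier_mat (rk F i) (rk F (Suc i)) \<and>
          (\<forall>b < rk F (Suc i). col (dif F i) b \<in> cx_mod d F i \<and>
                              cx_homog F i (dg F (Suc i) b) (col (dif F i) b))) \<and>
     M = (\<lambda>v. aug F \<bullet> v) ` cx_mod d F 0 \<and>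
     {v \<in> cx_mod d F 0. aug F \<bullet> v = 0} = (\<lambda>u. dif F 0 *\<^sub>v u) ` cx_mod d F 1 \<and>
     (\<forall>i. {v \<in> cx_mod d F (Suc i). dif F i *\<^sub>v v = 0\<^sub>v (rk F i)} =
          (\<lambda>u. dif F (Suc i) *\<^sub>v u) ` cx_mod d F (Suc (Suc i)))"

text \<open>\<open>\<mm>F\<^sub>i\<close> for the homogeneous maximal ideal \<open>\<mm>\<close> of polynomials without constant term, so
  that \<open>F\<^sub>i \<otimes> k = F\<^sub>i / \<mm>F\<^sub>i\<close>.\<close>

definition cx_max :: "nat \<Rightarrow> 'k::field free_cx \<Rightarrow> nat \<Rightarrow> (nat, 'k) mpol vec set" where
  "cx_max d F i = {v \<in> cx_mod d F i. \<forall>b < rk F i. Poly_Mapping.lookup (v $ b) 0 = 0}"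

text \<open>Preimages in \<open>F\<^sub>i\<close> of the cycles and of the boundaries of \<open>F \<otimes> k\<close>. Thus
  \<open>Tor\<^sub>i(M, k) = H\<^sub>i(F \<otimes> k)\<close> is the quotient of the two, as a graded module.\<close>

fun tor_cycles :: "nat \<Rightarrow> 'k::field free_cx \<Rightarrow> nat \<Rightarrow> (nat, 'k) mpol vec set" where
  "tor_cycles d F 0 = cx_mod d F 0"
| "tor_cycles d F (Suc i) = {v \<in> cx_mod d F (Suc i). dif F i *\<^sub>v v \<in> cx_max d F i}"

definition tor_boundaries :: "nat \<Rightarrow> 'k::field free_cx \<Rightarrow> nat \<Rightarrow> (nat, 'k) mpol vec set" where
  "tor_boundaries d F i =
     {w + dif F i *\<^sub>v u | w u. w \<in> cx_max d F i \<and> u \<in> cx_mod d F (Suc i)}"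

text \<open>\<open>Tor\<^sub>i(M, k)\<^sub>j \<noteq> 0\<close>, computed from a chosen graded free resolution of \<open>M\<close>.\<close>

definition tor_nonzero :: "nat \<Rightarrow> (nat, 'k::field) mpol set \<Rightarrow> nat \<Rightarrow> int \<Rightarrow> bool" where
  "tor_nonzero d M i j \<longleftrightarrow>
     (let F = (SOME F. graded_free_resolution d F M)
      in \<exists>v \<in> tor_cycles d F i. cx_homog F i j v \<and> v \<notin> tor_boundaries d F i)"

text \<open>Castelnuovo--Mumford regularity over \<open>R\<close> of a homogeneous ideal \<open>M\<close>, regarded as a graded
  module. The zero ideal, for which the maximum is over the empty set, gets regularity 0.\<close>

definition reg :: "nat \<Rightarrow> (nat, 'k::field) mpol set \<Rightarrow> int" where
  "reg d M = (let D = {j - int i | i j. tor_nonzero d M i j} in if D = {} then 0 else Max D)"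

text \<open>With 0-based rows, the forms \<open>\<ell>\<^sub>i\<^sub>+\<^sub>1, \<dots>, \<ell>\<^sub>d\<close> are \<open>row_form d g m\<close> for \<open>i \<le> m < d\<close>.\<close>

definition sreg :: "nat \<Rightarrow> nat \<Rightarrow> (nat, 'k::field) mpol set \<Rightarrow> int" where
  "sreg d i J =
     generic_value d (\<lambda>g. reg d (J <+>\<^bsub>mpr d\<^esub> Idl\<^bsub>mpr d\<^esub> (row_form d g ` {i..<d})))"

end

theory Submission
  imports Defs "HOL-Library.Product_Lexorder" "HOL-Library.Function_Algebras"
begin

text \<open>
  Regularity is read off from the degrees in which Koszul homology does not vanish. Let \<open>L\<close> be the
  ideal of the generic linear forms. Up to degrees that are bounded independently of \<open>n\<close>, the Koszul
  homology of \<open>I\<^sup>n + L\<close> is that of \<open>(I\<^sup>n + L) / L\<close>. These quotients are the pieces of a finitely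
  generated bigraded module over \<open>k[x, T]\<close>, with one variable \<open>T\<^sub>l\<close> for each generator of \<open>I\<close>. The
  variables \<open>x\<close> annihilate Koszul homology, so its lead monomials form finitely many cones in the
  \<open>T\<close>-directions, and the top degree is eventually linear in \<open>n\<close>, with the degree of some generator
  of \<open>I\<close> as slope. Let \<open>\<delta>\<close> be minimal such that for some \<open>N \<ge> 1\<close> the generators of \<open>I\<close> of degree at
  most \<open>\<delta>\<close> times \<open>I\<^sup>N\<^sup>-\<^sup>1\<close> generate \<open>I\<^sup>N\<close> modulo \<open>L\<close>. Then those generators suffice for the finite
  generation, so the slope is at most \<open>\<delta>\<close>, while minimality yields a minimal generator of degree at
  least \<open>\<delta> n\<close>; so the slope is \<open>\<delta>\<close> and the constant term is nonnegative.

  In each bidegree every condition says that a linear system with coefficients polynomial in the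
  entries of \<open>g\<close> is solvable, so it holds on a nonempty open set or fails on one; for fixed \<open>n\<close> a
  degree bound valid for generic \<open>g\<close> leaves only finitely many bidegrees.
\<close>

text \<open>The filter of nonempty open sets is closed under finite intersections only, and over a
  countable field no single \<open>g\<close> need be good for all \<open>n\<close>. So the growth
  argument never fixes \<open>g\<close>: it works with the monomials that are lead terms
  generically, each on an open set of its own, and recombines finitely many of them per bidegree.
  Two conditions are not a linear system as they stand. Vanishing of homology has the shape "for all
  cycles there is a boundary"; comparing lead indices of cycles and boundaries splits it into
  finitely many solvability questions. A degree bound concerns infinitely many degrees; it comes
  from Dickson's lemma and pseudo-reduction over the regular functions. Quotients are never formed:
  the homology of \<open>M / L\<close> is expressed by chains of \<open>M\<close> modulo
  \<open>L\<close>, so that everything lives in spans of elements that depend polynomially on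
  \<open>g\<close>. Koszul homology serves because it involves no resolution of the varying ideal.
  Monomials carry the lexicographic order of finitely supported functions; linearity and
  compatibility with addition suffice, since every induction runs over a finite set.\<close>

declare func_zero [simp del] func_plus [simp del]

section \<open>Koszul homology of graded modules\<close>

text \<open>The sign of \<open>e_a \<and> e_\<tau>\<close> relative to the sorted basis element. It
  acts as a map rather than as a scalar, since chains have coefficients in a mere abelian
  group.\<close>

definition sgs :: "nat \<Rightarrow> nat set \<Rightarrow> 'm::ab_group_add \<Rightarrow> 'm" where
  "sgs a \<tau> y = (if even (card {b\<in>\<tau>. b < a}) then y else - y)"

definition bd :: "nat set \<Rightarrow> (nat \<Rightarrow> 'm \<Rightarrow> 'm) \<Rightarrow> (nat set \<Rightarrow> 'm) \<Rightarrow> nat set \<Rightarrow> 'm::ab_group_add" where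
  "bd V X v \<tau> = (if \<tau> \<subseteq> V then \<Sum>a\<in>V - \<tau>. sgs a \<tau> (X a (v (insert a \<tau>))) else 0)"

definition wedge :: "nat \<Rightarrow> (nat set \<Rightarrow> 'm) \<Rightarrow> nat set \<Rightarrow> 'm::ab_group_add" where
  "wedge c v \<sigma> = (if c \<in> \<sigma> then sgs c (\<sigma> - {c}) (v (\<sigma> - {c})) else 0)"

text \<open>A Koszul chain is given by its coefficients \<open>v \<sigma>\<close> at the basis elements \<open>e\<^sub>\<sigma>\<close>, which have degree
  \<open>card \<sigma>\<close>. The differential is \<open>bd\<close>, and \<open>wedge c\<close> is the product with \<open>e\<^sub>c\<close>.\<close>

definition Kc :: "nat set \<Rightarrow> nat \<Rightarrow> (int \<Rightarrow> 'm set) \<Rightarrow> int \<Rightarrow> (nat set \<Rightarrow> 'm::ab_group_add) set" where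
  "Kc V p M j = {v. \<forall>\<sigma>. v \<sigma> \<in> M (j - int (card \<sigma>)) \<and> (v \<sigma> \<noteq> 0 \<longrightarrow> \<sigma> \<subseteq> V \<and> card \<sigma> = p)}"

text \<open>The homology of \<open>M / L\<close>, in homological degree \<open>p\<close> and internal degree \<open>j\<close>, is zero.\<close>

definition hzr :: "nat set \<Rightarrow> (nat \<Rightarrow> 'm::ab_group_add \<Rightarrow> 'm) \<Rightarrow> nat \<Rightarrow> (int \<Rightarrow> 'm set) \<Rightarrow> (int \<Rightarrow> 'm set) \<Rightarrow> int \<Rightarrow> bool" where
  "hzr V X p M L j \<longleftrightarrow> (\<forall>v\<in>Kc V p M j. (\<forall>\<tau>. bd V X v \<tau> \<in> L (j - int (card \<tau>))) \<longrightarrow>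
     (\<exists>u\<in>Kc V (Suc p) M j. \<forall>\<sigma>. v \<sigma> - bd V X u \<sigma> \<in> L (j - int (card \<sigma>))))"

abbreviation hz :: "nat set \<Rightarrow> (nat \<Rightarrow> 'm::ab_group_add \<Rightarrow> 'm) \<Rightarrow> nat \<Rightarrow> (int \<Rightarrow> 'm set) \<Rightarrow> int \<Rightarrow> bool" where
  "hz V X p M j \<equiv> hzr V X p M (\<lambda>_. {0}) j"

text \<open>The pieces sit inside one ambient group, so a submodule is just a smaller family.
  Scalars are absent: homology only sees the additive structure and the operators.\<close>

definition gmod :: "nat set \<Rightarrow> (nat \<Rightarrow> 'm \<Rightarrow> 'm) \<Rightarrow> (int \<Rightarrow> 'm::ab_group_add set) \<Rightarrow> bool" where
  "gmod V X M \<longleftrightarrow> (\<forall>j. 0 \<in> M j \<and> (\<forall>x\<in>M j. \<forall>y\<in>M j. x - y \<in> M j) \<and> (\<forall>a\<in>V. \<forall>x\<in>M j. X a x \<in> M (j + 1)))"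

lemma gmodD:
  assumes "gmod V X M"
  shows gmod_zero: "0 \<in> M j" and gmod_diff: "x \<in> M j \<Longrightarrow> y \<in> M j \<Longrightarrow> x - y \<in> M j"
    and gmod_X: "a \<in> V \<Longrightarrow> x \<in> M j \<Longrightarrow> X a x \<in> M (j + 1)"
    and gmod_uminus: "x \<in> M j \<Longrightarrow> - x \<in> M j"
    and gmod_add: "x \<in> M j \<Longrightarrow> y \<in> M j \<Longrightarrow> x + y \<in> M j"
proof -
  show 0: "0 \<in> M j" for j using assms by (auto simp: gmod_def)
  show d: "x \<in> M j \<Longrightarrow> y \<in> M j \<Longrightarrow> x - y \<in> M j" for x y j using assms by (auto simp: gmod_def)
  show "a \<in> V \<Longrightarrow> x \<in> M j \<Longrightarrow> X a x \<in> M (j + 1)" using assms by (auto simp: gmod_def)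
  show u: "x \<in> M j \<Longrightarrow> - x \<in> M j" for x j using d[OF 0[of j], of x] by simp
  show "x \<in> M j \<Longrightarrow> y \<in> M j \<Longrightarrow> x + y \<in> M j" using d[of x j "- y"] u[of y j] by simp
qed

lemma gmod_sum:
  assumes "gmod V X M" "\<And>a. a \<in> A \<Longrightarrow> f a \<in> M j"
  shows "sum f A \<in> M j"
  using assms(2) by (induction A rule: infinite_finite_induct) (auto intro: gmodD[OF assms(1)])

lemma sgs_zero [simp]: "sgs a \<tau> 0 = 0" by (simp add: sgs_def)
lemma sgs_sgs [simp]: "sgs a \<tau> (sgs a \<tau> y) = y" by (simp add: sgs_def)
lemma sgs_eq_0 [simp]: "sgs a \<tau> y = 0 \<longleftrightarrow> y = 0" by (simp add: sgs_def)
lemma sgs_empty [simp]: "sgs a {} y = y" by (simp add: sgs_def)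
lemma sgs_add: "sgs a \<tau> (x + y) = sgs a \<tau> x + sgs a \<tau> y" by (simp add: sgs_def)
lemma sgs_diff: "sgs a \<tau> (x - y) = sgs a \<tau> x - sgs a \<tau> y" by (simp add: sgs_def)
lemma sgs_minus: "sgs a \<tau> (- y) = - sgs a \<tau> y" by (simp add: sgs_def)
lemma sgs_sum: "sgs a \<tau> (sum f A) = (\<Sum>x\<in>A. sgs a \<tau> (f x))"
  by (simp add: sgs_def sum_negf)

lemma sgs_insert:
  assumes "finite \<tau>" "b \<notin> \<tau>"
  shows "sgs a (insert b \<tau>) y = (if b < a then - sgs a \<tau> y else sgs a \<tau> y)"
proof (cases "b < a")
  case True
  then have "{x\<in>insert b \<tau>. x < a} = insert b {x\<in>\<tau>. x < a}" by auto
  then show ?thesis using True assms by (simp add: sgs_def)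
next
  case False
  then have "{x\<in>insert b \<tau>. x < a} = {x\<in>\<tau>. x < a}" by auto
  then show ?thesis using False by (simp add: sgs_def)
qed

lemma sgs_comm: "sgs a \<tau> (sgs b \<tau>' y) = sgs b \<tau>' (sgs a \<tau> y)"
  by (simp add: sgs_def)

text \<open>Exactly one of \<open>a < b\<close> and \<open>b < a\<close> holds, so exactly one of
  the two signs flips when the other index is adjoined.\<close>

lemma sgs_swap:
  assumes "finite \<tau>" "a \<notin> \<tau>" "b \<notin> \<tau>" "a \<noteq> b"
  shows "sgs a (insert b \<tau>) (sgs b (insert a \<tau>) y) = - sgs b \<tau> (sgs a \<tau> y)"
  using assms by (cases "a < b") (simp_all add: sgs_insert sgs_minus sgs_comm[of a \<tau> b \<tau>])

lemma sgs_swap':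
  assumes "finite \<tau>" "a \<notin> \<tau>" "b \<notin> \<tau>" "a \<noteq> b"
  shows "sgs a \<tau> (sgs b (insert a \<tau>) y) = - sgs b \<tau> (sgs a (insert b \<tau>) y)"
  using assms by (cases "a < b") (simp_all add: sgs_insert sgs_minus sgs_comm[of a \<tau> b \<tau>])

text \<open>Additive commuting operators are all that the sign calculus needs. The locale covers
  \<open>k[x]\<close>, free modules, and multigraded strands, where every operator is the
  identity.\<close>

locale kop =
  fixes V :: "nat set" and X :: "nat \<Rightarrow> 'm::ab_group_add \<Rightarrow> 'm"
  assumes finV: "finite V"
    and X_add: "a \<in> V \<Longrightarrow> X a (x + y) = X a x + X a y"
    and X_comm: "a \<in> V \<Longrightarrow> b \<in> V \<Longrightarrow> X a (X b x) = X b (X a x)"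
begin

lemma X_zero [simp]: "a \<in> V \<Longrightarrow> X a 0 = 0"
  using X_add[of a 0 0] by simp

lemma X_uminus: "a \<in> V \<Longrightarrow> X a (- x) = - X a x"
  using X_add[of a x "- x"] by (simp add: eq_neg_iff_add_eq_0 add.commute)

lemma X_diff: "a \<in> V \<Longrightarrow> X a (x - y) = X a x - X a y"
  using X_add[of a x "- y"] X_uminus[of a y] by simp

lemma X_sum: "a \<in> V \<Longrightarrow> X a (sum f A) = (\<Sum>x\<in>A. X a (f x))"
  by (induction A rule: infinite_finite_induct) (auto simp: X_add)

lemma X_sgs: "a \<in> V \<Longrightarrow> X a (sgs b \<tau> y) = sgs b \<tau> (X a y)"
  by (simp add: sgs_def X_uminus)

lemma bd_add: "bd V X (\<lambda>\<sigma>. u \<sigma> + v \<sigma>) \<tau> = bd V X u \<tau> + bd V X v \<tau>"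
  by (simp add: bd_def X_add sgs_add sum.distrib)

lemma bd_diff: "bd V X (\<lambda>\<sigma>. u \<sigma> - v \<sigma>) \<tau> = bd V X u \<tau> - bd V X v \<tau>"
  by (simp add: bd_def X_diff sgs_diff sum_subtractf)

lemma bd_zero [simp]: "bd V X (\<lambda>_. 0) \<tau> = 0"
  by (simp add: bd_def)

text \<open>The homotopy formula \<open>d(e_c \<and> v) + e_c \<and> dv = x_c v\<close>. Over
  \<open>k[x]\<close> it shows that variables kill Koszul homology; on a strand, where
  \<open>x_c\<close> is the identity, it contracts the complex.\<close>

lemma bd_wedge:
  assumes c: "c \<in> V" and \<tau>: "\<tau> \<subseteq> V"
  shows "bd V X (wedge c v) \<tau> = X c (v \<tau>) - wedge c (bd V X v) \<tau>"
proof (cases "c \<in> \<tau>")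
  case False
  \<comment> \<open>Every \<open>a\<close> other than \<open>c\<close> leaves \<open>c\<close>
    outside \<open>insert a \<tau>\<close>, so only the term \<open>a = c\<close> survives.\<close>
  have "bd V X (wedge c v) \<tau> = (\<Sum>a\<in>V - \<tau>. if a = c then X c (v \<tau>) else 0)"
    unfolding bd_def if_P[OF \<tau>]
    by (rule sum.cong[OF refl]) (use False in \<open>auto simp: wedge_def X_sgs\<close>)
  also have "\<dots> = X c (v \<tau>)" using c False finV by (simp add: sum.delta')
  finally show ?thesis using False by (simp add: wedge_def)
next
  case True
  define \<rho> where "\<rho> = \<tau> - {c}"
  have \<tau>_eq: "\<tau> = insert c \<rho>" and c\<rho>: "c \<notin> \<rho>" and \<rho>V: "\<rho> \<subseteq> V" and fin: "finite \<rho>"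
    using True \<tau> finV finite_subset by (auto simp: \<rho>_def)
  have 1: "bd V X (wedge c v) \<tau> = (\<Sum>a\<in>V - \<tau>. - sgs c \<rho> (sgs a \<rho> (X a (v (insert a \<rho>)))))"
  proof -
    have "sgs a \<tau> (X a (wedge c v (insert a \<tau>))) = - sgs c \<rho> (sgs a \<rho> (X a (v (insert a \<rho>))))"
      if "a \<in> V - \<tau>" for a
    proof -
      have "insert a \<tau> - {c} = insert a \<rho>" using that True by (auto simp: \<tau>_eq c\<rho>)
      then show ?thesis using that fin c\<rho> True
        by (simp add: wedge_def X_sgs) (simp add: \<tau>_eq sgs_swap)
    qed
    then show ?thesis using \<tau> by (simp add: bd_def)
  qed
  have "bd V X v \<rho> = sgs c \<rho> (X c (v \<tau>)) + (\<Sum>a\<in>V - \<tau>. sgs a \<rho> (X a (v (insert a \<rho>))))"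
  proof -
    have "V - \<rho> = insert c (V - \<tau>)" using c c\<rho> by (auto simp: \<tau>_eq)
    moreover have "insert c \<rho> = \<tau>" by (simp add: \<tau>_eq)
    ultimately show ?thesis using finV True by (simp only: bd_def if_P[OF \<rho>V]) simp
  qed
  then have "wedge c (bd V X v) \<tau> = X c (v \<tau>) + (\<Sum>a\<in>V - \<tau>. sgs c \<rho> (sgs a \<rho> (X a (v (insert a \<rho>)))))"
    using True by (simp add: wedge_def \<rho>_def[symmetric] sgs_add sgs_sum)
  then show ?thesis using 1 by (simp add: sum_negf)
qed

text \<open>The terms of index \<open>(a, b)\<close> and \<open>(b, a)\<close> cancel. The double
  sum is cut into \<open>b < a\<close> and \<open>a < b\<close> because antisymmetry alone would
  only give that twice the sum is zero.\<close>

lemma bd_bd: "bd V X (bd V X v) \<tau> = 0"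
proof (cases "\<tau> \<subseteq> V")
  case True
  have fin: "finite \<tau>" using True finV finite_subset by blast
  define A where "A = V - \<tau>"
  have fA: "finite A" using finV by (simp add: A_def)
  define t where "t a b = sgs a \<tau> (sgs b (insert a \<tau>) (X a (X b (v (insert b (insert a \<tau>))))))" for a b
  have anti: "t a b = - t b a" if "a \<in> A" "b \<in> A" "a \<noteq> b" for a b
  proof -
    have "X a (X b (v (insert b (insert a \<tau>)))) = X b (X a (v (insert a (insert b \<tau>))))"
      using that X_comm[of a b] by (simp add: A_def insert_commute)
    then show ?thesis using that sgs_swap'[OF fin, of a b] by (simp add: t_def A_def)
  qed
  have "bd V X (bd V X v) \<tau> = (\<Sum>a\<in>A. \<Sum>b\<in>A - {a}. t a b)"
  proof -
    have "sgs a \<tau> (X a (bd V X v (insert a \<tau>))) = (\<Sum>b\<in>A - {a}. t a b)" if "a \<in> A" for a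
    proof -
      have V: "V - insert a \<tau> = A - {a}" by (auto simp: A_def)
      have "insert a \<tau> \<subseteq> V" "a \<in> V" using that True by (auto simp: A_def)
      moreover have "A - {a} \<subseteq> V" by (auto simp: A_def)
      ultimately show ?thesis
        unfolding bd_def V t_def by (auto simp: X_sum sgs_sum X_sgs intro!: sum.cong)
    qed
    then show ?thesis
      unfolding bd_def[of V X "bd V X v"] if_P[OF True] A_def[symmetric] by (rule sum.cong[OF refl])
  qed
  also have "\<dots> = (\<Sum>a\<in>A. (\<Sum>b\<in>{b\<in>A. b < a}. t a b) + (\<Sum>b\<in>{b\<in>A. a < b}. t a b))"
  proof (rule sum.cong[OF refl])
    fix a assume "a \<in> A"
    have e: "A - {a} = {b\<in>A. b < a} \<union> {b\<in>A. a < b}" by auto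
    show "(\<Sum>b\<in>A - {a}. t a b) = (\<Sum>b\<in>{b\<in>A. b < a}. t a b) + (\<Sum>b\<in>{b\<in>A. a < b}. t a b)"
      unfolding e by (rule sum.union_disjoint) (use fA in auto)
  qed
  also have "\<dots> = (\<Sum>a\<in>A. \<Sum>b\<in>{b\<in>A. b < a}. t a b) + (\<Sum>a\<in>A. \<Sum>b\<in>{b\<in>A. a < b}. t a b)"
    by (simp add: sum.distrib)
  also have "(\<Sum>a\<in>A. \<Sum>b\<in>{b\<in>A. a < b}. t a b) = (\<Sum>b\<in>A. \<Sum>a\<in>{a\<in>A. a < b}. t a b)"
    using fA by (rule sum.swap_restrict) (rule fA)
  also have "\<dots> = (\<Sum>b\<in>A. \<Sum>a\<in>{a\<in>A. a < b}. - t b a)"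
    by (intro sum.cong refl) (auto intro: anti)
  finally show ?thesis by (simp add: sum_negf)
next
  case False
  then show ?thesis by (simp add: bd_def)
qed

end

section \<open>Chains with coefficients in a graded module\<close>

lemma bd_hom:
  assumes "\<And>x y. \<phi> (x + y) = \<phi> x + \<phi> y" and "\<And>a x. a \<in> V \<Longrightarrow> \<phi> (X a x) = Y a (\<phi> x)"
  shows "bd V Y (\<lambda>\<sigma>. \<phi> (v \<sigma>)) \<tau> = \<phi> (bd V X v \<tau>)"
proof -
  have 0: "\<phi> 0 = 0" using assms(1)[of 0 0] by simp
  have m: "\<phi> (- x) = - \<phi> x" for x
    using assms(1)[of x "- x"] 0 by (simp add: eq_neg_iff_add_eq_0 add.commute)
  have s: "\<phi> (sgs a \<tau> y) = sgs a \<tau> (\<phi> y)" for a \<tau> y by (simp add: sgs_def m)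
  have "\<phi> (sum f A) = (\<Sum>x\<in>A. \<phi> (f x))" for f :: "nat \<Rightarrow> _" and A
    by (induction A rule: infinite_finite_induct) (auto simp: 0 assms(1))
  then show ?thesis by (simp add: bd_def 0 s assms(2))
qed

lemma Kc_support: "v \<in> Kc V p M j \<Longrightarrow> v \<sigma> \<noteq> 0 \<Longrightarrow> \<sigma> \<subseteq> V \<and> card \<sigma> = p"
  by (auto simp: Kc_def)

lemma Kc_mem: "v \<in> Kc V p M j \<Longrightarrow> v \<sigma> \<in> M (j - int (card \<sigma>))"
  by (auto simp: Kc_def)

lemma KcI: "(\<And>\<sigma>. v \<sigma> \<in> M (j - int (card \<sigma>))) \<Longrightarrow> (\<And>\<sigma>. v \<sigma> \<noteq> 0 \<Longrightarrow> \<sigma> \<subseteq> V \<and> card \<sigma> = p) \<Longrightarrow> v \<in> Kc V p M j"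
  by (auto simp: Kc_def)

lemma Kc_diff:
  assumes "gmod V X M" "u \<in> Kc V p M j" "v \<in> Kc V p M j"
  shows "(\<lambda>\<sigma>. u \<sigma> - v \<sigma>) \<in> Kc V p M j"
proof (rule KcI)
  show "u \<sigma> - v \<sigma> \<in> M (j - int (card \<sigma>))" for \<sigma>
    using gmod_diff[OF assms(1)] Kc_mem[OF assms(2)] Kc_mem[OF assms(3)] by blast
  show "\<sigma> \<subseteq> V \<and> card \<sigma> = p" if "u \<sigma> - v \<sigma> \<noteq> 0" for \<sigma>
    using that Kc_support[OF assms(2), of \<sigma>] Kc_support[OF assms(3), of \<sigma>] by (cases "u \<sigma> = 0") auto
qed

lemma Kc_add:
  assumes "gmod V X M" "u \<in> Kc V p M j" "v \<in> Kc V p M j"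
  shows "(\<lambda>\<sigma>. u \<sigma> + v \<sigma>) \<in> Kc V p M j"
proof (rule KcI)
  show "u \<sigma> + v \<sigma> \<in> M (j - int (card \<sigma>))" for \<sigma>
    using gmod_add[OF assms(1)] Kc_mem[OF assms(2)] Kc_mem[OF assms(3)] by blast
  show "\<sigma> \<subseteq> V \<and> card \<sigma> = p" if "u \<sigma> + v \<sigma> \<noteq> 0" for \<sigma>
    using that Kc_support[OF assms(2), of \<sigma>] Kc_support[OF assms(3), of \<sigma>] by (cases "u \<sigma> = 0") auto
qed

lemma Kc_mono: "(\<And>j. L j \<subseteq> M j) \<Longrightarrow> Kc V p L j \<subseteq> Kc V p M j"
  unfolding Kc_def by blast

lemma gmod_sgs: "gmod V X M \<Longrightarrow> x \<in> M j \<Longrightarrow> sgs a \<tau> x \<in> M j"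
  by (simp add: sgs_def gmodD)

lemma Kc_0_bd: "v \<in> Kc V 0 M j \<Longrightarrow> kop V X \<Longrightarrow> bd V X v \<tau> = 0"
  unfolding bd_def
proof (simp, rule impI, rule sum.neutral, rule ballI)
  fix a assume v: "v \<in> Kc V 0 M j" and k: "kop V X" and \<tau>: "\<tau> \<subseteq> V" and a: "a \<in> V - \<tau>"
  have "finite (insert a \<tau>)" using \<tau> k finite_subset by (auto simp: kop_def)
  then have "v (insert a \<tau>) = 0" using Kc_support[OF v, of "insert a \<tau>"] by (metis card_eq_0_iff insert_not_empty)
  then show "sgs a \<tau> (X a (v (insert a \<tau>))) = 0" using kop.X_zero[OF k] a by simp
qed

lemma Kc_bd:
  assumes g: "gmod V X M" and k: "kop V X" and u: "u \<in> Kc V (Suc p) M j"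
  shows "bd V X u \<in> Kc V p M j"
proof (rule KcI)
  have fV: "finite V" using k by (simp add: kop_def)
  show "bd V X u \<sigma> \<in> M (j - int (card \<sigma>))" for \<sigma>
  proof (cases "\<sigma> \<subseteq> V")
    case True
    have f: "finite \<sigma>" using True fV finite_subset by blast
    have "sgs a \<sigma> (X a (u (insert a \<sigma>))) \<in> M (j - int (card \<sigma>))" if "a \<in> V - \<sigma>" for a
    proof -
      have "X a (u (insert a \<sigma>)) \<in> M (j - int (card (insert a \<sigma>)) + 1)"
        using that Kc_mem[OF u, of "insert a \<sigma>"] by (intro gmod_X[OF g]) auto
      moreover have "j - int (card (insert a \<sigma>)) + 1 = j - int (card \<sigma>)" using that f by simp
      ultimately show ?thesis using gmod_sgs[OF g] by metis
    qed
    then show ?thesis unfolding bd_def if_P[OF True] by (rule gmod_sum[OF g])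
  qed (simp add: bd_def gmod_zero[OF g])
  show "\<sigma> \<subseteq> V \<and> card \<sigma> = p" if "bd V X u \<sigma> \<noteq> 0" for \<sigma>
  proof -
    have \<sigma>: "\<sigma> \<subseteq> V" using that by (auto simp: bd_def split: if_splits)
    have "(\<Sum>a\<in>V - \<sigma>. sgs a \<sigma> (X a (u (insert a \<sigma>)))) \<noteq> 0" using that by (simp only: bd_def if_P[OF \<sigma>]) simp
    from sum.not_neutral_contains_not_neutral[OF this]
    obtain a where a: "a \<in> V - \<sigma>" "sgs a \<sigma> (X a (u (insert a \<sigma>))) \<noteq> 0" by blast
    then have "u (insert a \<sigma>) \<noteq> 0" using kop.X_zero[OF k] by auto
    then have "card (insert a \<sigma>) = Suc p" using Kc_support[OF u] by blast
    then show ?thesis using \<sigma> a fV finite_subset[of \<sigma> V] by auto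
  qed
qed

lemma hzD:
  assumes "hz V X p M j" "v \<in> Kc V p M j" "\<And>\<tau>. bd V X v \<tau> = 0"
  obtains u where "u \<in> Kc V (Suc p) M j" "bd V X u = v"
proof -
  obtain u where u: "u \<in> Kc V (Suc p) M j" and "\<forall>\<sigma>. v \<sigma> - bd V X u \<sigma> = 0"
    using assms unfolding hzr_def by auto
  then have "bd V X u = v" by (simp add: fun_eq_iff)
  then show ?thesis using that u by blast
qed

lemma hzI:
  assumes "\<And>v. v \<in> Kc V p M j \<Longrightarrow> (\<And>\<tau>. bd V X v \<tau> = 0) \<Longrightarrow> \<exists>u\<in>Kc V (Suc p) M j. bd V X u = v"
  shows "hz V X p M j"
  using assms unfolding hzr_def by fastforce

text \<open>Injectivity of \<open>H_p(N) \<rightarrow> H_p(F)\<close> in degree \<open>j\<close>.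
  Stated through the kernel so that it stays meaningful for \<open>p = 0\<close>, where the homology
  of a free module does not vanish.\<close>

definition kz :: "nat set \<Rightarrow> (nat \<Rightarrow> 'm::ab_group_add \<Rightarrow> 'm) \<Rightarrow> nat \<Rightarrow> (int \<Rightarrow> 'm set) \<Rightarrow> (int \<Rightarrow> 'm set) \<Rightarrow> int \<Rightarrow> bool" where
  "kz V X p N F j \<longleftrightarrow> (\<forall>u\<in>Kc V (Suc p) F j. bd V X u \<in> Kc V p N j \<longrightarrow>
     (\<exists>w\<in>Kc V (Suc p) N j. bd V X w = bd V X u))"

text \<open>The connecting homomorphism of \<open>0 \<rightarrow> N \<rightarrow> F \<rightarrow> M \<rightarrow> 0\<close>.\<close>

lemma hz_shift:
  fixes X :: "nat \<Rightarrow> 'm::ab_group_add \<Rightarrow> 'm" and Y :: "nat \<Rightarrow> 'n::ab_group_add \<Rightarrow> 'n"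
  assumes kX: "kop V X" and kY: "kop V Y" and gF: "gmod V X F"
    and add: "\<And>x y. \<phi> (x + y) = \<phi> x + \<phi> y" and lin: "\<And>a x. a \<in> V \<Longrightarrow> \<phi> (X a x) = Y a (\<phi> x)"
    and M: "\<And>j. M j = \<phi> ` F j" and N: "\<And>j. N j = {y\<in>F j. \<phi> y = 0}"
    and acyc: "hz V X (Suc p) F j"
  shows "hz V Y (Suc p) M j \<longleftrightarrow> kz V X p N F j"
proof -
  have 0: "\<phi> 0 = 0" using add[of 0 0] by simp
  have minus: "\<phi> (x - y) = \<phi> x - \<phi> y" for x y
    using add[of "x - y" y] by (simp add: algebra_simps)
  have hom: "bd V Y (\<lambda>\<sigma>. \<phi> (v \<sigma>)) \<tau> = \<phi> (bd V X v \<tau>)" for v \<tau>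
    by (rule bd_hom[where \<phi>=\<phi> and X=X and Y=Y]) (simp_all add: add lin)
  have push: "(\<lambda>\<sigma>. \<phi> (u \<sigma>)) \<in> Kc V q M j" if "u \<in> Kc V q F j" for u q
  proof (rule KcI)
    show "\<phi> (u \<sigma>) \<in> M (j - int (card \<sigma>))" for \<sigma> using Kc_mem[OF that, of \<sigma>] by (simp add: M)
    show "\<sigma> \<subseteq> V \<and> card \<sigma> = q" if "\<phi> (u \<sigma>) \<noteq> 0" for \<sigma>
      using that Kc_support[OF \<open>u \<in> Kc V q F j\<close>, of \<sigma>] 0 by (cases "u \<sigma> = 0") auto
  qed
  \<comment> \<open>Zero coefficients are lifted to zero, which keeps the support of the lift and
    hence its homological degree under control.\<close>
  have lift: "\<exists>w\<in>Kc V q F j. \<forall>\<sigma>. \<phi> (w \<sigma>) = v \<sigma>" if v: "v \<in> Kc V q M j" for v q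
  proof -
    have "\<exists>y. y \<in> F (j - int (card \<sigma>)) \<and> \<phi> y = v \<sigma> \<and> (v \<sigma> = 0 \<longrightarrow> y = 0)" for \<sigma>
      using Kc_mem[OF v, of \<sigma>] gmod_zero[OF gF] 0 by (cases "v \<sigma> = 0") (auto simp: M)
    then obtain w where w: "\<And>\<sigma>. w \<sigma> \<in> F (j - int (card \<sigma>)) \<and> \<phi> (w \<sigma>) = v \<sigma> \<and> (v \<sigma> = 0 \<longrightarrow> w \<sigma> = 0)"
      by metis
    have "w \<in> Kc V q F j"
    proof (rule KcI)
      show "w \<sigma> \<in> F (j - int (card \<sigma>))" for \<sigma> using w by blast
      show "\<sigma> \<subseteq> V \<and> card \<sigma> = q" if "w \<sigma> \<noteq> 0" for \<sigma>
        using that w[of \<sigma>] Kc_support[OF v, of \<sigma>] by blast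
    qed
    then show ?thesis using w by auto
  qed
  have KN: "u \<in> Kc V q N j \<longleftrightarrow> u \<in> Kc V q F j \<and> (\<forall>\<sigma>. \<phi> (u \<sigma>) = 0)" for u q
    by (auto simp: Kc_def N)
  show ?thesis
  proof
    assume h: "hz V Y (Suc p) M j"
    show "kz V X p N F j" unfolding kz_def
    proof (intro ballI impI)
      fix u assume u: "u \<in> Kc V (Suc p) F j" and b: "bd V X u \<in> Kc V p N j"
      have "bd V Y (\<lambda>\<sigma>. \<phi> (u \<sigma>)) \<tau> = 0" for \<tau> using b by (simp add: hom KN)
      then obtain w where w: "w \<in> Kc V (Suc (Suc p)) M j" "bd V Y w = (\<lambda>\<sigma>. \<phi> (u \<sigma>))"
        by (rule hzD[OF h push[OF u]])
      from lift[OF w(1)] obtain w' where w0: "w' \<in> Kc V (Suc (Suc p)) F j" and w1: "\<forall>\<sigma>. \<phi> (w' \<sigma>) = w \<sigma>" ..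
      note w' = w0 w1[rule_format]
      \<comment> \<open>Subtracting a boundary moves \<open>u\<close> into \<open>N\<close> without
        changing its differential.\<close>
      let ?z = "\<lambda>\<sigma>. u \<sigma> - bd V X w' \<sigma>"
      have "\<phi> (bd V X w' \<sigma>) = \<phi> (u \<sigma>)" for \<sigma>
        using hom[of w' \<sigma>] w'(2) fun_cong[OF w(2), of \<sigma>] by simp
      then have "?z \<in> Kc V (Suc p) N j"
        using Kc_diff[OF gF u Kc_bd[OF gF kX w'(1)]] by (simp add: KN minus)
      moreover have "bd V X ?z = bd V X u"
        using kop.bd_diff[OF kX] kop.bd_bd[OF kX] by fastforce
      ultimately show "\<exists>w\<in>Kc V (Suc p) N j. bd V X w = bd V X u" by blast
    qed
  next
    assume h: "kz V X p N F j"
    show "hz V Y (Suc p) M j"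
    proof (rule hzI)
      fix z assume z: "z \<in> Kc V (Suc p) M j" "\<And>\<tau>. bd V Y z \<tau> = 0"
      from lift[OF z(1)] obtain u where u0: "u \<in> Kc V (Suc p) F j" and u1: "\<forall>\<sigma>. \<phi> (u \<sigma>) = z \<sigma>" ..
      note u = u0 u1[rule_format]
      have "bd V X u \<in> Kc V p N j" using Kc_bd[OF gF kX u(1)] z(2) hom[of u] by (simp add: KN u(2))
      then obtain w where w: "w \<in> Kc V (Suc p) N j" "bd V X w = bd V X u"
        using h u(1) unfolding kz_def by blast
      let ?z = "\<lambda>\<sigma>. u \<sigma> - w \<sigma>"
      have wF: "w \<in> Kc V (Suc p) F j" using w(1) by (simp add: KN)
      have "bd V X ?z \<tau> = 0" for \<tau> by (simp add: kop.bd_diff[OF kX] w(2))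
      then obtain y where y: "y \<in> Kc V (Suc (Suc p)) F j" "bd V X y = ?z"
        by (rule hzD[OF acyc Kc_diff[OF gF u(1) wF]])
      have "bd V Y (\<lambda>\<sigma>. \<phi> (y \<sigma>)) \<tau> = z \<tau>" for \<tau>
      proof -
        have "\<phi> (w \<tau>) = 0" using w(1) by (simp add: KN)
        moreover have "bd V X y \<tau> = u \<tau> - w \<tau>" using y(2) by (simp only:)
        ultimately show ?thesis using hom[of y \<tau>] by (simp add: minus u(2))
      qed
      then have "bd V Y (\<lambda>\<sigma>. \<phi> (y \<sigma>)) = z" by (simp add: fun_eq_iff)
      then show "\<exists>u\<in>Kc V (Suc (Suc p)) M j. bd V Y u = z" using push[OF y(1)] by blast
    qed
  qed
qed

text \<open>Above homological degree 0 the module \<open>F\<close> is acyclic, so every cycle of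
  \<open>N\<close> bounds in \<open>F\<close> and the kernel is all of the homology.\<close>

lemma kz_eq_hz:
  assumes kX: "kop V X" and gF: "gmod V X F" and gN: "gmod V X N" and sub: "\<And>j. N j \<subseteq> F j" and acyc: "hz V X (Suc p) F j"
  shows "kz V X (Suc p) N F j \<longleftrightarrow> hz V X (Suc p) N j"
proof
  assume h: "kz V X (Suc p) N F j"
  show "hz V X (Suc p) N j"
  proof (rule hzI)
    fix v assume v: "v \<in> Kc V (Suc p) N j" "\<And>\<tau>. bd V X v \<tau> = 0"
    have "v \<in> Kc V (Suc p) F j" using v(1) Kc_mono[where L=N and M=F, OF sub] by blast
    then obtain u where "u \<in> Kc V (Suc (Suc p)) F j" "bd V X u = v" using v(2) by (rule hzD[OF acyc])
    then show "\<exists>u\<in>Kc V (Suc (Suc p)) N j. bd V X u = v" using h v(1) unfolding kz_def by blast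
  qed
next
  assume h: "hz V X (Suc p) N j"
  show "kz V X (Suc p) N F j" unfolding kz_def
  proof (intro ballI impI)
    fix u assume "bd V X u \<in> Kc V (Suc p) N j"
    then obtain w where "w \<in> Kc V (Suc (Suc p)) N j" "bd V X w = bd V X u"
      using kop.bd_bd[OF kX] by (rule hzD[OF h])
    then show "\<exists>w\<in>Kc V (Suc (Suc p)) N j. bd V X w = bd V X u" by blast
  qed
qed

text \<open>The long exact sequence of
  \<open>0 \<rightarrow> L \<rightarrow> M \<rightarrow> M / L\<close>: the neighbours of
  \<open>H_p(M) \<rightarrow> H_p(M / L)\<close> vanish. This divides out the ideal of the linear
  forms beyond a degree bound for its own homology.\<close>

lemma hz_iff_hzr:
  assumes kX: "kop V X" and gM: "gmod V X M" and gL: "gmod V X L" and sub: "\<And>j. L j \<subseteq> M j"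
    and L1: "hz V X p L j" and L0: "p > 0 \<Longrightarrow> hz V X (p - 1) L j"
  shows "hz V X p M j \<longleftrightarrow> hzr V X p M L j"
proof
  assume h: "hz V X p M j"
  show "hzr V X p M L j" unfolding hzr_def
  proof (intro ballI impI)
    fix v assume v: "v \<in> Kc V p M j" and b: "\<forall>\<tau>. bd V X v \<tau> \<in> L (j - int (card \<tau>))"
    \<comment> \<open>For \<open>p > 0\<close> the differential of a cycle modulo \<open>L\<close>
      is a cycle of \<open>L\<close> in homological degree \<open>p - 1\<close>; as it bounds there,
      \<open>v\<close> can be corrected to a genuine cycle.\<close>
    have "\<exists>l\<in>Kc V p L j. bd V X l = bd V X v"
    proof (cases p)
      case 0
      have "(\<lambda>_. 0) \<in> Kc V p L j" using gmod_zero[OF gL] by (simp add: Kc_def)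
      moreover have "bd V X (\<lambda>_. 0) = bd V X v"
        using Kc_0_bd[OF v[unfolded 0] kX] kop.bd_zero[OF kX] by fastforce
      ultimately show ?thesis by blast
    next
      case (Suc q)
      have "bd V X v \<in> Kc V q M j" using Kc_bd[OF gM kX] v Suc by blast
      then have "bd V X v \<in> Kc V q L j" using b by (auto simp: Kc_def)
      moreover have "hz V X q L j" using L0 Suc by simp
      ultimately obtain l where "l \<in> Kc V (Suc q) L j" "bd V X l = bd V X v"
        using kop.bd_bd[OF kX] hzD[of V X q L j "bd V X v"] by metis
      then show ?thesis using Suc by blast
    qed
    then obtain l where l: "l \<in> Kc V p L j" "bd V X l = bd V X v" by blast
    have lM: "l \<in> Kc V p M j" using l Kc_mono[where L=L and M=M, OF sub] by blast
    have "bd V X (\<lambda>\<sigma>. v \<sigma> - l \<sigma>) \<tau> = 0" for \<tau> by (simp add: kop.bd_diff[OF kX] l(2))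
    then obtain u where u: "u \<in> Kc V (Suc p) M j" "bd V X u = (\<lambda>\<sigma>. v \<sigma> - l \<sigma>)"
      by (rule hzD[OF h Kc_diff[OF gM v lM]])
    have "v \<sigma> - bd V X u \<sigma> \<in> L (j - int (card \<sigma>))" for \<sigma>
      using Kc_mem[OF l(1), of \<sigma>] by (simp add: u(2))
    then show "\<exists>u\<in>Kc V (Suc p) M j. \<forall>\<sigma>. v \<sigma> - bd V X u \<sigma> \<in> L (j - int (card \<sigma>))"
      using u(1) by blast
  qed
next
  assume h: "hzr V X p M L j"
  show "hz V X p M j"
  proof (rule hzI)
    fix v assume v: "v \<in> Kc V p M j" "\<And>\<tau>. bd V X v \<tau> = 0"
    then obtain u where u: "u \<in> Kc V (Suc p) M j" "\<forall>\<sigma>. v \<sigma> - bd V X u \<sigma> \<in> L (j - int (card \<sigma>))"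
      using h gmod_zero[OF gL] unfolding hzr_def by metis
    let ?l = "\<lambda>\<sigma>. v \<sigma> - bd V X u \<sigma>"
    have "?l \<in> Kc V p M j" using Kc_diff[OF gM v(1) Kc_bd[OF gM kX u(1)]] .
    then have l: "?l \<in> Kc V p L j" using u(2) by (auto simp: Kc_def)
    have "bd V X ?l \<tau> = 0" for \<tau> by (simp add: kop.bd_diff[OF kX] v(2) kop.bd_bd[OF kX])
    then obtain l' where l': "l' \<in> Kc V (Suc p) L j" "bd V X l' = ?l" by (rule hzD[OF L1 l])
    have "(\<lambda>\<sigma>. u \<sigma> + l' \<sigma>) \<in> Kc V (Suc p) M j" using Kc_add[OF gM u(1)] l'(1) Kc_mono[where L=L and M=M, OF sub] by blast
    moreover have "bd V X (\<lambda>\<sigma>. u \<sigma> + l' \<sigma>) = v"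
      by (rule ext) (simp add: kop.bd_add[OF kX] l'(2))
    ultimately show "\<exists>u\<in>Kc V (Suc p) M j. bd V X u = v" by blast
  qed
qed

section \<open>Monomials and homogeneous polynomials\<close>

declare One_nat_def [simp del]

type_synonym mono = "nat \<Rightarrow>\<^sub>0 nat"

abbreviation (input) lk :: "('a \<Rightarrow>\<^sub>0 'b::zero) \<Rightarrow> 'a \<Rightarrow> 'b" where "lk \<equiv> Poly_Mapping.lookup"

lemma lookup_single_mult:
  fixes p :: "'a::cancel_comm_monoid_add \<Rightarrow>\<^sub>0 'k::comm_semiring_1"
  shows "lk (Poly_Mapping.single \<mu> c * p) (\<mu> + m) = c * lk p m"
proof -
  have "lk (Poly_Mapping.single \<mu> c * p) (\<mu> + m) = prod_fun (lk (Poly_Mapping.single \<mu> c)) (lk p) (\<mu> + m)"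
    by (simp add: times_poly_mapping.rep_eq)
  also have "\<dots> = (\<Sum>l. (c when \<mu> = l) * (\<Sum>q. lk p q when \<mu> + m = l + q))"
    by (simp add: prod_fun_def lookup_single)
  also have "\<dots> = (\<Sum>l. (c * (\<Sum>q. lk p q when \<mu> + m = l + q)) when l = \<mu>)"
    by (rule Sum_any.cong) (auto simp: when_def)
  also have "\<dots> = c * lk p m" by (simp add: eq_commute[of m])
  finally show ?thesis .
qed

lemma lookup_single_mult_0:
  fixes p :: "'a::cancel_comm_monoid_add \<Rightarrow>\<^sub>0 'k::comm_semiring_1"
  assumes "\<And>m'. m \<noteq> \<mu> + m'"
  shows "lk (Poly_Mapping.single \<mu> c * p) m = 0"
proof -
  have "m \<notin> Poly_Mapping.keys (Poly_Mapping.single \<mu> c * p)"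
    using assms keys_mult[of "Poly_Mapping.single \<mu> c" p] by (auto split: if_splits)
  then show ?thesis by (simp add: in_keys_iff)
qed

lemma lookup_const_mult: "lk (Poly_Mapping.single 0 c * p) m = c * lk (p :: ('v, 'k::field) mpol) m"
  using lookup_single_mult[of 0 c p m] by simp

lemma mono_diff: "(\<And>a. lk \<mu> a \<le> lk m a) \<Longrightarrow> \<mu> + (m - \<mu>) = (m :: 'v \<Rightarrow>\<^sub>0 nat)"
  by (rule poly_mapping_eqI) (simp add: lookup_add lookup_minus)

lemma keys_add_nat: "Poly_Mapping.keys (m + m' :: 'v \<Rightarrow>\<^sub>0 nat) = Poly_Mapping.keys m \<union> Poly_Mapping.keys m'"
  by (auto simp: in_keys_iff lookup_add)

lemma keys_minus_nat: "Poly_Mapping.keys (m - m' :: 'v \<Rightarrow>\<^sub>0 nat) \<subseteq> Poly_Mapping.keys m"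
  by (auto simp: in_keys_iff lookup_minus)

lemma mono_deg_superset: "finite A \<Longrightarrow> Poly_Mapping.keys m \<subseteq> A \<Longrightarrow> mono_deg m = (\<Sum>a\<in>A. lk m a)"
  unfolding mono_deg_def by (rule sum.mono_neutral_left) (auto simp: in_keys_iff)

lemma mono_deg_add: "mono_deg (m + m') = mono_deg m + mono_deg m'"
  using mono_deg_superset[of "Poly_Mapping.keys m \<union> Poly_Mapping.keys m'" m]
    mono_deg_superset[of "Poly_Mapping.keys m \<union> Poly_Mapping.keys m'" m']
    mono_deg_superset[of "Poly_Mapping.keys m \<union> Poly_Mapping.keys m'" "m + m'"]
  by (simp add: keys_add_nat lookup_add sum.distrib)

lemma mono_deg_0 [simp]: "mono_deg 0 = 0" by (simp add: mono_deg_def)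

lemma mono_deg_single [simp]: "mono_deg (Poly_Mapping.single a n) = n"
  by (simp add: mono_deg_def)

lemma lookup_le_mono_deg: "lk m a \<le> mono_deg m"
  by (cases "a \<in> Poly_Mapping.keys m") (auto simp: mono_deg_def in_keys_iff intro: member_le_sum)

lemma mono_deg_eq_0: "mono_deg m = 0 \<longleftrightarrow> m = 0"
  using lookup_le_mono_deg[of m] by (auto intro!: poly_mapping_eqI)

text \<open>Exponent of the squarefree monomial of \<open>\<sigma>\<close>, which is the multidegree
  of \<open>e_\<sigma>\<close>.\<close>

definition ind :: "'v set \<Rightarrow> 'v \<Rightarrow>\<^sub>0 nat" where
  "ind \<sigma> = (\<Sum>a\<in>\<sigma>. Poly_Mapping.single a 1)"

lemma lookup_ind: "finite \<sigma> \<Longrightarrow> lk (ind \<sigma>) a = (if a \<in> \<sigma> then 1 else 0)"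
  by (simp add: ind_def lookup_sum lookup_single when_def)

lemma ind_insert: "finite \<sigma> \<Longrightarrow> a \<notin> \<sigma> \<Longrightarrow> ind (insert a \<sigma>) = Poly_Mapping.single a 1 + ind \<sigma>"
  by (simp add: ind_def)

lemma mono_deg_ind: "finite \<sigma> \<Longrightarrow> mono_deg (ind \<sigma>) = card \<sigma>"
  by (induction \<sigma> rule: finite_induct) (auto simp: ind_insert mono_deg_add, simp add: ind_def)

lemma keys_ind: "finite \<sigma> \<Longrightarrow> Poly_Mapping.keys (ind \<sigma>) = \<sigma>"
  by (auto simp: in_keys_iff lookup_ind split: if_splits)

section \<open>Finiteness properties of monomials, and Dickson's lemma\<close>

lemma finite_monos:
  assumes "finite A"
  shows "finite {m :: 'v \<Rightarrow>\<^sub>0 nat. Poly_Mapping.keys m \<subseteq> A \<and> mono_deg m \<le> n}"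
proof -
  have "finite {f. (\<forall>a. (a \<in> A \<longrightarrow> f a \<in> {..n}) \<and> (a \<notin> A \<longrightarrow> f a = 0))}"
    using finite_set_of_finite_funs[OF assms, of "{..n}" 0] by simp
  moreover have "lk ` {m :: 'v \<Rightarrow>\<^sub>0 nat. Poly_Mapping.keys m \<subseteq> A \<and> mono_deg m \<le> n} \<subseteq>
      {f. (\<forall>a. (a \<in> A \<longrightarrow> f a \<in> {..n}) \<and> (a \<notin> A \<longrightarrow> f a = 0))}"
  proof (rule image_subsetI, rule CollectI, rule allI)
    fix m :: "'v \<Rightarrow>\<^sub>0 nat" and a
    assume "m \<in> {m. Poly_Mapping.keys m \<subseteq> A \<and> mono_deg m \<le> n}"
    then show "(a \<in> A \<longrightarrow> lk m a \<in> {..n}) \<and> (a \<notin> A \<longrightarrow> lk m a = 0)"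
      using lookup_le_mono_deg[of m a] by (auto simp: in_keys_iff)
  qed
  ultimately have "finite (lk ` {m :: 'v \<Rightarrow>\<^sub>0 nat. Poly_Mapping.keys m \<subseteq> A \<and> mono_deg m \<le> n})"
    by (rule rev_finite_subset)
  then show ?thesis by (rule finite_imageD) (rule inj_onI, erule Poly_Mapping.lookup_inject[THEN iffD1])
qed

text \<open>Induction on the number of variables. A finite basis \<open>B\<close> for the smaller
  set bounds the new exponent of its members by some \<open>T\<close>: vectors whose new exponent is
  at least \<open>T\<close> are handled by \<open>B\<close>, the others lie in one of finitely many
  slices, each with a finite basis of its own.\<close>

lemma dickson_fun:
  assumes "finite V"
  shows "\<exists>B\<subseteq>A. finite B \<and> (\<forall>a\<in>A. \<exists>b\<in>B. \<forall>v\<in>V. b v \<le> (a v :: nat))"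
  using assms
proof (induction V arbitrary: A rule: finite_induct)
  case empty
  show ?case
  proof (cases "A = {}")
    case False
    then obtain a where "a \<in> A" by blast
    then show ?thesis by (intro exI[of _ "{a}"]) auto
  qed auto
next
  case (insert x V)
  obtain B where B: "B \<subseteq> A" "finite B" "\<forall>a\<in>A. \<exists>b\<in>B. \<forall>v\<in>V. b v \<le> a v"
    using insert.IH[of A] by blast
  define T where "T = Max (insert 0 ((\<lambda>b. b x) ` B))"
  have T: "b x \<le> T" if "b \<in> B" for b using that B(2) by (auto simp: T_def)
  have "\<forall>t. \<exists>C. C \<subseteq> {a\<in>A. a x = t} \<and> finite C \<and> (\<forall>a\<in>{a\<in>A. a x = t}. \<exists>b\<in>C. \<forall>v\<in>V. b v \<le> a v)"
    using insert.IH by blast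
  from choice[OF this] obtain C where
    "\<forall>t. C t \<subseteq> {a\<in>A. a x = t} \<and> finite (C t) \<and> (\<forall>a\<in>{a\<in>A. a x = t}. \<exists>b\<in>C t. \<forall>v\<in>V. b v \<le> a v)" ..
  then have C: "\<And>t. C t \<subseteq> {a\<in>A. a x = t}" "\<And>t. finite (C t)"
    "\<And>t a. a \<in> A \<Longrightarrow> a x = t \<Longrightarrow> \<exists>b\<in>C t. \<forall>v\<in>V. b v \<le> a v"
    by blast+
  have "\<exists>b\<in>B \<union> (\<Union>t<T. C t). \<forall>v\<in>insert x V. b v \<le> a v" if a: "a \<in> A" for a
  proof (cases "a x < T")
    case True
    obtain b where b: "b \<in> C (a x)" "\<forall>v\<in>V. b v \<le> a v" using C(3)[OF a refl] by blast
    then have "b x = a x" using C(1) by blast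
    then show ?thesis using b True by (intro bexI[of _ b]) auto
  next
    case False
    obtain b where b: "b \<in> B" "\<forall>v\<in>V. b v \<le> a v" using B(3) a by blast
    then show ?thesis using T[OF b(1)] False by (intro bexI[of _ b]) auto
  qed
  moreover have "B \<union> (\<Union>t<T. C t) \<subseteq> A" using B(1) C(1) by blast
  moreover have "finite (B \<union> (\<Union>t<T. C t))" using B(2) C(2) by blast
  ultimately show ?case by blast
qed

text \<open>Monomials tagged by finitely many components, as for lead terms in a free module. The
  cofactor \<open>\<mu>\<close> is explicit because later arguments multiply by it.\<close>

lemma dickson:
  fixes A :: "('c \<times> ('v \<Rightarrow>\<^sub>0 nat)) set"
  assumes C: "finite C" and V: "finite V" and A: "\<And>c m. (c, m) \<in> A \<Longrightarrow> c \<in> C \<and> Poly_Mapping.keys m \<subseteq> V"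
  shows "\<exists>B\<subseteq>A. finite B \<and> (\<forall>c m. (c, m) \<in> A \<longrightarrow> (\<exists>m0 \<mu>. (c, m0) \<in> B \<and> m = m0 + \<mu>))"
proof -
  have "\<forall>c. \<exists>B. B \<subseteq> {m. (c, m) \<in> A} \<and> finite B \<and> (\<forall>m\<in>{m. (c, m) \<in> A}. \<exists>m0 \<mu>. m0 \<in> B \<and> m = m0 + \<mu>)"
  proof
    fix c
    obtain B' where B': "B' \<subseteq> lk ` {m. (c, m) \<in> A}" "finite B'"
      "\<forall>a\<in>lk ` {m. (c, m) \<in> A}. \<exists>b\<in>B'. \<forall>v\<in>V. b v \<le> a v"
      using dickson_fun[OF V, of "lk ` {m. (c, m) \<in> A}"] by blast
    obtain B where B: "B \<subseteq> {m. (c, m) \<in> A}" "finite B" "B' = lk ` B"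
      using finite_subset_image[OF B'(2,1)] by blast
    have "\<exists>m0 \<mu>. m0 \<in> B \<and> m = m0 + \<mu>" if m: "(c, m) \<in> A" for m
    proof -
      obtain m0 where m0: "m0 \<in> B" "\<forall>v\<in>V. lk m0 v \<le> lk m v" using B'(3) B(3) m by fastforce
      have "Poly_Mapping.keys m0 \<subseteq> V" using m0(1) B(1) A by blast
      then have "lk m0 v \<le> lk m v" for v using m0(2) by (metis in_keys_iff le0 subsetD)
      then have "m = m0 + (m - m0)" by (simp add: mono_diff)
      then show ?thesis using m0(1) by blast
    qed
    then show "\<exists>B. B \<subseteq> {m. (c, m) \<in> A} \<and> finite B \<and> (\<forall>m\<in>{m. (c, m) \<in> A}. \<exists>m0 \<mu>. m0 \<in> B \<and> m = m0 + \<mu>)"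
      using B(1,2) by blast
  qed
  from choice[OF this] obtain B where
    "\<forall>c. B c \<subseteq> {m. (c, m) \<in> A} \<and> finite (B c) \<and> (\<forall>m\<in>{m. (c, m) \<in> A}. \<exists>m0 \<mu>. m0 \<in> B c \<and> m = m0 + \<mu>)" ..
  then have B: "\<And>c. B c \<subseteq> {m. (c, m) \<in> A}" "\<And>c. finite (B c)"
    "\<And>c m. (c, m) \<in> A \<Longrightarrow> \<exists>m0 \<mu>. m0 \<in> B c \<and> m = m0 + \<mu>" by blast+
  have "finite (SIGMA c:C. B c)" using C B(2) by blast
  moreover have "(SIGMA c:C. B c) \<subseteq> A" using B(1) by blast
  moreover have "\<forall>c m. (c, m) \<in> A \<longrightarrow> (\<exists>m0 \<mu>. (c, m0) \<in> (SIGMA c:C. B c) \<and> m = m0 + \<mu>)"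
  proof (intro allI impI)
    fix c m assume a: "(c, m) \<in> A"
    from B(3)[OF a] obtain m0 \<mu> where "m0 \<in> B c" "m = m0 + \<mu>" by blast
    then show "\<exists>m0 \<mu>. (c, m0) \<in> (SIGMA c:C. B c) \<and> m = m0 + \<mu>"
      using A[OF a] by (intro exI[of _ m0] exI[of _ \<mu>]) simp
  qed
  ultimately show ?thesis by blast
qed

section \<open>Graded pieces of the polynomial ring\<close>

definition hp :: "nat \<Rightarrow> int \<Rightarrow> (nat, 'k::field) mpol set" where
  "hp d j = {p. \<forall>m\<in>Poly_Mapping.keys p. Poly_Mapping.keys m \<subseteq> {..<d} \<and> int (mono_deg m) = j}"

abbreviation Xp :: "nat \<Rightarrow> (nat, 'k::field) mpol \<Rightarrow> (nat, 'k) mpol" where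
  "Xp \<equiv> (\<lambda>a p. mp_var a * p)"

lemma hpD: "p \<in> hp d j \<Longrightarrow> lk p m \<noteq> 0 \<Longrightarrow> Poly_Mapping.keys m \<subseteq> {..<d} \<and> int (mono_deg m) = j"
  by (auto simp: hp_def in_keys_iff)

lemma hpI: "(\<And>m. lk p m \<noteq> 0 \<Longrightarrow> Poly_Mapping.keys m \<subseteq> {..<d} \<and> int (mono_deg m) = j) \<Longrightarrow> p \<in> hp d j"
  by (auto simp: hp_def in_keys_iff)

lemma hp_0 [simp]: "0 \<in> hp d j" by (simp add: hp_def)

lemma hp_add: "p \<in> hp d j \<Longrightarrow> q \<in> hp d j \<Longrightarrow> p + q \<in> hp d j"
  using keys_add[of p q] by (auto simp: hp_def)

lemma hp_uminus: "p \<in> hp d j \<Longrightarrow> - p \<in> hp d j"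
  by (simp add: hp_def in_keys_iff)

lemma hp_diff: "p \<in> hp d j \<Longrightarrow> q \<in> hp d j \<Longrightarrow> p - q \<in> hp d j"
  using hp_add[of p d j "- q"] hp_uminus[of q d j] by simp

lemma hp_sum: "(\<And>a. a \<in> A \<Longrightarrow> f a \<in> hp d j) \<Longrightarrow> sum f A \<in> hp d j"
  by (induction A rule: infinite_finite_induct) (auto intro: hp_add)

lemma hp_mult:
  assumes "p \<in> hp d i" "q \<in> hp d j"
  shows "p * q \<in> hp d (i + j)"
  using assms keys_mult[of p q] by (fastforce simp: hp_def keys_add_nat mono_deg_add)

lemma hp_single: "Poly_Mapping.keys m \<subseteq> {..<d} \<Longrightarrow> int (mono_deg m) = j \<Longrightarrow> Poly_Mapping.single m c \<in> hp d j"
  by (auto simp: hp_def)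

lemma hp_const: "Poly_Mapping.single 0 c \<in> hp d 0"
  by (rule hp_single) auto

lemma hp_var: "a < d \<Longrightarrow> mp_var a \<in> hp d 1"
  by (rule hp_single) auto

lemma hp_neg: "j < 0 \<Longrightarrow> p \<in> hp d j \<Longrightarrow> p = 0"
  by (rule poly_mapping_eqI) (metis hpD lookup_zero of_nat_0_le_iff not_le)

lemma gmod_hp: "gmod {..<d} Xp (hp d)"
  unfolding gmod_def
proof (intro allI conjI ballI)
  fix j a and x :: "(nat, 'k::field) mpol" assume "a \<in> {..<d}" "x \<in> hp d j"
  then show "mp_var a * x \<in> hp d (j + 1)" using hp_mult[OF hp_var[of a d], of x j] by (simp add: add.commute)
qed (simp_all add: hp_diff)

lemma kop_Xp: "finite V \<Longrightarrow> kop V Xp"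
  by unfold_locales (auto simp: algebra_simps)

lemma kop_id: "finite V \<Longrightarrow> kop V (\<lambda>a y. y)"
  by unfold_locales auto

lemma lookup_sgs: "lk (sgs a \<tau> y) m = sgs a \<tau> (lk y m)"
  by (simp add: sgs_def)

lemma lookup_var_mult:
  fixes p :: "(nat, 'k::field) mpol"
  shows "lk (mp_var a * p) m = (if a \<in> Poly_Mapping.keys m then lk p (m - Poly_Mapping.single a 1) else 0)"
proof (cases "a \<in> Poly_Mapping.keys m")
  case True
  then have "Poly_Mapping.single a 1 + (m - Poly_Mapping.single a 1) = m"
    by (intro mono_diff) (auto simp: lookup_single when_def in_keys_iff)
  then show ?thesis using True lookup_single_mult[of "Poly_Mapping.single a 1" 1 p "m - Poly_Mapping.single a 1"]
    by simp
next
  case False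
  have "m \<noteq> Poly_Mapping.single a 1 + m'" for m' using False by (auto simp: keys_add_nat)
  then show ?thesis using False by (simp add: lookup_single_mult_0)
qed

text \<open>With \<open>e_\<sigma>\<close> in multidegree \<open>ind \<sigma>\<close> the Koszul
  complex of \<open>k[x]\<close> splits by multidegree. In the strand of \<open>\<mu>\<close> each
  \<open>\<sigma>\<close> inside the support of \<open>\<mu>\<close> contributes one coefficient and
  each variable acts as the identity; this is why \<open>bd\<close> takes the set of variables as an
  argument.\<close>

lemma strand:
  fixes v :: "nat set \<Rightarrow> (nat, 'k::field) mpol"
  assumes V: "finite V" and \<mu>: "Poly_Mapping.keys \<mu> \<subseteq> V" and \<tau>: "\<tau> \<subseteq> Poly_Mapping.keys \<mu>"
  shows "lk (bd V Xp v \<tau>) (\<mu> - ind \<tau>) =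
    bd (Poly_Mapping.keys \<mu>) (\<lambda>a y. y) (\<lambda>\<sigma>. if \<sigma> \<subseteq> Poly_Mapping.keys \<mu> then lk (v \<sigma>) (\<mu> - ind \<sigma>) else 0) \<tau>"
proof -
  have f: "finite \<tau>" using finite_subset[OF \<tau>] by simp
  have \<tau>V: "\<tau> \<subseteq> V" using \<tau> \<mu> by blast
  have a: "lk (mp_var a * v (insert a \<tau>)) (\<mu> - ind \<tau>) =
      (if a \<in> Poly_Mapping.keys \<mu> then lk (v (insert a \<tau>)) (\<mu> - ind (insert a \<tau>)) else 0)" if "a \<notin> \<tau>" for a
  proof -
    have "a \<in> Poly_Mapping.keys (\<mu> - ind \<tau>) \<longleftrightarrow> a \<in> Poly_Mapping.keys \<mu>"
      using that f by (simp add: in_keys_iff lookup_minus lookup_ind)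
    moreover have "\<mu> - ind \<tau> - Poly_Mapping.single a 1 = \<mu> - ind (insert a \<tau>)"
      using that f by (simp add: ind_insert add.commute diff_diff_eq)
    ultimately show ?thesis by (simp only: lookup_var_mult)
  qed
  have "lk (bd V Xp v \<tau>) (\<mu> - ind \<tau>) = (\<Sum>b\<in>V - \<tau>. sgs b \<tau> (lk (mp_var b * v (insert b \<tau>)) (\<mu> - ind \<tau>)))"
    unfolding bd_def if_P[OF \<tau>V] by (simp add: lookup_sum lookup_sgs)
  also have "\<dots> = (\<Sum>b\<in>V - \<tau>. if b \<in> Poly_Mapping.keys \<mu> then sgs b \<tau> (lk (v (insert b \<tau>)) (\<mu> - ind (insert b \<tau>))) else 0)"
    by (rule sum.cong[OF refl]) (simp add: a)
  also have "\<dots> = (\<Sum>b\<in>Poly_Mapping.keys \<mu> - \<tau>. sgs b \<tau> (lk (v (insert b \<tau>)) (\<mu> - ind (insert b \<tau>))))"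
    using V \<mu> by (intro sum.mono_neutral_cong_right) auto
  also have "\<dots> = bd (Poly_Mapping.keys \<mu>) (\<lambda>a y. y) (\<lambda>\<sigma>. if \<sigma> \<subseteq> Poly_Mapping.keys \<mu> then lk (v \<sigma>) (\<mu> - ind \<sigma>) else 0) \<tau>"
    unfolding bd_def if_P[OF \<tau>] by (rule sum.cong[OF refl]) (use \<tau> in auto)
  finally show ?thesis .
qed

text \<open>The multigraded strand of weight \<open>\<mu>\<close> with \<open>\<mu> c > E\<close> is contracted by \<open>e\<^sub>c \<and> _\<close>; peeling off
  the strand of largest weight reduces an ideal to its initial ideal.\<close>

lemma hz_bound:
  fixes J :: "int \<Rightarrow> (nat, 'k::field) mpol set"
  assumes g: "gmod {..<d} Xp J" and sc: "\<And>j c f. f \<in> J j \<Longrightarrow> mp_const c * f \<in> J j"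
    and hp: "\<And>j. J j \<subseteq> hp d j"
    and lead1: "\<And>j f m. f \<in> J j \<Longrightarrow> lk f m \<noteq> 0 \<Longrightarrow> (\<And>m'. m < m' \<Longrightarrow> lk f m' = 0) \<Longrightarrow> m \<in> LM"
    and lead2: "\<And>m. m \<in> LM \<Longrightarrow> \<exists>f\<in>J (int (mono_deg m)). lk f m = 1 \<and> (\<forall>m'>m. lk f m' = 0)"
    and LM: "\<And>m c. m \<in> LM \<Longrightarrow> c < d \<Longrightarrow> lk m c > E \<Longrightarrow> m - Poly_Mapping.single c 1 \<in> LM"
    and j: "j > int (d * E)"
  shows "hz {..<d} Xp p J j"
proof -
  let ?V = "{..<d}"
  have k: "kop ?V Xp" by (rule kop_Xp) simp
  \<comment> \<open>All multidegrees of total degree \<open>j\<close>; their finiteness replaces a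
    well-order.\<close>
  define T where "T = {m. Poly_Mapping.keys m \<subseteq> ?V \<and> int (mono_deg m) = j}"
  have finT: "finite T" using finite_monos[of ?V "nat j"] unfolding T_def by (rule finite_subset[rotated]) auto
  have wt: "m + ind \<sigma> \<in> T" if "v \<in> Kc ?V q J j" "lk (v \<sigma>) m \<noteq> 0" for v :: "nat set \<Rightarrow> (nat, 'k) mpol" and q \<sigma> m
  proof -
    have "v \<sigma> \<in> hp d (j - int (card \<sigma>))" using Kc_mem[OF that(1)] hp by blast
    then have m: "Poly_Mapping.keys m \<subseteq> ?V" "int (mono_deg m) = j - int (card \<sigma>)" using hpD that(2) by blast+
    have "v \<sigma> \<noteq> 0" using that(2) by auto
    then have "\<sigma> \<subseteq> ?V" using Kc_support[OF that(1)] by blast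
    then have "finite \<sigma>" "\<sigma> \<subseteq> ?V" using finite_subset by auto
    then show ?thesis using m by (auto simp: T_def keys_add_nat keys_ind mono_deg_add mono_deg_ind)
  qed
  \<comment> \<open>Induction on a down-closed set of multidegrees containing the support of the
    cycle; each round clears its largest element.\<close>
  have main: "\<exists>u\<in>Kc ?V (Suc p) J j. bd ?V Xp u = v"
    if "finite A" "A \<subseteq> T" "\<And>x y. x \<in> A \<Longrightarrow> y \<in> T \<Longrightarrow> y < x \<Longrightarrow> y \<in> A"
      "v \<in> Kc ?V p J j" "\<And>\<tau>. bd ?V Xp v \<tau> = 0" "\<And>\<sigma> m. lk (v \<sigma>) m \<noteq> 0 \<Longrightarrow> m + ind \<sigma> \<in> A" for A v
    using that
  proof (induction A arbitrary: v rule: finite_linorder_max_induct)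
    case empty
    have "v = (\<lambda>_. 0)" using empty.prems(5) by (intro ext poly_mapping_eqI) auto
    then show ?case using gmod_zero[OF g] kop.bd_zero[OF k] by (intro bexI[of _ "\<lambda>_. 0"]) (auto simp: Kc_def)
  next
    case (insert \<mu> A)
    have down: "y \<in> A" if "y \<in> T" "y < x" "x \<in> insert \<mu> A" for x y
      using insert.prems(2)[OF that(3,1,2)] that(2,3) insert.hyps(2) by force
    have AT: "A \<subseteq> T" and \<mu>T: "\<mu> \<in> T" using insert.prems(1) by auto
    let ?K = "Poly_Mapping.keys \<mu>"
    have \<mu>V: "?K \<subseteq> ?V" and \<mu>deg: "int (mono_deg \<mu>) = j" using \<mu>T by (auto simp: T_def)
    \<comment> \<open>By pigeonhole: \<open>d\<close> exponents of at most \<open>E\<close> add up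
      to at most \<open>d * E < j\<close>.\<close>
    have "\<exists>c<d. lk \<mu> c > E"
    proof (rule ccontr)
      assume "\<not> ?thesis"
      then have "\<And>c. c \<in> ?V \<Longrightarrow> lk \<mu> c \<le> E" by (meson lessThan_iff not_le)
      then have "mono_deg \<mu> \<le> card ?V * E"
        using mono_deg_superset[OF _ \<mu>V] sum_bounded_above[of ?V "lk \<mu>" E] by simp
      then have "int (mono_deg \<mu>) \<le> int (d * E)" by (simp only: of_nat_le_iff card_lessThan)
      then show False using j \<mu>deg by linarith
    qed
    then obtain c where c: "c < d" "lk \<mu> c > E" by blast
    have cK: "c \<in> ?K" using c by (simp add: in_keys_iff)
    \<comment> \<open>The part of \<open>v\<close> of multidegree \<open>\<mu>\<close>. It is a
      cycle of the strand, hence the boundary of \<open>y = e_c \<and> z\<close> there.\<close>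
    define z where "z \<sigma> = (if \<sigma> \<subseteq> ?K then lk (v \<sigma>) (\<mu> - ind \<sigma>) else 0)" for \<sigma>
    define y where "y = wedge c z"
    have bdz: "bd ?K (\<lambda>a y. y) z \<tau> = 0" for \<tau>
    proof (cases "\<tau> \<subseteq> ?K")
      case True
      then show ?thesis using strand[OF _ \<mu>V True, of v] insert.prems(4) by (simp add: z_def[abs_def])
    qed (simp add: bd_def)
    have bdy: "bd ?K (\<lambda>a y. y) y \<tau> = z \<tau>" if "\<tau> \<subseteq> ?K" for \<tau>
      using kop.bd_wedge[OF kop_id cK that, of z] by (simp add: y_def bdz wedge_def)
    have indle: "ind \<sigma> + (\<mu> - ind \<sigma>) = \<mu>" if "\<sigma> \<subseteq> ?K" for \<sigma>
      using that finite_subset[OF that] by (intro mono_diff) (auto simp: lookup_ind in_keys_iff Suc_le_eq)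
    \<comment> \<open>Passing from \<open>z\<close> to \<open>y\<close> divides the monomial by
      \<open>x_c\<close>. It was a lead monomial with exponent above \<open>E\<close> at
      \<open>c\<close>, so the quotient is still in \<open>LM\<close>.\<close>
    have ysupp: "\<sigma> \<subseteq> ?K \<and> card \<sigma> = Suc p \<and> \<mu> - ind \<sigma> \<in> LM" if "y \<sigma> \<noteq> 0" for \<sigma>
    proof -
      let ?s = "\<sigma> - {c}"
      have c\<sigma>: "c \<in> \<sigma>" and "z ?s \<noteq> 0" using that by (auto simp: y_def wedge_def split: if_splits)
      then have s: "?s \<subseteq> ?K" and nz: "lk (v ?s) (\<mu> - ind ?s) \<noteq> 0" by (auto simp: z_def split: if_splits)
      have fs: "finite ?s" using finite_subset[OF s] by simp
      have \<sigma>: "\<sigma> = insert c ?s" using c\<sigma> by auto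
      have "v ?s \<noteq> 0" using nz by auto
      then have "card ?s = p" using Kc_support[OF insert.prems(3)] by blast
      then have card: "card \<sigma> = Suc p" using \<sigma> fs by (metis Diff_iff card_insert_disjoint insertI1)
      have "lk (v ?s) m' = 0" if "\<mu> - ind ?s < m'" for m'
      proof (rule ccontr)
        assume "lk (v ?s) m' \<noteq> 0"
        then have "m' + ind ?s \<in> insert \<mu> A" using insert.prems(5) by blast
        then have "m' + ind ?s \<le> \<mu>" using insert.hyps(2) by auto
        moreover have "\<mu> - ind ?s + ind ?s < m' + ind ?s" using that by (rule add_strict_right_mono)
        ultimately show False using indle[OF s] by (simp add: add.commute)
      qed
      then have "\<mu> - ind ?s \<in> LM" using lead1[OF Kc_mem[OF insert.prems(3)] nz] by blast
      moreover have "lk (\<mu> - ind ?s) c > E" using c fs by (simp add: lookup_minus lookup_ind)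
      ultimately have "\<mu> - ind ?s - Poly_Mapping.single c 1 \<in> LM" using LM c(1) by blast
      moreover have "\<mu> - ind ?s - Poly_Mapping.single c 1 = \<mu> - ind \<sigma>"
      proof -
        have "ind \<sigma> = Poly_Mapping.single c 1 + ind ?s" using ind_insert[OF fs, of c] \<sigma> by simp
        then show ?thesis by (simp add: add.commute diff_diff_eq)
      qed
      ultimately show ?thesis using card s \<sigma> cK by (metis insert_subset)
    qed
    obtain fm where fm: "\<And>m. m \<in> LM \<Longrightarrow> fm m \<in> J (int (mono_deg m)) \<and> lk (fm m) m = 1 \<and> (\<forall>m'>m. lk (fm m) m' = 0)"
      using lead2 by metis
    \<comment> \<open>The coefficients of \<open>y\<close> are lifted to elements of
      \<open>J\<close> with the prescribed lead monomials, so \<open>bd u\<close> agrees with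
      \<open>v\<close> in multidegree \<open>\<mu>\<close> and has nothing above it.\<close>
    define u where "u \<sigma> = (if y \<sigma> \<noteq> 0 then mp_const (y \<sigma>) * fm (\<mu> - ind \<sigma>) else 0)" for \<sigma>
    have u: "u \<in> Kc ?V (Suc p) J j"
    proof (rule KcI)
      fix \<sigma>
      show "u \<sigma> \<in> J (j - int (card \<sigma>))"
      proof (cases "y \<sigma> = 0")
        case False
        have s: "\<sigma> \<subseteq> ?K" using ysupp[OF False] by blast
        have "mono_deg \<mu> = card \<sigma> + mono_deg (\<mu> - ind \<sigma>)"
          using mono_deg_add[of "ind \<sigma>" "\<mu> - ind \<sigma>"] indle[OF s] mono_deg_ind[of \<sigma>] finite_subset[OF s] by simp
        then have "int (mono_deg (\<mu> - ind \<sigma>)) = j - int (card \<sigma>)" using \<mu>deg by linarith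
        then show ?thesis using False fm ysupp[OF False] sc by (simp add: u_def) metis
      qed (simp add: u_def gmod_zero[OF g])
      show "\<sigma> \<subseteq> ?V \<and> card \<sigma> = Suc p" if "u \<sigma> \<noteq> 0"
        using that ysupp[of \<sigma>] \<mu>V by (auto simp: u_def split: if_splits)
    qed
    have ule: "m + ind \<sigma> \<le> \<mu>" if "lk (u \<sigma>) m \<noteq> 0" for \<sigma> m
    proof -
      have y0: "y \<sigma> \<noteq> 0" using that by (auto simp: u_def)
      then have "lk (fm (\<mu> - ind \<sigma>)) m \<noteq> 0" using that by (simp add: u_def lookup_const_mult)
      then have "m \<le> \<mu> - ind \<sigma>" using fm ysupp[OF y0] by (meson not_le)
      then have "ind \<sigma> + m \<le> ind \<sigma> + (\<mu> - ind \<sigma>)" by (rule add_left_mono)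
      then show ?thesis using indle ysupp[OF y0] by (simp add: add.commute)
    qed
    have uy: "(if \<sigma> \<subseteq> ?K then lk (u \<sigma>) (\<mu> - ind \<sigma>) else 0) = y \<sigma>" for \<sigma>
      using ysupp[of \<sigma>] fm by (auto simp: u_def lookup_const_mult)
    have bdu: "lk (bd ?V Xp u \<sigma>) (\<mu> - ind \<sigma>) = z \<sigma>" if "\<sigma> \<subseteq> ?K" for \<sigma>
      using strand[OF _ \<mu>V that, of u] bdy[OF that] unfolding uy by simp
    have bdule: "m + ind \<tau> \<le> \<mu>" if nz: "lk (bd ?V Xp u \<tau>) m \<noteq> 0" for \<tau> m
    proof -
      have \<tau>: "\<tau> \<subseteq> ?V" using nz by (auto simp: bd_def split: if_splits)
      have "(\<Sum>a\<in>?V - \<tau>. sgs a \<tau> (lk (mp_var a * u (insert a \<tau>)) m)) \<noteq> 0"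
        using nz unfolding bd_def if_P[OF \<tau>] by (simp add: lookup_sum lookup_sgs)
      from sum.not_neutral_contains_not_neutral[OF this]
      obtain a where a: "a \<in> ?V - \<tau>" "lk (mp_var a * u (insert a \<tau>)) m \<noteq> 0" by auto
      then have am: "a \<in> Poly_Mapping.keys m" and "lk (u (insert a \<tau>)) (m - Poly_Mapping.single a 1) \<noteq> 0"
        by (auto simp only: lookup_var_mult split: if_splits)
      then have "m - Poly_Mapping.single a 1 + ind (insert a \<tau>) \<le> \<mu>" using ule by blast
      moreover have "Poly_Mapping.single a 1 + (m - Poly_Mapping.single a 1) = m"
        using am by (intro mono_diff) (auto simp: lookup_single when_def in_keys_iff)
      moreover have "ind (insert a \<tau>) = Poly_Mapping.single a 1 + ind \<tau>"
        using a(1) finite_subset[OF \<tau>] by (intro ind_insert) auto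
      moreover have "A + (x + t) = (x + A) + t" for A x t :: mono by (simp only: ac_simps)
      ultimately show ?thesis by (simp only:)
    qed
    let ?v' = "\<lambda>\<sigma>. v \<sigma> - bd ?V Xp u \<sigma>"
    have v': "?v' \<in> Kc ?V p J j" using Kc_diff[OF g insert.prems(3) Kc_bd[OF g k u]] .
    have sup: "m + ind \<sigma> \<in> A" if nz: "lk (?v' \<sigma>) m \<noteq> 0" for \<sigma> m
    proof -
      have T: "m + ind \<sigma> \<in> T" using wt[OF v' nz] .
      have fin\<sigma>: "finite \<sigma>"
      proof -
        have "?v' \<sigma> \<noteq> 0" using nz by auto
        then have "\<sigma> \<subseteq> ?V" using Kc_support[OF v'] by blast
        then show ?thesis by (rule finite_subset) simp
      qed
      have "m + ind \<sigma> \<le> \<mu>"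
      proof (cases "lk (v \<sigma>) m = 0")
        case True
        then show ?thesis using bdule[of \<sigma> m] nz by (simp add: lookup_minus)
      next
        case False
        then show ?thesis using insert.prems(5)[OF False] insert.hyps(2) by auto
      qed
      moreover have "m + ind \<sigma> \<noteq> \<mu>"
      proof
        assume e: "m + ind \<sigma> = \<mu>"
        then have s: "\<sigma> \<subseteq> ?K" using keys_ind[OF fin\<sigma>] keys_add_nat[of m "ind \<sigma>"] by auto
        have "m = \<mu> - ind \<sigma>" using e by (metis add_diff_cancel_right')
        then show False using nz bdu[OF s] s by (simp add: lookup_minus z_def)
      qed
      ultimately show ?thesis using down[OF T, of \<mu>] by auto
    qed
    have z': "bd ?V Xp ?v' \<tau> = 0" for \<tau>
      by (simp add: kop.bd_diff[OF k] insert.prems(4) kop.bd_bd[OF k])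
    have "\<exists>w\<in>Kc ?V (Suc p) J j. bd ?V Xp w = ?v'"
      by (rule insert.IH[OF AT _ v' z' sup]) (rule down, assumption+, simp)
    then obtain w where w: "w \<in> Kc ?V (Suc p) J j" "bd ?V Xp w = ?v'" ..
    have "bd ?V Xp (\<lambda>\<sigma>. w \<sigma> + u \<sigma>) = v"
      by (rule ext) (simp add: kop.bd_add[OF k] w(2))
    then show ?case using Kc_add[OF g w(1) u] by blast
  qed
  show ?thesis
  proof (rule hzI)
    fix v assume v: "v \<in> Kc ?V p J j" "\<And>\<tau>. bd ?V Xp v \<tau> = 0"
    show "\<exists>u\<in>Kc ?V (Suc p) J j. bd ?V Xp u = v"
      by (rule main[OF finT]) (use v wt in auto)
  qed
qed

text \<open>Every monomial is a lead monomial of \<open>k[x]\<close>, so \<open>hz_bound\<close>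
  applies with \<open>E = 0\<close>. In degrees \<open>j \<le> 0\<close> a chain of positive
  homological degree has coefficients of negative degree and vanishes.\<close>

lemma hz_hp: "hz {..<d} Xp (Suc p) (hp d :: int \<Rightarrow> (nat, 'k::field) mpol set) j"
proof (cases "j > 0")
  case True
  show ?thesis
  proof (rule hz_bound[where LM="{m. Poly_Mapping.keys m \<subseteq> {..<d}}" and E=0])
    show "mp_const c * f \<in> hp d j" if "f \<in> hp d j" for j c and f :: "(nat, 'k) mpol"
      using hp_mult[OF hp_const that] by simp
    show "\<exists>f\<in>hp d (int (mono_deg m)). lk f m = (1::'k) \<and> (\<forall>m'>m. lk f m' = 0)"
      if "m \<in> {m. Poly_Mapping.keys m \<subseteq> {..<d}}" for m
      using that by (intro bexI[of _ "mp_mono m"]) (auto simp: lookup_single when_def intro: hp_single)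
    show "m - Poly_Mapping.single c 1 \<in> {m. Poly_Mapping.keys m \<subseteq> {..<d}}"
      if "m \<in> {m. Poly_Mapping.keys m \<subseteq> {..<d}}" for m :: mono and c
      using that keys_minus_nat[of m "Poly_Mapping.single c 1"] by blast
    show "gmod {..<d} Xp (hp d)" by (rule gmod_hp)
  qed (use True in \<open>auto dest: hpD\<close>)
next
  case False
  show ?thesis
  proof (rule hzI)
    fix v :: "nat set \<Rightarrow> (nat, 'k) mpol" assume v: "v \<in> Kc {..<d} (Suc p) (hp d) j"
    have "v \<sigma> = 0" for \<sigma>
      using Kc_support[OF v, of \<sigma>] Kc_mem[OF v, of \<sigma>] hp_neg[of "j - int (card \<sigma>)" "v \<sigma>"] False by fastforce
    then have "bd {..<d} Xp (\<lambda>_. 0) = v" by (simp add: fun_eq_iff kop.bd_zero[OF kop_Xp])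
    then show "\<exists>u\<in>Kc {..<d} (Suc (Suc p)) (hp d) j. bd {..<d} Xp u = v"
      by (intro bexI[of _ "\<lambda>_. 0"]) (auto simp: Kc_def)
  qed
qed

section \<open>Submodules of graded free modules\<close>

definition Pd :: "nat \<Rightarrow> (nat, 'k::field) mpol set" where "Pd d = {p. mp_vars p \<subseteq> {..<d}}"

lemma carrier_mpr [simp]: "carrier (mpr d) = Pd d" by (simp add: mpr_def Pd_def)

lemma Pd_iff: "p \<in> Pd d \<longleftrightarrow> (\<forall>m. lk p m \<noteq> 0 \<longrightarrow> Poly_Mapping.keys m \<subseteq> {..<d})"
  unfolding Pd_def mp_vars_def mem_Collect_eq UN_subset_iff Ball_def by (simp add: in_keys_iff[of _ p])

lemma Pd_0 [simp]: "0 \<in> Pd d" by (simp add: Pd_iff)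

lemma Pd_add: "p \<in> Pd d \<Longrightarrow> q \<in> Pd d \<Longrightarrow> p + q \<in> Pd d"
  unfolding Pd_iff by (metis add.right_neutral lookup_add)

lemma Pd_uminus: "p \<in> Pd d \<Longrightarrow> - p \<in> Pd d"
  by (simp add: Pd_iff)

lemma Pd_mult: "p \<in> Pd d \<Longrightarrow> q \<in> Pd d \<Longrightarrow> p * q \<in> Pd d"
  using keys_mult[of p q] by (fastforce simp: Pd_def mp_vars_def keys_add_nat)

lemma Pd_sum: "(\<And>a. a \<in> A \<Longrightarrow> f a \<in> Pd d) \<Longrightarrow> sum f A \<in> Pd d"
  by (induction A rule: infinite_finite_induct) (auto intro: Pd_add)

lemma hp_Pd: "p \<in> hp d j \<Longrightarrow> p \<in> Pd d"
  by (auto simp: Pd_iff dest: hpD)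

lemma poly_sum_monomials: "(p :: 'a \<Rightarrow>\<^sub>0 'b::comm_monoid_add) = (\<Sum>m\<in>Poly_Mapping.keys p. Poly_Mapping.single m (lk p m))"
  by (rule poly_mapping_eqI) (simp add: lookup_sum lookup_single when_def not_in_keys_iff_lookup_eq_zero sum.delta' in_keys_iff)

section \<open>Homogeneous components\<close>

definition hc :: "int \<Rightarrow> ('v, 'k::field) mpol \<Rightarrow> ('v, 'k) mpol" where
  "hc j p = (\<Sum>m\<in>{m\<in>Poly_Mapping.keys p. int (mono_deg m) = j}. Poly_Mapping.single m (lk p m))"

lemma lookup_hc: "lk (hc j p) m = (if int (mono_deg m) = j then lk p m else 0)"
proof -
  have "finite {m\<in>Poly_Mapping.keys p. int (mono_deg m) = j}" by simp
  then show ?thesis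
    by (simp add: hc_def lookup_sum lookup_single when_def sum.delta' in_keys_iff)
qed

lemma hc_add: "hc j (p + q) = hc j p + hc j q"
  by (rule poly_mapping_eqI) (simp add: lookup_hc lookup_add)

lemma hc_sum: "hc j (sum f A) = (\<Sum>a\<in>A. hc j (f a))"
  by (rule poly_mapping_eqI) (simp add: lookup_hc lookup_sum)

lemma hc_0 [simp]: "hc j 0 = 0"
  by (rule poly_mapping_eqI) (simp add: lookup_hc)

lemma hc_hp: "p \<in> Pd d \<Longrightarrow> hc j p \<in> hp d j"
  by (rule hpI) (auto simp: lookup_hc Pd_iff split: if_splits)

lemma hc_of_hp: "p \<in> hp d i \<Longrightarrow> hc j p = (if i = j then p else 0)"
  by (rule poly_mapping_eqI) (auto simp: lookup_hc dest: hpD)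

definition hdegs :: "('v, 'k::field) mpol \<Rightarrow> int set" where
  "hdegs p = (\<lambda>m. int (mono_deg m)) ` Poly_Mapping.keys p"

lemma finite_hdegs [simp]: "finite (hdegs p)" by (simp add: hdegs_def)

lemma sum_hc:
  assumes "finite A" "hdegs p \<subseteq> A"
  shows "(\<Sum>j\<in>A. hc j p) = p"
proof (rule poly_mapping_eqI)
  fix m
  have "int (mono_deg m) \<in> A" if "lk p m \<noteq> 0" using that assms(2) by (auto simp: hdegs_def in_keys_iff)
  then show "lk (\<Sum>j\<in>A. hc j p) m = lk p m"
    using assms(1) by (auto simp: lookup_sum lookup_hc sum.delta')
qed

lemma hc_mult:
  assumes p: "p \<in> Pd d" and q: "q \<in> hp d e"
  shows "hc j (p * q) = hc (j - e) p * q"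
proof -
  define A where "A = insert (j - e) (hdegs p)"
  have "p * q = (\<Sum>i\<in>A. hc i p * q)"
    using sum_hc[of A p] by (simp add: A_def sum_distrib_right[symmetric] subset_insertI)
  then have "hc j (p * q) = (\<Sum>i\<in>A. hc j (hc i p * q))" by (simp add: hc_sum)
  also have "\<dots> = (\<Sum>i\<in>A. if i = j - e then hc i p * q else 0)"
    by (rule sum.cong[OF refl]) (subst hc_of_hp[OF hp_mult[OF hc_hp[OF p] q]], auto)
  also have "\<dots> = hc (j - e) p * q" by (simp add: A_def)
  finally show ?thesis .
qed

text \<open>Degree \<open>j\<close> of the free module with basis degrees \<open>e\<close>. Vectors
  are functions that vanish beyond the rank, so that free modules of all ranks share one ambient
  group.\<close>

definition Fm :: "nat \<Rightarrow> nat \<Rightarrow> (nat \<Rightarrow> int) \<Rightarrow> int \<Rightarrow> (nat \<Rightarrow> (nat, 'k::field) mpol) set" where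
  "Fm d r e j = {y. (\<forall>b<r. y b \<in> hp d (j - e b)) \<and> (\<forall>b\<ge>r. y b = 0)}"

abbreviation XF :: "nat \<Rightarrow> (nat \<Rightarrow> (nat, 'k::field) mpol) \<Rightarrow> nat \<Rightarrow> (nat, 'k) mpol" where
  "XF \<equiv> (\<lambda>a y b. mp_var a * y b)"

lemma kop_XF: "finite V \<Longrightarrow> kop V XF"
  by unfold_locales (auto simp: algebra_simps fun_eq_iff)

lemma gmod_Fm: "gmod {..<d} XF (Fm d r e)"
  unfolding gmod_def
proof (intro allI conjI ballI)
  fix j and x y :: "nat \<Rightarrow> (nat, 'k::field) mpol" and a
  show "0 \<in> Fm d r e j" by (simp add: Fm_def)
  assume x: "x \<in> Fm d r e j"
  show "x - y \<in> Fm d r e j" if "y \<in> Fm d r e j" using x that by (simp add: Fm_def hp_diff)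
  show "(\<lambda>b. mp_var a * x b) \<in> Fm d r e (j + 1)" if "a \<in> {..<d}"
  proof -
    have "mp_var a * x b \<in> hp d (j + 1 - e b)" if "b < r" for b
      using hp_mult[OF hp_var[of a d], of "x b" "j - e b"] x that \<open>a \<in> {..<d}\<close> by (simp add: Fm_def algebra_simps)
    then show ?thesis using x by (simp add: Fm_def)
  qed
qed

lemma gmod_mult:
  fixes N :: "int \<Rightarrow> (nat \<Rightarrow> (nat, 'k::field) mpol) set"
  assumes g: "gmod {..<d} XF N" and sc: "\<And>j c y. y \<in> N j \<Longrightarrow> (\<lambda>b. mp_const c * y b) \<in> N j"
    and y: "y \<in> N j" and q: "q \<in> hp d i"
  shows "(\<lambda>b. q * y b) \<in> N (j + i)"
proof -
  have mono: "(\<lambda>b. mp_mono m * y b) \<in> N (j + int n)"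
    if "Poly_Mapping.keys m \<subseteq> {..<d}" "mono_deg m = n" for m n
    using that
  proof (induction n arbitrary: m)
    case 0
    then show ?case using y by (simp add: mono_deg_eq_0)
  next
    case (Suc n)
    then obtain a where a: "a \<in> Poly_Mapping.keys m"
      by (metis all_not_in_conv mono_deg_def nat.distinct(1) sum.empty)
    define m' where "m' = m - Poly_Mapping.single a 1"
    have m: "m = Poly_Mapping.single a 1 + m'"
      unfolding m'_def by (subst mono_diff) (use a in \<open>auto simp: lookup_single when_def in_keys_iff\<close>)
    have "mono_deg m' = n" "Poly_Mapping.keys m' \<subseteq> {..<d}" "a < d"
      using Suc.prems a m by (auto simp: mono_deg_add keys_add_nat)
    then have "(\<lambda>b. mp_var a * (mp_mono m' * y b)) \<in> N (j + int n + 1)"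
      using gmod_X[OF g _ Suc.IH, of a m'] by simp
    moreover have "(\<lambda>b. mp_var a * (mp_mono m' * y b)) = (\<lambda>b. mp_mono m * y b)"
      unfolding m by (simp add: mult.assoc[symmetric] mult_single)
    moreover have "j + int n + 1 = j + int (Suc n)" by simp
    ultimately show ?case by (simp only:)
  qed
  have "(\<lambda>b. (\<Sum>m\<in>A. Poly_Mapping.single m (lk q m)) * y b) \<in> N (j + i)" if "A \<subseteq> Poly_Mapping.keys q" "finite A" for A
    using that(2,1)
  proof (induction A rule: finite_induct)
    case empty
    have "(\<lambda>b. 0) \<in> N (j + i)" using gmod_zero[OF g] by (simp add: zero_fun_def)
    then show ?case by simp
  next
    case (insert m A)
    have "Poly_Mapping.keys m \<subseteq> {..<d}" "int (mono_deg m) = i" using insert.prems hpD[OF q, of m] by (auto simp: in_keys_iff)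
    then have "(\<lambda>b. mp_const (lk q m) * (mp_mono m * y b)) \<in> N (j + i)" using mono[of m "mono_deg m"] sc by blast
    moreover have "(\<lambda>b. mp_const (lk q m) * (mp_mono m * y b)) = (\<lambda>b. Poly_Mapping.single m (lk q m) * y b)"
      by (simp add: mult.assoc[symmetric] mult_single)
    ultimately have "(\<lambda>b. Poly_Mapping.single m (lk q m) * y b) + (\<lambda>b. (\<Sum>m\<in>A. Poly_Mapping.single m (lk q m)) * y b) \<in> N (j + i)"
      using gmod_add[OF g] insert by simp
    then show ?case using insert.hyps by (simp add: plus_fun_def distrib_right)
  qed
  from this[of "Poly_Mapping.keys q"] show ?thesis using poly_sum_monomials[of q] by simp
qed

definition gens :: "nat \<Rightarrow> (int \<Rightarrow> (nat \<Rightarrow> (nat, 'k::field) mpol) set) \<Rightarrow> nat \<Rightarrow> (nat \<Rightarrow> int) \<Rightarrow> (nat \<Rightarrow> nat \<Rightarrow> (nat, 'k) mpol) \<Rightarrow> bool" where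
  "gens d N r e G \<longleftrightarrow> (\<forall>b<r. G b \<in> N (e b)) \<and>
     (\<forall>j. \<forall>y\<in>N j. \<exists>c\<in>Fm d r e j. \<forall>i. y i = (\<Sum>b<r. c b * G b i))"

text \<open>Groebner bases: lead terms are pairs of a position and a monomial, Dickson's lemma picks
  finitely many that divide all others, and elements realizing them generate by division. Division
  ends because a fixed degree contains only finitely many terms.\<close>

lemma noether:
  fixes N :: "int \<Rightarrow> (nat \<Rightarrow> (nat, 'k::field) mpol) set"
  assumes g: "gmod {..<d} XF N" and sc: "\<And>j c y. y \<in> N j \<Longrightarrow> (\<lambda>b. mp_const c * y b) \<in> N j"
    and sub: "\<And>j. N j \<subseteq> Fm d r e j"
  shows "\<exists>r' e' G. gens d N r' e' G"
proof -
  let ?V = "{..<d}"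
  \<comment> \<open>Monic with lead term \<open>(b, m)\<close> in the lexicographic order on pairs:
    the position is compared before the monomial.\<close>
  define led where "led y b m \<longleftrightarrow> b < r \<and> lk (y b) m = (1::'k) \<and> (\<forall>b' m'. (b, m) < (b', m') \<longrightarrow> lk (y b') m' = 0)" for y :: "nat \<Rightarrow> (nat, 'k) mpol" and b m
  define LD where "LD = {(b, m). \<exists>j. \<exists>y\<in>N j. led y b m}"
  have degs: "Poly_Mapping.keys m \<subseteq> ?V \<and> int (mono_deg m) = j - e b \<and> b < r" if "y \<in> N j" "lk (y b) m \<noteq> 0" for y j b m
    using that subsetD[OF sub[of j] that(1)] hpD[of "y b" d "j - e b" m] by (cases "b < r") (auto simp: Fm_def)
  have "\<exists>B\<subseteq>LD. finite B \<and> (\<forall>c m. (c, m) \<in> LD \<longrightarrow> (\<exists>m0 \<mu>. (c, m0) \<in> B \<and> m = m0 + \<mu>))"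
  proof (rule dickson[where C="{..<r}" and V="?V"])
    fix b m assume "(b, m) \<in> LD"
    then obtain j y where y: "y \<in> N j" "led y b m" by (auto simp: LD_def)
    then have "lk (y b) m \<noteq> 0" by (simp add: led_def)
    then show "b \<in> {..<r} \<and> Poly_Mapping.keys m \<subseteq> ?V" using degs[OF y(1)] by auto
  qed auto
  then obtain B where B: "B \<subseteq> LD" "finite B" "\<And>c m. (c, m) \<in> LD \<Longrightarrow> \<exists>m0 \<mu>. (c, m0) \<in> B \<and> m = m0 + \<mu>" by blast
  define r' where "r' = card B"
  obtain h where h: "bij_betw h {0..<r'} B" using ex_bij_betw_nat_finite[OF B(2)] unfolding r'_def by blast
  have "\<forall>i. \<exists>jy. i < r' \<longrightarrow> snd jy \<in> N (fst jy) \<and> led (snd jy) (fst (h i)) (snd (h i))"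
  proof (intro allI)
    fix i
    show "\<exists>jy. i < r' \<longrightarrow> snd jy \<in> N (fst jy) \<and> led (snd jy) (fst (h i)) (snd (h i))"
    proof (cases "i < r'")
      case True
      have "h i \<in> LD" using h True B(1) by (auto simp: bij_betw_def)
      then obtain j y where "y \<in> N j" "led y (fst (h i)) (snd (h i))" unfolding LD_def by (auto simp: split_beta)
      then show ?thesis by (intro exI[of _ "(j, y)"]) simp
    qed simp
  qed
  from choice[OF this] obtain jy where
    jy: "\<forall>i. i < r' \<longrightarrow> snd (jy i) \<in> N (fst (jy i)) \<and> led (snd (jy i)) (fst (h i)) (snd (h i))" ..
  define e' where "e' i = fst (jy i)" for i
  define G where "G i = snd (jy i)" for i
  have eG: "\<And>i. i < r' \<Longrightarrow> G i \<in> N (e' i) \<and> led (G i) (fst (h i)) (snd (h i))"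
    using jy by (simp add: e'_def G_def)
  \<comment> \<open>Division: \<open>A\<close> is a down-closed set of terms of degree
    \<open>j\<close> containing those of \<open>y\<close>; its largest term is removed by a multiple
    of a generator.\<close>
  have main: "\<exists>c\<in>Fm d r' e' j. \<forall>i. y i = (\<Sum>b<r'. c b * G b i)"
    if "finite A" "A \<subseteq> T" "\<And>x z. x \<in> A \<Longrightarrow> z \<in> T \<Longrightarrow> z < x \<Longrightarrow> z \<in> A"
      "T = {(b, m). b < r \<and> Poly_Mapping.keys m \<subseteq> ?V \<and> int (mono_deg m) = j - e b}"
      "y \<in> N j" "\<And>b m. lk (y b) m \<noteq> 0 \<Longrightarrow> (b, m) \<in> A" for A T j y
    using that
  proof (induction A arbitrary: y rule: finite_linorder_max_induct)
    case empty
    have "y i = 0" for i by (rule poly_mapping_eqI) (use empty.prems(5) in auto)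
    then show ?case by (intro bexI[of _ "\<lambda>_. 0"]) (auto simp: Fm_def)
  next
    case (insert bm A)
    obtain b m where bm: "bm = (b, m)" by force
    have down: "z \<in> A" if "z \<in> T" "z < x" "x \<in> insert bm A" for x z
      using insert.prems(2)[OF that(3,1,2)] that(2,3) insert.hyps(2) by force
    have AT: "A \<subseteq> T" and bmT: "(b, m) \<in> T" using insert.prems(1) bm by auto
    have T: "b < r" "Poly_Mapping.keys m \<subseteq> ?V" "int (mono_deg m) = j - e b" using bmT insert.prems(3) by auto
    show ?case
    proof (cases "lk (y b) m = 0")
      case True
      then have "lk (y b') m' \<noteq> 0 \<Longrightarrow> (b', m') \<in> A" for b' m' using insert.prems(5) bm by auto
      then show ?thesis using insert.IH[OF AT _ insert.prems(3,4)] down by blast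
    next
      case False
      define k where "k = lk (y b) m"
      have "led (\<lambda>i. mp_const (inverse k) * y i) b m"
      proof -
        have "lk (y b') m' = 0" if "(b, m) < (b', m')" for b' m'
        proof (rule ccontr)
          assume "lk (y b') m' \<noteq> 0"
          then have "(b', m') \<in> insert bm A" by (rule insert.prems(5))
          then show False using that insert.hyps(2) unfolding bm by (metis insertE less_asym less_irrefl)
        qed
        then show ?thesis using False T by (simp add: led_def lookup_const_mult k_def)
      qed
      then have "(b, m) \<in> LD" using sc[OF insert.prems(4)] by (auto simp: LD_def)
      then obtain m0 \<mu> where m0: "(b, m0) \<in> B" "m = m0 + \<mu>" using B(3) by blast
      then obtain i where i: "i < r'" "h i = (b, m0)" using h by (metis atLeastLessThan_iff bij_betw_def imageE)
      have Gi: "G i \<in> N (e' i)" and ledi: "led (G i) b m0" using eG[OF i(1)] i(2) by auto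
      have "lk (G i b) m0 \<noteq> 0" using ledi by (simp add: led_def)
      then have e'i: "int (mono_deg m0) = e' i - e b" using degs[OF Gi] by blast
      define q where "q = Poly_Mapping.single \<mu> k"
      have q: "q \<in> hp d (j - e' i)" unfolding q_def
        by (rule hp_single) (use T m0(2) e'i in \<open>auto simp: keys_add_nat mono_deg_add\<close>)
      define y' where "y' = (\<lambda>b. y b - q * G i b)"
      have "(\<lambda>b. q * G i b) \<in> N j" using gmod_mult[OF g sc Gi q] by simp
      then have y': "y' \<in> N j" using gmod_diff[OF g insert.prems(4)] by (simp add: y'_def fun_diff_def)
      have supp: "(b', m') \<in> A" if nz: "lk (y' b') m' \<noteq> 0" for b' m'
      proof -
        have inT: "(b', m') \<in> T" using degs[OF y' nz] insert.prems(3) by auto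
        have le: "(b', m') \<le> (b, m)"
        proof (cases "lk (y b') m' = 0")
          case True
          then have "lk (q * G i b') m' \<noteq> 0" using nz by (simp add: y'_def lookup_minus)
          then obtain m'' where m'': "m' = \<mu> + m''" unfolding q_def using lookup_single_mult_0 by blast
          then have "lk (G i b') m'' \<noteq> 0" using \<open>lk (q * G i b') m' \<noteq> 0\<close> by (auto simp: q_def lookup_single_mult)
          then have "(b', m'') \<le> (b, m0)" using ledi unfolding led_def by (meson not_le)
          then show ?thesis using m'' m0(2) by (auto simp: less_eq_prod_def add.commute)
        next
          case False
          then show ?thesis using insert.prems(5)[OF False] insert.hyps(2) bm by force
        qed
        have "lk (q * G i b) m = k"
          using ledi lookup_single_mult[of \<mu> k "G i b" m0] by (simp add: q_def m0(2) led_def add.commute)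
        then have "lk (y' b) m = 0" by (simp add: y'_def lookup_minus k_def)
        then have "(b', m') \<noteq> (b, m)" using nz by auto
        then have "(b', m') < (b, m)" using le by (metis order_le_less)
        then show ?thesis using down[OF inT, of bm] unfolding bm by blast
      qed
      obtain c where c: "c \<in> Fm d r' e' j" "\<And>i. y' i = (\<Sum>b<r'. c b * G b i)"
        using insert.IH[OF AT _ insert.prems(3) y' supp] down by blast
      let ?c = "c(i := c i + q)"
      have "?c \<in> Fm d r' e' j" using c(1) q i(1) by (auto simp: Fm_def hp_add)
      moreover have "y l = (\<Sum>b<r'. ?c b * G b l)" for l
      proof -
        have "(\<Sum>b<r'. ?c b * G b l) = (\<Sum>b<r'. c b * G b l + (if b = i then q * G i l else 0))"
          by (rule sum.cong) (auto simp: distrib_right)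
        also have "\<dots> = y' l + q * G i l" using i(1) by (simp add: sum.distrib c(2) sum.delta')
        finally show ?thesis by (simp add: y'_def)
      qed
      ultimately show ?thesis by blast
    qed
  qed
  have "\<exists>c\<in>Fm d r' e' j. \<forall>i. y i = (\<Sum>b<r'. c b * G b i)" if y: "y \<in> N j" for j y
  proof (rule main)
    let ?T = "{(b, m). b < r \<and> Poly_Mapping.keys m \<subseteq> ?V \<and> int (mono_deg m) = j - e b}"
    have "?T \<subseteq> (SIGMA b:{..<r}. {m. Poly_Mapping.keys m \<subseteq> ?V \<and> mono_deg m \<le> nat (j - e b)})" by auto
    moreover have "finite (SIGMA b:{..<r}. {m. Poly_Mapping.keys m \<subseteq> ?V \<and> mono_deg m \<le> nat (j - e b)})"
      by (intro finite_SigmaI finite_monos) auto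
    ultimately show "finite ?T" by (rule finite_subset)
    show "(b, m) \<in> ?T" if "lk (y b) m \<noteq> 0" for b m using degs[OF y that] by auto
  qed (use y in auto)
  then show ?thesis unfolding gens_def using eG by blast
qed

section \<open>Koszul homology in degree zero\<close>

lemma sum_fun_apply: "(sum f A) b = (\<Sum>a\<in>A. f a b)"
  by (induction A rule: infinite_finite_induct) auto

lemma hz_Fm: "hz {..<d} XF (Suc p) (Fm d r e :: int \<Rightarrow> (nat \<Rightarrow> (nat, 'k::field) mpol) set) j"
proof (rule hzI)
  fix v :: "nat set \<Rightarrow> nat \<Rightarrow> (nat, 'k) mpol"
  assume v: "v \<in> Kc {..<d} (Suc p) (Fm d r e) j" and bv: "\<And>\<tau>. bd {..<d} XF v \<tau> = 0"
  have comp: "bd {..<d} Xp (\<lambda>\<sigma>. u \<sigma> b) \<tau> = bd {..<d} XF u \<tau> b" for u :: "nat set \<Rightarrow> nat \<Rightarrow> (nat, 'k) mpol" and b \<tau>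
    by (rule bd_hom[where \<phi>="\<lambda>y. y b" and X=XF and Y=Xp]) simp_all
  have "\<forall>b. \<exists>u. b < r \<longrightarrow> u \<in> Kc {..<d} (Suc (Suc p)) (hp d) (j - e b) \<and> bd {..<d} Xp u = (\<lambda>\<sigma>. v \<sigma> b)"
  proof
    fix b
    show "\<exists>u. b < r \<longrightarrow> u \<in> Kc {..<d} (Suc (Suc p)) (hp d) (j - e b) \<and> bd {..<d} Xp u = (\<lambda>\<sigma>. v \<sigma> b)"
    proof (cases "b < r")
      case True
      have "(\<lambda>\<sigma>. v \<sigma> b) \<in> Kc {..<d} (Suc p) (hp d) (j - e b)"
      proof (rule KcI)
        show "v \<sigma> b \<in> hp d (j - e b - int (card \<sigma>))" for \<sigma>
          using Kc_mem[OF v, of \<sigma>] True by (simp add: Fm_def algebra_simps)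
        show "\<sigma> \<subseteq> {..<d} \<and> card \<sigma> = Suc p" if "v \<sigma> b \<noteq> 0" for \<sigma>
        proof -
          have "v \<sigma> \<noteq> 0" using that by auto
          then show ?thesis by (rule Kc_support[OF v])
        qed
      qed
      moreover have "bd {..<d} Xp (\<lambda>\<sigma>. v \<sigma> b) \<tau> = 0" for \<tau> by (simp only: comp bv zero_fun_apply)
      ultimately obtain u where "u \<in> Kc {..<d} (Suc (Suc p)) (hp d) (j - e b)" "bd {..<d} Xp u = (\<lambda>\<sigma>. v \<sigma> b)"
        by (rule hzD[OF hz_hp])
      then show ?thesis by blast
    qed simp
  qed
  from choice[OF this] obtain U where
    U: "\<forall>b. b < r \<longrightarrow> U b \<in> Kc {..<d} (Suc (Suc p)) (hp d) (j - e b) \<and> bd {..<d} Xp (U b) = (\<lambda>\<sigma>. v \<sigma> b)" ..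
  note U1 = U[rule_format, THEN conjunct1] and U2 = U[rule_format, THEN conjunct2]
  define u where "u = (\<lambda>\<sigma> b. if b < r then U b \<sigma> else 0)"
  have "u \<in> Kc {..<d} (Suc (Suc p)) (Fm d r e) j"
  proof (rule KcI)
    fix \<sigma>
    have "U b \<sigma> \<in> hp d (j - int (card \<sigma>) - e b)" if "b < r" for b
    proof -
      from Kc_mem[OF U1[OF that], of \<sigma>] show ?thesis by (simp add: algebra_simps)
    qed
    then show "u \<sigma> \<in> Fm d r e (j - int (card \<sigma>))" by (simp add: Fm_def u_def)
    assume "u \<sigma> \<noteq> 0"
    then obtain b where "u \<sigma> b \<noteq> 0" by (auto simp: fun_eq_iff)
    then have b: "b < r" and nz: "U b \<sigma> \<noteq> 0" by (auto simp: u_def split: if_splits)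
    from Kc_support[OF U1[OF b] nz] show "\<sigma> \<subseteq> {..<d} \<and> card \<sigma> = Suc (Suc p)" .
  qed
  moreover have "bd {..<d} XF u \<tau> b = v \<tau> b" for \<tau> b
  proof (cases "b < r")
    case True
    have "bd {..<d} XF u \<tau> b = bd {..<d} Xp (U b) \<tau>" using True by (subst comp[symmetric]) (simp add: u_def)
    then show ?thesis by (simp only: U2[OF True])
  next
    case False
    have "bd {..<d} XF u \<tau> b = bd {..<d} Xp (\<lambda>_. 0 :: (nat, 'k) mpol) \<tau>" using False by (subst comp[symmetric]) (simp add: u_def)
    also have "\<dots> = 0" by (rule kop.bd_zero[OF kop_Xp]) simp
    also have "\<dots> = v \<tau> b" using Kc_mem[OF v, of \<tau>] False by (simp add: Fm_def)
    finally show ?thesis .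
  qed
  then have "bd {..<d} XF u = v" by (simp add: fun_eq_iff)
  ultimately show "\<exists>u\<in>Kc {..<d} (Suc (Suc p)) (Fm d r e) j. bd {..<d} XF u = v" by blast
qed

lemma kzD:
  assumes "kz V X p N F j" "u \<in> Kc V (Suc p) F j" "bd V X u \<in> Kc V p N j"
  obtains w where "w \<in> Kc V (Suc p) N j" "bd V X w = bd V X u"
  using assms(1)[unfolded kz_def, rule_format, OF assms(2,3)] that by (elim bexE)

text \<open>Degree \<open>j\<close> of the maximal ideal times \<open>F\<close>, which is also the
  image of the Koszul differential in homological degree 0.\<close>

definition mm :: "nat set \<Rightarrow> (nat \<Rightarrow> 'm::ab_group_add \<Rightarrow> 'm) \<Rightarrow> (int \<Rightarrow> 'm set) \<Rightarrow> int \<Rightarrow> 'm set" where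
  "mm V X F j = {y. \<exists>w. (\<forall>a\<in>V. w a \<in> F (j - 1)) \<and> y = (\<Sum>a\<in>V. X a (w a))}"

lemma mmI: "(\<forall>a\<in>V. w a \<in> F (j - 1)) \<Longrightarrow> (\<Sum>a\<in>V. X a (w a)) \<in> mm V X F j"
  unfolding mm_def by blast

lemma mmE:
  assumes "y \<in> mm V X F j"
  obtains w where "\<forall>a\<in>V. w a \<in> F (j - 1)" "y = (\<Sum>a\<in>V. X a (w a))"
  using assms unfolding mm_def by blast

definition chain0 :: "'m::ab_group_add \<Rightarrow> nat set \<Rightarrow> 'm" where
  "chain0 y \<sigma> = (if \<sigma> = {} then y else 0)"

definition chain1 :: "nat set \<Rightarrow> (nat \<Rightarrow> 'm::ab_group_add) \<Rightarrow> nat set \<Rightarrow> 'm" where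
  "chain1 V w \<sigma> = (if \<exists>a\<in>V. \<sigma> = {a} then w (the_elem \<sigma>) else 0)"

lemma chain0_Kc: "gmod V X M \<Longrightarrow> y \<in> M j \<Longrightarrow> chain0 y \<in> Kc V 0 M j"
  by (rule KcI) (auto simp: chain0_def gmod_zero split: if_splits)

lemma chain1_Kc:
  assumes "gmod V X M" "\<forall>a\<in>V. w a \<in> M (j - 1)"
  shows "chain1 V w \<in> Kc V (Suc 0) M j"
  by (rule KcI) (use assms(2) in \<open>auto simp: chain1_def gmod_zero[OF assms(1)] split: if_splits\<close>)

lemma Kc0_eq:
  assumes "finite V" "v \<in> Kc V 0 M j"
  shows "v = chain0 (v {})"
proof
  fix \<sigma>
  have "v \<sigma> = 0" if "\<sigma> \<noteq> {}"
    using Kc_support[OF assms(2), of \<sigma>] that finite_subset[OF _ assms(1), of \<sigma>] by auto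
  then show "v \<sigma> = chain0 (v {}) \<sigma>" by (auto simp: chain0_def)
qed

lemma bd_at_empty: "bd V X u {} = (\<Sum>a\<in>V. X a (u {a}))"
  by (simp add: bd_def)

lemma bd_Kc1:
  assumes k: "kop V X" and g: "gmod V X M" and u: "u \<in> Kc V (Suc 0) M j"
  shows "bd V X u = chain0 (\<Sum>a\<in>V. X a (u {a}))"
  using Kc0_eq[OF _ Kc_bd[OF g k u]] k bd_at_empty[of V X u] by (simp add: kop_def)

lemma bd_chain1:
  assumes k: "kop V X" and g: "gmod V X M" and w: "\<forall>a\<in>V. w a \<in> M (j - 1)"
  shows "bd V X (chain1 V w) = chain0 (\<Sum>a\<in>V. X a (w a))"
proof -
  have "(\<Sum>a\<in>V. X a (chain1 V w {a})) = (\<Sum>a\<in>V. X a (w a))"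
    by (rule sum.cong[OF refl]) (simp add: chain1_def)
  then show ?thesis using bd_Kc1[OF k g chain1_Kc[OF g w]] by simp
qed

lemma chain0_inj: "chain0 x = chain0 y \<Longrightarrow> x = y"
  by (drule fun_cong[of _ _ "{}"]) (simp add: chain0_def)

lemma Kc_singleton: "u \<in> Kc V (Suc 0) M j \<Longrightarrow> u {a} \<in> M (j - 1)"
  using Kc_mem[of u V "Suc 0" M j "{a}"] by simp

text \<open>Homology in degree 0 is \<open>M\<close> modulo the maximal ideal times
  \<open>M\<close>; boundaries are the combinations of variables.\<close>

lemma hz0_iff:
  assumes k: "kop V X" and g: "gmod V X M"
  shows "hz V X 0 M j \<longleftrightarrow> M j \<subseteq> mm V X M j"
proof
  assume h: "hz V X 0 M j"
  show "M j \<subseteq> mm V X M j"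
  proof
    fix y assume y: "y \<in> M j"
    obtain u where u: "u \<in> Kc V (Suc 0) M j" "bd V X u = chain0 y"
      using Kc_0_bd[OF chain0_Kc[OF g y] k] by (rule hzD[OF h chain0_Kc[OF g y]])
    have "chain0 y = chain0 (\<Sum>a\<in>V. X a (u {a}))" using bd_Kc1[OF k g u(1)] by (simp only: u(2))
    then have "y = (\<Sum>a\<in>V. X a (u {a}))" by (rule chain0_inj)
    then show "y \<in> mm V X M j" using mmI[of V "\<lambda>a. u {a}" M j X] Kc_singleton[OF u(1)] by simp
  qed
next
  assume h: "M j \<subseteq> mm V X M j"
  show "hz V X 0 M j"
  proof (rule hzI)
    fix v assume v: "v \<in> Kc V 0 M j"
    have "v {} \<in> M j" using Kc_mem[OF v, of "{}"] by simp
    then have "v {} \<in> mm V X M j" using h by (rule rev_subsetD)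
    then obtain w where w: "\<forall>a\<in>V. w a \<in> M (j - 1)" "v {} = (\<Sum>a\<in>V. X a (w a))"
      by (rule mmE)
    have "v = chain0 (v {})" by (rule Kc0_eq[OF _ v]) (use k in \<open>simp add: kop_def\<close>)
    then have "bd V X (chain1 V w) = v" using bd_chain1[OF k g w(1)] w(2) by simp
    then show "\<exists>u\<in>Kc V (Suc 0) M j. bd V X u = v" using chain1_Kc[OF g w(1)] by (intro bexI[of _ "chain1 V w"])
  qed
qed

text \<open>With \<open>m\<close> the maximal ideal, the kernel of
  \<open>N / mN \<rightarrow> F / mF\<close> is \<open>(N \<inter> mF) / mN\<close>.\<close>

lemma kz0_iff:
  assumes k: "kop V X" and g: "gmod V X F" and gN: "gmod V X N"
  shows "kz V X 0 N F j \<longleftrightarrow> N j \<inter> mm V X F j \<subseteq> mm V X N j"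
proof
  assume h: "kz V X 0 N F j"
  show "N j \<inter> mm V X F j \<subseteq> mm V X N j"
  proof
    fix y assume y: "y \<in> N j \<inter> mm V X F j"
    then have yN: "y \<in> N j" and "y \<in> mm V X F j" by simp_all
    from this(2) obtain w where w: "\<forall>a\<in>V. w a \<in> F (j - 1)" "y = (\<Sum>a\<in>V. X a (w a))" by (rule mmE)
    have b: "bd V X (chain1 V w) = chain0 y" using bd_chain1[OF k g w(1)] w(2) by simp
    have "bd V X (chain1 V w) \<in> Kc V 0 N j" unfolding b by (rule chain0_Kc[OF gN yN])
    with chain1_Kc[OF g w(1)] obtain u where "u \<in> Kc V (Suc 0) N j" "bd V X u = bd V X (chain1 V w)"
      by (rule kzD[OF h])
    then have u: "u \<in> Kc V (Suc 0) N j" "bd V X u = chain0 y" by (simp_all only: b)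
    have "chain0 y = chain0 (\<Sum>a\<in>V. X a (u {a}))" using bd_Kc1[OF k gN u(1)] by (simp only: u(2))
    then have "y = (\<Sum>a\<in>V. X a (u {a}))" by (rule chain0_inj)
    then show "y \<in> mm V X N j" using mmI[of V "\<lambda>a. u {a}" N j X] Kc_singleton[OF u(1)] by simp
  qed
next
  assume h: "N j \<inter> mm V X F j \<subseteq> mm V X N j"
  show "kz V X 0 N F j" unfolding kz_def
  proof (intro ballI impI)
    fix u assume u: "u \<in> Kc V (Suc 0) F j" and b: "bd V X u \<in> Kc V 0 N j"
    let ?y = "\<Sum>a\<in>V. X a (u {a})"
    have bu: "bd V X u = chain0 ?y" by (rule bd_Kc1[OF k g u])
    have "?y \<in> N j" using Kc_mem[OF b, of "{}"] unfolding bu by (simp add: chain0_def)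
    moreover have "?y \<in> mm V X F j" using mmI[of V "\<lambda>a. u {a}" F j X] Kc_singleton[OF u] by simp
    ultimately have "?y \<in> mm V X N j" using h by (rule rev_subsetD[OF IntI])
    then obtain w where w: "\<forall>a\<in>V. w a \<in> N (j - 1)" "?y = (\<Sum>a\<in>V. X a (w a))"
      by (rule mmE)
    have "bd V X (chain1 V w) = bd V X u" using bd_chain1[OF k gN w(1)] w(2) bu by simp
    then show "\<exists>w\<in>Kc V (Suc 0) N j. bd V X w = bd V X u" using chain1_Kc[OF gN w(1)] by (intro bexI[of _ "chain1 V w"])
  qed
qed

lemma hp_mm:
  fixes p :: "(nat, 'k::field) mpol"
  assumes p: "p \<in> hp d j"
  shows "p \<in> mm {..<d} Xp (hp d) j \<longleftrightarrow> lk p 0 = 0"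
proof
  assume "p \<in> mm {..<d} Xp (hp d) j"
  then obtain w where "p = (\<Sum>a<d. mp_var a * w a)" by (rule mmE)
  then show "lk p 0 = 0" by (simp add: lookup_sum lookup_var_mult)
next
  assume p0: "lk p 0 = 0"
  \<comment> \<open>Each monomial other than 1 is charged to the smallest variable occurring in it;
    grouping \<open>p\<close> by this variable exhibits it as a combination of variables.\<close>
  define f where "f m = Min (Poly_Mapping.keys m)" for m :: mono
  have f: "f m \<in> Poly_Mapping.keys m" if "m \<in> Poly_Mapping.keys p" for m
  proof -
    have "m \<noteq> 0" using that p0 by (auto simp: in_keys_iff)
    then show ?thesis unfolding f_def by (intro Min_in) (auto simp: keys_eq_empty)
  qed
  have fd: "f m < d" if "m \<in> Poly_Mapping.keys p" for m
    using f[OF that] hpD[OF p, of m] that by (auto simp: in_keys_iff[of _ p])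
  define w where "w a = (\<Sum>m\<in>{m\<in>Poly_Mapping.keys p. f m = a}. Poly_Mapping.single (m - Poly_Mapping.single a 1) (lk p m))" for a
  have s: "Poly_Mapping.single (f m) 1 + (m - Poly_Mapping.single (f m) 1) = m" if "m \<in> Poly_Mapping.keys p" for m
    by (rule mono_diff) (use f[OF that] in \<open>auto simp: lookup_single when_def in_keys_iff\<close>)
  have "w a \<in> hp d (j - 1)" for a
    unfolding w_def
  proof (rule hp_sum)
    fix m assume "m \<in> {m\<in>Poly_Mapping.keys p. f m = a}"
    then have m: "m \<in> Poly_Mapping.keys p" "a = f m" by auto
    have "Poly_Mapping.keys m \<subseteq> {..<d} \<and> int (mono_deg m) = j" using hpD[OF p, of m] m(1) by (simp add: in_keys_iff[of _ p])
    moreover have "mono_deg m = 1 + mono_deg (m - Poly_Mapping.single a 1)"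
      using s[OF m(1)] mono_deg_add[of "Poly_Mapping.single a 1" "m - Poly_Mapping.single a 1"] m(2) by simp
    ultimately show "Poly_Mapping.single (m - Poly_Mapping.single a 1) (lk p m) \<in> hp d (j - 1)"
      using keys_minus_nat[of m "Poly_Mapping.single a 1"] by (intro hp_single) auto
  qed
  moreover have "p = (\<Sum>a<d. mp_var a * w a)"
  proof -
    have "(\<Sum>a<d. mp_var a * w a) = (\<Sum>a<d. \<Sum>m\<in>{m\<in>Poly_Mapping.keys p. f m = a}. Poly_Mapping.single m (lk p m))"
      unfolding w_def sum_distrib_left
    proof (intro sum.cong[OF refl])
      fix a m assume "m \<in> {m\<in>Poly_Mapping.keys p. f m = a}"
      then have "Poly_Mapping.single a 1 + (m - Poly_Mapping.single a 1) = m" using s by auto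
      then show "mp_var a * Poly_Mapping.single (m - Poly_Mapping.single a 1) (lk p m) = Poly_Mapping.single m (lk p m)"
        by (simp add: mult_single)
    qed
    also have "\<dots> = (\<Sum>m\<in>Poly_Mapping.keys p. Poly_Mapping.single m (lk p m))"
      by (rule sum.group) (use fd in auto)
    finally show ?thesis using poly_sum_monomials[of p] by simp
  qed
  ultimately show "p \<in> mm {..<d} Xp (hp d) j" using mmI[of "{..<d}" w "hp d" j Xp] by simp
qed

lemma Fm_mm:
  fixes y :: "nat \<Rightarrow> (nat, 'k::field) mpol"
  assumes y: "y \<in> Fm d r e j"
  shows "y \<in> mm {..<d} XF (Fm d r e) j \<longleftrightarrow> (\<forall>b<r. lk (y b) 0 = 0)"
proof
  assume "y \<in> mm {..<d} XF (Fm d r e) j"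
  then obtain w where "y = (\<Sum>a<d. (\<lambda>b. mp_var a * w a b))" by (rule mmE)
  then show "\<forall>b<r. lk (y b) 0 = 0" by (simp add: sum_fun_apply lookup_sum lookup_var_mult)
next
  assume h: "\<forall>b<r. lk (y b) 0 = 0"
  have "\<forall>b. \<exists>w. b < r \<longrightarrow> (\<forall>a<d. w a \<in> hp d (j - e b - 1)) \<and> y b = (\<Sum>a<d. mp_var a * w a)"
  proof
    fix b
    show "\<exists>w. b < r \<longrightarrow> (\<forall>a<d. w a \<in> hp d (j - e b - 1)) \<and> y b = (\<Sum>a<d. mp_var a * w a)"
    proof (cases "b < r")
      case True
      then have "y b \<in> mm {..<d} Xp (hp d) (j - e b)" using hp_mm[of "y b" d "j - e b"] y h by (simp add: Fm_def)
      then show ?thesis by (auto simp: mm_def)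
    qed simp
  qed
  from choice[OF this] obtain W where
    W: "\<forall>b. b < r \<longrightarrow> (\<forall>a<d. W b a \<in> hp d (j - e b - 1)) \<and> y b = (\<Sum>a<d. mp_var a * W b a)" ..
  define w where "w a b = (if b < r then W b a else 0)" for a b
  have "w a \<in> Fm d r e (j - 1)" if "a \<in> {..<d}" for a
    using W that by (simp add: Fm_def w_def algebra_simps)
  moreover have "y = (\<Sum>a<d. XF a (w a))"
  proof
    fix b
    show "y b = (\<Sum>a<d. XF a (w a)) b"
    proof (cases "b < r")
      case True
      then show ?thesis using W by (simp add: sum_fun_apply w_def)
    next
      case False
      then show ?thesis using y by (simp add: sum_fun_apply w_def Fm_def)
    qed
  qed
  ultimately show "y \<in> mm {..<d} XF (Fm d r e) j" using mmI[of "{..<d}" w "Fm d r e" j XF] by simp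
qed

section \<open>Homogeneous maps of free modules\<close>

definition lin :: "nat \<Rightarrow> nat \<Rightarrow> (nat \<Rightarrow> nat \<Rightarrow> (nat, 'k::field) mpol) \<Rightarrow> (nat \<Rightarrow> (nat, 'k) mpol) \<Rightarrow> nat \<Rightarrow> (nat, 'k) mpol" where
  "lin r s G y i = (if i < s then \<Sum>b<r. y b * G b i else 0)"

lemma lin_add: "lin r s G (x + y) = lin r s G x + lin r s G y"
  by (rule ext) (simp add: lin_def distrib_right sum.distrib)

lemma lin_zero: "lin r s G 0 = 0"
  by (rule ext) (simp add: lin_def)

lemma lin_sum: "lin r s G (sum f A) = (\<Sum>a\<in>A. lin r s G (f a))"
  by (induction A rule: infinite_finite_induct) (simp_all only: sum.infinite sum.empty sum.insert lin_zero lin_add not_False_eq_True simp_thms)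

lemma lin_diff: "lin r s G (x - y) = lin r s G x - lin r s G y"
  by (rule ext) (simp add: lin_def left_diff_distrib sum_subtractf)

lemma lin_XF: "lin r s G (XF a y) = XF a (lin r s G y)"
  by (rule ext) (simp add: lin_def sum_distrib_left mult.assoc)

definition hom :: "nat \<Rightarrow> nat \<Rightarrow> (nat \<Rightarrow> int) \<Rightarrow> nat \<Rightarrow> (nat \<Rightarrow> int) \<Rightarrow> (nat \<Rightarrow> nat \<Rightarrow> (nat, 'k::field) mpol) \<Rightarrow> bool" where
  "hom d r e s f G \<longleftrightarrow> (\<forall>b<r. \<forall>i<s. G b i \<in> hp d (e b - f i))"

lemma lin_Fm: "hom d r e s f G \<Longrightarrow> y \<in> Fm d r e j \<Longrightarrow> lin r s G y \<in> Fm d s f j"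
proof -
  assume h: "hom d r e s f G" and y: "y \<in> Fm d r e j"
  have "y b * G b i \<in> hp d (j - f i)" if "b < r" "i < s" for b i
    using hp_mult[of "y b" d "j - e b" "G b i" "e b - f i"] h y that by (simp add: hom_def Fm_def)
  then show ?thesis by (auto simp: Fm_def lin_def intro!: hp_sum)
qed

definition PF :: "nat \<Rightarrow> nat \<Rightarrow> (nat \<Rightarrow> (nat, 'k::field) mpol) set" where
  "PF d r = {y. (\<forall>b<r. y b \<in> Pd d) \<and> (\<forall>b\<ge>r. y b = 0)}"

lemma Fm_PF: "y \<in> Fm d r e j \<Longrightarrow> y \<in> PF d r"
  by (auto simp: Fm_def PF_def intro: hp_Pd)

lemma PF_sum: "(\<And>a. a \<in> A \<Longrightarrow> f a \<in> PF d r) \<Longrightarrow> sum f A \<in> PF d r"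
  by (auto simp: PF_def sum_fun_apply intro!: Pd_sum)

definition hcF :: "nat \<Rightarrow> (nat \<Rightarrow> int) \<Rightarrow> int \<Rightarrow> (nat \<Rightarrow> (nat, 'k::field) mpol) \<Rightarrow> nat \<Rightarrow> (nat, 'k) mpol" where
  "hcF r e j y b = (if b < r then hc (j - e b) (y b) else 0)"

lemma hcF_Fm: "y \<in> PF d r \<Longrightarrow> hcF r e j y \<in> Fm d r e j"
  by (simp add: Fm_def PF_def hcF_def hc_hp)

lemma hcF_of_Fm: "y \<in> Fm d r e j \<Longrightarrow> hcF r e j y = y"
  by (rule ext) (auto simp: Fm_def hcF_def hc_of_hp)

lemma hcF_0: "hcF r e j 0 = 0"
  by (rule ext) (simp add: hcF_def)

lemma lin_hcF:
  assumes "hom d r e s f G" "y \<in> PF d r"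
  shows "lin r s G (hcF r e j y) = hcF s f j (lin r s G y)"
proof
  fix i
  have "hc (j - f i) (y b * G b i) = hc (j - e b) (y b) * G b i" if "b < r" "i < s" for b i
    using hc_mult[of "y b" d "G b i" "e b - f i" "j - f i"] assms that by (simp add: hom_def PF_def)
  then show "lin r s G (hcF r e j y) i = hcF s f j (lin r s G y) i"
    by (simp add: lin_def hcF_def hc_sum)
qed

lemma PF_sum_hcF:
  assumes y: "y \<in> PF d r"
  shows "\<exists>A. finite A \<and> y = (\<Sum>j\<in>A. hcF r e j y)"
proof -
  define A where "A = (\<Union>b<r. (\<lambda>i. i + e b) ` hdegs (y b))"
  have fA: "finite A" by (simp add: A_def)
  have "y b = (\<Sum>j\<in>A. hcF r e j y) b" for b
  proof (cases "b < r")
    case True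
    have "(\<Sum>j\<in>A. hc (j - e b) (y b)) = (\<Sum>i\<in>(\<lambda>j. j - e b) ` A. hc i (y b))"
      by (subst sum.reindex) (auto simp: inj_on_def)
    also have "\<dots> = y b"
    proof (rule sum_hc)
      show "hdegs (y b) \<subseteq> (\<lambda>j. j - e b) ` A"
      proof
        fix i assume "i \<in> hdegs (y b)"
        then have "i + e b \<in> A" using True by (auto simp: A_def)
        then show "i \<in> (\<lambda>j. j - e b) ` A" by (rule rev_image_eqI) simp
      qed
    qed (simp add: fA)
    finally show ?thesis using True by (simp add: sum_fun_apply hcF_def)
  next
    case False
    then show ?thesis using y by (simp add: sum_fun_apply hcF_def PF_def)
  qed
  then show ?thesis using fA by blast
qed

text \<open>Resolutions are defined by exactness of ungraded modules, whereas dimension shifting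
  works degree by degree. Homogeneous maps commute with \<open>hcF\<close> and every vector is a
  finite sum of components, so both notions agree.\<close>

lemma exact_iff:
  fixes G G' :: "nat \<Rightarrow> nat \<Rightarrow> (nat, 'k::field) mpol"
  assumes h: "hom d r e s f G" and h': "hom d r' e' r e G'"
  shows "{y\<in>PF d r. lin r s G y = 0} = lin r' r G' ` PF d r' \<longleftrightarrow>
    (\<forall>j. {y\<in>Fm d r e j. lin r s G y = 0} = lin r' r G' ` Fm d r' e' j)"
proof
  assume ex: "{y\<in>PF d r. lin r s G y = 0} = lin r' r G' ` PF d r'"
  show "\<forall>j. {y\<in>Fm d r e j. lin r s G y = 0} = lin r' r G' ` Fm d r' e' j"
  proof (intro allI equalityI subsetI)
    fix j y assume y: "y \<in> {y\<in>Fm d r e j. lin r s G y = 0}"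
    then have "y \<in> {y\<in>PF d r. lin r s G y = 0}" by (auto intro: Fm_PF)
    then obtain u where u: "u \<in> PF d r'" "y = lin r' r G' u" unfolding ex by (rule imageE)
    have "y = lin r' r G' (hcF r' e' j u)" using lin_hcF[OF h' u(1)] hcF_of_Fm[of y d r e j] y u(2) by simp
    then show "y \<in> lin r' r G' ` Fm d r' e' j" using hcF_Fm[OF u(1)] by (rule image_eqI)
  next
    fix j y assume "y \<in> lin r' r G' ` Fm d r' e' j"
    then obtain u where u: "u \<in> Fm d r' e' j" "y = lin r' r G' u" by blast
    have "y \<in> lin r' r G' ` PF d r'" unfolding u(2) by (rule imageI) (rule Fm_PF[OF u(1)])
    then have "lin r s G y = 0" unfolding ex[symmetric] by simp
    then show "y \<in> {y\<in>Fm d r e j. lin r s G y = 0}" using lin_Fm[OF h' u(1)] u(2) by simp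
  qed
next
  assume ex: "\<forall>j. {y\<in>Fm d r e j. lin r s G y = 0} = lin r' r G' ` Fm d r' e' j"
  have linPF: "lin r' r G' u \<in> PF d r" if u: "u \<in> PF d r'" for u
  proof -
    obtain A where A: "u = (\<Sum>j\<in>A. hcF r' e' j u)" using PF_sum_hcF[OF u] by blast
    have "lin r' r G' u = (\<Sum>j\<in>A. lin r' r G' (hcF r' e' j u))" by (subst A) (rule lin_sum)
    moreover have "lin r' r G' (hcF r' e' j u) \<in> PF d r" for j using lin_Fm[OF h' hcF_Fm[OF u]] by (rule Fm_PF)
    ultimately show ?thesis by (simp add: PF_sum)
  qed
  show "{y\<in>PF d r. lin r s G y = 0} = lin r' r G' ` PF d r'"
  proof (intro equalityI subsetI)
    fix y assume "y \<in> {y\<in>PF d r. lin r s G y = 0}"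
    then have y: "y \<in> PF d r" "lin r s G y = 0" by auto
    have "\<forall>j. \<exists>u. u \<in> Fm d r' e' j \<and> hcF r e j y = lin r' r G' u"
    proof
      fix j
      have "lin r s G (hcF r e j y) = 0" unfolding lin_hcF[OF h y(1)] y(2) by (rule hcF_0)
      then have "hcF r e j y \<in> {y\<in>Fm d r e j. lin r s G y = 0}" using hcF_Fm[OF y(1)] by simp
      then have "hcF r e j y \<in> lin r' r G' ` Fm d r' e' j" by (simp only: ex[rule_format])
      then show "\<exists>u. u \<in> Fm d r' e' j \<and> hcF r e j y = lin r' r G' u" by (elim imageE) (intro exI conjI)
    qed
    from choice[OF this] obtain U where U: "\<forall>j. U j \<in> Fm d r' e' j \<and> hcF r e j y = lin r' r G' (U j)" ..
    obtain A where A: "y = (\<Sum>j\<in>A. hcF r e j y)" using PF_sum_hcF[OF y(1)] by blast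
    have "(\<Sum>j\<in>A. hcF r e j y) = lin r' r G' (\<Sum>j\<in>A. U j)" unfolding lin_sum using U by simp
    then have "y = lin r' r G' (\<Sum>j\<in>A. U j)" using A by simp
    moreover have "(\<Sum>j\<in>A. U j) \<in> PF d r'" using U by (intro PF_sum) (blast intro: Fm_PF)
    ultimately show "y \<in> lin r' r G' ` PF d r'" by (rule image_eqI)
  next
    fix y assume "y \<in> lin r' r G' ` PF d r'"
    then obtain u where u: "u \<in> PF d r'" "y = lin r' r G' u" by blast
    obtain A where A: "u = (\<Sum>j\<in>A. hcF r' e' j u)" using PF_sum_hcF[OF u(1)] by blast
    have "lin r s G (lin r' r G' (hcF r' e' j u)) = 0" for j
    proof -
      have "lin r' r G' (hcF r' e' j u) \<in> {y\<in>Fm d r e j. lin r s G y = 0}"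
        unfolding ex[rule_format] by (rule imageI) (rule hcF_Fm[OF u(1)])
      then show ?thesis by simp
    qed
    then have "lin r s G (lin r' r G' (\<Sum>j\<in>A. hcF r' e' j u)) = 0" by (simp add: lin_sum)
    then show "y \<in> {y\<in>PF d r. lin r s G y = 0}" using A linPF[OF u(1)] u(2) by simp
  qed
qed

section \<open>Koszul homology along a free resolution\<close>

lemma gmod_kernel:
  fixes X :: "nat \<Rightarrow> 'm::ab_group_add \<Rightarrow> 'm" and Y :: "nat \<Rightarrow> 'n::ab_group_add \<Rightarrow> 'n"
  assumes g: "gmod V X F" and kY: "kop V Y"
    and add: "\<And>x y. \<phi> (x + y) = \<phi> x + \<phi> y" and lin: "\<And>a x. a \<in> V \<Longrightarrow> \<phi> (X a x) = Y a (\<phi> x)"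
  shows "gmod V X (\<lambda>j. {y\<in>F j. \<phi> y = 0})"
proof -
  have 0: "\<phi> 0 = 0" using add[of 0 0] by simp
  have minus: "\<phi> (x - y) = \<phi> x - \<phi> y" for x y
    using add[of "x - y" y] by (simp add: algebra_simps)
  show ?thesis unfolding gmod_def
    using g by (auto simp: 0 minus lin kop.X_zero[OF kY] gmodD)
qed

lemma mm_subset: "gmod V X F \<Longrightarrow> y \<in> mm V X F j \<Longrightarrow> y \<in> F j"
  by (erule mmE, simp, rule gmod_sum, assumption) (use gmod_X[of V X F _ _ "j - 1"] in auto)

text \<open>Since \<open>\<phi>\<close> maps \<open>F\<close> onto \<open>M\<close>, the quotient
  \<open>M / mM\<close> is \<open>F / (mF + ker \<phi>)\<close>, with \<open>m\<close> the maximal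
  ideal.\<close>

lemma mm_image_iff:
  fixes X :: "nat \<Rightarrow> 'm::ab_group_add \<Rightarrow> 'm" and Y :: "nat \<Rightarrow> 'n::ab_group_add \<Rightarrow> 'n"
  assumes g: "gmod V X F"
    and add: "\<And>x y. \<phi> (x + y) = \<phi> x + \<phi> y" and lin: "\<And>a x. a \<in> V \<Longrightarrow> \<phi> (X a x) = Y a (\<phi> x)"
    and M: "\<And>j. M j = \<phi> ` F j" and y: "y \<in> F j"
  shows "\<phi> y \<in> mm V Y M j \<longleftrightarrow> (\<exists>w\<in>mm V X F j. \<exists>k\<in>{y\<in>F j. \<phi> y = 0}. y = w + k)"
proof -
  have 0: "\<phi> 0 = 0" using add[of 0 0] by simp
  have minus: "\<phi> (x - y) = \<phi> x - \<phi> y" for x y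
    using add[of "x - y" y] by (simp add: algebra_simps)
  have sum: "\<phi> (\<Sum>a\<in>V. X a (f a)) = (\<Sum>a\<in>V. Y a (\<phi> (f a)))" for f
  proof -
    have "\<phi> (\<Sum>a\<in>A. X a (f a)) = (\<Sum>a\<in>A. Y a (\<phi> (f a)))" if "A \<subseteq> V" for A
      using that by (induction A rule: infinite_finite_induct) (auto simp: 0 add lin)
    then show ?thesis by simp
  qed
  show ?thesis
  proof
    assume "\<phi> y \<in> mm V Y M j"
    then obtain w where w: "\<forall>a\<in>V. w a \<in> M (j - 1)" "\<phi> y = (\<Sum>a\<in>V. Y a (w a))" by (rule mmE)
    have "\<forall>a. \<exists>f. a \<in> V \<longrightarrow> f \<in> F (j - 1) \<and> w a = \<phi> f" using w(1) by (auto simp: M image_iff)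
    from choice[OF this] obtain f where f: "\<forall>a. a \<in> V \<longrightarrow> f a \<in> F (j - 1) \<and> w a = \<phi> (f a)" ..
    let ?w = "\<Sum>a\<in>V. X a (f a)"
    have wm: "?w \<in> mm V X F j" by (rule mmI) (use f in simp)
    have "\<phi> ?w = \<phi> y" unfolding sum w(2) by (rule sum.cong) (use f in auto)
    then have "y - ?w \<in> {y\<in>F j. \<phi> y = 0}" using gmod_diff[OF g y mm_subset[OF g wm]] by (simp add: minus)
    then show "\<exists>w\<in>mm V X F j. \<exists>k\<in>{y\<in>F j. \<phi> y = 0}. y = w + k"
      by (intro bexI[OF _ wm] bexI[of _ "y - ?w"]) simp
  next
    assume "\<exists>w\<in>mm V X F j. \<exists>k\<in>{y\<in>F j. \<phi> y = 0}. y = w + k"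
    then obtain w k where wk: "w \<in> mm V X F j" "\<phi> k = 0" "y = w + k" by auto
    from wk(1) obtain f where f: "\<forall>a\<in>V. f a \<in> F (j - 1)" "w = (\<Sum>a\<in>V. X a (f a))" by (rule mmE)
    have "\<phi> y = (\<Sum>a\<in>V. Y a (\<phi> (f a)))" using wk(2,3) f(2) by (simp add: add sum)
    then show "\<phi> y \<in> mm V Y M j" using mmI[of V "\<lambda>a. \<phi> (f a)" M j Y] f(1) by (simp add: M)
  qed
qed

lemma image_Int_subset_iff: "f ` S \<inter> A \<subseteq> B \<longleftrightarrow> (\<forall>y\<in>S. f y \<in> A \<longrightarrow> f y \<in> B)"
  by auto

locale gres =
  fixes d :: nat and M :: "int \<Rightarrow> (nat, 'k::field) mpol set" and r :: "nat \<Rightarrow> nat" and e :: "nat \<Rightarrow> nat \<Rightarrow> int"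
    and g :: "nat \<Rightarrow> (nat, 'k) mpol" and G :: "nat \<Rightarrow> nat \<Rightarrow> nat \<Rightarrow> (nat, 'k) mpol"
  assumes M0: "\<And>j. M j = (\<lambda>y. lin (r 0) 1 (\<lambda>b i. g b) y 0) ` Fm d (r 0) (e 0) j"
    and ex0: "\<And>j. {y\<in>Fm d (r 0) (e 0) j. lin (r 0) 1 (\<lambda>b i. g b) y = 0} = lin (r 1) (r 0) (G 0) ` Fm d (r 1) (e 1) j"
    and exS: "\<And>q j. {y\<in>Fm d (r (Suc q)) (e (Suc q)) j. lin (r (Suc q)) (r q) (G q) y = 0} =
      lin (r (Suc (Suc q))) (r (Suc q)) (G (Suc q)) ` Fm d (r (Suc (Suc q))) (e (Suc (Suc q))) j"
begin

abbreviation "phi0 y \<equiv> lin (r 0) 1 (\<lambda>b i. g b) y 0"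
abbreviation "phi q \<equiv> lin (r (Suc q)) (r q) (G q)"
abbreviation "Fq q \<equiv> Fm d (r q) (e q)"
text \<open>The syzygy modules. As images they are covered by a free module; as kernels
  (\<open>N0\<close>, \<open>NS\<close>) they are the left term of a short exact sequence. Dimension
  shifting needs both descriptions.\<close>

definition "N q j = phi q ` Fq (Suc q) j"

lemma N0: "N 0 j = {y\<in>Fq 0 j. phi0 y = 0}"
proof -
  have "lin (r 0) 1 (\<lambda>b i. g b) y = 0 \<longleftrightarrow> phi0 y = 0" for y
    by (auto simp: fun_eq_iff lin_def)
  then show ?thesis using ex0[of j] by (simp add: N_def One_nat_def)
qed

lemma NS: "N (Suc q) j = {y\<in>Fq (Suc q) j. phi q y = 0}"
  using exS[of q j] by (simp add: N_def)

lemma N_sub: "N q j \<subseteq> Fq q j"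
  by (cases q) (auto simp: N0 NS)

lemma kopF: "kop {..<d} XF" by (rule kop_XF) simp
lemma kopP: "kop {..<d} Xp" by (rule kop_Xp) simp

lemma phi0_add: "phi0 (x + y) = phi0 x + phi0 y" by (simp add: lin_add)
lemma phi0_X: "phi0 (XF a y) = Xp a (phi0 y)" by (simp add: lin_XF)

lemma gN: "gmod {..<d} XF (N q)"
proof (cases q)
  case 0
  have "gmod {..<d} XF (\<lambda>j. {y\<in>Fq 0 j. phi0 y = 0})"
    by (rule gmod_kernel[where \<phi>="\<lambda>y. phi0 y" and Y=Xp, OF gmod_Fm kopP phi0_add phi0_X])
  moreover have "N q = (\<lambda>j. {y\<in>Fq 0 j. phi0 y = 0})" by (rule ext) (simp add: 0 N0)
  ultimately show ?thesis by simp
next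
  case (Suc p)
  have "gmod {..<d} XF (\<lambda>j. {y\<in>Fq (Suc p) j. phi p y = 0})"
    by (rule gmod_kernel[where \<phi>="phi p" and Y=XF, OF gmod_Fm kopF lin_add lin_XF])
  moreover have "N q = (\<lambda>j. {y\<in>Fq (Suc p) j. phi p y = 0})" by (rule ext) (simp add: Suc NS)
  ultimately show ?thesis by simp
qed

lemma shift_N: "hz {..<d} XF (Suc p) (N q) j \<longleftrightarrow> kz {..<d} XF p (N (Suc q)) (Fq (Suc q)) j"
  by (rule hz_shift[where \<phi>="phi q", OF kopF kopF gmod_Fm lin_add lin_XF N_def NS hz_Fm])

text \<open>Dimension shifting: free modules are acyclic above homological degree 0, so each step to
  the next syzygy module lowers the homological degree by one.\<close>

lemma hz_N: "hz {..<d} XF (Suc p) (N q) j \<longleftrightarrow> kz {..<d} XF 0 (N (Suc (q + p))) (Fq (Suc (q + p))) j"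
proof (induction p arbitrary: q)
  case 0
  show ?case by (simp only: shift_N add_0_right)
next
  case (Suc p)
  have "hz {..<d} XF (Suc (Suc p)) (N q) j \<longleftrightarrow> hz {..<d} XF (Suc p) (N (Suc q)) j"
    unfolding shift_N[of "Suc p" q] by (rule kz_eq_hz[OF kopF gmod_Fm gN N_sub hz_Fm])
  then show ?case using Suc.IH[of "Suc q"] by (simp add: func_zero)
qed

lemma shift_M: "hz {..<d} Xp (Suc p) M j \<longleftrightarrow> kz {..<d} XF p (N 0) (Fq 0) j"
  by (rule hz_shift[where \<phi>="\<lambda>y. phi0 y", OF kopF kopP gmod_Fm phi0_add phi0_X M0 N0 hz_Fm])

lemma hz_M_Suc: "hz {..<d} Xp (Suc p) M j \<longleftrightarrow> kz {..<d} XF 0 (N p) (Fq p) j"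
proof (cases p)
  case 0
  show ?thesis unfolding 0 by (rule shift_M)
next
  case (Suc q)
  have "hz {..<d} Xp (Suc (Suc q)) M j \<longleftrightarrow> hz {..<d} XF (Suc q) (N 0) j"
    unfolding shift_M[of "Suc q"] by (rule kz_eq_hz[OF kopF gmod_Fm gN N_sub hz_Fm])
  then show ?thesis using hz_N[of q 0 j] Suc by (simp add: func_zero)
qed

text \<open>Cycles and boundaries of \<open>F \<otimes> k\<close>, lifted to \<open>F\<close> and,
  for boundaries, confined to one internal degree; they mirror \<open>tor_cycles\<close> and
  \<open>tor_boundaries\<close>.\<close>

definition "cyc p y \<longleftrightarrow> (case p of 0 \<Rightarrow> True | Suc q \<Rightarrow> \<forall>i<r q. lk (phi q y i) 0 = 0)"

definition "bnd p j y \<longleftrightarrow> (\<exists>w\<in>Fq p j. \<exists>u\<in>Fq (Suc p) j. (\<forall>b<r p. lk (w b) 0 = 0) \<and> y = w + phi p u)"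

lemma bnd_iff: "bnd p j y \<longleftrightarrow> (\<exists>w\<in>mm {..<d} XF (Fq p) j. \<exists>k\<in>N p j. y = w + k)"
proof
  assume "bnd p j y"
  then obtain w u where wu: "w \<in> Fq p j" "u \<in> Fq (Suc p) j" "\<forall>b<r p. lk (w b) 0 = 0" "y = w + phi p u"
    unfolding bnd_def by auto
  show "\<exists>w\<in>mm {..<d} XF (Fq p) j. \<exists>k\<in>N p j. y = w + k"
  proof (intro bexI)
    show "y = w + phi p u" by (rule wu(4))
    show "phi p u \<in> N p j" using wu(2) by (simp add: N_def)
    show "w \<in> mm {..<d} XF (Fq p) j" using wu(1,3) by (simp add: Fm_mm)
  qed
next
  assume "\<exists>w\<in>mm {..<d} XF (Fq p) j. \<exists>k\<in>N p j. y = w + k"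
  then obtain w k where wk: "w \<in> mm {..<d} XF (Fq p) j" "k \<in> N p j" "y = w + k" by auto
  have w: "w \<in> Fq p j" by (rule mm_subset[OF gmod_Fm wk(1)])
  obtain u where u: "u \<in> Fq (Suc p) j" "k = phi p u" using wk(2) by (auto simp: N_def)
  show "bnd p j y" unfolding bnd_def
  proof (intro bexI conjI)
    show "y = w + phi p u" using wk(3) u(2) by simp
    show "\<forall>b<r p. lk (w b) 0 = 0" using wk(1) Fm_mm[OF w] by simp
  qed (rule w u(1))+
qed

text \<open>Balancing of Tor. By dimension shifting, homology in degree \<open>Suc q\<close> is the
  kernel of \<open>N q / m \<rightarrow> F q / m\<close>, with \<open>m\<close> the maximal ideal.
  The element \<open>phi q y\<close> lies in \<open>m\<close> times the free module iff
  \<open>y\<close> is a cycle modulo \<open>m\<close>, and in \<open>m\<close> times the syzygies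
  iff \<open>y\<close> is, modulo \<open>m\<close>, in the kernel of \<open>phi q\<close>, that is,
  a boundary.\<close>

lemma hz_M_iff: "hz {..<d} Xp p M j \<longleftrightarrow> (\<forall>y\<in>Fq p j. cyc p y \<longrightarrow> bnd p j y)"
proof (cases p)
  case 0
  have gM: "gmod {..<d} Xp M" unfolding gmod_def
  proof (intro allI conjI ballI)
    fix i
    have z: "phi0 0 = 0" by (simp add: lin_zero)
    show "0 \<in> M i" unfolding M0 by (rule image_eqI[of _ _ 0]) (simp_all add: z gmod_zero[OF gmod_Fm])
    fix x assume "x \<in> M i"
    then obtain x' where x': "x' \<in> Fq 0 i" "x = phi0 x'" unfolding M0 by (rule imageE)
    show "x - y \<in> M i" if "y \<in> M i" for y
    proof -
      obtain y' where y': "y' \<in> Fq 0 i" "y = phi0 y'" using \<open>y \<in> M i\<close> unfolding M0 by (rule imageE)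
      have "x - y = phi0 (x' - y')" by (simp add: x' y' lin_diff)
      then show ?thesis unfolding M0 using gmod_diff[OF gmod_Fm x'(1) y'(1)] by (rule image_eqI)
    qed
    show "mp_var a * x \<in> M (i + 1)" if "a \<in> {..<d}" for a
    proof -
      have "mp_var a * x = phi0 (XF a x')" by (simp add: x' phi0_X)
      then show ?thesis unfolding M0 using gmod_X[OF gmod_Fm that x'(1)] by (rule image_eqI)
    qed
  qed
  have "hz {..<d} Xp 0 M j \<longleftrightarrow> (\<forall>y\<in>Fq 0 j. phi0 y \<in> mm {..<d} Xp M j)"
    unfolding hz0_iff[OF kopP gM] M0[of j] by (rule image_subset_iff)
  also have "\<dots> \<longleftrightarrow> (\<forall>y\<in>Fq 0 j. bnd 0 j y)"
  proof (rule ball_cong[OF refl])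
    fix y :: "nat \<Rightarrow> (nat, 'k) mpol" assume y: "y \<in> Fq 0 j"
    show "phi0 y \<in> mm {..<d} Xp M j \<longleftrightarrow> bnd 0 j y"
      unfolding bnd_iff N0 by (rule mm_image_iff[where \<phi>="\<lambda>y. phi0 y" and Y=Xp, OF gmod_Fm phi0_add phi0_X M0 y])
  qed
  finally show ?thesis by (simp add: 0 cyc_def)
next
  case (Suc q)
  have "hz {..<d} Xp p M j \<longleftrightarrow> (\<forall>y\<in>Fq p j. phi q y \<in> mm {..<d} XF (Fq q) j \<longrightarrow> phi q y \<in> mm {..<d} XF (N q) j)"
    unfolding Suc hz_M_Suc kz0_iff[OF kopF gmod_Fm gN] N_def[of q j] by (rule image_Int_subset_iff)
  also have "\<dots> \<longleftrightarrow> (\<forall>y\<in>Fq p j. cyc p y \<longrightarrow> bnd p j y)"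
  proof (rule ball_cong[OF refl])
    fix y :: "nat \<Rightarrow> (nat, 'k) mpol" assume y: "y \<in> Fq p j"
    have "phi q y \<in> Fq q j" using N_sub[of q j] y by (auto simp: N_def Suc)
    then have "phi q y \<in> mm {..<d} XF (Fq q) j \<longleftrightarrow> cyc p y" by (simp add: Fm_mm cyc_def Suc)
    moreover have "phi q y \<in> mm {..<d} XF (N q) j \<longleftrightarrow> bnd p j y"
      unfolding bnd_iff Suc NS by (rule mm_image_iff[where \<phi>="phi q" and Y=XF, OF gmod_Fm lin_add lin_XF N_def y[unfolded Suc]])
    ultimately show "(phi q y \<in> mm {..<d} XF (Fq q) j \<longrightarrow> phi q y \<in> mm {..<d} XF (N q) j) \<longleftrightarrow> (cyc p y \<longrightarrow> bnd p j y)" by simp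
  qed
  finally show ?thesis .
qed

end

text \<open>Vectors carry their dimension and their type is no group; as functions padded by zero
  they live in the additive group that chains require.\<close>

definition fv :: "nat \<Rightarrow> (nat, 'k::field) mpol vec \<Rightarrow> nat \<Rightarrow> (nat, 'k) mpol" where
  "fv r v b = (if b < r then v $ b else 0)"

lemma fv_inj: "inj_on (fv r) (carrier_vec r)"
proof (rule inj_onI)
  fix v w :: "(nat, 'k::field) mpol vec" assume vw: "v \<in> carrier_vec r" "w \<in> carrier_vec r" and e: "fv r v = fv r w"
  show "v = w"
  proof (rule eq_vecI)
    show "v $ i = w $ i" if "i < dim_vec w" for i
      using fun_cong[OF e, of i] that vw by (simp add: fv_def)
  qed (use vw in simp)
qed

lemma fv_vec: "y \<in> PF d r \<Longrightarrow> fv r (vec r y) = y"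
  by (rule ext) (auto simp: fv_def PF_def)

lemma fv_add: "v \<in> carrier_vec r \<Longrightarrow> w \<in> carrier_vec r \<Longrightarrow> fv r (v + w) = fv r v + fv r w"
  by (rule ext) (auto simp: fv_def)

lemma cx_mod_iff: "v \<in> cx_mod d F i \<longleftrightarrow> v \<in> carrier_vec (rk F i) \<and> fv (rk F i) v \<in> PF d (rk F i)"
  by (auto simp: cx_mod_def fv_def PF_def)

lemma cx_mod_image:
  fixes F :: "'k::field free_cx"
  shows "fv (rk F i) ` cx_mod d F i = PF d (rk F i)"
proof (intro equalityI subsetI)
  fix y :: "nat \<Rightarrow> (nat, 'k) mpol" assume y: "y \<in> PF d (rk F i)"
  have "vec (rk F i) y \<in> cx_mod d F i" using y by (simp add: cx_mod_iff fv_vec)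
  then show "y \<in> fv (rk F i) ` cx_mod d F i" using fv_vec[OF y] by (intro image_eqI[of _ _ "vec (rk F i) y"]) simp_all
qed (auto simp: cx_mod_iff)

lemma homog_Pd_iff: "homog_of_deg j p \<and> p \<in> Pd d \<longleftrightarrow> p \<in> hp d j"
  by (auto simp: homog_of_deg_def hp_def Pd_iff in_keys_iff[of _ p])

lemma cx_homog_iff:
  "v \<in> cx_mod d F i \<and> cx_homog F i j v \<longleftrightarrow> v \<in> carrier_vec (rk F i) \<and> fv (rk F i) v \<in> Fm d (rk F i) (dg F i) j"
proof -
  have "(\<forall>b<rk F i. v $ b \<in> Pd d) \<and> (\<forall>b<rk F i. homog_of_deg (j - dg F i b) (v $ b)) \<longleftrightarrow>
      (\<forall>b<rk F i. v $ b \<in> hp d (j - dg F i b))"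
    using homog_Pd_iff by blast
  then show ?thesis by (simp add: cx_mod_def cx_homog_def Fm_def fv_def)
qed

definition cxg :: "'k::field free_cx \<Rightarrow> nat \<Rightarrow> (nat, 'k) mpol" where "cxg F b = aug F $ b"
definition cxG :: "'k::field free_cx \<Rightarrow> nat \<Rightarrow> nat \<Rightarrow> nat \<Rightarrow> (nat, 'k) mpol" where "cxG F q b i = dif F q $$ (i, b)"

lemma aug_lin: "v \<in> carrier_vec (rk F 0) \<Longrightarrow> aug F \<bullet> v = lin (rk F 0) 1 (\<lambda>b i. cxg F b) (fv (rk F 0) v) 0"
  by (auto simp: scalar_prod_def lin_def fv_def cxg_def lessThan_atLeast0 mult.commute intro!: sum.cong)

lemma dif_lin:
  assumes "dif F q \<in> carrier_mat (rk F q) (rk F (Suc q))" "v \<in> carrier_vec (rk F (Suc q))"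
  shows "fv (rk F q) (dif F q *\<^sub>v v) = lin (rk F (Suc q)) (rk F q) (cxG F q) (fv (rk F (Suc q)) v)"
proof
  fix i
  show "fv (rk F q) (dif F q *\<^sub>v v) i = lin (rk F (Suc q)) (rk F q) (cxG F q) (fv (rk F (Suc q)) v) i"
  proof (cases "i < rk F q")
    case True
    have "row (dif F q) i \<bullet> v = (\<Sum>b<rk F (Suc q). v $ b * dif F q $$ (i, b))"
      using assms True by (auto simp: scalar_prod_def lessThan_atLeast0 mult.commute intro!: sum.cong)
    also have "\<dots> = (\<Sum>b<rk F (Suc q). fv (rk F (Suc q)) v b * cxG F q b i)"
      by (rule sum.cong[OF refl]) (simp add: fv_def cxG_def)
    finally show ?thesis using assms True by (simp add: fv_def[of "rk F q"] lin_def)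
  qed (simp add: fv_def lin_def)
qed

lemma lin1_zero_iff: "lin r 1 G y = 0 \<longleftrightarrow> lin r 1 G y 0 = 0"
  by (auto simp: fun_eq_iff lin_def)

definition wf_cx :: "nat \<Rightarrow> 'k::field free_cx \<Rightarrow> bool" where
  "wf_cx d F \<longleftrightarrow> aug F \<in> cx_mod d F 0 \<and>
     (\<forall>b < rk F 0. homog_of_deg (dg F 0 b) (aug F $ b)) \<and>
     (\<forall>i. dif F i \<in> carrier_mat (rk F i) (rk F (Suc i)) \<and>
          (\<forall>b < rk F (Suc i). col (dif F i) b \<in> cx_mod d F i \<and> cx_homog F i (dg F (Suc i) b) (col (dif F i) b)))"

lemma wf_cx_iff:
  "wf_cx d F \<longleftrightarrow> aug F \<in> carrier_vec (rk F 0) \<and> (\<forall>i. dif F i \<in> carrier_mat (rk F i) (rk F (Suc i))) \<and>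
     hom d (rk F 0) (dg F 0) 1 (\<lambda>_. 0) (\<lambda>b i. cxg F b) \<and>
     (\<forall>q. hom d (rk F (Suc q)) (dg F (Suc q)) (rk F q) (dg F q) (cxG F q))"
proof -
  have 1: "aug F \<in> cx_mod d F 0 \<and> (\<forall>b < rk F 0. homog_of_deg (dg F 0 b) (aug F $ b)) \<longleftrightarrow>
      aug F \<in> carrier_vec (rk F 0) \<and> hom d (rk F 0) (dg F 0) 1 (\<lambda>_. 0) (\<lambda>b i. cxg F b)"
    using homog_Pd_iff[of _ _ d] by (simp add: cx_mod_def hom_def cxg_def) blast
  have 2: "(\<forall>b < rk F (Suc i). col (dif F i) b \<in> cx_mod d F i \<and> cx_homog F i (dg F (Suc i) b) (col (dif F i) b)) \<longleftrightarrow>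
      hom d (rk F (Suc i)) (dg F (Suc i)) (rk F i) (dg F i) (cxG F i)"
    if c: "dif F i \<in> carrier_mat (rk F i) (rk F (Suc i))" for i
  proof -
    have "fv (rk F i) (col (dif F i) b) \<in> Fm d (rk F i) (dg F i) (dg F (Suc i) b) \<longleftrightarrow>
        (\<forall>l<rk F i. cxG F i b l \<in> hp d (dg F (Suc i) b - dg F i l))" if "b < rk F (Suc i)" for b
      using c that by (simp add: Fm_def fv_def cxG_def)
    moreover have "col (dif F i) b \<in> carrier_vec (rk F i)" for b
      using c col_dim[of "dif F i" b] by simp
    ultimately show ?thesis unfolding cx_homog_iff hom_def by simp
  qed
  have "wf_cx d F \<longleftrightarrow> (aug F \<in> cx_mod d F 0 \<and> (\<forall>b < rk F 0. homog_of_deg (dg F 0 b) (aug F $ b))) \<and>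
      (\<forall>i. dif F i \<in> carrier_mat (rk F i) (rk F (Suc i)) \<and>
        (\<forall>b < rk F (Suc i). col (dif F i) b \<in> cx_mod d F i \<and> cx_homog F i (dg F (Suc i) b) (col (dif F i) b)))"
    by (simp only: wf_cx_def conj_assoc)
  also have "(\<forall>i. dif F i \<in> carrier_mat (rk F i) (rk F (Suc i)) \<and>
        (\<forall>b < rk F (Suc i). col (dif F i) b \<in> cx_mod d F i \<and> cx_homog F i (dg F (Suc i) b) (col (dif F i) b))) \<longleftrightarrow>
      (\<forall>i. dif F i \<in> carrier_mat (rk F i) (rk F (Suc i)) \<and>
        hom d (rk F (Suc i)) (dg F (Suc i)) (rk F i) (dg F i) (cxG F i))"
    by (rule all_cong1) (rule conj_cong[OF refl 2])
  finally show ?thesis unfolding 1 by (simp only: conj_assoc all_conj_distrib) blast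
qed

section \<open>Regularity and Koszul homology\<close>

lemma fv_Collect:
  assumes "\<And>v. v \<in> cx_mod d F i \<Longrightarrow> P v \<longleftrightarrow> Q (fv (rk F i) v)"
  shows "fv (rk F i) ` {v\<in>cx_mod d F i. P v} = {y\<in>PF d (rk F i). Q y}"
  unfolding cx_mod_image[symmetric] using assms by auto

lemma fv_dif_image:
  assumes "dif F q \<in> carrier_mat (rk F q) (rk F (Suc q))"
  shows "fv (rk F q) ` (\<lambda>u. dif F q *\<^sub>v u) ` cx_mod d F (Suc q) =
    lin (rk F (Suc q)) (rk F q) (cxG F q) ` PF d (rk F (Suc q))"
  unfolding cx_mod_image[symmetric] image_image
  by (rule image_cong[OF refl]) (rule dif_lin[OF assms], simp add: cx_mod_def)

lemma carrier_vec_eq_iff: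
  assumes "S \<subseteq> carrier_vec r" "T \<subseteq> carrier_vec r"
  shows "S = T \<longleftrightarrow> fv r ` S = fv r ` T"
  using inj_on_image_eq_iff[OF fv_inj assms] by simp

lemma gfr_iff:
  "graded_free_resolution d F M \<longleftrightarrow> wf_cx d F \<and>
     M = (\<lambda>y. lin (rk F 0) 1 (\<lambda>b i. cxg F b) y 0) ` PF d (rk F 0) \<and>
     {y\<in>PF d (rk F 0). lin (rk F 0) 1 (\<lambda>b i. cxg F b) y = 0} = lin (rk F (Suc 0)) (rk F 0) (cxG F 0) ` PF d (rk F (Suc 0)) \<and>
     (\<forall>i. {y\<in>PF d (rk F (Suc i)). lin (rk F (Suc i)) (rk F i) (cxG F i) y = 0} =
       lin (rk F (Suc (Suc i))) (rk F (Suc i)) (cxG F (Suc i)) ` PF d (rk F (Suc (Suc i))))"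
proof (cases "wf_cx d F")
  case False
  then show ?thesis by (auto simp: graded_free_resolution_def wf_cx_def)
next
  case True
  then have c: "dif F i \<in> carrier_mat (rk F i) (rk F (Suc i))" for i by (simp add: wf_cx_def)
  have sub: "{v\<in>cx_mod d F i. P v} \<subseteq> carrier_vec (rk F i)" for P i by (auto simp: cx_mod_def)
  have sub': "(\<lambda>u. dif F i *\<^sub>v u) ` cx_mod d F (Suc i) \<subseteq> carrier_vec (rk F i)" for i
    using c[of i] by (auto simp: cx_mod_def)
  have m: "(\<lambda>v. aug F \<bullet> v) ` cx_mod d F 0 = (\<lambda>y. lin (rk F 0) 1 (\<lambda>b i. cxg F b) y 0) ` PF d (rk F 0)"
    unfolding cx_mod_image[symmetric] image_image
    by (rule image_cong[OF refl]) (rule aug_lin, simp add: cx_mod_def)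
  have e0: "{v \<in> cx_mod d F 0. aug F \<bullet> v = 0} = (\<lambda>u. dif F 0 *\<^sub>v u) ` cx_mod d F (Suc 0) \<longleftrightarrow>
      {y\<in>PF d (rk F 0). lin (rk F 0) 1 (\<lambda>b i. cxg F b) y = 0} = lin (rk F (Suc 0)) (rk F 0) (cxG F 0) ` PF d (rk F (Suc 0))"
  proof -
    have "fv (rk F 0) ` {v \<in> cx_mod d F 0. aug F \<bullet> v = 0} = {y\<in>PF d (rk F 0). lin (rk F 0) 1 (\<lambda>b i. cxg F b) y = 0}"
      by (rule fv_Collect) (simp add: lin1_zero_iff aug_lin cx_mod_def)
    then show ?thesis unfolding carrier_vec_eq_iff[OF sub sub'] fv_dif_image[OF c] by simp
  qed
  have eS: "{v \<in> cx_mod d F (Suc i). dif F i *\<^sub>v v = 0\<^sub>v (rk F i)} = (\<lambda>u. dif F (Suc i) *\<^sub>v u) ` cx_mod d F (Suc (Suc i)) \<longleftrightarrow>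
      {y\<in>PF d (rk F (Suc i)). lin (rk F (Suc i)) (rk F i) (cxG F i) y = 0} =
       lin (rk F (Suc (Suc i))) (rk F (Suc i)) (cxG F (Suc i)) ` PF d (rk F (Suc (Suc i)))" for i
  proof -
    have "fv (rk F (Suc i)) ` {v \<in> cx_mod d F (Suc i). dif F i *\<^sub>v v = 0\<^sub>v (rk F i)} =
        {y\<in>PF d (rk F (Suc i)). lin (rk F (Suc i)) (rk F i) (cxG F i) y = 0}"
    proof (rule fv_Collect)
      fix v assume "v \<in> cx_mod d F (Suc i)"
      then have v: "v \<in> carrier_vec (rk F (Suc i))" by (simp add: cx_mod_def)
      have w: "dif F i *\<^sub>v v \<in> carrier_vec (rk F i)" by (rule mult_mat_vec_carrier[OF c v])
      have z: "fv (rk F i) (0\<^sub>v (rk F i)) = (0 :: nat \<Rightarrow> (nat, 'a) mpol)" by (rule ext) (simp add: fv_def)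
      have "dif F i *\<^sub>v v = 0\<^sub>v (rk F i) \<longleftrightarrow> fv (rk F i) (dif F i *\<^sub>v v) = fv (rk F i) (0\<^sub>v (rk F i))"
        using inj_on_eq_iff[OF fv_inj w zero_carrier_vec] by simp
      then show "dif F i *\<^sub>v v = 0\<^sub>v (rk F i) \<longleftrightarrow> lin (rk F (Suc i)) (rk F i) (cxG F i) (fv (rk F (Suc i)) v) = 0"
        unfolding z dif_lin[OF c v] .
    qed
    then show ?thesis unfolding carrier_vec_eq_iff[OF sub sub'] fv_dif_image[OF c] by simp
  qed
  have "graded_free_resolution d F M \<longleftrightarrow> wf_cx d F \<and> M = (\<lambda>v. aug F \<bullet> v) ` cx_mod d F 0 \<and>
     {v \<in> cx_mod d F 0. aug F \<bullet> v = 0} = (\<lambda>u. dif F 0 *\<^sub>v u) ` cx_mod d F 1 \<and>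
     (\<forall>i. {v \<in> cx_mod d F (Suc i). dif F i *\<^sub>v v = 0\<^sub>v (rk F i)} =
          (\<lambda>u. dif F (Suc i) *\<^sub>v u) ` cx_mod d F (Suc (Suc i)))"
    by (simp only: graded_free_resolution_def wf_cx_def conj_assoc)
  then show ?thesis unfolding One_nat_def m e0 eS .
qed

lemma hcF_add: "hcF r e j (x + y) = hcF r e j x + hcF r e j y"
  by (rule ext) (simp add: hcF_def hc_add)

text \<open>Every graded free resolution gives the same answer, namely Koszul homology; thus the
  resolution chosen in \<open>tor_nonzero\<close> is immaterial.\<close>

lemma tor_iff:
  fixes F :: "'k::field free_cx"
  assumes res: "graded_free_resolution d F M"
  shows "(\<exists>v\<in>tor_cycles d F p. cx_homog F p j v \<and> v \<notin> tor_boundaries d F p) \<longleftrightarrow>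
    \<not> hz {..<d} Xp p (\<lambda>j. M \<inter> hp d j) j"
proof -
  let ?r = "rk F" and ?e = "dg F" and ?G = "cxG F"
  have wf: "wf_cx d F" and M: "M = (\<lambda>y. lin (?r 0) 1 (\<lambda>b i. cxg F b) y 0) ` PF d (?r 0)"
    and E0: "{y\<in>PF d (?r 0). lin (?r 0) 1 (\<lambda>b i. cxg F b) y = 0} = lin (?r (Suc 0)) (?r 0) (?G 0) ` PF d (?r (Suc 0))"
    and ES: "\<And>i. {y\<in>PF d (?r (Suc i)). lin (?r (Suc i)) (?r i) (?G i) y = 0} =
       lin (?r (Suc (Suc i))) (?r (Suc i)) (?G (Suc i)) ` PF d (?r (Suc (Suc i)))"
    using res unfolding gfr_iff by simp_all
  have c: "dif F i \<in> carrier_mat (?r i) (?r (Suc i))" for i using wf by (simp add: wf_cx_def)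
  have h0: "hom d (?r 0) (?e 0) 1 (\<lambda>_. 0) (\<lambda>b i. cxg F b)" and hS: "hom d (?r (Suc q)) (?e (Suc q)) (?r q) (?e q) (?G q)" for q
    using wf unfolding wf_cx_iff by simp_all
  interpret gres d "\<lambda>j. M \<inter> hp d j" ?r ?e "cxg F" ?G
  proof
    fix j
    show "M \<inter> hp d j = (\<lambda>y. lin (?r 0) 1 (\<lambda>b i. cxg F b) y 0) ` Fm d (?r 0) (?e 0) j"
    proof (intro equalityI subsetI)
      fix x assume x: "x \<in> M \<inter> hp d j"
      then obtain y where y: "y \<in> PF d (?r 0)" "x = lin (?r 0) 1 (\<lambda>b i. cxg F b) y 0" unfolding M by blast
      have "lin (?r 0) 1 (\<lambda>b i. cxg F b) (hcF (?r 0) (?e 0) j y) 0 = hc j x"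
        unfolding lin_hcF[OF h0 y(1)] y(2) by (simp add: hcF_def)
      also have "\<dots> = x" using x by (simp add: hc_of_hp[of x d j])
      finally show "x \<in> (\<lambda>y. lin (?r 0) 1 (\<lambda>b i. cxg F b) y 0) ` Fm d (?r 0) (?e 0) j"
        using hcF_Fm[OF y(1), of "?e 0" j] by (intro image_eqI[of _ _ "hcF (?r 0) (?e 0) j y"]) simp_all
    next
      fix x assume "x \<in> (\<lambda>y. lin (?r 0) 1 (\<lambda>b i. cxg F b) y 0) ` Fm d (?r 0) (?e 0) j"
      then obtain y where y: "x = lin (?r 0) 1 (\<lambda>b i. cxg F b) y 0" "y \<in> Fm d (?r 0) (?e 0) j" by (rule imageE)
      have "x \<in> M" unfolding M y(1) by (rule image_eqI[OF refl Fm_PF[OF y(2)]])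
      moreover have "x \<in> hp d j" using lin_Fm[OF h0 y(2)] y(1) by (simp add: Fm_def)
      ultimately show "x \<in> M \<inter> hp d j" by simp
    qed
    show "{y\<in>Fm d (?r 0) (?e 0) j. lin (?r 0) 1 (\<lambda>b i. cxg F b) y = 0} = lin (?r 1) (?r 0) (?G 0) ` Fm d (?r 1) (?e 1) j"
      using exact_iff[OF h0 hS[of 0]] E0 unfolding One_nat_def by blast
    fix q
    show "{y\<in>Fm d (?r (Suc q)) (?e (Suc q)) j. lin (?r (Suc q)) (?r q) (?G q) y = 0} =
      lin (?r (Suc (Suc q))) (?r (Suc q)) (?G (Suc q)) ` Fm d (?r (Suc (Suc q))) (?e (Suc (Suc q))) j"
      using exact_iff[OF hS[of q] hS[of "Suc q"]] ES[of q] by blast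
  qed
  have cyc: "v \<in> tor_cycles d F p \<and> cx_homog F p j v \<longleftrightarrow>
      v \<in> carrier_vec (?r p) \<and> fv (?r p) v \<in> Fq p j \<and> cyc p (fv (?r p) v)" for v
  proof (cases p)
    case 0
    then show ?thesis using cx_homog_iff[of v d F 0 j] by (simp add: cyc_def)
  next
    case (Suc q)
    have "dif F q *\<^sub>v v \<in> cx_max d F q \<longleftrightarrow> cyc p (fv (?r p) v)"
      if v: "v \<in> carrier_vec (?r p)" and h: "fv (?r p) v \<in> Fq p j"
    proof -
      have e: "fv (?r q) (dif F q *\<^sub>v v) = phi q (fv (?r p) v)" unfolding Suc by (rule dif_lin[OF c v[unfolded Suc]])
      have "phi q (fv (?r p) v) \<in> PF d (?r q)" using Fm_PF[OF lin_Fm[OF hS h[unfolded Suc]]] by (simp add: Suc)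
      then have m: "dif F q *\<^sub>v v \<in> cx_mod d F q" unfolding cx_mod_iff e using c[of q] v by (simp add: Suc)
      have "(dif F q *\<^sub>v v) $ i = phi q (fv (?r p) v) i" if "i < ?r q" for i
        using fun_cong[OF e, of i] that by (simp add: fv_def[of "?r q"])
      then show ?thesis using m by (simp add: cx_max_def cyc_def Suc)
    qed
    then show ?thesis using cx_homog_iff[of v d F p j] by (auto simp: Suc)
  qed
  have bnd: "v \<in> tor_boundaries d F p \<longleftrightarrow> bnd p j (fv (?r p) v)"
    if v: "v \<in> carrier_vec (?r p)" and h: "fv (?r p) v \<in> Fq p j" for v
  proof
    assume "v \<in> tor_boundaries d F p"
    then obtain w u where wu: "w \<in> cx_max d F p" "u \<in> cx_mod d F (Suc p)" "v = w + dif F p *\<^sub>v u"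
      unfolding tor_boundaries_def by blast
    have wm: "w \<in> cx_mod d F p" and w0: "\<And>b. b < ?r p \<Longrightarrow> lk (w $ b) 0 = 0" using wu(1) by (simp_all add: cx_max_def)
    let ?w = "fv (?r p) w" and ?u = "fv (?r (Suc p)) u"
    have wP: "?w \<in> PF d (?r p)" and wc: "w \<in> carrier_vec (?r p)" using wm by (simp_all add: cx_mod_iff)
    have uP: "?u \<in> PF d (?r (Suc p))" and uc: "u \<in> carrier_vec (?r (Suc p))" using wu(2) by (simp_all add: cx_mod_iff)
    have "fv (?r p) v = ?w + phi p ?u"
      unfolding wu(3) using fv_add[OF wc, of "dif F p *\<^sub>v u"] c[of p] uc by (simp add: dif_lin[OF c uc])
    \<comment> \<open>A witness in \<open>tor_boundaries\<close> need not be homogeneous, so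
      components of degree \<open>j\<close> are taken on both sides.\<close>
    then have "hcF (?r p) (?e p) j (fv (?r p) v) = hcF (?r p) (?e p) j ?w + phi p (hcF (?r (Suc p)) (?e (Suc p)) j ?u)"
      by (simp only: hcF_add lin_hcF[OF hS uP])
    then have e: "fv (?r p) v = hcF (?r p) (?e p) j ?w + phi p (hcF (?r (Suc p)) (?e (Suc p)) j ?u)"
      by (simp only: hcF_of_Fm[OF h])
    show "bnd p j (fv (?r p) v)" unfolding bnd_def
    proof (intro bexI conjI)
      show "fv (?r p) v = hcF (?r p) (?e p) j ?w + phi p (hcF (?r (Suc p)) (?e (Suc p)) j ?u)" by (rule e)
      show "\<forall>b<?r p. lk (hcF (?r p) (?e p) j ?w b) 0 = 0" using w0 by (simp add: hcF_def fv_def lookup_hc)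
    qed (rule hcF_Fm uP wP)+
  next
    assume "bnd p j (fv (?r p) v)"
    then obtain w u where wu: "w \<in> Fq p j" "u \<in> Fq (Suc p) j" "\<forall>b<?r p. lk (w b) 0 = 0" "fv (?r p) v = w + phi p u"
      unfolding bnd_def by blast
    let ?w = "vec (?r p) w" and ?u = "vec (?r (Suc p)) u"
    have fw: "fv (?r p) ?w = w" and fu: "fv (?r (Suc p)) ?u = u" using fv_vec Fm_PF wu(1,2) by blast+
    have uc: "?u \<in> carrier_vec (?r (Suc p))" by simp
    have "fv (?r p) v = fv (?r p) (?w + dif F p *\<^sub>v ?u)"
      using fv_add[of ?w "?r p" "dif F p *\<^sub>v ?u"] c[of p] by (simp add: dif_lin[OF c uc] fw fu wu(4))
    then have "v = ?w + dif F p *\<^sub>v ?u"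
      using inj_on_eq_iff[OF fv_inj v, of "?w + dif F p *\<^sub>v ?u"] c[of p] by simp
    moreover have "?w \<in> cx_max d F p"
      using Fm_PF[OF wu(1)] wu(3) by (simp add: cx_max_def cx_mod_iff fw)
    moreover have "?u \<in> cx_mod d F (Suc p)" using Fm_PF[OF wu(2)] by (simp add: cx_mod_iff fu)
    ultimately show "v \<in> tor_boundaries d F p" unfolding tor_boundaries_def by blast
  qed
  have "(\<exists>v\<in>tor_cycles d F p. cx_homog F p j v \<and> v \<notin> tor_boundaries d F p) \<longleftrightarrow>
      (\<exists>v. v \<in> carrier_vec (?r p) \<and> fv (?r p) v \<in> Fq p j \<and> cyc p (fv (?r p) v) \<and> \<not> bnd p j (fv (?r p) v))"
    using cyc bnd by blast
  also have "\<dots> \<longleftrightarrow> (\<exists>y\<in>Fq p j. cyc p y \<and> \<not> bnd p j y)"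
  proof
    assume "\<exists>y\<in>Fq p j. cyc p y \<and> \<not> bnd p j y"
    then obtain y where y: "y \<in> Fq p j" "cyc p y" "\<not> bnd p j y" by blast
    have "fv (?r p) (vec (?r p) y) = y" using fv_vec[OF Fm_PF[OF y(1)]] .
    then show "\<exists>v. v \<in> carrier_vec (?r p) \<and> fv (?r p) v \<in> Fq p j \<and> cyc p (fv (?r p) v) \<and> \<not> bnd p j (fv (?r p) v)"
      using y by (intro exI[of _ "vec (?r p) y"]) simp
  qed blast
  also have "\<dots> \<longleftrightarrow> \<not> hz {..<d} Xp p (\<lambda>j. M \<inter> hp d j) j" unfolding hz_M_iff by blast
  finally show ?thesis .
qed

section \<open>Existence of graded free resolutions\<close>

definition hid :: "nat \<Rightarrow> (nat, 'k::field) mpol set \<Rightarrow> bool" where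
  "hid d M \<longleftrightarrow> M \<subseteq> Pd d \<and> 0 \<in> M \<and> (\<forall>x\<in>M. \<forall>y\<in>M. x + y \<in> M) \<and> (\<forall>p\<in>Pd d. \<forall>x\<in>M. p * x \<in> M) \<and> (\<forall>j. \<forall>x\<in>M. hc j x \<in> M)"

lemma hid_sum: "hid d M \<Longrightarrow> (\<And>a. a \<in> A \<Longrightarrow> f a \<in> M) \<Longrightarrow> sum f A \<in> M"
  by (induction A rule: infinite_finite_induct) (auto simp: hid_def)

lemma hid_uminus:
  assumes "hid d M" "x \<in> M" shows "- x \<in> M"
proof -
  have "- mp_const 1 \<in> Pd d" by (rule Pd_uminus) (rule hp_Pd[OF hp_const])
  then have "(- mp_const 1) * x \<in> M" using assms unfolding hid_def by blast
  then show ?thesis by (simp add: single_one)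
qed

lemma hid_diff: "hid d M \<Longrightarrow> x \<in> M \<Longrightarrow> y \<in> M \<Longrightarrow> x - y \<in> M"
  unfolding diff_conv_add_uminus[of x y] using hid_uminus[of d M y] unfolding hid_def by blast

lemma gens_image:
  fixes N :: "int \<Rightarrow> (nat \<Rightarrow> (nat, 'k::field) mpol) set"
  assumes g: "gmod {..<d} XF N" and sc: "\<And>j c y. y \<in> N j \<Longrightarrow> (\<lambda>b. mp_const c * y b) \<in> N j"
    and sub: "\<And>j. N j \<subseteq> Fm d r e j" and gens: "gens d N r' e' G"
  shows "N j = lin r' r G ` Fm d r' e' j" and "hom d r' e' r e G"
proof -
  have GN: "G b \<in> N (e' b)" if "b < r'" for b using gens that by (simp add: gens_def)
  show "hom d r' e' r e G" unfolding hom_def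
    using GN sub by (auto simp: Fm_def)
  show "N j = lin r' r G ` Fm d r' e' j"
  proof (intro equalityI subsetI)
    fix y assume y: "y \<in> N j"
    then obtain c where c: "c \<in> Fm d r' e' j" "\<forall>i. y i = (\<Sum>b<r'. c b * G b i)" using gens unfolding gens_def by meson
    have "y i = lin r' r G c i" for i
    proof (cases "i < r")
      case True then show ?thesis using c(2) by (simp add: lin_def)
    next
      case False
      then show ?thesis using subsetD[OF sub y] by (simp add: lin_def Fm_def)
    qed
    then have "y = lin r' r G c" by (rule ext)
    then show "y \<in> lin r' r G ` Fm d r' e' j" using c(1) by (rule image_eqI)
  next
    fix y assume "y \<in> lin r' r G ` Fm d r' e' j"
    then obtain c where c: "y = lin r' r G c" "c \<in> Fm d r' e' j" by (rule imageE)
    have G0: "G b i = 0" if "b < r'" "\<not> i < r" for b i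
      using subsetD[OF sub GN[OF that(1)]] that(2) by (simp add: Fm_def)
    have "y = (\<Sum>b<r'. (\<lambda>i. c b * G b i))"
      unfolding c(1) by (rule ext) (simp add: lin_def sum_fun_apply G0)
    moreover have "(\<lambda>i. c b * G b i) \<in> N j" if "b < r'" for b
      using gmod_mult[OF g sc GN[OF that], of "c b" "j - e' b"] c(2) that by (simp add: Fm_def)
    then have "(\<Sum>b<r'. (\<lambda>i. c b * G b i)) \<in> N j" by (intro gmod_sum[OF g]) simp
    ultimately show "y \<in> N j" by (simp only:)
  qed
qed

text \<open>Kernels of homogeneous maps are graded submodules, so \<open>noether\<close> can be
  iterated along all natural numbers. Without existence the choice in \<open>tor_nonzero\<close>
  would say nothing.\<close>

lemma gfr_exists:
  fixes M :: "(nat, 'k::field) mpol set"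
  assumes M: "hid d M"
  shows "\<exists>F. graded_free_resolution d F M"
proof -
  \<comment> \<open>The ideal is regarded as a submodule of the free module of rank one.\<close>
  define emb :: "(nat, 'k) mpol \<Rightarrow> nat \<Rightarrow> (nat, 'k) mpol" where "emb p i = (if i < 1 then p else 0)" for p i
  define N0 where "N0 j = emb ` (M \<inter> hp d j)" for j
  have embI: "y \<in> N0 j \<longleftrightarrow> y 0 \<in> M \<inter> hp d j \<and> (\<forall>i\<ge>1. y i = 0)" for y j
  proof
    assume "y \<in> N0 j" then show "y 0 \<in> M \<inter> hp d j \<and> (\<forall>i\<ge>1. y i = 0)" by (auto simp: N0_def emb_def)
  next
    assume y: "y 0 \<in> M \<inter> hp d j \<and> (\<forall>i\<ge>1. y i = 0)"
    then have "y = emb (y 0)" by (auto simp: emb_def fun_eq_iff One_nat_def not_less_eq_eq)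
    then show "y \<in> N0 j" using y unfolding N0_def by blast
  qed
  have mulM: "q * x \<in> M" if "q \<in> hp d i" "x \<in> M" for q i x
    using M hp_Pd[OF that(1)] that(2) unfolding hid_def by blast
  have g0: "gmod {..<d} XF N0" unfolding gmod_def
  proof (intro allI conjI ballI)
    fix j a and x y assume x: "x \<in> N0 j"
    show "x - y \<in> N0 j" if "y \<in> N0 j" using x that hid_diff[OF M] by (simp add: embI hp_diff)
    show "(\<lambda>b. Xp a (x b)) \<in> N0 (j + 1)" if "a \<in> {..<d}"
      using x that mulM[OF hp_var[of a d], of "x 0"] gmod_X[OF gmod_hp that, of "x 0" j] by (simp add: embI)
  qed (use M in \<open>simp add: embI hid_def\<close>)
  have sc0: "(\<lambda>b. mp_const c * y b) \<in> N0 j" if "y \<in> N0 j" for j c y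
    using that mulM[OF hp_const] hp_mult[OF hp_const, of "y 0" d j c] by (simp add: embI)
  have sub0: "N0 j \<subseteq> Fm d 1 (\<lambda>_. 0) j" for j by (auto simp: embI Fm_def One_nat_def)
  obtain r0 e0 G0 where gens0: "gens d N0 r0 e0 G0" using noether[OF g0 sc0 sub0] by blast
  have N01: "N0 j = lin r0 1 G0 ` Fm d r0 e0 j" for j by (rule gens_image(1)[OF g0 sc0 sub0 gens0])
  have N02: "hom d r0 e0 1 (\<lambda>_. 0) G0" by (rule gens_image(2)[OF g0 sc0 sub0 gens0])
  define K where "K r e s G j = {y\<in>Fm d r e j. lin r s G y = (0 :: nat \<Rightarrow> (nat, 'k) mpol)}" for r e s G j
  have gK: "gmod {..<d} XF (K r e s G)" for r e s G
    unfolding K_def[abs_def] by (rule gmod_kernel[where \<phi>="lin r s G" and Y=XF, OF gmod_Fm kop_XF lin_add lin_XF]) simp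
  have scK: "(\<lambda>b. mp_const c * y b) \<in> K r e s G j" if "y \<in> K r e s G j" for r e s G j c y
  proof -
    have "mp_const c * y b \<in> hp d (j - e b)" if "b < r" for b
      using hp_mult[OF hp_const, of "y b" d "j - e b" c] \<open>y \<in> K r e s G j\<close> that by (simp add: K_def Fm_def)
    moreover have "lin r s G (\<lambda>b. mp_const c * y b) i = mp_const c * lin r s G y i" for i
      by (simp add: lin_def sum_distrib_left mult.assoc)
    then have "lin r s G (\<lambda>b. mp_const c * y b) = 0" using that by (simp add: K_def fun_eq_iff)
    ultimately show ?thesis using that by (simp add: K_def Fm_def)
  qed
  have subK: "K r e s G j \<subseteq> Fm d r e j" for r e s G j by (auto simp: K_def)
  \<comment> \<open>A state consists of rank, basis degrees, rank of the target and matrix; a step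
    covers the kernel of the current matrix by a new free module.\<close>
  define step where "step = (\<lambda>(r, e, s, G). let x = (SOME x. gens d (K r e s G) (fst x) (fst (snd x)) (snd (snd x)))
     in (fst x, fst (snd x), r :: nat, snd (snd x)))"
  define St where "St = rec_nat (r0, e0, 1, \<lambda>b i. G0 b 0) (\<lambda>_. step)"
  define r where "r q = fst (St q)" for q
  define e where "e q = fst (snd (St q))" for q
  define s where "s q = fst (snd (snd (St q)))" for q
  define G where "G q = snd (snd (snd (St q)))" for q
  have St: "St q = (r q, e q, s q, G q)" for q by (simp add: r_def e_def s_def G_def)
  have St0: "St 0 = (r0, e0, 1, \<lambda>b i. G0 b 0)" by (simp add: St_def)
  have StS: "St (Suc q) = step (St q)" for q by (simp add: St_def)
  have stepg: "s (Suc q) = r q \<and> gens d (K (r q) (e q) (s q) (G q)) (r (Suc q)) (e (Suc q)) (G (Suc q))" for q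
  proof -
    let ?P = "\<lambda>x. gens d (K (r q) (e q) (s q) (G q)) (fst x) (fst (snd x)) (snd (snd x))"
    obtain r' e' G' where "gens d (K (r q) (e q) (s q) (G q)) r' e' G'" using noether[OF gK scK subK] by blast
    then have "?P (r', e', G')" by simp
    then have P: "?P (SOME x. ?P x)" by (rule someI)
    have "St (Suc q) = (fst (SOME x. ?P x), fst (snd (SOME x. ?P x)), r q, snd (snd (SOME x. ?P x)))"
      unfolding StS by (simp add: St[of q] step_def Let_def)
    then have "r (Suc q) = fst (SOME x. ?P x)" "e (Suc q) = fst (snd (SOME x. ?P x))" "s (Suc q) = r q"
      "G (Suc q) = snd (snd (SOME x. ?P x))" by (simp_all add: St)
    then show ?thesis using P by simp
  qed
  have stepG: "K (r q) (e q) (s q) (G q) j = lin (r (Suc q)) (r q) (G (Suc q)) ` Fm d (r (Suc q)) (e (Suc q)) j"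
    and stepH: "hom d (r (Suc q)) (e (Suc q)) (r q) (e q) (G (Suc q))" for q j
    using gens_image[OF gK scK subK, of "r q" "e q" "s q" "G q" "r (Suc q)" "e (Suc q)" "G (Suc q)"] stepg[of q] by blast+
  have z: "r 0 = r0" "e 0 = e0" "s 0 = 1" "G 0 = (\<lambda>b i. G0 b 0)" using St0 by (simp_all add: St)
  define F where "F = \<lparr>rk = r, dg = e, aug = vec (r 0) (\<lambda>b. G0 b 0),
    dif = (\<lambda>q. mat (r q) (r (Suc q)) (\<lambda>(i, b). G (Suc q) b i))\<rparr>"
  have F: "rk F = r" "dg F = e" by (simp_all add: F_def)
  have lin0: "lin (r 0) 1 (\<lambda>b i. cxg F b) = lin (r 0) 1 (\<lambda>b i. G0 b 0)"
    by (intro ext) (simp add: lin_def cxg_def F_def)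
  have linS: "lin (r (Suc q)) (r q) (cxG F q) = lin (r (Suc q)) (r q) (G (Suc q))" for q
    by (intro ext) (simp add: lin_def cxG_def F_def)
  have linG0: "lin (r 0) 1 (\<lambda>b i. G0 b 0) = lin r0 1 G0"
    by (intro ext) (simp add: lin_def z One_nat_def)
  have h0: "hom d (r 0) (e 0) 1 (\<lambda>_. 0) (\<lambda>b i. cxg F b)"
    using N02 by (simp add: hom_def cxg_def F_def z One_nat_def)
  have hS: "hom d (r (Suc q)) (e (Suc q)) (r q) (e q) (cxG F q)" for q
    using stepH[of q] by (simp add: hom_def cxG_def F_def)
  have "graded_free_resolution d F M" unfolding gfr_iff F
  proof (intro conjI allI)
    show "wf_cx d F" unfolding wf_cx_iff F using h0 hS by (simp add: F_def)
    have E0: "\<forall>j. {y\<in>Fm d (r 0) (e 0) j. lin (r 0) 1 (\<lambda>b i. cxg F b) y = 0} =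
        lin (r (Suc 0)) (r 0) (cxG F 0) ` Fm d (r (Suc 0)) (e (Suc 0)) j"
      unfolding lin0 linS stepG[symmetric] K_def unfolding z by simp
    then show "{y\<in>PF d (r 0). lin (r 0) 1 (\<lambda>b i. cxg F b) y = 0} = lin (r (Suc 0)) (r 0) (cxG F 0) ` PF d (r (Suc 0))"
      using exact_iff[OF h0 hS[of 0]] by blast
    fix q
    have "\<forall>j. {y\<in>Fm d (r (Suc q)) (e (Suc q)) j. lin (r (Suc q)) (r q) (cxG F q) y = 0} =
        lin (r (Suc (Suc q))) (r (Suc q)) (cxG F (Suc q)) ` Fm d (r (Suc (Suc q))) (e (Suc (Suc q))) j"
      unfolding linS stepG[symmetric] K_def using stepg[of q] by simp
    then show "{y\<in>PF d (r (Suc q)). lin (r (Suc q)) (r q) (cxG F q) y = 0} =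
        lin (r (Suc (Suc q))) (r (Suc q)) (cxG F (Suc q)) ` PF d (r (Suc (Suc q)))"
      using exact_iff[OF hS[of q] hS[of "Suc q"]] by blast
  next
    have L: "M \<inter> hp d j = (\<lambda>y. lin (r 0) 1 (\<lambda>b i. cxg F b) y 0) ` Fm d (r 0) (e 0) j" for j
    proof -
      have "M \<inter> hp d j = (\<lambda>y. y 0) ` N0 j" by (simp add: N0_def image_image emb_def)
      then show ?thesis unfolding lin0 linG0 unfolding z by (simp only: N01 image_image)
    qed
    show "M = (\<lambda>y. lin (r 0) 1 (\<lambda>b i. cxg F b) y 0) ` PF d (r 0)"
    proof (intro equalityI subsetI)
      fix x assume x: "x \<in> M"
      have "\<forall>j. \<exists>y. y \<in> Fm d (r 0) (e 0) j \<and> hc j x = lin (r 0) 1 (\<lambda>b i. cxg F b) y 0"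
      proof
        fix j
        have "x \<in> Pd d" using M x by (auto simp: hid_def)
        then have "hc j x \<in> M \<inter> hp d j" using M x by (simp add: hid_def hc_hp)
        then show "\<exists>y. y \<in> Fm d (r 0) (e 0) j \<and> hc j x = lin (r 0) 1 (\<lambda>b i. cxg F b) y 0" unfolding L by blast
      qed
      from choice[OF this] obtain Y where Y: "\<forall>j. Y j \<in> Fm d (r 0) (e 0) j \<and> hc j x = lin (r 0) 1 (\<lambda>b i. cxg F b) (Y j) 0" ..
      have "x = (\<Sum>j\<in>hdegs x. hc j x)" using sum_hc[of "hdegs x" x] by simp
      also have "\<dots> = (\<Sum>j\<in>hdegs x. lin (r 0) 1 (\<lambda>b i. cxg F b) (Y j)) 0"
        unfolding sum_fun_apply using Y by simp
      also have "\<dots> = lin (r 0) 1 (\<lambda>b i. cxg F b) (\<Sum>j\<in>hdegs x. Y j) 0" unfolding lin_sum ..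
      finally have "x = lin (r 0) 1 (\<lambda>b i. cxg F b) (\<Sum>j\<in>hdegs x. Y j) 0" .
      moreover have "(\<Sum>j\<in>hdegs x. Y j) \<in> PF d (r 0)"
        by (rule PF_sum) (rule Fm_PF[OF Y[rule_format, THEN conjunct1]])
      ultimately show "x \<in> (\<lambda>y. lin (r 0) 1 (\<lambda>b i. cxg F b) y 0) ` PF d (r 0)" by (rule image_eqI)
    next
      fix x assume "x \<in> (\<lambda>y. lin (r 0) 1 (\<lambda>b i. cxg F b) y 0) ` PF d (r 0)"
      then obtain y where y: "x = lin (r 0) 1 (\<lambda>b i. cxg F b) y 0" "y \<in> PF d (r 0)" by (rule imageE)
      obtain A where A: "y = (\<Sum>j\<in>A. hcF (r 0) (e 0) j y)" using PF_sum_hcF[OF y(2)] by blast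
      have "x = (\<Sum>j\<in>A. lin (r 0) 1 (\<lambda>b i. cxg F b) (hcF (r 0) (e 0) j y)) 0"
        unfolding y(1) by (subst A) (simp only: lin_sum)
      moreover have "lin (r 0) 1 (\<lambda>b i. cxg F b) (hcF (r 0) (e 0) j y) 0 \<in> M" for j
      proof -
        have "lin (r 0) 1 (\<lambda>b i. cxg F b) (hcF (r 0) (e 0) j y) 0 \<in> M \<inter> hp d j"
          unfolding L by (rule imageI) (rule hcF_Fm[OF y(2)])
        then show ?thesis by simp
      qed
      then have "(\<Sum>j\<in>A. lin (r 0) 1 (\<lambda>b i. cxg F b) (hcF (r 0) (e 0) j y) 0) \<in> M" by (intro hid_sum[OF M])
      ultimately show "x \<in> M" by (simp only: sum_fun_apply)
    qed
  qed
  then show ?thesis by (rule exI)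
qed

definition hD :: "nat \<Rightarrow> (int \<Rightarrow> (nat, 'k::field) mpol set) \<Rightarrow> int set" where
  "hD d M = {j - int p | p j. \<not> hz {..<d} Xp p M j}"

theorem reg_eq:
  assumes "hid d J"
  shows "reg d J = (if hD d (\<lambda>j. J \<inter> hp d j) = {} then 0 else Max (hD d (\<lambda>j. J \<inter> hp d j)))"
proof -
  let ?F = "SOME F. graded_free_resolution d F J"
  have "graded_free_resolution d ?F J" using gfr_exists[OF assms] by (rule someI_ex)
  from tor_iff[OF this] have "tor_nonzero d J p j \<longleftrightarrow> \<not> hz {..<d} Xp p (\<lambda>j. J \<inter> hp d j) j" for p j
    by (simp add: tor_nonzero_def Let_def)
  then have "{j - int i | i j. tor_nonzero d J i j} = hD d (\<lambda>j. J \<inter> hp d j)" by (simp add: hD_def)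
  then show ?thesis by (simp add: reg_def Let_def)
qed

section \<open>Linear algebra over regular functions\<close>

context vector_space
begin

lemma span_image_iff:
  assumes "finite W"
  shows "x \<in> span (b ` W) \<longleftrightarrow> (\<exists>c. x = (\<Sum>w\<in>W. c w *s b w))"
  using assms
proof (induction W arbitrary: x rule: finite_induct)
  case (insert a W)
  have "x \<in> span (b ` insert a W) \<longleftrightarrow> (\<exists>k. x - k *s b a \<in> span (b ` W))"
    using span_insert[of "b a" "b ` W"] by simp
  also have "\<dots> \<longleftrightarrow> (\<exists>k c. x - k *s b a = (\<Sum>w\<in>W. c w *s b w))" by (simp only: insert.IH)
  also have "\<dots> \<longleftrightarrow> (\<exists>c. x = (\<Sum>w\<in>insert a W. c w *s b w))"
  proof
    assume "\<exists>k c. x - k *s b a = (\<Sum>w\<in>W. c w *s b w)"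
    then obtain k c where kc: "x - k *s b a = (\<Sum>w\<in>W. c w *s b w)" by blast
    have "(\<Sum>w\<in>W. (c(a := k)) w *s b w) = (\<Sum>w\<in>W. c w *s b w)" using insert.hyps(2) by (intro sum.cong) auto
    then have "x = (\<Sum>w\<in>insert a W. (c(a := k)) w *s b w)" using kc insert.hyps by (simp add: algebra_simps)
    then show "\<exists>c. x = (\<Sum>w\<in>insert a W. c w *s b w)" by (rule exI[of _ "c(a := k)"])
  next
    assume "\<exists>c. x = (\<Sum>w\<in>insert a W. c w *s b w)"
    then obtain c where c: "x = (\<Sum>w\<in>insert a W. c w *s b w)" by blast
    show "\<exists>k c. x - k *s b a = (\<Sum>w\<in>W. c w *s b w)"
      by (rule exI[of _ "c a"], rule exI[of _ c]) (simp add: c insert.hyps)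
  qed
  finally show ?case .
qed simp

text \<open>If every lead index of \<open>Z\<close> is a lead index of \<open>B\<close>, the top term of an element of \<open>Z\<close> can be
  cancelled by an element of \<open>B\<close>.\<close>

lemma lead_subset:
  fixes y :: "'w::linorder \<Rightarrow> 'b"
  assumes W: "finite W" and Z: "subspace Z" and B: "subspace B" and BZ: "B \<subseteq> Z"
    and lead: "\<And>w. w \<in> W \<Longrightarrow> \<exists>c. y w + (\<Sum>v\<in>{v\<in>W. v < w}. c v *s y v) \<in> Z \<Longrightarrow>
      \<exists>c. y w + (\<Sum>v\<in>{v\<in>W. v < w}. c v *s y v) \<in> B"
    and z: "(\<Sum>w\<in>W. c w *s y w) \<in> Z"
  shows "(\<Sum>w\<in>W. c w *s y w) \<in> B"
proof -
  have "(\<Sum>w\<in>A. c w *s y w) \<in> B"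
    if "finite A" "A \<subseteq> W" "\<And>v w. w \<in> A \<Longrightarrow> v \<in> W \<Longrightarrow> v < w \<Longrightarrow> v \<in> A" "(\<Sum>w\<in>A. c w *s y w) \<in> Z" for A c
    using that
  proof (induction A arbitrary: c rule: finite_linorder_max_induct)
    case empty
    then show ?case using subspace_0[OF B] by simp
  next
    case (insert b A)
    have bA: "b \<notin> A" using insert.hyps(2) by auto
    have down: "v \<in> A" if "w \<in> A" "v \<in> W" "v < w" for v w
      using insert.prems(2)[of w v] that insert.hyps(2) by force
    have AW: "A \<subseteq> W" and bW: "b \<in> W" using insert.prems(1) by auto
    have IH: "(\<Sum>w\<in>A. c w *s y w) \<in> B" if "(\<Sum>w\<in>A. c w *s y w) \<in> Z" for c
    proof (rule insert.IH)
      show "v \<in> A" if "w \<in> A" "v \<in> W" "v < w" for v w using down[OF that] .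
    qed (fact AW that)+
    have Aeq: "{v\<in>W. v < b} = A" using insert.prems(2)[of b] insert.hyps(2) AW by force
    have split: "(\<Sum>w\<in>insert b A. c w *s y w) = c b *s y b + (\<Sum>w\<in>A. c w *s y w)" for c
      using bA insert.hyps(1) by simp
    show ?case
    proof (cases "c b = 0")
      case True
      then have e: "(\<Sum>w\<in>insert b A. c w *s y w) = (\<Sum>w\<in>A. c w *s y w)" by (simp add: split)
      show ?thesis unfolding e by (rule IH) (use insert.prems(3) e in simp)
    next
      case False
      have "inverse (c b) *s (\<Sum>w\<in>insert b A. c w *s y w) \<in> Z" by (rule subspace_scale[OF Z insert.prems(3)])
      then have "y b + (\<Sum>v\<in>A. (inverse (c b) * c v) *s y v) \<in> Z"
        using False by (simp add: split scale_right_distrib scale_sum_right)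
      then have "\<exists>c. y b + (\<Sum>v\<in>{v\<in>W. v < b}. c v *s y v) \<in> Z" unfolding Aeq
        by (rule exI[of "\<lambda>c'. y b + (\<Sum>v\<in>A. c' v *s y v) \<in> Z" "\<lambda>v. inverse (c b) * c v"])
      then obtain c' where c': "y b + (\<Sum>v\<in>A. c' v *s y v) \<in> B" using lead[OF bW] unfolding Aeq by blast
      let ?\<beta> = "c b *s (y b + (\<Sum>v\<in>A. c' v *s y v))"
      have \<beta>B: "?\<beta> \<in> B" by (rule subspace_scale[OF B c'])
      have e: "(\<Sum>w\<in>insert b A. c w *s y w) - ?\<beta> = (\<Sum>v\<in>A. (c v - c b * c' v) *s y v)"
        by (simp add: split scale_right_distrib scale_sum_right scale_left_diff_distrib sum_subtractf)
      have "(\<Sum>v\<in>A. (c v - c b * c' v) *s y v) \<in> Z"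
        unfolding e[symmetric] by (rule subspace_diff[OF Z insert.prems(3)]) (use \<beta>B BZ in blast)
      then have "(\<Sum>v\<in>A. (c v - c b * c' v) *s y v) \<in> B" by (rule IH)
      then have "(\<Sum>w\<in>insert b A. c w *s y w) - ?\<beta> + ?\<beta> \<in> B" unfolding e by (rule subspace_add[OF B _ \<beta>B])
      then show ?thesis by simp
    qed
  qed
  from this[OF W] show ?thesis using z by blast
qed

end

section \<open>Polynomials and chains as vector spaces\<close>

abbreviation sp :: "'k \<Rightarrow> ('v, 'k::field) mpol \<Rightarrow> ('v, 'k) mpol" where "sp c p \<equiv> mp_const c * p"

interpretation pv: vector_space "sp :: 'k \<Rightarrow> ('v, 'k::field) mpol \<Rightarrow> ('v, 'k) mpol"
  by unfold_locales (simp_all add: distrib_left distrib_right single_add mult.assoc[symmetric] mult_single)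

definition cs :: "'k \<Rightarrow> (nat set \<Rightarrow> (nat, 'k::field) mpol) \<Rightarrow> nat set \<Rightarrow> (nat, 'k) mpol" where
  "cs c v = (\<lambda>\<sigma>. mp_const c * v \<sigma>)"

interpretation cv: vector_space "cs :: 'k \<Rightarrow> (nat set \<Rightarrow> (nat, 'k::field) mpol) \<Rightarrow> nat set \<Rightarrow> (nat, 'k) mpol"
  by unfold_locales (simp_all add: cs_def fun_eq_iff distrib_left distrib_right single_add mult.assoc[symmetric] mult_single)

definition esing :: "nat set \<Rightarrow> 'm \<Rightarrow> nat set \<Rightarrow> 'm::zero" where
  "esing \<sigma> p \<tau> = (if \<tau> = \<sigma> then p else 0)"

text \<open>Unlike \<open>Kc\<close> this allows several homological degrees at once, as needed for
  the space of all chains with coefficients in \<open>L\<close>.\<close>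

definition CS :: "nat set set \<Rightarrow> (int \<Rightarrow> (nat, 'k::field) mpol set) \<Rightarrow> int \<Rightarrow> (nat set \<Rightarrow> (nat, 'k) mpol) set" where
  "CS T M j = {v. \<forall>\<sigma>. v \<sigma> \<in> M (j - int (card \<sigma>)) \<and> (v \<sigma> \<noteq> 0 \<longrightarrow> \<sigma> \<in> T)}"

lemma Kc_CS: "Kc V p M j = CS {\<sigma>. \<sigma> \<subseteq> V \<and> card \<sigma> = p} M j"
  by (simp add: Kc_def CS_def)

lemma CS_span:
  assumes T: "finite T" and W: "\<And>j. finite (W j)" and M: "\<And>j. M j = pv.span (b ` W j)"
  shows "CS T M j = cv.span ((\<lambda>(\<sigma>, w). esing \<sigma> (b w)) ` (SIGMA \<sigma>:T. W (j - int (card \<sigma>))))"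
proof (intro equalityI subsetI)
  let ?I = "SIGMA \<sigma>:T. W (j - int (card \<sigma>))"
  have fI: "finite ?I" using T W by (rule finite_SigmaI)
  fix v assume v: "v \<in> CS T M j"
  have "\<forall>\<sigma>. \<exists>c. v \<sigma> = (\<Sum>w\<in>W (j - int (card \<sigma>)). sp (c w) (b w))"
  proof
    fix \<sigma>
    have "v \<sigma> \<in> pv.span (b ` W (j - int (card \<sigma>)))" using v by (simp add: CS_def M[symmetric])
    then show "\<exists>c. v \<sigma> = (\<Sum>w\<in>W (j - int (card \<sigma>)). sp (c w) (b w))" by (simp only: pv.span_image_iff[OF W])
  qed
  from choice[OF this] obtain c where c: "\<forall>\<sigma>. v \<sigma> = (\<Sum>w\<in>W (j - int (card \<sigma>)). sp (c \<sigma> w) (b w))" ..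
  have "v = (\<Sum>(\<sigma>, w)\<in>?I. cs (c \<sigma> w) (esing \<sigma> (b w)))"
  proof
    fix \<tau>
    have "(\<Sum>(\<sigma>, w)\<in>?I. cs (c \<sigma> w) (esing \<sigma> (b w))) \<tau> = (\<Sum>(\<sigma>, w)\<in>?I. if \<sigma> = \<tau> then sp (c \<sigma> w) (b w) else 0)"
      by (simp add: sum_fun_apply split_beta cs_def esing_def if_distrib eq_commute cong: if_cong)
    also have "\<dots> = (\<Sum>\<sigma>\<in>T. \<Sum>w\<in>W (j - int (card \<sigma>)). if \<sigma> = \<tau> then sp (c \<sigma> w) (b w) else 0)"
      by (rule sum.Sigma[symmetric]) (use T W in auto)
    also have "\<dots> = (\<Sum>\<sigma>\<in>T. if \<sigma> = \<tau> then v \<tau> else 0)"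
      by (rule sum.cong[OF refl]) (use c in auto)
    also have "\<dots> = (if \<tau> \<in> T then v \<tau> else 0)" using T by (simp add: sum.delta)
    also have "\<dots> = v \<tau>" using v by (auto simp: CS_def)
    finally show "v \<tau> = (\<Sum>(\<sigma>, w)\<in>?I. cs (c \<sigma> w) (esing \<sigma> (b w))) \<tau>" by simp
  qed
  then have "v = (\<Sum>x\<in>?I. cs ((\<lambda>(\<sigma>, w). c \<sigma> w) x) ((\<lambda>(\<sigma>, w). esing \<sigma> (b w)) x))" by (simp add: split_beta)
  then show "v \<in> cv.span ((\<lambda>(\<sigma>, w). esing \<sigma> (b w)) ` ?I)" unfolding cv.span_image_iff[OF fI]
    by (rule exI[of _ "\<lambda>x. case x of (\<sigma>, w) \<Rightarrow> c \<sigma> w"])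
next
  have sub: "cv.subspace (CS T M j)"
  proof (rule cv.subspaceI)
    show "0 \<in> CS T M j" by (simp add: CS_def M pv.span_zero)
    show "x + y \<in> CS T M j" if "x \<in> CS T M j" "y \<in> CS T M j" for x y
    proof -
      have x: "x \<sigma> \<in> pv.span (b ` W (j - int (card \<sigma>)))" "x \<sigma> \<noteq> 0 \<Longrightarrow> \<sigma> \<in> T"
        and y: "y \<sigma> \<in> pv.span (b ` W (j - int (card \<sigma>)))" "y \<sigma> \<noteq> 0 \<Longrightarrow> \<sigma> \<in> T" for \<sigma>
        using that by (simp_all add: CS_def M)
      have "x \<sigma> + y \<sigma> \<noteq> 0 \<Longrightarrow> \<sigma> \<in> T" for \<sigma> using x(2)[of \<sigma>] y(2)[of \<sigma>] by (cases "x \<sigma> = 0") auto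
      then show ?thesis by (simp add: CS_def M pv.span_add[OF x(1) y(1)])
    qed
    show "cs c x \<in> CS T M j" if "x \<in> CS T M j" for x c
    proof -
      have x: "x \<sigma> \<in> pv.span (b ` W (j - int (card \<sigma>)))" "x \<sigma> \<noteq> 0 \<Longrightarrow> \<sigma> \<in> T" for \<sigma>
        using that by (simp_all add: CS_def M)
      have "sp c (x \<sigma>) \<noteq> 0 \<Longrightarrow> \<sigma> \<in> T" for \<sigma> using x(2)[of \<sigma>] by (cases "x \<sigma> = 0") auto
      then show ?thesis by (simp add: CS_def M cs_def pv.span_scale[OF x(1)])
    qed
  qed
  have "(\<lambda>(\<sigma>, w). esing \<sigma> (b w)) ` (SIGMA \<sigma>:T. W (j - int (card \<sigma>))) \<subseteq> CS T M j"
  proof (rule image_subsetI)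
    fix x assume "x \<in> (SIGMA \<sigma>:T. W (j - int (card \<sigma>)))"
    then obtain \<sigma> w where x: "x = (\<sigma>, w)" "\<sigma> \<in> T" "w \<in> W (j - int (card \<sigma>))" by (rule SigmaE) blast
    have "b w \<in> pv.span (b ` W (j - int (card \<sigma>)))" using x(3) by (intro pv.span_base imageI)
    then show "(case x of (\<sigma>, w) \<Rightarrow> esing \<sigma> (b w)) \<in> CS T M j"
      using x(2) by (simp add: x(1) CS_def M esing_def pv.span_zero)
  qed
  from cv.span_minimal[OF this sub]
  show "v \<in> CS T M j" if "v \<in> cv.span ((\<lambda>(\<sigma>, w). esing \<sigma> (b w)) ` (SIGMA \<sigma>:T. W (j - int (card \<sigma>))))" for v
    using that by (rule subsetD)
qed

lemma sgs_sp: "sgs a \<tau> (sp c p) = sp c (sgs a \<tau> p)" by (simp add: sgs_def)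

lemma Xp_sp: "Xp a (sp c p) = sp c (Xp a p)" by (rule mult.left_commute)

lemma bd_cs: "finite V \<Longrightarrow> bd V Xp (cs c v) = cs c (bd V Xp v)"
  by (rule ext) (simp add: cs_def bd_def sum_distrib_left sgs_sp Xp_sp)

lemma bd_plus: "finite V \<Longrightarrow> bd V Xp (u + v) = bd V Xp u + bd V Xp v"
proof
  fix \<tau> assume "finite V"
  have "bd V Xp (\<lambda>\<sigma>. u \<sigma> + v \<sigma>) \<tau> = bd V Xp u \<tau> + bd V Xp v \<tau>"
    by (rule kop.bd_add[OF kop_Xp]) fact
  then show "bd V Xp (u + v) \<tau> = (bd V Xp u + bd V Xp v) \<tau>" by (simp only: plus_fun_def)
qed

lemma bd_null: "finite V \<Longrightarrow> bd V Xp 0 = 0"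
  by (rule ext) (simp add: bd_def)

lemma bd_lincomb: "finite V \<Longrightarrow> bd V Xp (\<Sum>w\<in>W. cs (c w) (y w)) = (\<Sum>w\<in>W. cs (c w) (bd V Xp (y w)))"
  by (induction W rule: infinite_finite_induct) (simp_all add: bd_null bd_plus bd_cs)

text \<open>\<open>RF\<close> plays the role of the regular functions on \<open>S\<close>, and \<open>F\<close> that of the filter generated by the
  nonempty Zariski open sets.\<close>

locale generic =
  fixes F :: "'g filter" and S :: "'g set" and RF :: "('g \<Rightarrow> 'k::field) set"
  assumes F_nb: "F \<noteq> bot" and ev_S: "eventually (\<lambda>g. g \<in> S) F"
    and RF_const: "(\<lambda>_. c) \<in> RF" and RF_add: "a \<in> RF \<Longrightarrow> b \<in> RF \<Longrightarrow> (\<lambda>g. a g + b g) \<in> RF"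
    and RF_mult: "a \<in> RF \<Longrightarrow> b \<in> RF \<Longrightarrow> (\<lambda>g. a g * b g) \<in> RF"
    and RF_dich: "a \<in> RF \<Longrightarrow> (\<forall>g\<in>S. a g = 0) \<or> eventually (\<lambda>g. a g \<noteq> 0) F"
begin

lemma RF_uminus: "a \<in> RF \<Longrightarrow> (\<lambda>g. - a g) \<in> RF"
  using RF_mult[OF RF_const[of "-1"], of a] by simp

lemma RF_diff: "a \<in> RF \<Longrightarrow> b \<in> RF \<Longrightarrow> (\<lambda>g. a g - b g) \<in> RF"
  using RF_add[OF _ RF_uminus, of a b] by simp

lemma RF_sum: "(\<And>i. i \<in> A \<Longrightarrow> f i \<in> RF) \<Longrightarrow> (\<lambda>g. \<Sum>i\<in>A. f i g) \<in> RF"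
  by (induction A rule: infinite_finite_induct) (auto intro: RF_const RF_add)

text \<open>An arbitrary predicate can be neither generically true nor generically false. Being
  decided passes to implications and to finite conjunctions only, which is why infinite families of
  conditions need separate care.\<close>

definition decided :: "('g \<Rightarrow> bool) \<Rightarrow> bool" where
  "decided P \<longleftrightarrow> eventually P F \<or> eventually (\<lambda>g. \<not> P g) F"

lemma decided_not_ev: "decided P \<Longrightarrow> \<not> eventually P F \<Longrightarrow> eventually (\<lambda>g. \<not> P g) F"
  by (simp add: decided_def)

lemma decided_imp: "decided P \<Longrightarrow> decided Q \<Longrightarrow> decided (\<lambda>g. P g \<longrightarrow> Q g)"
proof -
  assume P: "decided P" and Q: "decided Q"
  consider "eventually Q F" | "eventually (\<lambda>g. \<not> P g) F" | "eventually P F" "eventually (\<lambda>g. \<not> Q g) F"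
    using P Q by (auto simp: decided_def)
  then show ?thesis
  proof cases
    case 1 then show ?thesis unfolding decided_def by (intro disjI1) (erule eventually_mono, simp)
  next
    case 2 then show ?thesis unfolding decided_def by (intro disjI1) (erule eventually_mono, simp)
  next
    case 3 then show ?thesis unfolding decided_def by (intro disjI2) (erule eventually_elim2, simp, simp)
  qed
qed

lemma decided_ball: "finite A \<Longrightarrow> (\<And>i. i \<in> A \<Longrightarrow> decided (P i)) \<Longrightarrow> decided (\<lambda>g. \<forall>i\<in>A. P i g)"
proof (cases "\<forall>i\<in>A. eventually (P i) F")
  case True
  assume "finite A"
  then show ?thesis using True by (simp add: decided_def eventually_ball_finite)
next
  case False
  assume d: "\<And>i. i \<in> A \<Longrightarrow> decided (P i)"
  obtain i where i: "i \<in> A" "eventually (\<lambda>g. \<not> P i g) F" using False d decided_not_ev by blast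
  have "eventually (\<lambda>g. \<not> (\<forall>i\<in>A. P i g)) F" using i(2) by (rule eventually_mono) (use i(1) in blast)
  then show ?thesis unfolding decided_def ..
qed

lemma decided_cong:
  assumes "eventually (\<lambda>g. P g \<longleftrightarrow> Q g) F" "decided P"
  shows "decided Q"
  using assms(2) unfolding decided_def
proof
  assume "eventually P F"
  with assms(1) show "eventually Q F \<or> eventually (\<lambda>g. \<not> Q g) F"
    by (intro disjI1) (erule eventually_elim2, assumption, simp)
next
  assume "eventually (\<lambda>g. \<not> P g) F"
  with assms(1) show "eventually Q F \<or> eventually (\<lambda>g. \<not> Q g) F"
    by (intro disjI2) (erule eventually_elim2, assumption, simp)
qed

text \<open>Solvability after clearing a denominator \<open>q\<close>. The identity holds at every
  point of \<open>S\<close>, even at zeros of \<open>q\<close>, so that solutions can be combined as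
  regular families before a point is chosen.\<close>

definition reg_solvable :: "'i set \<Rightarrow> ('g \<Rightarrow> 'e \<Rightarrow> 'k) \<Rightarrow> ('i \<Rightarrow> 'g \<Rightarrow> 'e \<Rightarrow> 'k) \<Rightarrow> bool" where
  "reg_solvable W w0 u \<longleftrightarrow> (\<exists>q c. q \<in> RF \<and> (\<forall>i\<in>W. c i \<in> RF) \<and> eventually (\<lambda>g. q g \<noteq> 0) F \<and>
      (\<forall>g\<in>S. \<forall>e. q g * w0 g e = (\<Sum>i\<in>W. c i g * u i g e)))"

definition ev_unsolvable :: "'i set \<Rightarrow> ('g \<Rightarrow> 'e \<Rightarrow> 'k) \<Rightarrow> ('i \<Rightarrow> 'g \<Rightarrow> 'e \<Rightarrow> 'k) \<Rightarrow> bool" where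
  "ev_unsolvable W w0 u \<longleftrightarrow> eventually (\<lambda>g. \<not> (\<exists>c. \<forall>e. w0 g e = (\<Sum>i\<in>W. c i * u i g e))) F"

text \<open>Fraction-free Gaussian elimination by induction on the unknowns; the equations, indexed
  by \<open>e\<close>, may be infinite in number. A column that vanishes on \<open>S\<close> is
  dropped; otherwise one of its entries is generically nonzero and serves as pivot.\<close>

lemma solvable_decided:
  assumes W: "finite W" and w0: "\<And>e. (\<lambda>g. w0 g e) \<in> RF" and u: "\<And>i e. i \<in> W \<Longrightarrow> (\<lambda>g. u i g e) \<in> RF"
  shows "reg_solvable W w0 u \<or> ev_unsolvable W w0 u"
  using W w0 u
proof (induction W arbitrary: w0 u rule: finite_induct)
  case empty
  show ?case
  proof (cases "\<forall>e. \<forall>g\<in>S. w0 g e = 0")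
    case True
    then show ?thesis unfolding reg_solvable_def by (intro disjI1 exI[of _ "\<lambda>_. 1"]) (auto intro: RF_const)
  next
    case False
    then obtain e where "\<not> (\<forall>g\<in>S. w0 g e = 0)" by blast
    then have "eventually (\<lambda>g. w0 g e \<noteq> 0) F" using RF_dich[OF empty(1)] by blast
    then show ?thesis unfolding ev_unsolvable_def by (intro disjI2) (erule eventually_mono, auto)
  qed
next
  case (insert x W)
  have uW: "\<And>i e. i \<in> W \<Longrightarrow> (\<lambda>g. u i g e) \<in> RF" and ux: "\<And>e. (\<lambda>g. u x g e) \<in> RF" using insert.prems(2) by auto
  note w0 = insert.prems(1)
  show ?case
  proof (cases "\<forall>e. \<forall>g\<in>S. u x g e = 0")
    case True
    have "reg_solvable W w0 u \<or> ev_unsolvable W w0 u" by (rule insert.IH) (rule w0 uW, assumption?)+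
    then show ?thesis unfolding reg_solvable_def ev_unsolvable_def
    proof (elim disjE exE conjE, goal_cases)
      case (1 q c)
      let ?c = "c(x := \<lambda>_. 0)"
      have "(\<Sum>i\<in>insert x W. ?c i g * u i g e) = (\<Sum>i\<in>W. c i g * u i g e)" for g e
        using insert.hyps by (auto intro!: sum.cong)
      then show ?case using 1 by (intro disjI1 exI[of _ q] exI[of _ ?c]) (auto intro: RF_const)
    next
      case 2
      have "eventually (\<lambda>g. g \<in> S \<and> \<not> (\<exists>c. \<forall>e. w0 g e = (\<Sum>i\<in>W. c i * u i g e))) F"
        using ev_S 2 by (rule eventually_conj)
      then show ?case
      proof (intro disjI2, elim eventually_mono, safe, goal_cases)
        case (1 g c)
        have "\<forall>e. w0 g e = (\<Sum>i\<in>W. c i * u i g e)" using 1 True insert.hyps by simp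
        then show ?case using 1 by blast
      qed
    qed
  next
    case False
    then obtain e0 where "\<not> (\<forall>g\<in>S. u x g e0 = 0)" by blast
    then have ev0: "eventually (\<lambda>g. u x g e0 \<noteq> 0) F" using RF_dich[OF ux] by blast
    \<comment> \<open>Cross multiplication with the pivot row \<open>e0\<close> removes the unknown
      \<open>x\<close>.\<close>
    define w' where "w' g e = u x g e0 * w0 g e - w0 g e0 * u x g e" for g e
    define u' where "u' i g e = u x g e0 * u i g e - u i g e0 * u x g e" for i g e
    have w'R: "(\<lambda>g. w' g e) \<in> RF" for e unfolding w'_def by (intro RF_diff RF_mult ux w0)
    have u'R: "(\<lambda>g. u' i g e) \<in> RF" if "i \<in> W" for i e unfolding u'_def by (intro RF_diff RF_mult ux uW that)
    have "reg_solvable W w' u' \<or> ev_unsolvable W w' u'" by (rule insert.IH) (rule w'R u'R, assumption?)+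
    then show ?thesis unfolding reg_solvable_def ev_unsolvable_def
    proof (elim disjE exE conjE, goal_cases)
      case (1 q c)
      \<comment> \<open>Back substitution: the denominator acquires the pivot as a factor, and the
        coefficient of \<open>x\<close> is read off from the row \<open>e0\<close>.\<close>
      define Q where "Q g = q g * u x g e0" for g
      define C where "C i g = (if i = x then q g * w0 g e0 - (\<Sum>l\<in>W. c l g * u l g e0) else c i g * u x g e0)" for i g
      have "Q \<in> RF" unfolding Q_def[abs_def] by (intro RF_mult 1 ux)
      moreover have "C i \<in> RF" if "i \<in> insert x W" for i
        using that 1 unfolding C_def[abs_def] by (cases "i = x") (auto intro!: RF_diff RF_mult RF_sum ux w0 uW)
      moreover have "eventually (\<lambda>g. Q g \<noteq> 0) F"
        using eventually_conj[OF 1(3) ev0] by (rule eventually_mono) (simp add: Q_def)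
      moreover have "Q g * w0 g e = (\<Sum>i\<in>insert x W. C i g * u i g e)" if "g \<in> S" for g e
      proof -
        have "(\<Sum>i\<in>insert x W. C i g * u i g e) = C x g * u x g e + (\<Sum>i\<in>W. c i g * u x g e0 * u i g e)"
          using insert.hyps by (auto simp: C_def intro!: sum.cong)
        also have "\<dots> = q g * w0 g e0 * u x g e + (\<Sum>i\<in>W. c i g * u' i g e)"
          by (simp add: C_def u'_def algebra_simps sum_subtractf sum_distrib_left sum_distrib_right)
        also have "(\<Sum>i\<in>W. c i g * u' i g e) = q g * w' g e" using 1 that by simp
        finally show ?thesis by (simp add: Q_def w'_def algebra_simps)
      qed
      ultimately show ?case by (intro disjI1 exI[of _ Q] exI[of _ C]) blast
    next
      case 2
      then show ?case
      proof (intro disjI2, elim eventually_mono, safe, goal_cases)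
        case (1 g c)
        have h: "\<forall>e. w0 g e = (\<Sum>i\<in>insert x W. c i * u i g e)" using 1 by blast
        have "w' g e = (\<Sum>i\<in>W. c i * u' i g e)" for e
        proof -
          have "w' g e = (\<Sum>i\<in>insert x W. c i * u' i g e)"
            using h by (simp only: w'_def u'_def right_diff_distrib sum_subtractf sum_distrib_left sum_distrib_right ac_simps)
          also have "\<dots> = (\<Sum>i\<in>W. c i * u' i g e)" using insert.hyps by (simp add: u'_def)
          finally show ?thesis .
        qed
        then have "\<exists>c. \<forall>e. w' g e = (\<Sum>i\<in>W. c i * u' i g e)" by blast
        then show ?case using 1 by blast
      qed
    qed
  qed
qed

lemma solvable_dec:
  assumes W: "finite W" and w0: "\<And>e. (\<lambda>g. w0 g e) \<in> RF" and u: "\<And>i e. i \<in> W \<Longrightarrow> (\<lambda>g. u i g e) \<in> RF"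
  shows "decided (\<lambda>g. \<exists>c. \<forall>e. w0 g e = (\<Sum>i\<in>W. c i * u i g e))"
proof -
  have "reg_solvable W w0 u \<or> ev_unsolvable W w0 u" by (rule solvable_decided) (rule W w0 u, assumption?)+
  then show ?thesis unfolding reg_solvable_def ev_unsolvable_def
proof (elim disjE exE conjE, goal_cases)
  case (1 q c)
  have "eventually (\<lambda>g. g \<in> S \<and> q g \<noteq> 0) F" using ev_S 1(3) by (rule eventually_conj)
  then show ?case unfolding decided_def
  proof (intro disjI1, elim eventually_mono, goal_cases)
    case (1 g)
    have "w0 g e = (\<Sum>i\<in>W. (c i g / q g) * u i g e)" for e
    proof -
      have "q g * w0 g e = (\<Sum>i\<in>W. c i g * u i g e)" using 1 \<open>\<forall>g\<in>S. \<forall>e. q g * w0 g e = (\<Sum>i\<in>W. c i g * u i g e)\<close> by blast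
      then have "w0 g e = (\<Sum>i\<in>W. c i g * u i g e) / q g" using 1 by (simp add: field_simps)
      then show ?thesis by (simp add: sum_divide_distrib)
    qed
    then show ?case by (intro exI[of _ "\<lambda>i. c i g / q g"]) simp
  qed
next
  case 2
  then show ?case by (simp add: decided_def)
qed
qed

section \<open>Regular families of polynomials and chains\<close>

definition regp :: "('g \<Rightarrow> (nat, 'k) mpol) \<Rightarrow> bool" where
  "regp f \<longleftrightarrow> (\<forall>m. (\<lambda>g. lk (f g) m) \<in> RF)"

definition regc :: "('g \<Rightarrow> nat set \<Rightarrow> (nat, 'k) mpol) \<Rightarrow> bool" where
  "regc v \<longleftrightarrow> (\<forall>\<sigma>. regp (\<lambda>g. v g \<sigma>))"

lemma regp_const: "regp (\<lambda>_. p)" by (simp add: regp_def RF_const)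
lemma regp_diff: "regp f \<Longrightarrow> regp h \<Longrightarrow> regp (\<lambda>g. f g - h g)" by (simp add: regp_def lookup_minus RF_diff)
lemma regp_sum: "(\<And>i. i \<in> A \<Longrightarrow> regp (f i)) \<Longrightarrow> regp (\<lambda>g. \<Sum>i\<in>A. f i g)" by (simp add: regp_def lookup_sum RF_sum)
lemma regp_scale: "a \<in> RF \<Longrightarrow> regp f \<Longrightarrow> regp (\<lambda>g. mp_const (a g) * f g)" by (simp add: regp_def lookup_const_mult RF_mult)
lemma regp_uminus: "regp f \<Longrightarrow> regp (\<lambda>g. - f g)" by (simp add: regp_def RF_uminus)
lemma regp_sgs: "regp f \<Longrightarrow> regp (\<lambda>g. sgs a \<tau> (f g))"
  by (cases "even (card {b\<in>\<tau>. b < a})") (simp_all add: sgs_def regp_uminus)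

lemma regp_mono: "regp f \<Longrightarrow> regp (\<lambda>g. mp_mono \<mu> * f g)"
  unfolding regp_def
proof
  fix m assume f: "\<forall>m. (\<lambda>g. lk (f g) m) \<in> RF"
  show "(\<lambda>g. lk (mp_mono \<mu> * f g) m) \<in> RF"
  proof (cases "\<exists>m'. m = \<mu> + m'")
    case True
    then obtain m' where "m = \<mu> + m'" by blast
    then show ?thesis using f by (simp add: lookup_single_mult)
  next
    case False
    then have "lk (mp_mono \<mu> * f g) m = 0" for g by (intro lookup_single_mult_0) blast
    then show ?thesis by (simp add: RF_const)
  qed
qed

lemma regc_bd: "regc v \<Longrightarrow> regc (\<lambda>g. bd V Xp (v g))"
  unfolding regc_def
proof
  fix \<tau> assume v: "\<forall>\<sigma>. regp (\<lambda>g. v g \<sigma>)"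
  show "regp (\<lambda>g. bd V Xp (v g) \<tau>)"
    by (cases "\<tau> \<subseteq> V") (auto simp: bd_def intro!: regp_sum regp_sgs regp_mono regp_const v[rule_format])
qed

lemma regc_esing: "regp f \<Longrightarrow> regc (\<lambda>g. esing \<sigma> (f g))"
  unfolding regc_def
proof
  fix \<tau> assume "regp f"
  then show "regp (\<lambda>g. esing \<sigma> (f g) \<tau>)" by (cases "\<tau> = \<sigma>") (simp_all add: esing_def regp_const)
qed

text \<open>The coefficients along \<open>W\<close> and along \<open>Y\<close> are the unknowns of
  one linear system, with an equation for each Koszul basis element and monomial.\<close>

lemma coset_meets_span_decided:
  assumes W: "finite W" and Y: "finite Y" and x0: "regc x0" and x: "\<And>w. w \<in> W \<Longrightarrow> regc (x w)" and y: "\<And>i. i \<in> Y \<Longrightarrow> regc (y i)"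
  shows "decided (\<lambda>g. \<exists>c. x0 g + (\<Sum>w\<in>W. cs (c w) (x w g)) \<in> cv.span ((\<lambda>i. y i g) ` Y))"
proof -
  define u where "u i g e = (case i of Inl w \<Rightarrow> - lk (x w g (fst e)) (snd e) | Inr l \<Rightarrow> lk (y l g (fst e)) (snd e))" for i g e
  have dec: "decided (\<lambda>g. \<exists>c. \<forall>e. lk (x0 g (fst e)) (snd e) = (\<Sum>i\<in>W <+> Y. c i * u i g e))"
  proof (rule solvable_dec)
    show "finite (W <+> Y)" using W Y by simp
    show "(\<lambda>g. lk (x0 g (fst e)) (snd e)) \<in> RF" for e using x0 by (simp add: regc_def regp_def)
    show "(\<lambda>g. u i g e) \<in> RF" if "i \<in> W <+> Y" for i e
    proof (cases i)
      case (Inl w)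
      then have "(\<lambda>g. lk (x w g (fst e)) (snd e)) \<in> RF" using that x by (auto simp: regc_def regp_def)
      then show ?thesis by (simp add: u_def Inl RF_uminus)
    next
      case (Inr l)
      then show ?thesis using that y by (auto simp: u_def regc_def regp_def)
    qed
  qed
  have "(\<exists>c. \<forall>e. lk (x0 g (fst e)) (snd e) = (\<Sum>i\<in>W <+> Y. c i * u i g e)) \<longleftrightarrow>
      (\<exists>c. x0 g + (\<Sum>w\<in>W. cs (c w) (x w g)) \<in> cv.span ((\<lambda>i. y i g) ` Y))" for g
  proof -
    have sum: "(\<Sum>i\<in>W <+> Y. c i * u i g e) =
        - (\<Sum>w\<in>W. c (Inl w) * lk (x w g (fst e)) (snd e)) + (\<Sum>i\<in>Y. c (Inr i) * lk (y i g (fst e)) (snd e))" for c e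
      using W Y by (simp add: sum.Plus u_def sum_negf)
    have eq: "x0 g + (\<Sum>w\<in>W. cs (c w) (x w g)) = (\<Sum>i\<in>Y. cs (c' i) (y i g)) \<longleftrightarrow>
        (\<forall>e. lk (x0 g (fst e)) (snd e) = - (\<Sum>w\<in>W. c w * lk (x w g (fst e)) (snd e)) + (\<Sum>i\<in>Y. c' i * lk (y i g (fst e)) (snd e)))" for c c'
      by (simp add: fun_eq_iff poly_mapping_eq_iff lookup_add sum_fun_apply lookup_sum cs_def lookup_const_mult eq_neg_iff_add_eq_0 algebra_simps add_eq_0_iff)
    show ?thesis
    proof
      assume "\<exists>c. \<forall>e. lk (x0 g (fst e)) (snd e) = (\<Sum>i\<in>W <+> Y. c i * u i g e)"
      then obtain c where c: "\<forall>e. lk (x0 g (fst e)) (snd e) = (\<Sum>i\<in>W <+> Y. c i * u i g e)" by blast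
      have "x0 g + (\<Sum>w\<in>W. cs (c (Inl w)) (x w g)) = (\<Sum>i\<in>Y. cs (c (Inr i)) (y i g))"
        unfolding eq using c unfolding sum .
      then have "x0 g + (\<Sum>w\<in>W. cs (c (Inl w)) (x w g)) \<in> cv.span ((\<lambda>i. y i g) ` Y)"
        unfolding cv.span_image_iff[OF Y] by (rule exI[of _ "\<lambda>i. c (Inr i)"])
      then show "\<exists>c. x0 g + (\<Sum>w\<in>W. cs (c w) (x w g)) \<in> cv.span ((\<lambda>i. y i g) ` Y)" by (rule exI[of _ "\<lambda>w. c (Inl w)"])
    next
      assume "\<exists>c. x0 g + (\<Sum>w\<in>W. cs (c w) (x w g)) \<in> cv.span ((\<lambda>i. y i g) ` Y)"
      then obtain c c' where "x0 g + (\<Sum>w\<in>W. cs (c w) (x w g)) = (\<Sum>i\<in>Y. cs (c' i) (y i g))"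
        unfolding cv.span_image_iff[OF Y] by blast
      then have "\<forall>e. lk (x0 g (fst e)) (snd e) = (\<Sum>i\<in>W <+> Y. case_sum c c' i * u i g e)"
        unfolding eq sum by simp
      then show "\<exists>c. \<forall>e. lk (x0 g (fst e)) (snd e) = (\<Sum>i\<in>W <+> Y. c i * u i g e)" by (rule exI[of _ "case_sum c c'"])
    qed
  qed
  then show ?thesis using dec by simp
qed

end

section \<open>Lead terms of Koszul cycles\<close>

text \<open>Preimages of the cycles of the complex of \<open>M / L\<close>; \<open>Bs\<close> plays
  the same role for the boundaries. Membership in the chains of \<open>M\<close> is imposed
  separately where it matters.\<close>

definition Zs :: "nat set \<Rightarrow> (int \<Rightarrow> (nat, 'k::field) mpol set) \<Rightarrow> int \<Rightarrow> (nat set \<Rightarrow> (nat, 'k) mpol) set" where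
  "Zs V L j = {x. bd V Xp x \<in> CS (Pow V) L j}"

definition Bs :: "nat set \<Rightarrow> nat \<Rightarrow> (int \<Rightarrow> (nat, 'k::field) mpol set) \<Rightarrow> (int \<Rightarrow> (nat, 'k) mpol set) \<Rightarrow> int \<Rightarrow> (nat set \<Rightarrow> (nat, 'k) mpol) set" where
  "Bs V p M L j = {x. \<exists>u\<in>Kc V (Suc p) M j. x - bd V Xp u \<in> CS (Pow V) L j}"

lemma subspace_CS:
  assumes L: "\<And>j. pv.subspace (L j)"
  shows "cv.subspace (CS T L j)"
proof (rule cv.subspaceI)
  show "0 \<in> CS T L j" by (simp add: CS_def pv.subspace_0[OF L])
  fix x assume x: "x \<in> CS T L j"
  then have x1: "x \<sigma> \<in> L (j - int (card \<sigma>))" and x2: "x \<sigma> \<noteq> 0 \<Longrightarrow> \<sigma> \<in> T" for \<sigma> by (simp_all add: CS_def)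
  show "x + y \<in> CS T L j" if "y \<in> CS T L j" for y
  proof -
    have y1: "y \<sigma> \<in> L (j - int (card \<sigma>))" and y2: "y \<sigma> \<noteq> 0 \<Longrightarrow> \<sigma> \<in> T" for \<sigma> using that by (simp_all add: CS_def)
    have "x \<sigma> + y \<sigma> \<noteq> 0 \<Longrightarrow> \<sigma> \<in> T" for \<sigma> using x2[of \<sigma>] y2[of \<sigma>] by (cases "x \<sigma> = 0") auto
    then show ?thesis by (simp add: CS_def pv.subspace_add[OF L x1 y1])
  qed
  show "cs c x \<in> CS T L j" for c
  proof -
    have "sp c (x \<sigma>) \<noteq> 0 \<Longrightarrow> \<sigma> \<in> T" for \<sigma> using x2[of \<sigma>] by (cases "x \<sigma> = 0") auto
    then show ?thesis by (simp add: CS_def cs_def pv.subspace_scale[OF L x1])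
  qed
qed

lemma bd_minus: "finite V \<Longrightarrow> bd V Xp (u - v) = bd V Xp u - bd V Xp v"
  using bd_plus[of V "u - v" v] by simp

lemma bd_bd_null: "finite V \<Longrightarrow> bd V Xp (bd V Xp u) = 0"
  using kop.bd_bd[OF kop_Xp, of V u] by (simp add: fun_eq_iff)

lemma CS_bd:
  assumes V: "finite V" and g: "gmod V Xp L" and x: "x \<in> CS (Pow V) L j"
  shows "bd V Xp x \<in> CS (Pow V) L j"
proof -
  have m: "bd V Xp x \<sigma> \<in> L (j - int (card \<sigma>))" for \<sigma>
  proof (cases "\<sigma> \<subseteq> V")
    case True
    have f: "finite \<sigma>" using True V by (rule finite_subset)
    have "sgs a \<sigma> (Xp a (x (insert a \<sigma>))) \<in> L (j - int (card \<sigma>))" if a: "a \<in> V - \<sigma>" for a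
    proof -
      have "x (insert a \<sigma>) \<in> L (j - int (card (insert a \<sigma>)))" using x by (simp add: CS_def)
      then have "Xp a (x (insert a \<sigma>)) \<in> L (j - int (card (insert a \<sigma>)) + 1)" using a by (intro gmod_X[OF g]) auto
      moreover have "j - int (card (insert a \<sigma>)) + 1 = j - int (card \<sigma>)" using a f by simp
      ultimately show ?thesis by (intro gmod_sgs[OF g]) (simp only:)
    qed
    then show ?thesis unfolding bd_def if_P[OF True] by (rule gmod_sum[OF g])
  qed (simp add: bd_def gmod_zero[OF g])
  then show ?thesis by (auto simp: CS_def bd_def)
qed

lemma subspace_Zs:
  assumes V: "finite V" and L: "\<And>j. pv.subspace (L j)"
  shows "cv.subspace (Zs V L j)"
proof (rule cv.subspaceI)
  note sL = subspace_CS[where L=L, OF L, of "Pow V" j]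
  show "0 \<in> Zs V L j" by (simp add: Zs_def bd_null[OF V] cv.subspace_0[OF sL])
  show "x + y \<in> Zs V L j" if "x \<in> Zs V L j" "y \<in> Zs V L j" for x y
    using that by (simp add: Zs_def bd_plus[OF V] cv.subspace_add[OF sL])
  show "cs c x \<in> Zs V L j" if "x \<in> Zs V L j" for x c
    using that by (simp add: Zs_def bd_cs[OF V] cv.subspace_scale[OF sL])
qed

lemma subspace_Bs:
  assumes V: "finite V" and L: "\<And>j. pv.subspace (L j)" and M: "\<And>j. pv.subspace (M j)"
  shows "cv.subspace (Bs V p M L j)"
proof (rule cv.subspaceI)
  note sL = subspace_CS[where L=L, OF L, of "Pow V" j]
  note sM = subspace_CS[where L=M, OF M, of "{\<sigma>. \<sigma> \<subseteq> V \<and> card \<sigma> = Suc p}" j, folded Kc_CS]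
  show "0 \<in> Bs V p M L j" unfolding Bs_def mem_Collect_eq
    by (rule bexI[of _ 0]) (simp_all add: bd_null[OF V] cv.subspace_0[OF sL] cv.subspace_0[OF sM])
  show "x + y \<in> Bs V p M L j" if xy: "x \<in> Bs V p M L j" "y \<in> Bs V p M L j" for x y
  proof -
    obtain u w where u: "u \<in> Kc V (Suc p) M j" "x - bd V Xp u \<in> CS (Pow V) L j"
      and w: "w \<in> Kc V (Suc p) M j" "y - bd V Xp w \<in> CS (Pow V) L j" using xy by (auto simp: Bs_def)
    have "x + y - bd V Xp (u + w) = (x - bd V Xp u) + (y - bd V Xp w)" by (simp add: bd_plus[OF V])
    then have "x + y - bd V Xp (u + w) \<in> CS (Pow V) L j" using cv.subspace_add[OF sL u(2) w(2)] by (simp only:)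
    then show ?thesis unfolding Bs_def mem_Collect_eq using cv.subspace_add[OF sM u(1) w(1)] by (rule bexI)
  qed
  show "cs c x \<in> Bs V p M L j" if x: "x \<in> Bs V p M L j" for x c
  proof -
    obtain u where u: "u \<in> Kc V (Suc p) M j" "x - bd V Xp u \<in> CS (Pow V) L j" using x by (auto simp: Bs_def)
    have "cs c x - bd V Xp (cs c u) = cs c (x - bd V Xp u)" by (simp add: bd_cs[OF V] cv.scale_right_diff_distrib)
    then have "cs c x - bd V Xp (cs c u) \<in> CS (Pow V) L j" using cv.subspace_scale[OF sL u(2)] by (simp only:)
    then show ?thesis unfolding Bs_def mem_Collect_eq using cv.subspace_scale[OF sM u(1)] by (rule bexI)
  qed
qed

lemma Bs_sub_Zs:
  assumes V: "finite V" and g: "gmod V Xp L"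
  shows "Bs V p M L j \<subseteq> Zs V L j"
proof
  fix x assume "x \<in> Bs V p M L j"
  then obtain u where u: "x - bd V Xp u \<in> CS (Pow V) L j" by (auto simp: Bs_def)
  have "bd V Xp (x - bd V Xp u) = bd V Xp x" by (simp add: bd_minus[OF V] bd_bd_null[OF V])
  then show "x \<in> Zs V L j" using CS_bd[OF V g u] by (simp add: Zs_def)
qed

text \<open>Vanishing of homology quantifies over all cycles and is thus no single linear system. By
  \<open>lead_subset\<close> it suffices that each lead index of a cycle is one of a boundary, and
  for fixed \<open>w\<close> both conditions ask whether a coset meets a subspace.\<close>

lemma hzr_iff_leads:
  fixes y :: "'w::linorder \<Rightarrow> nat set \<Rightarrow> (nat, 'k::field) mpol"
  assumes V: "finite V" and g: "gmod V Xp L" and L: "\<And>j. pv.subspace (L j)" and M: "\<And>j. pv.subspace (M j)"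
    and W: "finite W" and y: "\<And>w. w \<in> W \<Longrightarrow> y w \<in> Kc V p M j"
    and span: "\<And>v. v \<in> Kc V p M j \<Longrightarrow> \<exists>c. v - (\<Sum>w\<in>W. cs (c w) (y w)) \<in> CS (Pow V) L j"
  shows "hzr V Xp p M L j \<longleftrightarrow> (\<forall>w\<in>W. (\<exists>c. y w + (\<Sum>v\<in>{v\<in>W. v < w}. cs (c v) (y v)) \<in> Zs V L j) \<longrightarrow>
     (\<exists>c. y w + (\<Sum>v\<in>{v\<in>W. v < w}. cs (c v) (y v)) \<in> Bs V p M L j))"
proof -
  note sZ = subspace_Zs[where L=L, OF V L, of j]
  note sB = subspace_Bs[where L=L and M=M, OF V L M, of p j]
  note sK = subspace_CS[where L=M, OF M, of "{\<sigma>. \<sigma> \<subseteq> V \<and> card \<sigma> = p}" j, folded Kc_CS]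
  have Zi: "(\<forall>\<tau>. bd V Xp v \<tau> \<in> L (j - int (card \<tau>))) \<longleftrightarrow> v \<in> Zs V L j" for v
    by (auto simp: Zs_def CS_def bd_def)
  have Bi: "(\<exists>u\<in>Kc V (Suc p) M j. \<forall>\<sigma>. v \<sigma> - bd V Xp u \<sigma> \<in> L (j - int (card \<sigma>))) \<longleftrightarrow> v \<in> Bs V p M L j"
    if v: "v \<in> Kc V p M j" for v
  proof -
    have "v \<sigma> - bd V Xp u \<sigma> \<noteq> 0 \<Longrightarrow> \<sigma> \<subseteq> V" for u \<sigma>
      using Kc_support[OF v, of \<sigma>] by (cases "v \<sigma> = 0") (auto simp: bd_def split: if_splits)
    then show ?thesis by (simp add: Bs_def CS_def)
  qed
  have hzr: "hzr V Xp p M L j \<longleftrightarrow> (\<forall>v\<in>Kc V p M j. v \<in> Zs V L j \<longrightarrow> v \<in> Bs V p M L j)"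
    unfolding hzr_def Zi using Bi by simp
  have CSB: "x \<in> Bs V p M L j" if "x \<in> CS (Pow V) L j" for x
    unfolding Bs_def mem_Collect_eq
    by (rule bexI[of _ 0]) (use that cv.subspace_0[OF subspace_CS[where L=M, OF M, of "{\<sigma>. \<sigma> \<subseteq> V \<and> card \<sigma> = Suc p}" j, folded Kc_CS]] in \<open>simp_all add: bd_null[OF V]\<close>)
  show ?thesis unfolding hzr
  proof
    assume h: "\<forall>v\<in>Kc V p M j. v \<in> Zs V L j \<longrightarrow> v \<in> Bs V p M L j"
    show "\<forall>w\<in>W. (\<exists>c. y w + (\<Sum>v\<in>{v\<in>W. v < w}. cs (c v) (y v)) \<in> Zs V L j) \<longrightarrow>
     (\<exists>c. y w + (\<Sum>v\<in>{v\<in>W. v < w}. cs (c v) (y v)) \<in> Bs V p M L j)"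
    proof (intro ballI impI)
      fix w assume w: "w \<in> W" and "\<exists>c. y w + (\<Sum>v\<in>{v\<in>W. v < w}. cs (c v) (y v)) \<in> Zs V L j"
      then obtain c where c: "y w + (\<Sum>v\<in>{v\<in>W. v < w}. cs (c v) (y v)) \<in> Zs V L j" by blast
      have "y w + (\<Sum>v\<in>{v\<in>W. v < w}. cs (c v) (y v)) \<in> Kc V p M j"
        by (intro cv.subspace_add[OF sK] cv.subspace_sum[OF sK] cv.subspace_scale[OF sK] y w) simp
      then have "y w + (\<Sum>v\<in>{v\<in>W. v < w}. cs (c v) (y v)) \<in> Bs V p M L j" using h c by blast
      then show "\<exists>c. y w + (\<Sum>v\<in>{v\<in>W. v < w}. cs (c v) (y v)) \<in> Bs V p M L j" by (rule exI[of _ c])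
    qed
  next
    assume h: "\<forall>w\<in>W. (\<exists>c. y w + (\<Sum>v\<in>{v\<in>W. v < w}. cs (c v) (y v)) \<in> Zs V L j) \<longrightarrow>
     (\<exists>c. y w + (\<Sum>v\<in>{v\<in>W. v < w}. cs (c v) (y v)) \<in> Bs V p M L j)"
    show "\<forall>v\<in>Kc V p M j. v \<in> Zs V L j \<longrightarrow> v \<in> Bs V p M L j"
    proof (intro ballI impI)
      fix v assume v: "v \<in> Kc V p M j" "v \<in> Zs V L j"
      obtain c where c: "v - (\<Sum>w\<in>W. cs (c w) (y w)) \<in> CS (Pow V) L j" using span[OF v(1)] by blast
      let ?s = "\<Sum>w\<in>W. cs (c w) (y w)"
      have d: "v - ?s \<in> Bs V p M L j" using c by (rule CSB)
      then have "v - ?s \<in> Zs V L j" using Bs_sub_Zs[OF V g] by (rule rev_subsetD)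
      then have "v - (v - ?s) \<in> Zs V L j" by (rule cv.subspace_diff[OF sZ v(2)])
      then have s: "?s \<in> Zs V L j" by simp
      have "?s \<in> Bs V p M L j"
        by (rule cv.lead_subset[OF W sZ sB Bs_sub_Zs[OF V g] _ s]) (use h in blast)
      then have "(v - ?s) + ?s \<in> Bs V p M L j" by (rule cv.subspace_add[OF sB d])
      then show "v \<in> Bs V p M L j" by simp
    qed
  qed
qed

context generic
begin

section \<open>Homology of regular families is decided\<close>

definition spanfam :: "(int \<Rightarrow> 'w set) \<Rightarrow> ('w \<Rightarrow> 'g \<Rightarrow> (nat, 'k) mpol) \<Rightarrow> 'g \<Rightarrow> int \<Rightarrow> (nat, 'k) mpol set" where
  "spanfam WM bM g j = pv.span ((\<lambda>w. bM w g) ` WM j)"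

definition regfam :: "(int \<Rightarrow> 'w set) \<Rightarrow> ('w \<Rightarrow> 'g \<Rightarrow> (nat, 'k) mpol) \<Rightarrow> bool" where
  "regfam WM bM \<longleftrightarrow> (\<forall>j. finite (WM j) \<and> (\<forall>w\<in>WM j. regp (bM w)))"

lemma CS_spanfam:
  assumes "regfam WM bM" "finite T"
  shows "CS T (spanfam WM bM g) j = cv.span ((\<lambda>(\<sigma>, w). esing \<sigma> (bM w g)) ` (SIGMA \<sigma>:T. WM (j - int (card \<sigma>))))"
  by (rule CS_span) (use assms in \<open>simp_all add: regfam_def spanfam_def\<close>)

lemma leads_decided:
  fixes V :: "nat set" and y :: "'y::linorder \<Rightarrow> 'g \<Rightarrow> nat set \<Rightarrow> (nat, 'k) mpol"
  assumes V: "finite V" and rM: "regfam WM bM" and rL: "regfam WL bL"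
    and W: "finite W" and y: "\<And>v. v \<in> W \<Longrightarrow> regc (y v)" and w: "w \<in> W"
  shows Z_decided: "decided (\<lambda>g. \<exists>c. y w g + (\<Sum>v\<in>{v\<in>W. v < w}. cs (c v) (y v g)) \<in> Zs V (spanfam WL bL g) j)"
    and B_decided: "decided (\<lambda>g. \<exists>c. y w g + (\<Sum>v\<in>{v\<in>W. v < w}. cs (c v) (y v g)) \<in> Bs V p (spanfam WM bM g) (spanfam WL bL g) j)"
proof -
  let ?I = "SIGMA \<sigma>:Pow V. WL (j - int (card \<sigma>))"
  let ?T = "{\<sigma>. \<sigma> \<subseteq> V \<and> card \<sigma> = Suc p}"
  let ?J = "SIGMA \<sigma>:?T. WM (j - int (card \<sigma>))"
  let ?W = "{v\<in>W. v < w}"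
  define el where "el i g = (case i of (\<sigma>, l) \<Rightarrow> esing \<sigma> (bL l g))" for i g
  define em where "em i g = (case i of (\<sigma>, l) \<Rightarrow> esing \<sigma> (bM l g))" for i g
  have fP: "finite (Pow V)" using V by simp
  have fT: "finite ?T" by (rule finite_subset[OF _ fP]) auto
  have fI: "finite ?I" using rL by (intro finite_SigmaI fP) (simp add: regfam_def)
  have fJ: "finite ?J" using rM by (intro finite_SigmaI fT) (simp add: regfam_def)
  have rel: "regc (el i)" if "i \<in> ?I" for i
    using that rL by (auto simp: el_def[abs_def] regfam_def intro!: regc_esing)
  have rem: "regc (em i)" if "i \<in> ?J" for i
    using that rM by (auto simp: em_def[abs_def] regfam_def intro!: regc_esing)
  have CL: "CS (Pow V) (spanfam WL bL g) j = cv.span ((\<lambda>i. el i g) ` ?I)" for g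
    unfolding CS_spanfam[OF rL fP] by (simp add: el_def[abs_def] split_def)
  have CM: "Kc V (Suc p) (spanfam WM bM g) j = cv.span ((\<lambda>i. em i g) ` ?J)" for g
    unfolding Kc_CS CS_spanfam[OF rM fT] by (simp add: em_def[abs_def] split_def)
  have fW: "finite ?W" using W by simp
  have "decided (\<lambda>g. \<exists>c. bd V Xp (y w g) + (\<Sum>v\<in>?W. cs (c v) (bd V Xp (y v g))) \<in> cv.span ((\<lambda>i. el i g) ` ?I))"
    by (rule coset_meets_span_decided[OF fW fI]) (use rel y w in \<open>simp_all add: regc_bd\<close>)
  then show "decided (\<lambda>g. \<exists>c. y w g + (\<Sum>v\<in>?W. cs (c v) (y v g)) \<in> Zs V (spanfam WL bL g) j)"
    by (simp add: Zs_def CL bd_plus[OF V] bd_lincomb[OF V])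
  \<comment> \<open>Boundaries modulo \<open>L\<close> are spanned by the boundaries of the
    generating chains of \<open>M\<close> together with the chains of \<open>L\<close>.\<close>
  define eb where "eb i g = (case i of Inl a \<Rightarrow> bd V Xp (em a g) | Inr a \<Rightarrow> el a g)" for i g
  have reb: "regc (eb i)" if "i \<in> ?J <+> ?I" for i
    using that rel rem by (auto simp: eb_def[abs_def] regc_bd)
  have fB: "finite (?J <+> ?I)" using fI fJ by simp
  have "Bs V p (spanfam WM bM g) (spanfam WL bL g) j = cv.span ((\<lambda>i. eb i g) ` (?J <+> ?I))" for g
  proof -
    have eq: "(\<Sum>i\<in>?J <+> ?I. cs (c i) (eb i g)) = bd V Xp (\<Sum>i\<in>?J. cs (c (Inl i)) (em i g)) + (\<Sum>i\<in>?I. cs (c (Inr i)) (el i g))" for c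
      using fI fJ by (simp add: sum.Plus eb_def bd_lincomb[OF V])
    show ?thesis
    proof (intro equalityI subsetI)
      fix x assume "x \<in> Bs V p (spanfam WM bM g) (spanfam WL bL g) j"
      then obtain u where u: "u \<in> cv.span ((\<lambda>i. em i g) ` ?J)" "x - bd V Xp u \<in> cv.span ((\<lambda>i. el i g) ` ?I)"
        by (auto simp: Bs_def CM CL)
      obtain a b where a: "u = (\<Sum>i\<in>?J. cs (a i) (em i g))" and b: "x - bd V Xp u = (\<Sum>i\<in>?I. cs (b i) (el i g))"
        using u unfolding cv.span_image_iff[OF fI] cv.span_image_iff[OF fJ] by blast
      have "x = bd V Xp u + (x - bd V Xp u)" by simp
      also have "\<dots> = (\<Sum>i\<in>?J <+> ?I. cs (case_sum a b i) (eb i g))" unfolding eq b by (simp add: a)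
      finally show "x \<in> cv.span ((\<lambda>i. eb i g) ` (?J <+> ?I))"
        unfolding cv.span_image_iff[OF fB] by (rule exI[of _ "case_sum a b"])
    next
      fix x assume "x \<in> cv.span ((\<lambda>i. eb i g) ` (?J <+> ?I))"
      then obtain c where c: "x = (\<Sum>i\<in>?J <+> ?I. cs (c i) (eb i g))" unfolding cv.span_image_iff[OF fB] by blast
      let ?u = "\<Sum>i\<in>?J. cs (c (Inl i)) (em i g)"
      have "?u \<in> Kc V (Suc p) (spanfam WM bM g) j" unfolding CM cv.span_image_iff[OF fJ] by (rule exI[of _ "\<lambda>i. c (Inl i)"]) simp
      moreover have "x - bd V Xp ?u \<in> CS (Pow V) (spanfam WL bL g) j"
        unfolding CL cv.span_image_iff[OF fI] by (rule exI[of _ "\<lambda>i. c (Inr i)"]) (simp add: c eq)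
      ultimately show "x \<in> Bs V p (spanfam WM bM g) (spanfam WL bL g) j" by (auto simp: Bs_def)
    qed
  qed
  moreover have "decided (\<lambda>g. \<exists>c. y w g + (\<Sum>v\<in>?W. cs (c v) (y v g)) \<in> cv.span ((\<lambda>i. eb i g) ` (?J <+> ?I)))"
    by (rule coset_meets_span_decided[OF fW fB]) (use reb y w in simp_all)
  ultimately show "decided (\<lambda>g. \<exists>c. y w g + (\<Sum>v\<in>?W. cs (c v) (y v g)) \<in> Bs V p (spanfam WM bM g) (spanfam WL bL g) j)"
    by simp
qed

lemma subspace_spanfam: "pv.subspace (spanfam WM bM g j)"
  unfolding spanfam_def by (rule pv.subspace_span)

lemma hzr_decided:
  assumes V: "finite V" and rM: "regfam WM bM" and rL: "regfam WL bL"
    and gL: "\<And>g. g \<in> S \<Longrightarrow> gmod V Xp (spanfam WL bL g)"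
  shows "decided (\<lambda>g. hzr V Xp p (spanfam WM bM g) (spanfam WL bL g) j)"
proof -
  let ?T = "{\<sigma>. \<sigma> \<subseteq> V \<and> card \<sigma> = p}"
  let ?J = "SIGMA \<sigma>:?T. WM (j - int (card \<sigma>))"
  define em where "em i g = (case i of (\<sigma>, l) \<Rightarrow> esing \<sigma> (bM l g))" for i g
  have fT: "finite ?T" by (rule finite_subset[of _ "Pow V"]) (use V in auto)
  have fJ: "finite ?J" using rM by (intro finite_SigmaI fT) (simp add: regfam_def)
  have rem: "regc (em i)" if "i \<in> ?J" for i
    using that rM by (auto simp: em_def[abs_def] regfam_def intro!: regc_esing)
  have CM: "Kc V p (spanfam WM bM g) j = cv.span ((\<lambda>i. em i g) ` ?J)" for g
    unfolding Kc_CS CS_spanfam[OF rM fT] by (simp add: em_def[abs_def] split_def)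
  \<comment> \<open>Enumerating the generators supplies a linear order for the lead indices; any
    order would do.\<close>
  obtain h where h: "bij_betw h {0..<card ?J} ?J" using ex_bij_betw_nat_finite[OF fJ] by blast
  define N where "N = card ?J"
  define y where "y n g = em (h n) g" for n g
  have hJ: "h n \<in> ?J" if "n \<in> {0..<N}" for n using h that unfolding N_def bij_betw_def by blast
  have ry: "regc (y n)" if "n \<in> {0..<N}" for n using rem[OF hJ[OF that]] by (simp add: y_def[abs_def])
  have img: "(\<lambda>i. em i g) ` ?J = (\<lambda>n. y n g) ` {0..<N}" for g
  proof -
    have "h ` {0..<N} = ?J" using h unfolding N_def bij_betw_def by blast
    then have "(\<lambda>i. em i g) ` ?J = (\<lambda>i. em i g) ` (h ` {0..<N})" by simp
    then show ?thesis by (simp only: image_image y_def)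
  qed
  have fN: "finite {0..<N}" by simp
  let ?Z = "\<lambda>w g. \<exists>c. y w g + (\<Sum>v\<in>{v\<in>{0..<N}. v < w}. cs (c v) (y v g)) \<in> Zs V (spanfam WL bL g) j"
  let ?B = "\<lambda>w g. \<exists>c. y w g + (\<Sum>v\<in>{v\<in>{0..<N}. v < w}. cs (c v) (y v g)) \<in> Bs V p (spanfam WM bM g) (spanfam WL bL g) j"
  have dec: "decided (\<lambda>g. \<forall>w\<in>{0..<N}. ?Z w g \<longrightarrow> ?B w g)"
    by (intro decided_ball decided_imp Z_decided[OF V rM rL] B_decided[OF V rM rL] ry fN)
  have "eventually (\<lambda>g. (\<forall>w\<in>{0..<N}. ?Z w g \<longrightarrow> ?B w g) \<longleftrightarrow> hzr V Xp p (spanfam WM bM g) (spanfam WL bL g) j) F"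
    using ev_S
  proof (rule eventually_mono)
    fix g assume g: "g \<in> S"
    have "hzr V Xp p (spanfam WM bM g) (spanfam WL bL g) j \<longleftrightarrow> (\<forall>w\<in>{0..<N}. ?Z w g \<longrightarrow> ?B w g)"
    proof (rule hzr_iff_leads[OF V gL[OF g] subspace_spanfam subspace_spanfam fN])
      show "y w g \<in> Kc V p (spanfam WM bM g) j" if "w \<in> {0..<N}" for w
        unfolding CM img by (rule cv.span_base) (use that in blast)
      fix v assume "v \<in> Kc V p (spanfam WM bM g) j"
      then obtain c where "v = (\<Sum>w\<in>{0..<N}. cs (c w) (y w g))" unfolding CM img cv.span_image_iff[OF fN] by blast
      then show "\<exists>c. v - (\<Sum>w\<in>{0..<N}. cs (c w) (y w g)) \<in> CS (Pow V) (spanfam WL bL g) j"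
        using cv.subspace_0[OF subspace_CS[where L="spanfam WL bL g", OF subspace_spanfam]] by (intro exI[of _ c]) simp
    qed
    then show "(\<forall>w\<in>{0..<N}. ?Z w g \<longrightarrow> ?B w g) \<longleftrightarrow> hzr V Xp p (spanfam WM bM g) (spanfam WL bL g) j" by (rule sym)
  qed
  from decided_cong[OF this dec] show ?thesis .
qed

end

section \<open>A generic bound on Koszul homology\<close>

lemma gmod_mono_mult:
  assumes g: "gmod {..<d} Xp M" and f: "f \<in> M j"
  shows "Poly_Mapping.keys \<mu> \<subseteq> {..<d} \<Longrightarrow> mp_mono \<mu> * f \<in> M (j + int (mono_deg \<mu>))"
proof (induction "mono_deg \<mu>" arbitrary: \<mu>)
  case 0
  then have "\<mu> = 0" by (simp add: mono_deg_eq_0)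
  then show ?case using f by simp
next
  case (Suc n)
  then obtain a where a: "a \<in> Poly_Mapping.keys \<mu>"
    by (metis all_not_in_conv mono_deg_def nat.distinct(1) sum.empty)
  define \<nu> where "\<nu> = \<mu> - Poly_Mapping.single a 1"
  have \<mu>: "\<mu> = Poly_Mapping.single a 1 + \<nu>"
    unfolding \<nu>_def by (subst mono_diff) (use a in \<open>auto simp: lookup_single when_def in_keys_iff\<close>)
  have n: "n = mono_deg \<nu>" and k: "Poly_Mapping.keys \<nu> \<subseteq> {..<d}" and ad: "a \<in> {..<d}"
    using Suc.prems Suc.hyps(2) a \<mu> by (auto simp: mono_deg_add keys_add_nat)
  have "mp_var a * (mp_mono \<nu> * f) \<in> M (j + int (mono_deg \<nu>) + 1)"
    by (rule gmod_X[OF g ad Suc.hyps(1)[OF n k]])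
  moreover have "mp_var a * (mp_mono \<nu> * f) = mp_mono \<mu> * f"
    unfolding \<mu> by (simp add: mult.assoc[symmetric] mult_single)
  moreover have "j + int (mono_deg \<nu>) + 1 = j + int (mono_deg \<mu>)" unfolding \<mu> by (simp add: mono_deg_add)
  ultimately show ?case by (simp only:)
qed

lemma lookup_mono_mult_above:
  fixes f :: "(nat, 'k::field) mpol"
  assumes "\<And>m'. m < m' \<Longrightarrow> lk f m' = 0" "\<mu> + m < m'"
  shows "lk (mp_mono \<mu> * f) m' = 0"
proof (cases "\<exists>m''. m' = \<mu> + m''")
  case True
  then obtain m'' where m'': "m' = \<mu> + m''" by blast
  then have "m < m''" using assms(2) by simp
  then show ?thesis using assms(1) by (simp add: m'' lookup_single_mult)
next
  case False
  then show ?thesis by (intro lookup_single_mult_0) blast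
qed

context generic
begin

text \<open>Off a proper closed set, all members of a family of graded ideals with regular generators
  have the same lead monomials, although infinitely many degrees are involved: an unexpected lead
  monomial at one good point, continued to a regular family and pseudo-reduced by the generic
  lead terms, would be a lead monomial generically.\<close>

lemma uniform_bound:
  assumes rM: "regfam WM bM"
    and sub: "\<And>g j. g \<in> S \<Longrightarrow> spanfam WM bM g j \<subseteq> hp d j"
    and gM: "\<And>g. g \<in> S \<Longrightarrow> gmod {..<d} Xp (spanfam WM bM g)"
  shows "\<exists>c. eventually (\<lambda>g. \<forall>p j. j > c \<longrightarrow> hz {..<d} Xp p (spanfam WM bM g) j) F"
proof -
  let ?V = "{..<d}"
  let ?M = "spanfam WM bM"
  have fW: "finite (WM j)" for j using rM by (simp add: regfam_def)
  have rb: "regp (bM w)" if "w \<in> WM j" for w j using rM that by (auto simp: regfam_def)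
  have Miff: "f \<in> ?M g j \<longleftrightarrow> (\<exists>c. f = (\<Sum>w\<in>WM j. sp (c w) (bM w g)))" for f g j
    unfolding spanfam_def by (rule pv.span_image_iff[OF fW])
  have scM: "sp c f \<in> ?M g j" if "f \<in> ?M g j" for f c g j
    using that unfolding spanfam_def by (rule pv.span_scale)
  define lm where "lm g m \<longleftrightarrow> (\<exists>f\<in>?M g (int (mono_deg m)). lk f m = 1 \<and> (\<forall>m'>m. lk f m' = 0))" for g m
  \<comment> \<open>Monomials that lead generically, each on an open set of its own. A common open
    set is obtained later from the finitely many generators \<open>B0\<close>.\<close>
  define LM where "LM = {m. Poly_Mapping.keys m \<subseteq> ?V \<and> eventually (\<lambda>g. lm g m) F}"
  \<comment> \<open>One point with nonzero coefficient suffices, since a regular function that is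
    not identically zero on \<open>S\<close> is generically nonzero.\<close>
  have in_LM: "m \<in> LM" if r: "regp r" and rMj: "\<And>g. g \<in> S \<Longrightarrow> r g \<in> ?M g (int (mono_deg m))"
      and k: "Poly_Mapping.keys m \<subseteq> ?V" and ab: "\<And>g m'. g \<in> S \<Longrightarrow> m < m' \<Longrightarrow> lk (r g) m' = 0"
      and g0: "g0 \<in> S" "lk (r g0) m \<noteq> 0" for r m g0
  proof -
    have "(\<lambda>g. lk (r g) m) \<in> RF" using r by (simp add: regp_def)
    from RF_dich[OF this] have "eventually (\<lambda>g. lk (r g) m \<noteq> 0) F" using g0 by blast
    with ev_S have "eventually (\<lambda>g. lm g m) F"
    proof (rule eventually_elim2)
      fix g assume g: "g \<in> S" "lk (r g) m \<noteq> 0"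
      show "lm g m" unfolding lm_def
        by (rule bexI[of _ "sp (inverse (lk (r g) m)) (r g)"]) (use g ab scM[OF rMj] in \<open>auto simp: lookup_const_mult\<close>)
    qed
    then show ?thesis using k by (simp add: LM_def)
  qed
  have H: "\<exists>qh. fst qh \<in> RF \<and> eventually (\<lambda>g. fst qh g \<noteq> 0) F \<and> regp (snd qh) \<and>
      (\<forall>g\<in>S. snd qh g \<in> ?M g (int (mono_deg m)) \<and> lk (snd qh g) m = fst qh g \<and> (\<forall>m'>m. lk (snd qh g) m' = 0))"
    if m: "m \<in> LM" for m
  proof -
    let ?W = "WM (int (mono_deg m))"
    define w0 where "w0 g e = (if e = m then 1 else 0 :: 'k)" for g :: 'g and e :: mono
    \<comment> \<open>Coefficients below \<open>m\<close> are discarded: the system asks for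
      coefficient 1 at \<open>m\<close> and 0 above it.\<close>
    define u where "u w g e = (if m \<le> e then lk (bM w g) e else 0)" for w g e
    have "reg_solvable ?W w0 u \<or> ev_unsolvable ?W w0 u"
    proof (rule solvable_decided[OF fW])
      show "(\<lambda>g. w0 g e) \<in> RF" for e by (simp add: w0_def RF_const)
      show "(\<lambda>g. u w g e) \<in> RF" if "w \<in> ?W" for w e
        using rb[OF that] by (cases "m \<le> e") (simp_all add: u_def regp_def RF_const)
    qed
    moreover have "\<not> ev_unsolvable ?W w0 u"
    proof
      assume "ev_unsolvable ?W w0 u"
      then have "eventually (\<lambda>g. \<not> (\<exists>c. \<forall>e. w0 g e = (\<Sum>i\<in>?W. c i * u i g e))) F" by (simp only: ev_unsolvable_def)
      moreover have "eventually (\<lambda>g. lm g m) F" using m by (simp add: LM_def)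
      ultimately have "eventually (\<lambda>g. False) F"
      proof (rule eventually_elim2)
        fix g assume n: "\<not> (\<exists>c. \<forall>e. w0 g e = (\<Sum>i\<in>?W. c i * u i g e))" and l: "lm g m"
        obtain f where f: "f \<in> ?M g (int (mono_deg m))" "lk f m = 1" "\<forall>m'>m. lk f m' = 0" using l unfolding lm_def by blast
        obtain c where c: "f = (\<Sum>w\<in>?W. sp (c w) (bM w g))" using f(1) unfolding Miff by blast
        have "w0 g e = (\<Sum>i\<in>?W. c i * u i g e)" for e
        proof (cases "m \<le> e")
          case True
          then have "(\<Sum>i\<in>?W. c i * u i g e) = lk f e" by (simp add: u_def c lookup_sum lookup_const_mult)
          moreover have "lk f e = w0 g e" using f(2,3) True by (auto simp: w0_def order_le_less)
          ultimately show ?thesis by simp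
        next
          case False
          then show ?thesis by (auto simp: u_def w0_def)
        qed
        then show False using n by blast
      qed
      then show False using F_nb by simp
    qed
    ultimately obtain q c where qc: "q \<in> RF" "\<forall>i\<in>?W. c i \<in> RF" "eventually (\<lambda>g. q g \<noteq> 0) F"
      "\<forall>g\<in>S. \<forall>e. q g * w0 g e = (\<Sum>i\<in>?W. c i g * u i g e)" unfolding reg_solvable_def by blast
    define h where "h g = (\<Sum>w\<in>?W. sp (c w g) (bM w g))" for g
    have lh: "lk (h g) e = q g * w0 g e" if "g \<in> S" "m \<le> e" for g e
      using qc(4) that by (simp add: h_def lookup_sum lookup_const_mult u_def)
    have "regp h" unfolding h_def[abs_def] by (intro regp_sum regp_scale rb) (use qc(2) in auto)
    moreover have "h g \<in> ?M g (int (mono_deg m))" for g unfolding Miff by (rule exI[of _ "\<lambda>w. c w g"]) (simp add: h_def)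
    moreover have "lk (h g) m = q g \<and> (\<forall>m'>m. lk (h g) m' = 0)" if "g \<in> S" for g
      using lh[OF that] by (simp add: w0_def)
    ultimately show ?thesis using qc(1,3) by (intro exI[of _ "(q, h)"]) simp
  qed
  have "\<forall>m\<in>LM. \<exists>qh. fst qh \<in> RF \<and> eventually (\<lambda>g. fst qh g \<noteq> 0) F \<and> regp (snd qh) \<and>
      (\<forall>g\<in>S. snd qh g \<in> ?M g (int (mono_deg m)) \<and> lk (snd qh g) m = fst qh g \<and> (\<forall>m'>m. lk (snd qh g) m' = 0))"
    by (rule ballI) (rule H)
  from bchoice[OF this] obtain qh where qh: "\<forall>m\<in>LM. fst (qh m) \<in> RF \<and> eventually (\<lambda>g. fst (qh m) g \<noteq> 0) F \<and> regp (snd (qh m)) \<and>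
      (\<forall>g\<in>S. snd (qh m) g \<in> ?M g (int (mono_deg m)) \<and> lk (snd (qh m) g) m = fst (qh m) g \<and> (\<forall>m'>m. lk (snd (qh m) g) m' = 0))" ..
  define q where "q m = fst (qh m)" for m
  define h where "h m = snd (qh m)" for m
  have q: "q m \<in> RF" "eventually (\<lambda>g. q m g \<noteq> 0) F" "regp (h m)" if "m \<in> LM" for m
    using qh that by (simp_all add: q_def h_def)
  have h: "h m g \<in> ?M g (int (mono_deg m))" "lk (h m g) m = q m g" "\<And>m'. m < m' \<Longrightarrow> lk (h m g) m' = 0" if "m \<in> LM" "g \<in> S" for m g
    using qh that by (simp_all add: q_def h_def)
  have up: "\<mu> + m \<in> LM" if m: "m \<in> LM" and \<mu>: "Poly_Mapping.keys \<mu> \<subseteq> ?V" for \<mu> m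
  proof -
    have "eventually (\<lambda>g. lm g m) F" using m by (simp add: LM_def)
    with ev_S have "eventually (\<lambda>g. lm g (\<mu> + m)) F"
    proof (rule eventually_elim2)
      fix g assume g: "g \<in> S" and "lm g m"
      then obtain f where f: "f \<in> ?M g (int (mono_deg m))" "lk f m = 1" "\<And>m'. m < m' \<Longrightarrow> lk f m' = 0" unfolding lm_def by blast
      show "lm g (\<mu> + m)" unfolding lm_def
      proof (rule bexI, intro conjI allI impI)
        show "lk (mp_mono \<mu> * f) (\<mu> + m) = 1" by (simp add: lookup_single_mult f(2))
        show "lk (mp_mono \<mu> * f) m' = 0" if "\<mu> + m < m'" for m' by (rule lookup_mono_mult_above[OF f(3) that])
        have "mp_mono \<mu> * f \<in> ?M g (int (mono_deg m) + int (mono_deg \<mu>))" by (rule gmod_mono_mult[OF gM[OF g] f(1) \<mu>])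
        moreover have "int (mono_deg m) + int (mono_deg \<mu>) = int (mono_deg (\<mu> + m))" by (simp add: mono_deg_add)
        ultimately show "mp_mono \<mu> * f \<in> ?M g (int (mono_deg (\<mu> + m)))" by (simp only:)
      qed
    qed
    then show ?thesis using m \<mu> by (simp add: LM_def keys_add_nat)
  qed
  have "\<exists>B\<subseteq>{((), m) |m. m \<in> LM}. finite B \<and> (\<forall>c m. (c, m) \<in> {((), m) |m. m \<in> LM} \<longrightarrow> (\<exists>m0 \<mu>. (c, m0) \<in> B \<and> m = m0 + \<mu>))"
    by (rule dickson[where C="{()}" and V="?V"]) (auto simp: LM_def)
  then obtain B where B: "B \<subseteq> {((), m) |m. m \<in> LM}" "finite B"
    "\<And>c m. (c, m) \<in> {((), m) |m. m \<in> LM} \<Longrightarrow> \<exists>m0 \<mu>. (c, m0) \<in> B \<and> m = m0 + \<mu>" by blast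
  define B0 where "B0 = snd ` B"
  have B0: "B0 \<subseteq> LM" "finite B0" using B(1,2) by (auto simp: B0_def)
  have dec: "\<exists>m0\<in>B0. \<exists>\<mu>. m = \<mu> + m0 \<and> Poly_Mapping.keys \<mu> \<subseteq> ?V" if m: "m \<in> LM" for m
  proof -
    obtain m0 \<mu> where e: "((), m0) \<in> B" "m = m0 + \<mu>" using B(3)[of "()" m] m by blast
    have "m0 \<in> B0" using e(1) by (force simp: B0_def)
    moreover have "Poly_Mapping.keys \<mu> \<subseteq> ?V" using m by (auto simp: LM_def e(2) keys_add_nat)
    ultimately show ?thesis using e(2) by (metis add.commute)
  qed
  \<comment> \<open>Bounds every exponent of every generator of \<open>LM\<close>; a variable with
    larger exponent can be divided out inside \<open>LM\<close>.\<close>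
  define E where "E = (\<Sum>m\<in>B0. mono_deg m)"
  have E: "lk m c \<le> E" if "m \<in> B0" for m c
    using lookup_le_mono_deg[of m c] member_le_sum[OF that, of mono_deg] B0(2) unfolding E_def by simp
  have good: "eventually (\<lambda>g. g \<in> S \<and> (\<forall>m\<in>B0. q m g \<noteq> 0)) F"
  proof (rule eventually_conj[OF ev_S eventually_ball_finite[OF B0(2)]], rule ballI)
    fix m assume "m \<in> B0"
    then have "m \<in> LM" using B0(1) by blast
    then show "eventually (\<lambda>g. q m g \<noteq> 0) F" by (rule q(2))
  qed
  have main: "hz ?V Xp p (?M g0) j" if g0: "g0 \<in> S" "\<forall>m\<in>B0. q m g0 \<noteq> 0" and j: "j > int (d * E)" for g0 p j
  proof (rule hz_bound[where LM=LM and E=E, OF gM[OF g0(1)] scM sub[OF g0(1)] _ _ _ j])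
    show "m - Poly_Mapping.single c 1 \<in> LM" if m: "m \<in> LM" and c: "c < d" "E < lk m c" for m c
    proof -
      obtain m0 \<mu> where e: "m0 \<in> B0" "m = \<mu> + m0" "Poly_Mapping.keys \<mu> \<subseteq> ?V" using dec[OF m] by blast
      have "c \<in> Poly_Mapping.keys \<mu>" using c(2) E[OF e(1), of c] by (simp add: e(2) lookup_add in_keys_iff)
      then have s: "Poly_Mapping.single c 1 + (\<mu> - Poly_Mapping.single c 1) = \<mu>"
        by (intro mono_diff) (auto simp: lookup_single when_def in_keys_iff)
      have "m = Poly_Mapping.single c 1 + ((\<mu> - Poly_Mapping.single c 1) + m0)"
        using s e(2) by (simp only: add.assoc[symmetric])
      then have "m - Poly_Mapping.single c 1 = (\<mu> - Poly_Mapping.single c 1) + m0" by simp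
      moreover have "(\<mu> - Poly_Mapping.single c 1) + m0 \<in> LM"
        by (rule up) (use e(1,3) B0(1) keys_minus_nat[of \<mu> "Poly_Mapping.single c 1"] in auto)
      ultimately show ?thesis by simp
    qed
    show "\<exists>f\<in>?M g0 (int (mono_deg m)). lk f m = 1 \<and> (\<forall>m'>m. lk f m' = 0)" if m: "m \<in> LM" for m
    proof -
      obtain m0 \<mu> where e: "m0 \<in> B0" "m = \<mu> + m0" "Poly_Mapping.keys \<mu> \<subseteq> ?V" using dec[OF m] by blast
      have m0: "m0 \<in> LM" using e(1) B0(1) by blast
      let ?f = "sp (inverse (q m0 g0)) (mp_mono \<mu> * h m0 g0)"
      have q0: "q m0 g0 \<noteq> 0" using g0(2) e(1) by blast
      show ?thesis
      proof (rule bexI[of _ ?f], intro conjI allI impI)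
        show "lk ?f m = 1" using q0 by (simp add: lookup_const_mult e(2) lookup_single_mult h(2)[OF m0 g0(1)])
        show "lk ?f m' = 0" if "m < m'" for m'
        proof -
          have "lk (mp_mono \<mu> * h m0 g0) m' = 0"
            by (rule lookup_mono_mult_above[OF h(3)[OF m0 g0(1)]]) (use that e(2) in simp_all)
          then show ?thesis by (simp add: lookup_const_mult)
        qed
        have "mp_mono \<mu> * h m0 g0 \<in> ?M g0 (int (mono_deg m0) + int (mono_deg \<mu>))"
          by (rule gmod_mono_mult[OF gM[OF g0(1)] h(1)[OF m0 g0(1)] e(3)])
        moreover have "int (mono_deg m0) + int (mono_deg \<mu>) = int (mono_deg m)" by (simp add: mono_deg_add e(2))
        ultimately show "?f \<in> ?M g0 (int (mono_deg m))" by (intro scM) (simp only:)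
      qed
    qed
    \<comment> \<open>The delicate direction: a good point \<open>g0\<close> might have additional
      lead monomials. Freezing the coefficients of \<open>f\<close> gives a regular family through
      \<open>f\<close>, whose monomials above \<open>m\<close> are then cleared from the top down at
      all points of \<open>S\<close>.\<close>
    show "m \<in> LM" if f: "f \<in> ?M g0 i" and nz: "lk f m \<noteq> 0" and ab: "\<And>m'. m < m' \<Longrightarrow> lk f m' = 0" for f m i
    proof -
      have km: "Poly_Mapping.keys m \<subseteq> ?V" and i: "int (mono_deg m) = i" using hpD[of f d i m] f sub[OF g0(1)] nz by blast+
      define A0 where "A0 = {m'. m < m' \<and> Poly_Mapping.keys m' \<subseteq> ?V \<and> int (mono_deg m') = i}"
      have fA0: "finite A0" using finite_monos[of ?V "nat i"] unfolding A0_def by (rule finite_subset[rotated]) auto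
      obtain a where a: "f = (\<Sum>w\<in>WM i. sp (a w) (bM w g0))" using f unfolding Miff by blast
      have "\<exists>r N. regp r \<and> (\<forall>g\<in>S. r g \<in> ?M g i) \<and> (\<forall>g\<in>S. \<forall>m'\<in>A. lk (r g) m' = 0) \<and> N \<noteq> 0 \<and> r g0 = sp N f"
        if "finite A" "A \<subseteq> A0" "\<And>x y. x \<in> A \<Longrightarrow> y \<in> A0 \<Longrightarrow> x < y \<Longrightarrow> y \<in> A" for A
        using that
      proof (induction A rule: finite_linorder_min_induct)
        case empty
        let ?r = "\<lambda>g. \<Sum>w\<in>WM i. sp (a w) (bM w g)"
        have "regp ?r" by (intro regp_sum regp_scale rb RF_const)
        moreover have "?r g \<in> ?M g i" for g unfolding Miff by (rule exI[of _ a]) simp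
        ultimately show ?case by (intro exI[of _ ?r] exI[of _ 1]) (simp add: a)
      next
        case (insert b A)
        have AA: "A \<subseteq> A0" and bA0: "b \<in> A0" using insert.prems(1) by auto
        have upA: "y \<in> A" if "x \<in> A" "y \<in> A0" "x < y" for x y
          using insert.prems(2)[of x y] that insert.hyps(2) by force
        have IH: "\<exists>r N. regp r \<and> (\<forall>g\<in>S. r g \<in> ?M g i) \<and> (\<forall>g\<in>S. \<forall>m'\<in>A. lk (r g) m' = 0) \<and> N \<noteq> 0 \<and> r g0 = sp N f"
          by (rule insert.IH[OF AA]) (erule (2) upA)
        obtain r N where r: "regp r" "\<forall>g\<in>S. r g \<in> ?M g i" "\<forall>g\<in>S. \<forall>m'\<in>A. lk (r g) m' = 0" "N \<noteq> 0" "r g0 = sp N f"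
          using IH by blast
        have b: "m < b" "Poly_Mapping.keys b \<subseteq> ?V" "int (mono_deg b) = i" using bA0 by (auto simp: A0_def)
        have abv: "lk (r g) m' = 0" if g: "g \<in> S" and m': "b < m'" for g m'
        proof (rule ccontr)
          assume n: "lk (r g) m' \<noteq> 0"
          have "r g \<in> hp d i" using r(2) sub g by blast
          from hpD[OF this n] have "m' \<in> A0" using m' b(1) by (simp add: A0_def)
          then have "m' \<in> insert b A" using insert.prems(2)[of b m'] m' by simp
          then show False using n r(3) g m' by auto
        qed
        show ?case
        proof (cases "b \<in> LM")
          case False
          \<comment> \<open>A nonzero coefficient at any point would make \<open>b\<close> a generic
            lead monomial.\<close>
          have "lk (r g) b = 0" if "g \<in> S" for g
          proof (rule ccontr)
            assume "lk (r g) b \<noteq> 0"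
            then have "b \<in> LM" by (intro in_LM[of r b g]) (use r(1,2) b abv that in auto)
            then show False using False by blast
          qed
          then show ?thesis using r by (intro exI[of _ r] exI[of _ N]) auto
        next
          case True
          obtain m0 \<mu> where e: "m0 \<in> B0" "b = \<mu> + m0" "Poly_Mapping.keys \<mu> \<subseteq> ?V" using dec[OF True] by blast
          have m0: "m0 \<in> LM" using e(1) B0(1) by blast
          \<comment> \<open>Pseudo-reduction by a generic lead term. At \<open>g0\<close> the
            subtracted term vanishes because \<open>f\<close> has no monomial above
            \<open>m\<close>, so \<open>f\<close> is merely rescaled, by a factor that is nonzero at
            a good point.\<close>
          define r' where "r' g = sp (q m0 g) (r g) - sp (lk (r g) b) (mp_mono \<mu> * h m0 g)" for g
          have "regp r'" unfolding r'_def[abs_def]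
            by (intro regp_diff regp_scale regp_mono q[OF m0] r(1)) (use r(1) in \<open>simp add: regp_def\<close>)
          moreover have "r' g \<in> ?M g i" if g: "g \<in> S" for g
          proof -
            have "mp_mono \<mu> * h m0 g \<in> ?M g (int (mono_deg m0) + int (mono_deg \<mu>))"
              by (rule gmod_mono_mult[OF gM[OF g] h(1)[OF m0 g] e(3)])
            moreover have "int (mono_deg m0) + int (mono_deg \<mu>) = i" using b(3) by (simp add: mono_deg_add e(2))
            ultimately have "mp_mono \<mu> * h m0 g \<in> ?M g i" by (simp only:)
            then show ?thesis unfolding r'_def using r(2) g by (intro pv.subspace_diff[OF subspace_spanfam] scM) auto
          qed
          moreover have "lk (r' g) m' = 0" if g: "g \<in> S" and m': "m' \<in> insert b A" for g m'
          proof (cases "m' = b")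
            case True
            then show ?thesis
              by (simp add: r'_def lookup_minus lookup_const_mult, simp add: e(2) lookup_single_mult h(2)[OF m0 g])
          next
            case False
            then have A: "m' \<in> A" "b < m'" using m' insert.hyps(2) by auto
            have "lk (mp_mono \<mu> * h m0 g) m' = 0"
              by (rule lookup_mono_mult_above[OF h(3)[OF m0 g]]) (use A(2) e(2) in simp_all)
            then show ?thesis using r(3) g A(1) by (simp add: r'_def lookup_minus lookup_const_mult)
          qed
          moreover have "r' g0 = sp (q m0 g0 * N) f"
          proof -
            have "lk (r g0) b = 0" using ab[OF b(1)] by (simp add: r(5) lookup_const_mult)
            then show ?thesis by (simp add: r'_def r(5) mult.assoc[symmetric] mult_single)
          qed
          moreover have "q m0 g0 * N \<noteq> 0" using r(4) g0(2) e(1) by simp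
          ultimately show ?thesis by (intro exI[of _ r'] exI[of _ "q m0 g0 * N"]) blast
        qed
      qed
      from this[OF fA0] obtain r N where r: "regp r" "\<forall>g\<in>S. r g \<in> ?M g i" "\<forall>g\<in>S. \<forall>m'\<in>A0. lk (r g) m' = 0" "N \<noteq> 0" "r g0 = sp N f"
        by blast
      have "lk (r g) m' = 0" if g: "g \<in> S" and m': "m < m'" for g m'
      proof (rule ccontr)
        assume n: "lk (r g) m' \<noteq> 0"
        have "r g \<in> hp d i" using r(2) sub g by blast
        from hpD[OF this n] have "m' \<in> A0" using m' by (simp add: A0_def)
        then show False using n r(3) g by blast
      qed
      moreover have "lk (r g0) m \<noteq> 0" using r(4) nz by (simp add: r(5) lookup_const_mult)
      ultimately show ?thesis using r(1,2) km i g0(1) by (intro in_LM[of r m g0]) auto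
    qed
  qed
  have "eventually (\<lambda>g. \<forall>p j. j > int (d * E) \<longrightarrow> hz ?V Xp p (?M g) j) F"
    using good
  proof (rule eventually_mono, intro allI impI)
    fix g p j assume "g \<in> S \<and> (\<forall>m\<in>B0. q m g \<noteq> 0)" "j > int (d * E)"
    then show "hz ?V Xp p (?M g) j" by (intro main) simp_all
  qed
  then show ?thesis by (rule exI)
qed

end

section \<open>Linear growth of staircases\<close>

definition wdeg :: "('v \<Rightarrow> nat) \<Rightarrow> ('v \<Rightarrow>\<^sub>0 nat) \<Rightarrow> nat" where
  "wdeg w m = (\<Sum>v\<in>Poly_Mapping.keys m. w v * lk m v)"

lemma wdeg_superset: "finite A \<Longrightarrow> Poly_Mapping.keys m \<subseteq> A \<Longrightarrow> wdeg w m = (\<Sum>v\<in>A. w v * lk m v)"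
  unfolding wdeg_def by (rule sum.mono_neutral_left) (auto simp: in_keys_iff)

lemma wdeg_add: "wdeg w (m + m') = wdeg w m + wdeg w m'"
  using wdeg_superset[of "Poly_Mapping.keys m \<union> Poly_Mapping.keys m'" m w]
    wdeg_superset[of "Poly_Mapping.keys m \<union> Poly_Mapping.keys m'" m' w]
    wdeg_superset[of "Poly_Mapping.keys m \<union> Poly_Mapping.keys m'" "m + m'" w]
  by (simp add: keys_add_nat lookup_add sum.distrib distrib_left)

lemma wdeg_0 [simp]: "wdeg w 0 = 0" by (simp add: wdeg_def)

lemma wdeg_single [simp]: "wdeg w (Poly_Mapping.single v n) = w v * n"
  by (simp add: wdeg_def)

lemma wdeg_le: "(\<And>v. v \<in> Poly_Mapping.keys m \<Longrightarrow> w v \<le> a) \<Longrightarrow> wdeg w m \<le> a * mono_deg m"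
  unfolding wdeg_def mono_deg_def sum_distrib_left by (rule sum_mono) simp

lemma wdeg_ge: "(\<And>v. v \<in> Poly_Mapping.keys m \<Longrightarrow> a \<le> w v) \<Longrightarrow> a * mono_deg m \<le> wdeg w m"
  unfolding wdeg_def mono_deg_def sum_distrib_left by (rule sum_mono) simp

text \<open>Induction on the generators: a cone survives the new generator \<open>b\<close> as a
  whole if a fixed exponent is already too small; otherwise what remains are slices on which the
  exponent of one free variable is fixed below that of \<open>b\<close>. The cones may
  overlap.\<close>

lemma staircase_complement:
  fixes B :: "('v \<Rightarrow>\<^sub>0 nat) set"
  assumes "finite B" and V: "finite V"
  shows "\<exists>P. finite P \<and> (\<forall>(\<gamma>, D)\<in>P. D \<subseteq> V) \<and>
    {m. Poly_Mapping.keys m \<subseteq> V \<and> \<not> (\<exists>b\<in>B. \<forall>v. lk b v \<le> lk m v)} =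
    (\<Union>(\<gamma>, D)\<in>P. {\<gamma> + \<beta> |\<beta>. Poly_Mapping.keys \<beta> \<subseteq> D})"
proof -
  \<comment> \<open>Strengthened so that \<open>\<gamma>\<close> involves no free variable: then the
    exponent of a free variable is that of \<open>\<beta>\<close> alone.\<close>
  have "\<exists>P. finite P \<and> (\<forall>p\<in>P. snd p \<subseteq> V \<and> Poly_Mapping.keys (fst p) \<subseteq> V - snd p) \<and>
    {m. Poly_Mapping.keys m \<subseteq> V \<and> \<not> (\<exists>b\<in>B. \<forall>v. lk b v \<le> lk m v)} =
    (\<Union>p\<in>P. {fst p + \<beta> |\<beta>. Poly_Mapping.keys \<beta> \<subseteq> snd p})"
    using assms(1)
  proof (induction B rule: finite_induct)
    case empty
    show ?case by (rule exI[of _ "{(0, V)}"]) auto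
  next
    case (insert b B)
    from insert.IH obtain P where P0: "finite P" "\<forall>p\<in>P. snd p \<subseteq> V \<and> Poly_Mapping.keys (fst p) \<subseteq> V - snd p"
      "{m. Poly_Mapping.keys m \<subseteq> V \<and> \<not> (\<exists>b\<in>B. \<forall>v. lk b v \<le> lk m v)} =
        (\<Union>p\<in>P. {fst p + \<beta> |\<beta>. Poly_Mapping.keys \<beta> \<subseteq> snd p})" by (elim exE conjE)
    have P: "finite P" "\<And>p. p \<in> P \<Longrightarrow> snd p \<subseteq> V" "\<And>p. p \<in> P \<Longrightarrow> Poly_Mapping.keys (fst p) \<subseteq> V - snd p"
      "{m. Poly_Mapping.keys m \<subseteq> V \<and> \<not> (\<exists>b\<in>B. \<forall>v. lk b v \<le> lk m v)} =
        (\<Union>p\<in>P. {fst p + \<beta> |\<beta>. Poly_Mapping.keys \<beta> \<subseteq> snd p})" using P0 by simp_all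
    define P1 where "P1 = {p\<in>P. \<exists>v. v \<notin> snd p \<and> lk (fst p) v < lk b v}"
    define cut where "cut = (\<lambda>(p :: ('v \<Rightarrow>\<^sub>0 nat) \<times> 'v set, v, t). (fst p + Poly_Mapping.single v t, snd p - {v}))"
    define I where "I = (SIGMA p:P. SIGMA v:snd p. {..<lk b v})"
    have fs: "finite (snd p)" if "p \<in> P" for p
    proof -
      have "snd p \<subseteq> V" using P(2) that by simp
      then show ?thesis by (rule finite_subset) (rule V)
    qed
    have "finite I" unfolding I_def by (intro finite_SigmaI P(1) fs finite_lessThan)
    then have "finite (P1 \<union> cut ` I)" using P(1) by (simp add: P1_def)
    moreover have "\<forall>p\<in>P1 \<union> cut ` I. snd p \<subseteq> V \<and> Poly_Mapping.keys (fst p) \<subseteq> V - snd p"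
    proof
      fix p assume "p \<in> P1 \<union> cut ` I"
      then show "snd p \<subseteq> V \<and> Poly_Mapping.keys (fst p) \<subseteq> V - snd p"
      proof
        assume "p \<in> P1" then show ?thesis using P(2,3)[of p] by (simp add: P1_def)
      next
        assume "p \<in> cut ` I"
        then obtain p' v t where p': "p' \<in> P" "v \<in> snd p'" "p = (fst p' + Poly_Mapping.single v t, snd p' - {v})"
          by (auto simp: I_def cut_def)
        have "Poly_Mapping.keys (Poly_Mapping.single v t) \<subseteq> {v}" by (cases "t = 0") simp_all
        then show ?thesis using P(2,3)[OF p'(1)] p'(2) by (auto simp: p'(3) keys_add_nat)
      qed
    qed
    moreover have "{m. Poly_Mapping.keys m \<subseteq> V \<and> \<not> (\<exists>b\<in>insert b B. \<forall>v. lk b v \<le> lk m v)} =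
        (\<Union>p\<in>P1 \<union> cut ` I. {fst p + \<beta> |\<beta>. Poly_Mapping.keys \<beta> \<subseteq> snd p})"
    proof (intro equalityI subsetI)
      fix m assume "m \<in> {m. Poly_Mapping.keys m \<subseteq> V \<and> \<not> (\<exists>b\<in>insert b B. \<forall>v. lk b v \<le> lk m v)}"
      then have m: "m \<in> {m. Poly_Mapping.keys m \<subseteq> V \<and> \<not> (\<exists>b\<in>B. \<forall>v. lk b v \<le> lk m v)}" and "\<not> (\<forall>v. lk b v \<le> lk m v)" by auto
      then obtain v where v: "lk m v < lk b v" by (auto simp: not_le)
      obtain p \<beta> where p: "p \<in> P" "m = fst p + \<beta>" "Poly_Mapping.keys \<beta> \<subseteq> snd p" using m unfolding P(4) by blast
      show "m \<in> (\<Union>p\<in>P1 \<union> cut ` I. {fst p + \<beta> |\<beta>. Poly_Mapping.keys \<beta> \<subseteq> snd p})"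
      proof (cases "v \<in> snd p")
        case False
        have "lk (fst p) v < lk b v" using v by (simp add: p(2) lookup_add)
        then have "p \<in> P1" using False p(1) by (auto simp: P1_def)
        then show ?thesis using p(2,3) by blast
      next
        case True
        let ?t = "lk \<beta> v"
        have "?t < lk b v" using v by (simp add: p(2) lookup_add)
        then have I: "(p, v, ?t) \<in> I" using p(1) True by (simp add: I_def)
        have "Poly_Mapping.single v ?t + (\<beta> - Poly_Mapping.single v ?t) = \<beta>"
          by (rule mono_diff) (simp add: lookup_single when_def)
        then have "m = fst (cut (p, v, ?t)) + (\<beta> - Poly_Mapping.single v ?t)" by (simp add: cut_def p(2) add.assoc)
        moreover have "Poly_Mapping.keys (\<beta> - Poly_Mapping.single v ?t) \<subseteq> snd (cut (p, v, ?t))"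
          using keys_minus_nat[of \<beta> "Poly_Mapping.single v ?t"] p(3) by (auto simp: cut_def in_keys_iff lookup_minus)
        ultimately show ?thesis using I by blast
      qed
    next
      fix m assume "m \<in> (\<Union>p\<in>P1 \<union> cut ` I. {fst p + \<beta> |\<beta>. Poly_Mapping.keys \<beta> \<subseteq> snd p})"
      then obtain p \<beta> where p: "p \<in> P1 \<union> cut ` I" "m = fst p + \<beta>" "Poly_Mapping.keys \<beta> \<subseteq> snd p" by blast
      have "m \<in> (\<Union>p\<in>P. {fst p + \<beta> |\<beta>. Poly_Mapping.keys \<beta> \<subseteq> snd p}) \<and> (\<exists>v. lk m v < lk b v)"
        using p(1)
      proof
        assume p1: "p \<in> P1"
        then obtain v where v: "v \<notin> snd p" "lk (fst p) v < lk b v" by (auto simp: P1_def)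
        have "lk \<beta> v = 0" using v(1) p(3) by (auto simp: in_keys_iff)
        then have "lk m v < lk b v" using v(2) by (simp add: p(2) lookup_add)
        moreover have "p \<in> P" using p1 by (simp add: P1_def)
        ultimately show ?thesis using p(2,3) by blast
      next
        assume "p \<in> cut ` I"
        then obtain p' v t where p': "p' \<in> P" "v \<in> snd p'" "t < lk b v" "p = (fst p' + Poly_Mapping.single v t, snd p' - {v})"
          by (auto simp: I_def cut_def)
        have "lk (fst p') v = 0" using P(3)[OF p'(1)] p'(2) by (auto simp: in_keys_iff)
        moreover have "lk \<beta> v = 0" using p(3) by (auto simp: p'(4) in_keys_iff)
        ultimately have "lk m v < lk b v" using p'(3) by (simp add: p(2) p'(4) lookup_add lookup_single)
        moreover have "m = fst p' + (Poly_Mapping.single v t + \<beta>)" by (simp add: p(2) p'(4) add.assoc)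
        moreover have "Poly_Mapping.keys (Poly_Mapping.single v t + \<beta>) \<subseteq> snd p'"
          using p(3) p'(2) by (cases "t = 0") (auto simp: keys_add_nat p'(4))
        ultimately show ?thesis using p'(1) by blast
      qed
      then show "m \<in> {m. Poly_Mapping.keys m \<subseteq> V \<and> \<not> (\<exists>b\<in>insert b B. \<forall>v. lk b v \<le> lk m v)}"
        unfolding P(4)[symmetric] by (auto simp: not_le)
    qed
    ultimately show ?case by (intro exI[of _ "P1 \<union> cut ` I"] conjI)
  qed
  then obtain P where P: "finite P" "\<forall>p\<in>P. snd p \<subseteq> V \<and> Poly_Mapping.keys (fst p) \<subseteq> V - snd p"
    "{m. Poly_Mapping.keys m \<subseteq> V \<and> \<not> (\<exists>b\<in>B. \<forall>v. lk b v \<le> lk m v)} =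
    (\<Union>p\<in>P. {fst p + \<beta> |\<beta>. Poly_Mapping.keys \<beta> \<subseteq> snd p})" by (elim exE conjE)
  show ?thesis
  proof (rule exI[of _ P], intro conjI)
    show "finite P" by (rule P(1))
    show "\<forall>(\<gamma>, D)\<in>P. D \<subseteq> V"
    proof (rule ballI, clarify)
      fix \<gamma> D v assume "(\<gamma>, D) \<in> P" "v \<in> D"
      then show "v \<in> V" using P(2) by fastforce
    qed
    show "{m. Poly_Mapping.keys m \<subseteq> V \<and> \<not> (\<exists>b\<in>B. \<forall>v. lk b v \<le> lk m v)} =
      (\<Union>(\<gamma>, D)\<in>P. {\<gamma> + \<beta> |\<beta>. Poly_Mapping.keys \<beta> \<subseteq> D})" unfolding P(3) by (simp only: split_def)
  qed
qed

text \<open>The second coordinate is the power. The line must be attained and not only be an upper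
  bound: this makes the property stable under finite unions and yields an exact maximum.\<close>

definition evlin :: "nat set \<Rightarrow> (int \<times> nat) set \<Rightarrow> bool" where
  "evlin A Q \<longleftrightarrow> (\<exists>n0. \<forall>n\<ge>n0. \<forall>y. (y, n) \<notin> Q) \<or>
     (\<exists>a\<in>A. \<exists>b n0. \<forall>n\<ge>n0. (int a * int n + b, n) \<in> Q \<and> (\<forall>y. (y, n) \<in> Q \<longrightarrow> y \<le> int a * int n + b))"

lemma evlin_empty: "evlin A {}" by (simp add: evlin_def)

text \<open>The steeper line wins eventually, and among parallel lines the higher one.\<close>

lemma evlin_Un:
  assumes "evlin A Q" "evlin A R"
  shows "evlin A (Q \<union> R)"
proof -
  have mix: "evlin A (Q \<union> R)" if Q: "\<exists>n0. \<forall>n\<ge>n0. \<forall>y. (y, n) \<notin> Q" and R: "evlin A R" for Q R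
  proof -
    obtain n0 where n0: "\<forall>n\<ge>n0. \<forall>y. (y, n) \<notin> Q" using Q by blast
    show ?thesis using R unfolding evlin_def
    proof
      assume "\<exists>n0. \<forall>n\<ge>n0. \<forall>y. (y, n) \<notin> R"
      then obtain n1 where "\<forall>n\<ge>n1. \<forall>y. (y, n) \<notin> R" by blast
      then show "(\<exists>n0. \<forall>n\<ge>n0. \<forall>y. (y, n) \<notin> Q \<union> R) \<or>
        (\<exists>a\<in>A. \<exists>b n0. \<forall>n\<ge>n0. (int a * int n + b, n) \<in> Q \<union> R \<and> (\<forall>y. (y, n) \<in> Q \<union> R \<longrightarrow> y \<le> int a * int n + b))"
        using n0 by (intro disjI1 exI[of _ "max n0 n1"]) simp
    next
      assume "\<exists>a\<in>A. \<exists>b n0. \<forall>n\<ge>n0. (int a * int n + b, n) \<in> R \<and> (\<forall>y. (y, n) \<in> R \<longrightarrow> y \<le> int a * int n + b)"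
      then obtain a b n1 where "a \<in> A" "\<forall>n\<ge>n1. (int a * int n + b, n) \<in> R \<and> (\<forall>y. (y, n) \<in> R \<longrightarrow> y \<le> int a * int n + b)" by blast
      then show "(\<exists>n0. \<forall>n\<ge>n0. \<forall>y. (y, n) \<notin> Q \<union> R) \<or>
        (\<exists>a\<in>A. \<exists>b n0. \<forall>n\<ge>n0. (int a * int n + b, n) \<in> Q \<union> R \<and> (\<forall>y. (y, n) \<in> Q \<union> R \<longrightarrow> y \<le> int a * int n + b))"
        using n0 by (intro disjI2 bexI[of _ a] exI[of _ b] exI[of _ "max n0 n1"]) simp_all
    qed
  qed
  have dom: "evlin A (Q \<union> R)"
    if a: "a \<in> A" and Q: "\<forall>n\<ge>n0. (int a * int n + b, n) \<in> Q \<and> (\<forall>y. (y, n) \<in> Q \<longrightarrow> y \<le> int a * int n + b)"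
      and R: "\<forall>n\<ge>n1. \<forall>y. (y, n) \<in> R \<longrightarrow> y \<le> int a' * int n + b'"
      and le: "\<forall>n\<ge>n2. int a' * int n + b' \<le> int a * int n + b" for a b n0 n1 n2 a' b' Q R
    unfolding evlin_def
  proof (intro disjI2 bexI[OF _ a] exI[of _ b] exI[of _ "max n0 (max n1 n2)"] allI impI conjI)
    fix n assume n: "max n0 (max n1 n2) \<le> n"
    show "(int a * int n + b, n) \<in> Q \<union> R" using Q n by simp
    show "y \<le> int a * int n + b" if "(y, n) \<in> Q \<union> R" for y
    proof (cases "(y, n) \<in> Q")
      case True then show ?thesis using Q n by simp
    next
      case False
      then have "y \<le> int a' * int n + b'" using R n that by simp
      also have "\<dots> \<le> int a * int n + b" using le n by simp
      finally show ?thesis .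
    qed
  qed
  show ?thesis
  proof (cases "(\<exists>n0. \<forall>n\<ge>n0. \<forall>y. (y, n) \<notin> Q) \<or> (\<exists>n0. \<forall>n\<ge>n0. \<forall>y. (y, n) \<notin> R)")
    case True
    then show ?thesis using mix[of Q R] mix[of R Q] assms by (auto simp: Un_commute)
  next
    case False
    then obtain a b n0 where a: "a \<in> A" and Q: "\<forall>n\<ge>n0. (int a * int n + b, n) \<in> Q \<and> (\<forall>y. (y, n) \<in> Q \<longrightarrow> y \<le> int a * int n + b)"
      using assms(1) unfolding evlin_def by blast
    obtain a' b' n1 where a': "a' \<in> A" and R: "\<forall>n\<ge>n1. (int a' * int n + b', n) \<in> R \<and> (\<forall>y. (y, n) \<in> R \<longrightarrow> y \<le> int a' * int n + b')"
      using assms(2) False unfolding evlin_def by blast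
    \<comment> \<open>The slopes are integers, so they differ by at least 1 and
      \<open>n \<ge> b' - b\<close> is enough.\<close>
    have cmp: "\<forall>n\<ge>nat (b' - b). int a' * int n + b' \<le> int a * int n + b" if "a' < a" for a a' b b'
    proof (intro allI impI)
      fix n assume "nat (b' - b) \<le> n"
      then have "b' - b \<le> int n" by simp
      also have "\<dots> \<le> int (a - a') * int n" using that by (simp add: mult_le_cancel_right1)
      also have "\<dots> = int a * int n - int a' * int n" using that by (simp add: of_nat_diff left_diff_distrib)
      finally show "int a' * int n + b' \<le> int a * int n + b" by simp
    qed
    consider "a' < a" | "a < a'" | "a = a'" "b' \<le> b" | "a = a'" "b \<le> b'" by linarith
    then show ?thesis
    proof cases
      case 1
      have R': "\<forall>n\<ge>n1. \<forall>y. (y, n) \<in> R \<longrightarrow> y \<le> int a' * int n + b'" using R by blast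
      show ?thesis by (rule dom[OF a Q R' cmp[OF 1]])
    next
      case 2
      have Q': "\<forall>n\<ge>n0. \<forall>y. (y, n) \<in> Q \<longrightarrow> y \<le> int a * int n + b" using Q by blast
      have "evlin A (R \<union> Q)" by (rule dom[OF a' R Q' cmp[OF 2]])
      then show ?thesis by (simp add: Un_commute)
    next
      case 3
      have R': "\<forall>n\<ge>n1. \<forall>y. (y, n) \<in> R \<longrightarrow> y \<le> int a' * int n + b'" using R by blast
      have le: "\<forall>n\<ge>0. int a' * int n + b' \<le> int a * int n + b" using 3 by simp
      show ?thesis by (rule dom[OF a Q R' le])
    next
      case 4
      have Q': "\<forall>n\<ge>n0. \<forall>y. (y, n) \<in> Q \<longrightarrow> y \<le> int a * int n + b" using Q by blast
      have le: "\<forall>n\<ge>0. int a * int n + b \<le> int a' * int n + b'" using 4 by simp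
      have "evlin A (R \<union> Q)" by (rule dom[OF a' R Q' le])
      then show ?thesis by (simp add: Un_commute)
    qed
  qed
qed

lemma evlin_UN: "finite I \<Longrightarrow> (\<And>i. i \<in> I \<Longrightarrow> evlin A (Q i)) \<Longrightarrow> evlin A (\<Union>i\<in>I. Q i)"
  by (induction I rule: finite_induct) (auto simp: evlin_empty intro: evlin_Un)

text \<open>The top is reached by spending the whole degree \<open>n - v\<close> on a direction of
  maximal weight; without directions only the power \<open>v\<close> occurs.\<close>

lemma evlin_cone:
  assumes D: "finite D" and A: "w ` D \<subseteq> A"
  shows "evlin A {(u + int (wdeg w \<beta>), v + mono_deg \<beta>) |\<beta>. Poly_Mapping.keys \<beta> \<subseteq> D}" (is "evlin A ?Q")
proof (cases "D = {}")
  case True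
  show ?thesis unfolding evlin_def
    by (intro disjI1 exI[of _ "Suc v"]) (auto simp: True)
next
  case False
  let ?a = "Max (w ` D)"
  have "?a \<in> w ` D" using D False by (intro Max_in) auto
  then obtain l where l: "l \<in> D" "w l = ?a" by auto
  show ?thesis unfolding evlin_def
  proof (intro disjI2 bexI[of _ ?a] exI[of _ "u - int ?a * int v"] exI[of _ v] allI impI conjI)
    show "?a \<in> A" using l A by auto
    fix n assume n: "v \<le> n"
    let ?\<beta> = "Poly_Mapping.single l (n - v)"
    have "Poly_Mapping.keys ?\<beta> \<subseteq> D" using l(1) by (cases "n = v") auto
    moreover have "u + int (wdeg w ?\<beta>) = int ?a * int n + (u - int ?a * int v)"
      using n l(2) by (simp add: of_nat_diff right_diff_distrib)
    moreover have "v + mono_deg ?\<beta> = n" using n by simp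
    ultimately show "(int ?a * int n + (u - int ?a * int v), n) \<in> ?Q"
      unfolding mem_Collect_eq by (intro exI[of _ ?\<beta>]) simp
    fix y assume "(y, n) \<in> ?Q"
    then obtain \<beta> where \<beta>: "y = u + int (wdeg w \<beta>)" "n = v + mono_deg \<beta>" "Poly_Mapping.keys \<beta> \<subseteq> D" by auto
    have "wdeg w \<beta> \<le> ?a * mono_deg \<beta>" by (rule wdeg_le) (use \<beta>(3) D in auto)
    then have "int (wdeg w \<beta>) \<le> int ?a * int (mono_deg \<beta>)" by (metis of_nat_le_iff of_nat_mult)
    then show "y \<le> int ?a * int n + (u - int ?a * int v)" by (simp add: \<beta>(1,2) distrib_left)
  qed
qed

text \<open>Multiplication by \<open>Vx\<close> sends \<open>LZ\<close> into \<open>LB\<close>, so \<open>LZ - LB\<close> only grows in the directions \<open>VT\<close>.\<close>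

lemma evlin_difference:
  fixes LZ LB :: "('c \<times> ('v \<Rightarrow>\<^sub>0 nat)) set"
  assumes C: "finite C" and Vx: "finite Vx" and VT: "finite VT"
    and LZ: "\<And>c m. (c, m) \<in> LZ \<Longrightarrow> c \<in> C \<and> Poly_Mapping.keys m \<subseteq> Vx \<union> VT"
    and upZ: "\<And>c m v. (c, m) \<in> LZ \<Longrightarrow> v \<in> VT \<Longrightarrow> (c, Poly_Mapping.single v 1 + m) \<in> LZ"
    and xZ: "\<And>c m v. (c, m) \<in> LZ \<Longrightarrow> v \<in> Vx \<Longrightarrow> (c, Poly_Mapping.single v 1 + m) \<in> LB"
    and upB: "\<And>c m v. (c, m) \<in> LB \<Longrightarrow> v \<in> Vx \<union> VT \<Longrightarrow> (c, Poly_Mapping.single v 1 + m) \<in> LB"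
    and tw: "\<And>v. v \<in> VT \<Longrightarrow> tw v = 1"
  shows "evlin (w ` VT) {(cu c + int (wdeg w m), cv c + wdeg tw m) |c m. (c, m) \<in> LZ - LB}"
proof -
  have up: "(c, \<mu> + m) \<in> Q" if Q: "(c, m) \<in> Q" "Poly_Mapping.keys \<mu> \<subseteq> U"
      and step: "\<And>c m v. (c, m) \<in> Q \<Longrightarrow> v \<in> U \<Longrightarrow> (c, Poly_Mapping.single v 1 + m) \<in> Q"
    for c m \<mu> U and Q :: "('c \<times> ('v \<Rightarrow>\<^sub>0 nat)) set"
    using Q
  proof (induction "mono_deg \<mu>" arbitrary: \<mu> m)
    case 0
    then show ?case by (simp add: mono_deg_eq_0)
  next
    case (Suc n)
    then obtain a where a: "a \<in> Poly_Mapping.keys \<mu>" by (metis all_not_in_conv mono_deg_def nat.distinct(1) sum.empty)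
    define \<nu> where "\<nu> = \<mu> - Poly_Mapping.single a 1"
    have \<mu>: "\<mu> = Poly_Mapping.single a 1 + \<nu>"
      unfolding \<nu>_def by (subst mono_diff) (use a in \<open>auto simp: lookup_single when_def in_keys_iff\<close>)
    have "n = mono_deg \<nu>" "Poly_Mapping.keys \<nu> \<subseteq> U" "a \<in> U"
      using Suc.prems Suc.hyps(2) a \<mu> by (auto simp: mono_deg_add keys_add_nat)
    then have "(c, \<nu> + (Poly_Mapping.single a 1 + m)) \<in> Q"
      by (intro Suc.hyps(1)[OF \<open>n = mono_deg \<nu>\<close>] step Suc.prems(1))
    then show ?case unfolding \<mu> by (simp add: ac_simps)
  qed
  have "\<exists>B\<subseteq>LZ. finite B \<and> (\<forall>c m. (c, m) \<in> LZ \<longrightarrow> (\<exists>m0 \<mu>. (c, m0) \<in> B \<and> m = m0 + \<mu>))"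
    by (rule dickson[where C=C and V="Vx \<union> VT"]) (use C Vx VT LZ in auto)
  then obtain B where B: "B \<subseteq> LZ" "finite B" "\<And>c m. (c, m) \<in> LZ \<Longrightarrow> \<exists>m0 \<mu>. (c, m0) \<in> B \<and> m = m0 + \<mu>" by blast
  \<comment> \<open>The part of \<open>LZ - LB\<close> above the generator \<open>b\<close> of
    \<open>LZ\<close>: a direction in \<open>Vx\<close> would lead into \<open>LB\<close>, so only
    exponents in \<open>VT\<close> remain.\<close>
  define Q where "Q b = {(cu (fst b) + int (wdeg w (snd b + \<mu>)), cv (fst b) + wdeg tw (snd b + \<mu>)) |\<mu>.
      Poly_Mapping.keys \<mu> \<subseteq> VT \<and> (fst b, snd b + \<mu>) \<notin> LB}" for b
  have eq: "{(cu c + int (wdeg w m), cv c + wdeg tw m) |c m. (c, m) \<in> LZ - LB} = (\<Union>b\<in>B. Q b)"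
  proof (intro equalityI subsetI)
    fix x assume "x \<in> {(cu c + int (wdeg w m), cv c + wdeg tw m) |c m. (c, m) \<in> LZ - LB}"
    then obtain c m where x: "x = (cu c + int (wdeg w m), cv c + wdeg tw m)" "(c, m) \<in> LZ" "(c, m) \<notin> LB" by blast
    obtain m0 \<mu> where m0: "(c, m0) \<in> B" "m = m0 + \<mu>" using B(3)[OF x(2)] by blast
    have k: "Poly_Mapping.keys \<mu> \<subseteq> Vx \<union> VT" using LZ[OF x(2)] by (simp add: m0(2) keys_add_nat)
    have "a \<notin> Vx" if a: "a \<in> Poly_Mapping.keys \<mu>" for a
    proof
      assume "a \<in> Vx"
      then have "(c, Poly_Mapping.single a 1 + m0) \<in> LB" using xZ m0(1) B(1) by blast
      then have "(c, (\<mu> - Poly_Mapping.single a 1) + (Poly_Mapping.single a 1 + m0)) \<in> LB"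
        by (rule up[where U="Vx \<union> VT"]) (use k keys_minus_nat[of \<mu> "Poly_Mapping.single a 1"] upB in auto)
      moreover have "Poly_Mapping.single a 1 + (\<mu> - Poly_Mapping.single a 1) = \<mu>"
        by (rule mono_diff) (use a in \<open>auto simp: lookup_single when_def in_keys_iff\<close>)
      then have "(\<mu> - Poly_Mapping.single a 1) + (Poly_Mapping.single a 1 + m0) = m" by (simp add: m0(2) ac_simps)
      ultimately show False using x(3) by simp
    qed
    then have "Poly_Mapping.keys \<mu> \<subseteq> VT" using k by blast
    then have "x \<in> Q (c, m0)" using x(1,3) m0(2) unfolding Q_def by auto
    then show "x \<in> (\<Union>b\<in>B. Q b)" using m0(1) by blast
  next
    fix x assume "x \<in> (\<Union>b\<in>B. Q b)"
    then obtain c m0 \<mu> where m0: "(c, m0) \<in> B" "Poly_Mapping.keys \<mu> \<subseteq> VT" "(c, m0 + \<mu>) \<notin> LB"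
      "x = (cu c + int (wdeg w (m0 + \<mu>)), cv c + wdeg tw (m0 + \<mu>))" by (auto simp: Q_def)
    have "(c, \<mu> + m0) \<in> LZ" by (rule up[where U=VT, OF _ m0(2)]) (use m0(1) B(1) upZ in auto)
    then show "x \<in> {(cu c + int (wdeg w m), cv c + wdeg tw m) |c m. (c, m) \<in> LZ - LB}"
      using m0(3,4) by (auto simp: add.commute)
  qed
  have "evlin (w ` VT) (Q b)" for b
  proof -
    \<comment> \<open>For fixed \<open>b\<close> the exponents that lead into \<open>LB\<close> form
      a monomial ideal in the variables \<open>VT\<close>; \<open>Q b\<close> comes from its
      complement, a finite union of cones.\<close>
    let ?U = "{((), \<mu>) |\<mu>. Poly_Mapping.keys \<mu> \<subseteq> VT \<and> (fst b, snd b + \<mu>) \<in> LB}"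
    have "\<exists>B\<subseteq>?U. finite B \<and> (\<forall>c m. (c, m) \<in> ?U \<longrightarrow> (\<exists>m0 \<mu>. (c, m0) \<in> B \<and> m = m0 + \<mu>))"
      by (rule dickson[where C="{()}" and V=VT]) (use VT in auto)
    then obtain B' where B': "B' \<subseteq> ?U" "finite B'" "\<And>c m. (c, m) \<in> ?U \<Longrightarrow> \<exists>m0 \<mu>. (c, m0) \<in> B' \<and> m = m0 + \<mu>" by blast
    have mem: "(fst b, snd b + \<mu>) \<in> LB \<longleftrightarrow> (\<exists>b'\<in>snd ` B'. \<forall>v. lk b' v \<le> lk \<mu> v)" if k: "Poly_Mapping.keys \<mu> \<subseteq> VT" for \<mu>
    proof
      assume "(fst b, snd b + \<mu>) \<in> LB"
      then have "((), \<mu>) \<in> ?U" using k by simp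
      from B'(3)[OF this] obtain m0 \<nu> where m0: "((), m0) \<in> B'" "\<mu> = m0 + \<nu>" by (elim exE conjE)
      have "m0 \<in> snd ` B'" by (rule rev_image_eqI[OF m0(1)]) simp
      then show "\<exists>b'\<in>snd ` B'. \<forall>v. lk b' v \<le> lk \<mu> v" by (rule rev_bexI) (simp add: m0(2) lookup_add)
    next
      assume "\<exists>b'\<in>snd ` B'. \<forall>v. lk b' v \<le> lk \<mu> v"
      then obtain b' where b': "((), b') \<in> B'" "\<And>v. lk b' v \<le> lk \<mu> v" by auto
      have \<mu>: "b' + (\<mu> - b') = \<mu>" by (rule mono_diff) (rule b'(2))
      have "(fst b, snd b + b') \<in> LB" using b'(1) B'(1) by blast
      then have "(fst b, (\<mu> - b') + (snd b + b')) \<in> LB"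
        by (rule up[where U="Vx \<union> VT"]) (use k keys_minus_nat[of \<mu> b'] upB in auto)
      moreover have "(\<mu> - b') + (snd b + b') = snd b + (b' + (\<mu> - b'))" by (simp only: ac_simps)
      ultimately show "(fst b, snd b + \<mu>) \<in> LB" using \<mu> by simp
    qed
    obtain P where P: "finite P" "\<forall>(\<gamma>, D)\<in>P. D \<subseteq> VT"
      "{m. Poly_Mapping.keys m \<subseteq> VT \<and> \<not> (\<exists>b\<in>snd ` B'. \<forall>v. lk b v \<le> lk m v)} = (\<Union>(\<gamma>, D)\<in>P. {\<gamma> + \<beta> |\<beta>. Poly_Mapping.keys \<beta> \<subseteq> D})"
      using staircase_complement[OF finite_imageI[OF B'(2), of snd] VT] by (elim exE conjE)
    define R where "R p = {((cu (fst b) + int (wdeg w (snd b + fst p))) + int (wdeg w \<beta>), (cv (fst b) + wdeg tw (snd b + fst p)) + mono_deg \<beta>) |\<beta>.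
        Poly_Mapping.keys \<beta> \<subseteq> snd p}" for p
    have "Q b = (\<lambda>\<mu>. (cu (fst b) + int (wdeg w (snd b + \<mu>)), cv (fst b) + wdeg tw (snd b + \<mu>))) `
        {m. Poly_Mapping.keys m \<subseteq> VT \<and> \<not> (\<exists>b\<in>snd ` B'. \<forall>v. lk b v \<le> lk m v)}"
    proof (intro equalityI subsetI)
      fix x assume "x \<in> Q b"
      then obtain \<mu> where "x = (cu (fst b) + int (wdeg w (snd b + \<mu>)), cv (fst b) + wdeg tw (snd b + \<mu>))"
        "Poly_Mapping.keys \<mu> \<subseteq> VT" "(fst b, snd b + \<mu>) \<notin> LB" unfolding Q_def by (elim CollectE exE conjE)
      with mem[of \<mu>] show "x \<in> (\<lambda>\<mu>. (cu (fst b) + int (wdeg w (snd b + \<mu>)), cv (fst b) + wdeg tw (snd b + \<mu>))) `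
        {m. Poly_Mapping.keys m \<subseteq> VT \<and> \<not> (\<exists>b\<in>snd ` B'. \<forall>v. lk b v \<le> lk m v)}" by (intro image_eqI[of _ _ \<mu>]) simp_all
    next
      fix x assume "x \<in> (\<lambda>\<mu>. (cu (fst b) + int (wdeg w (snd b + \<mu>)), cv (fst b) + wdeg tw (snd b + \<mu>))) `
        {m. Poly_Mapping.keys m \<subseteq> VT \<and> \<not> (\<exists>b\<in>snd ` B'. \<forall>v. lk b v \<le> lk m v)}"
      then obtain \<mu> where "x = (cu (fst b) + int (wdeg w (snd b + \<mu>)), cv (fst b) + wdeg tw (snd b + \<mu>))"
        "Poly_Mapping.keys \<mu> \<subseteq> VT" "\<not> (\<exists>b\<in>snd ` B'. \<forall>v. lk b v \<le> lk \<mu> v)" by (elim imageE CollectE conjE)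
      with mem[of \<mu>] show "x \<in> Q b" unfolding Q_def by (intro CollectI exI[of _ \<mu>]) simp
    qed
    also have "\<dots> = (\<Union>p\<in>P. R p)"
    proof -
      have "(\<lambda>\<mu>. (cu (fst b) + int (wdeg w (snd b + \<mu>)), cv (fst b) + wdeg tw (snd b + \<mu>))) ` {fst p + \<beta> |\<beta>. Poly_Mapping.keys \<beta> \<subseteq> snd p} = R p"
        if p: "p \<in> P" for p
      proof -
        have t: "wdeg tw \<beta> = mono_deg \<beta>" if "Poly_Mapping.keys \<beta> \<subseteq> snd p" for \<beta>
        proof -
          have "Poly_Mapping.keys \<beta> \<subseteq> VT" using that P(2) p by (auto simp: split_def)
          then show ?thesis unfolding wdeg_def mono_deg_def using tw by (intro sum.cong) auto
        qed
        have "(\<lambda>\<mu>. (cu (fst b) + int (wdeg w (snd b + \<mu>)), cv (fst b) + wdeg tw (snd b + \<mu>))) ` {fst p + \<beta> |\<beta>. Poly_Mapping.keys \<beta> \<subseteq> snd p} =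
          {(cu (fst b) + int (wdeg w (snd b + (fst p + \<beta>))), cv (fst b) + wdeg tw (snd b + (fst p + \<beta>))) |\<beta>. Poly_Mapping.keys \<beta> \<subseteq> snd p}" by blast
        also have "\<dots> = R p" unfolding R_def
          by (intro Collect_cong ex_cong1) (auto simp: wdeg_add t)
        finally show ?thesis .
      qed
      then show ?thesis unfolding P(3) by (simp add: image_UN split_def)
    qed
    finally have Qb: "Q b = (\<Union>p\<in>P. R p)" .
    show ?thesis unfolding Qb
    proof (rule evlin_UN[OF P(1)])
      fix p assume p: "p \<in> P"
      then have D: "snd p \<subseteq> VT" using P(2) by (auto simp: split_def)
      show "evlin (w ` VT) (R p)" unfolding R_def
        by (rule evlin_cone[OF finite_subset[OF D VT] image_mono[OF D]])
    qed
  qed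
  then show ?thesis unfolding eq by (intro evlin_UN[OF B(2)])
qed

section \<open>The Rees algebra\<close>

lemma span_Un_span: "pv.span (A \<union> pv.span B) = pv.span (A \<union> B)"
proof (rule subset_antisym)
  have "A \<subseteq> pv.span (A \<union> B)" using pv.span_superset[of "A \<union> B"] by blast
  moreover have "pv.span B \<subseteq> pv.span (A \<union> B)" by (rule pv.span_mono) simp
  ultimately show "pv.span (A \<union> pv.span B) \<subseteq> pv.span (A \<union> B)"
    by (intro pv.span_minimal[OF Un_least pv.subspace_span])
  show "pv.span (A \<union> B) \<subseteq> pv.span (A \<union> pv.span B)"
    by (rule pv.span_mono) (use pv.span_superset[of B] in blast)
qed

lemma span_mult:
  assumes q: "\<And>x. x \<in> A \<Longrightarrow> q * x \<in> pv.span B" and y: "y \<in> pv.span A"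
  shows "q * y \<in> pv.span B"
proof -
  have "pv.subspace {y. q * y \<in> pv.span B}"
    by (rule pv.subspaceI) (auto simp: pv.span_zero distrib_left mult.left_commute[of q] intro: pv.span_add pv.span_scale)
  then have "pv.span A \<subseteq> {y. q * y \<in> pv.span B}" by (rule pv.span_minimal[rotated]) (use q in blast)
  then show ?thesis using y by blast
qed

lemma mono_split:
  assumes "Poly_Mapping.keys \<epsilon> \<subseteq> A \<union> B"
  shows "\<exists>\<epsilon>1 \<epsilon>2. (\<epsilon> :: 'v \<Rightarrow>\<^sub>0 nat) = \<epsilon>1 + \<epsilon>2 \<and> Poly_Mapping.keys \<epsilon>1 \<subseteq> A \<and> Poly_Mapping.keys \<epsilon>2 \<subseteq> B"
proof -
  define r where "r C = (\<Sum>v\<in>Poly_Mapping.keys \<epsilon> \<inter> C. Poly_Mapping.single v (lk \<epsilon> v))" for C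
  have lr: "lk (r C) v = (if v \<in> C then lk \<epsilon> v else 0)" for C v
    by (auto simp: r_def lookup_sum lookup_single when_def in_keys_iff sum.delta')
  have "\<epsilon> = r A + r (- A)" by (rule poly_mapping_eqI) (simp add: lookup_add lr)
  moreover have "Poly_Mapping.keys (r A) \<subseteq> A" by (auto simp: in_keys_iff lr split: if_splits)
  moreover have "Poly_Mapping.keys (r (- A)) \<subseteq> Poly_Mapping.keys \<epsilon> - A" by (auto simp: in_keys_iff lr split: if_splits)
  then have "Poly_Mapping.keys (r (- A)) \<subseteq> B" using assms by blast
  ultimately show ?thesis by (intro exI[of _ "r A"] exI[of _ "r (- A)"] conjI)
qed

lemma mono_remove: "a \<in> Poly_Mapping.keys \<mu> \<Longrightarrow> \<exists>\<nu>. (\<mu> :: 'v \<Rightarrow>\<^sub>0 nat) = Poly_Mapping.single a 1 + \<nu>"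
  by (rule exI[of _ "\<mu> - Poly_Mapping.single a 1"], rule mono_diff[symmetric])
    (auto simp: lookup_single when_def in_keys_iff)

text \<open>As no variable weighs more than 1, variables can be split off one at a time until the
  weight is exactly \<open>N\<close>.\<close>

lemma mono_split_wdeg:
  assumes t: "\<And>v. tw v \<le> 1"
  shows "N \<le> wdeg tw \<epsilon> \<Longrightarrow> \<exists>\<epsilon>1 \<epsilon>2. \<epsilon> = \<epsilon>1 + \<epsilon>2 \<and> wdeg tw \<epsilon>1 = N"
proof (induction N)
  case 0
  show ?case by (rule exI[of _ 0], rule exI[of _ \<epsilon>]) simp
next
  case (Suc N)
  then obtain \<epsilon>1 \<epsilon>2 where e: "\<epsilon> = \<epsilon>1 + \<epsilon>2" "wdeg tw \<epsilon>1 = N" by auto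
  then have "wdeg tw \<epsilon>2 \<noteq> 0" using Suc.prems by (simp add: wdeg_add)
  then obtain v where v: "v \<in> Poly_Mapping.keys \<epsilon>2" "tw v \<noteq> 0" unfolding wdeg_def by (auto elim: sum.not_neutral_contains_not_neutral)
  obtain \<nu> where \<nu>: "\<epsilon>2 = Poly_Mapping.single v 1 + \<nu>" using mono_remove[OF v(1)] by blast
  have "tw v = 1" using t[of v] v(2) by simp
  then have "wdeg tw (\<epsilon>1 + Poly_Mapping.single v 1) = Suc N" using e(2) by (simp add: wdeg_add)
  moreover have "\<epsilon> = (\<epsilon>1 + Poly_Mapping.single v 1) + \<nu>" by (simp add: e(1) \<nu> add.assoc)
  ultimately show ?case by blast
qed

definition mev :: "('v \<Rightarrow> 'a::comm_semiring_1) \<Rightarrow> ('v \<Rightarrow>\<^sub>0 nat) \<Rightarrow> 'a" where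
  "mev y m = (\<Prod>v\<in>Poly_Mapping.keys m. y v ^ lk m v)"

lemma mev_superset: "finite A \<Longrightarrow> Poly_Mapping.keys m \<subseteq> A \<Longrightarrow> mev y m = (\<Prod>v\<in>A. y v ^ lk m v)"
  unfolding mev_def by (rule prod.mono_neutral_left) (auto simp: in_keys_iff)

lemma mev_add: "mev y (m + m') = mev y m * mev y m'"
  using mev_superset[of "Poly_Mapping.keys m \<union> Poly_Mapping.keys m'" m y]
    mev_superset[of "Poly_Mapping.keys m \<union> Poly_Mapping.keys m'" m' y]
    mev_superset[of "Poly_Mapping.keys m \<union> Poly_Mapping.keys m'" "m + m'" y]
  by (simp add: keys_add_nat lookup_add prod.distrib power_add)

lemma mev_0 [simp]: "mev y 0 = 1" by (simp add: mev_def)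

lemma mev_single [simp]: "mev y (Poly_Mapping.single v 1) = y v" by (simp add: mev_def)

lemma mono_induct_keys:
  assumes "Poly_Mapping.keys \<epsilon> \<subseteq> A" "P 0" "\<And>v \<epsilon>. v \<in> A \<Longrightarrow> Poly_Mapping.keys \<epsilon> \<subseteq> A \<Longrightarrow> P \<epsilon> \<Longrightarrow> P (Poly_Mapping.single v 1 + \<epsilon>)"
  shows "P (\<epsilon> :: 'v \<Rightarrow>\<^sub>0 nat)"
  using assms(1)
proof (induction "mono_deg \<epsilon>" arbitrary: \<epsilon>)
  case 0
  then have "\<epsilon> = 0" by (simp add: mono_deg_eq_0)
  then show ?case using assms(2) by simp
next
  case (Suc n)
  then obtain a where a: "a \<in> Poly_Mapping.keys \<epsilon>" by (metis all_not_in_conv mono_deg_def nat.distinct(1) sum.empty)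
  obtain \<nu> where \<nu>: "\<epsilon> = Poly_Mapping.single a 1 + \<nu>" using mono_remove[OF a] by blast
  have n: "n = mono_deg \<nu>" and k: "Poly_Mapping.keys \<nu> \<subseteq> A" "a \<in> A"
    using Suc.prems Suc.hyps(2) a \<nu> by (auto simp: mono_deg_add keys_add_nat)
  show ?case unfolding \<nu> by (rule assms(3)[OF k(2,1) Suc.hyps(1)[OF n k(1)]])
qed

text \<open>The family \<open>spanfam WL bL g\<close> may be any regular family of graded ideals;
  linear forms enter only at the end. Generators \<open>f l\<close> of positive degree make every
  bidegree finite, so the unit ideal is treated apart.\<close>

locale rees = generic F S RF
  for F :: "'g filter" and S :: "'g set" and RF :: "('g \<Rightarrow> 'k::field) set" +
  fixes d s :: nat and f :: "nat \<Rightarrow> (nat, 'k) mpol" and dl :: "nat \<Rightarrow> nat"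
    and WL :: "int \<Rightarrow> 'w set" and bL :: "'w \<Rightarrow> 'g \<Rightarrow> (nat, 'k) mpol"
  assumes f_hp: "l < s \<Longrightarrow> f l \<in> hp d (int (dl l))" and dl_pos: "l < s \<Longrightarrow> 1 \<le> dl l"
    and rL: "regfam WL bL" and L_hp: "g \<in> S \<Longrightarrow> spanfam WL bL g j \<subseteq> hp d j"
    and L_gmod: "g \<in> S \<Longrightarrow> gmod {..<d} Xp (spanfam WL bL g)"
begin

abbreviation "L \<equiv> spanfam WL bL"

text \<open>An index \<open>v < d\<close> stands for a variable of \<open>k[x]\<close>, the index
  \<open>d + l\<close> for the variable \<open>T_l\<close> of the Rees algebra. \<open>yv\<close>
  evaluates both in \<open>k[x]\<close>, while \<open>wt\<close> and \<open>tw\<close> record the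
  internal degree and the power.\<close>

definition yv :: "nat \<Rightarrow> (nat, 'k) mpol" where "yv v = (if v < d then mp_var v else f (v - d))"
definition wt :: "nat \<Rightarrow> nat" where "wt v = (if v < d then 1 else dl (v - d))"
definition tw :: "nat \<Rightarrow> nat" where "tw v = (if v < d then 0 else 1)"

abbreviation "ev \<equiv> mev yv"

lemma wt_pos: "v < d + s \<Longrightarrow> 1 \<le> wt v"
  using dl_pos[of "v - d"] by (simp add: wt_def)

lemma yv_hp: "v < d + s \<Longrightarrow> yv v \<in> hp d (int (wt v))"
  using f_hp[of "v - d"] hp_var[of v d] by (cases "v < d") (auto simp: yv_def wt_def)

lemma ev_hp:
  assumes "Poly_Mapping.keys \<epsilon> \<subseteq> {..<d + s}"
  shows "ev \<epsilon> \<in> hp d (int (wdeg wt \<epsilon>))"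
proof (rule mono_induct_keys[OF assms])
  show "ev 0 \<in> hp d (int (wdeg wt 0))" using hp_const[of 1 d] by simp
  fix v \<epsilon> assume v: "v \<in> {..<d + s}" and "Poly_Mapping.keys \<epsilon> \<subseteq> {..<d + s}" and e: "ev \<epsilon> \<in> hp d (int (wdeg wt \<epsilon>))"
  have "yv v * ev \<epsilon> \<in> hp d (int (wt v) + int (wdeg wt \<epsilon>))" by (rule hp_mult[OF yv_hp e]) (use v in simp)
  then show "ev (Poly_Mapping.single v 1 + \<epsilon>) \<in> hp d (int (wdeg wt (Poly_Mapping.single v 1 + \<epsilon>)))"
    by (simp add: mev_add wdeg_add)
qed

lemma L_mult: "g \<in> S \<Longrightarrow> q \<in> hp d i \<Longrightarrow> x \<in> L g j \<Longrightarrow> q * x \<in> L g (i + j)"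
proof -
  assume g: "g \<in> S" and q: "q \<in> hp d i" and x: "x \<in> L g j"
  have "Poly_Mapping.single m (lk q m) * x \<in> L g (i + j)" if m: "m \<in> Poly_Mapping.keys q" for m
  proof -
    have k: "Poly_Mapping.keys m \<subseteq> {..<d}" "int (mono_deg m) = i" using q m by (auto simp: hp_def)
    have "sp (lk q m) (mp_mono m * x) \<in> L g (j + int (mono_deg m))"
      using gmod_mono_mult[OF L_gmod[OF g] x k(1)] unfolding spanfam_def by (rule pv.span_scale)
    moreover have "sp (lk q m) (mp_mono m * x) = Poly_Mapping.single m (lk q m) * x"
      by (simp add: mult.assoc[symmetric] mult_single)
    moreover have "j + int (mono_deg m) = i + j" using k(2) by simp
    ultimately show ?thesis by (simp only:)
  qed
  then have "(\<Sum>m\<in>Poly_Mapping.keys q. Poly_Mapping.single m (lk q m) * x) \<in> L g (i + j)"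
    by (rule gmod_sum[OF L_gmod[OF g]])
  then show "q * x \<in> L g (i + j)" by (subst poly_sum_monomials[of q]) (simp add: sum_distrib_right)
qed

definition WJ :: "nat \<Rightarrow> int \<Rightarrow> (nat \<Rightarrow>\<^sub>0 nat) set" where
  "WJ n j = {\<epsilon>. Poly_Mapping.keys \<epsilon> \<subseteq> {..<d + s} \<and> wdeg tw \<epsilon> = n \<and> int (wdeg wt \<epsilon>) = j}"

lemma finite_WJ: "finite (WJ n j)"
proof (rule finite_subset)
  show "finite {m :: nat \<Rightarrow>\<^sub>0 nat. Poly_Mapping.keys m \<subseteq> {..<d + s} \<and> mono_deg m \<le> nat j}" by (rule finite_monos) simp
  have "mono_deg \<epsilon> \<le> nat j" if \<epsilon>: "\<epsilon> \<in> WJ n j" for \<epsilon>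
  proof -
    have "1 * mono_deg \<epsilon> \<le> wdeg wt \<epsilon>" by (rule wdeg_ge, rule wt_pos) (use \<epsilon> in \<open>auto simp: WJ_def\<close>)
    then show ?thesis using \<epsilon> by (auto simp: WJ_def)
  qed
  then show "WJ n j \<subseteq> {m. Poly_Mapping.keys m \<subseteq> {..<d + s} \<and> mono_deg m \<le> nat j}" by (auto simp: WJ_def)
qed

lemma WJ_hp: "\<epsilon> \<in> WJ n j \<Longrightarrow> ev \<epsilon> \<in> hp d j"
  using ev_hp[of \<epsilon>] by (auto simp: WJ_def)

text \<open>Index set of a regular spanning family for degree \<open>j\<close> of the
  \<open>n\<close>-th power plus \<open>L g\<close>. Only the part from \<open>L\<close> depends on
  \<open>g\<close>.\<close>

definition JW :: "nat \<Rightarrow> int \<Rightarrow> ((nat \<Rightarrow>\<^sub>0 nat) + 'w) set" where "JW n j = WJ n j <+> WL j"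
definition Jb :: "(nat \<Rightarrow>\<^sub>0 nat) + 'w \<Rightarrow> 'g \<Rightarrow> (nat, 'k) mpol" where "Jb = case_sum (\<lambda>\<epsilon> g. ev \<epsilon>) bL"
abbreviation "J n \<equiv> spanfam (JW n) Jb"

lemma rJ: "regfam (JW n) Jb"
  using rL finite_WJ by (auto simp: regfam_def JW_def Jb_def regp_const)

lemma J_eq: "J n g j = pv.span (ev ` WJ n j \<union> L g j)"
proof -
  have "(\<lambda>w. Jb w g) ` JW n j = ev ` WJ n j \<union> (\<lambda>w. bL w g) ` WL j"
    by (simp add: Jb_def JW_def Plus_def image_Un image_image)
  then show ?thesis unfolding spanfam_def span_Un_span by simp
qed

lemma L_J: "L g j \<subseteq> J n g j"
  unfolding J_eq using pv.span_superset[of "ev ` WJ n j \<union> L g j"] by blast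

lemma ev_J: "\<epsilon> \<in> WJ n j \<Longrightarrow> ev \<epsilon> \<in> J n g j"
  unfolding J_eq by (rule pv.span_base) simp

lemma subspace_hp: "pv.subspace (hp d j)"
  by (rule pv.subspaceI) (auto intro: hp_add hp_mult[OF hp_const, simplified])

lemma J_hp: "g \<in> S \<Longrightarrow> J n g j \<subseteq> hp d j"
  unfolding J_eq by (rule pv.span_minimal[OF _ subspace_hp]) (use L_hp WJ_hp in blast)

lemma WJ_mult: "v < d + s \<Longrightarrow> \<epsilon> \<in> WJ n j \<Longrightarrow> Poly_Mapping.single v 1 + \<epsilon> \<in> WJ (n + tw v) (j + int (wt v))"
  by (auto simp: WJ_def wdeg_add keys_add_nat)

lemma J_mult: "g \<in> S \<Longrightarrow> v < d + s \<Longrightarrow> x \<in> J n g j \<Longrightarrow> yv v * x \<in> J (n + tw v) g (j + int (wt v))"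
proof -
  assume g: "g \<in> S" and v: "v < d + s" and x: "x \<in> J n g j"
  have "yv v * z \<in> J (n + tw v) g (j + int (wt v))" if z: "z \<in> ev ` WJ n j \<union> L g j" for z
    using z
  proof
    assume "z \<in> ev ` WJ n j"
    then obtain \<epsilon> where e: "\<epsilon> \<in> WJ n j" "z = ev \<epsilon>" by blast
    show ?thesis using ev_J[OF WJ_mult[OF v e(1)]] by (simp add: mev_add e(2))
  next
    assume "z \<in> L g j"
    from L_mult[OF g yv_hp[OF v] this] show ?thesis using L_J by (auto simp: add.commute)
  qed
  then show ?thesis using x unfolding J_eq by (rule span_mult)
qed

lemma J_gmod: "g \<in> S \<Longrightarrow> gmod {..<d} Xp (J n g)"
  unfolding gmod_def
proof (intro allI conjI ballI)
  fix j assume g: "g \<in> S"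
  show "0 \<in> J n g j" unfolding spanfam_def by (rule pv.span_zero)
  show "x - y \<in> J n g j" if "x \<in> J n g j" "y \<in> J n g j" for x y
    using that unfolding spanfam_def by (rule pv.span_diff)
  show "mp_var a * x \<in> J n g (j + 1)" if "a \<in> {..<d}" "x \<in> J n g j" for a x
    using J_mult[OF g _ that(2), of a] that(1) by (simp add: yv_def tw_def wt_def)
qed

section \<open>Reductions\<close>

definition T :: "nat \<Rightarrow> nat set" where "T a = {d + l |l. l < s \<and> dl l \<le> a}"

lemma T_sub: "T a \<subseteq> {d..<d + s}" by (auto simp: T_def)

lemma finite_T: "finite (T a)" by (rule finite_subset[OF T_sub]) simp

text \<open>A reduction: modulo \<open>L\<close>, the products of \<open>N\<close> generators with a factor of degree at most \<open>a\<close>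
  generate the \<open>N\<close>-th power of the ideal.\<close>

definition redn :: "nat \<Rightarrow> nat \<Rightarrow> 'g \<Rightarrow> bool" where
  "redn N a g \<longleftrightarrow> (\<forall>j. ev ` WJ N j \<subseteq> pv.span (ev ` {\<epsilon> \<in> WJ N j. Poly_Mapping.keys \<epsilon> \<inter> T a \<noteq> {}} \<union> L g j))"

text \<open>Under \<open>redn N a\<close> these monomials generate, modulo \<open>L\<close> and from
  power \<open>N - 1\<close> on, everything as a module over the variables of \<open>k[x]\<close>
  and those in \<open>T a\<close>; see \<open>redn_gen\<close>.\<close>

definition \<Gamma> :: "nat \<Rightarrow> (nat \<Rightarrow>\<^sub>0 nat) set" where
  "\<Gamma> N = {\<gamma>. Poly_Mapping.keys \<gamma> \<subseteq> {d..<d + s} \<and> wdeg tw \<gamma> = N - 1}"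

lemma wdeg_tw_ge: "Poly_Mapping.keys \<gamma> \<subseteq> {d..} \<Longrightarrow> wdeg tw \<gamma> = mono_deg \<gamma>"
  unfolding wdeg_def mono_deg_def by (rule sum.cong) (auto simp: tw_def)

lemma wdeg_tw_less: "Poly_Mapping.keys \<gamma> \<subseteq> {..<d} \<Longrightarrow> wdeg tw \<gamma> = 0"
  unfolding wdeg_def by (rule sum.neutral) (auto simp: tw_def)

lemma finite_\<Gamma>: "finite (\<Gamma> N)"
proof (rule finite_subset)
  show "finite {m :: nat \<Rightarrow>\<^sub>0 nat. Poly_Mapping.keys m \<subseteq> {d..<d + s} \<and> mono_deg m \<le> N - 1}" by (rule finite_monos) simp
  have "wdeg tw \<gamma> = mono_deg \<gamma>" if "\<gamma> \<in> \<Gamma> N" for \<gamma> by (rule wdeg_tw_ge) (use that in \<open>auto simp: \<Gamma>_def\<close>)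
  then show "\<Gamma> N \<subseteq> {m. Poly_Mapping.keys m \<subseteq> {d..<d + s} \<and> mono_deg m \<le> N - 1}" by (auto simp: \<Gamma>_def)
qed

definition Rd :: "nat \<Rightarrow> nat \<Rightarrow> nat \<Rightarrow> int \<Rightarrow> (nat \<Rightarrow>\<^sub>0 nat) set" where
  "Rd N a n j = {\<epsilon> \<in> WJ n j. \<exists>\<gamma> \<epsilon>'. \<epsilon> = \<gamma> + \<epsilon>' \<and> \<gamma> \<in> \<Gamma> N \<and> Poly_Mapping.keys \<epsilon>' \<subseteq> {..<d} \<union> T a}"

text \<open>In power at least \<open>N\<close> a factor of power exactly \<open>N\<close> is split
  off and rewritten with some variable \<open>t\<close> in \<open>T a\<close>; removing
  \<open>t\<close> lowers the power by one, and the induction hypothesis applies to the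
  rest.\<close>

lemma redn_gen:
  assumes g: "g \<in> S" and r: "redn N a g" and N: "1 \<le> N"
  shows "\<epsilon> \<in> WJ (N - 1 + k) j \<Longrightarrow> ev \<epsilon> \<in> pv.span (ev ` Rd N a (N - 1 + k) j \<union> L g j)"
proof (induction k arbitrary: \<epsilon> j)
  case 0
  have "Poly_Mapping.keys \<epsilon> \<subseteq> {d..<d + s} \<union> {..<d}" using 0 by (auto simp: WJ_def)
  \<comment> \<open>In power \<open>N - 1\<close> the part of a monomial in the Rees variables is
    itself a member of \<open>\<Gamma> N\<close>.\<close>
  from mono_split[OF this] obtain \<gamma> \<epsilon>' where e: "\<epsilon> = \<gamma> + \<epsilon>'" "Poly_Mapping.keys \<gamma> \<subseteq> {d..<d + s}" "Poly_Mapping.keys \<epsilon>' \<subseteq> {..<d}" by blast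
  have "\<gamma> \<in> \<Gamma> N" using 0 wdeg_tw_less[OF e(3)] by (simp add: \<Gamma>_def e(2) WJ_def e(1) wdeg_add)
  then have "\<epsilon> \<in> Rd N a (N - 1 + 0) j" unfolding Rd_def using 0 e by blast
  then show ?case by (intro pv.span_base) blast
next
  case (Suc k)
  have tN: "wdeg tw \<epsilon> = N + k" using Suc.prems N by (simp add: WJ_def)
  have "tw v \<le> 1" for v by (simp add: tw_def)
  from mono_split_wdeg[of tw N \<epsilon>, OF this] tN obtain \<epsilon>1 \<epsilon>2 where e: "\<epsilon> = \<epsilon>1 + \<epsilon>2" "wdeg tw \<epsilon>1 = N" by auto
  define j1 where "j1 = int (wdeg wt \<epsilon>1)"
  have e1: "\<epsilon>1 \<in> WJ N j1" and k2: "Poly_Mapping.keys \<epsilon>2 \<subseteq> {..<d + s}" and t2: "wdeg tw \<epsilon>2 = k"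
    and j: "j = int (wdeg wt \<epsilon>2) + j1"
    using Suc.prems tN e by (auto simp: WJ_def keys_add_nat j1_def wdeg_add)
  have "ev \<epsilon>2 * x \<in> pv.span (ev ` Rd N a (N - 1 + Suc k) j \<union> L g j)"
    if x: "x \<in> ev ` {\<epsilon> \<in> WJ N j1. Poly_Mapping.keys \<epsilon> \<inter> T a \<noteq> {}} \<union> L g j1" for x
    using x
  proof
    assume "x \<in> L g j1"
    from L_mult[OF g ev_hp[OF k2] this] show ?thesis by (intro pv.span_base) (simp add: j)
  next
    assume "x \<in> ev ` {\<epsilon> \<in> WJ N j1. Poly_Mapping.keys \<epsilon> \<inter> T a \<noteq> {}}"
    then obtain \<mu> t where \<mu>: "x = ev \<mu>" "\<mu> \<in> WJ N j1" "t \<in> Poly_Mapping.keys \<mu>" "t \<in> T a" by blast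
    obtain \<mu>' where \<mu>': "\<mu> = Poly_Mapping.single t 1 + \<mu>'" using mono_remove[OF \<mu>(3)] by blast
    have td: "t < d + s" "tw t = 1" using T_sub[of a] \<mu>(4) by (auto simp: tw_def)
    define i where "i = int (wdeg wt (\<mu>' + \<epsilon>2))"
    have ji: "j = int (wt t) + i" using \<mu>(2) by (simp add: i_def j WJ_def \<mu>' wdeg_add)
    have tt: "wdeg tw (\<mu>' + \<epsilon>2) = N - 1 + k" using \<mu>(2) N td(2) t2 by (auto simp: WJ_def \<mu>' wdeg_add)
    have "\<mu>' + \<epsilon>2 \<in> WJ (N - 1 + k) i" using \<mu>(2) k2 tt by (auto simp: WJ_def \<mu>' keys_add_nat i_def)
    note IH = Suc.IH[OF this]
    have "yv t * z \<in> pv.span (ev ` Rd N a (N - 1 + Suc k) j \<union> L g j)" if z: "z \<in> ev ` Rd N a (N - 1 + k) i \<union> L g i" for z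
      using z
    proof
      assume "z \<in> L g i"
      from L_mult[OF g yv_hp[OF td(1)] this] show ?thesis by (intro pv.span_base) (simp add: ji)
    next
      assume "z \<in> ev ` Rd N a (N - 1 + k) i"
      then obtain \<gamma> \<epsilon>' where z: "z = ev (\<gamma> + \<epsilon>')" "\<gamma> + \<epsilon>' \<in> WJ (N - 1 + k) i" "\<gamma> \<in> \<Gamma> N" "Poly_Mapping.keys \<epsilon>' \<subseteq> {..<d} \<union> T a"
        unfolding Rd_def by blast
      have "Poly_Mapping.single t 1 + (\<gamma> + \<epsilon>') \<in> WJ (N - 1 + Suc k) j"
        using WJ_mult[OF td(1) z(2)] by (simp add: td(2) ji add.commute One_nat_def)
      moreover have "Poly_Mapping.single t 1 + (\<gamma> + \<epsilon>') = \<gamma> + (Poly_Mapping.single t 1 + \<epsilon>')" by (simp add: ac_simps)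
      moreover have "Poly_Mapping.keys (Poly_Mapping.single t 1 + \<epsilon>') \<subseteq> {..<d} \<union> T a" using z(4) \<mu>(4) by (auto simp: keys_add_nat)
      ultimately have "Poly_Mapping.single t 1 + (\<gamma> + \<epsilon>') \<in> Rd N a (N - 1 + Suc k) j" unfolding Rd_def using z(3) by blast
      then have "ev (Poly_Mapping.single t 1 + (\<gamma> + \<epsilon>')) \<in> pv.span (ev ` Rd N a (N - 1 + Suc k) j \<union> L g j)" by (intro pv.span_base) blast
      then show ?thesis by (simp add: z(1) mev_add)
    qed
    from span_mult[OF this IH] show ?thesis by (simp add: \<mu>(1) \<mu>' mev_add ac_simps)
  qed
  moreover have "ev \<epsilon>1 \<in> pv.span (ev ` {\<epsilon> \<in> WJ N j1. Poly_Mapping.keys \<epsilon> \<inter> T a \<noteq> {}} \<union> L g j1)"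
    using r e1 unfolding redn_def by blast
  ultimately have "ev \<epsilon>2 * ev \<epsilon>1 \<in> pv.span (ev ` Rd N a (N - 1 + Suc k) j \<union> L g j)" by (rule span_mult)
  then show ?case by (simp add: e(1) mev_add mult.commute)
qed

lemma J_Rd:
  assumes "g \<in> S" "redn N a g" "1 \<le> N" "N - 1 \<le> n"
  shows "J n g j = pv.span (ev ` Rd N a n j \<union> L g j)"
proof (rule subset_antisym)
  obtain k where k: "n = N - 1 + k" using assms(4) le_Suc_ex by blast
  have "ev \<epsilon> \<in> pv.span (ev ` Rd N a n j \<union> L g j)" if "\<epsilon> \<in> WJ n j" for \<epsilon>
    using redn_gen[OF assms(1-3), of \<epsilon> k j] that by (simp only: k)
  moreover have "x \<in> pv.span (ev ` Rd N a n j \<union> L g j)" if "x \<in> L g j" for x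
    by (rule pv.span_base) (simp add: that)
  ultimately show "J n g j \<subseteq> pv.span (ev ` Rd N a n j \<union> L g j)" unfolding J_eq
    by (intro pv.span_minimal pv.subspace_span) auto
  show "pv.span (ev ` Rd N a n j \<union> L g j) \<subseteq> J n g j" unfolding J_eq
    by (rule pv.span_mono) (auto simp: Rd_def)
qed

text \<open>All generators have positive degree, so \<open>T 0\<close> is empty and
  \<open>redn N 0\<close> puts the \<open>N\<close>-th power inside \<open>L\<close>.\<close>

lemma J_stable:
  assumes g: "g \<in> S" and r: "redn N 0 g" and n: "N \<le> n"
  shows "J n g j = L g j"
proof (rule subset_antisym[OF _ L_J])
  have T0: "T 0 = {}" using dl_pos by (force simp: T_def)
  have "ev \<epsilon> \<in> L g j" if \<epsilon>: "\<epsilon> \<in> WJ n j" for \<epsilon>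
  proof -
    have "tw v \<le> 1" for v by (simp add: tw_def)
    from mono_split_wdeg[of tw N \<epsilon>, OF this] \<epsilon> n obtain \<epsilon>1 \<epsilon>2 where e: "\<epsilon> = \<epsilon>1 + \<epsilon>2" "wdeg tw \<epsilon>1 = N" by (auto simp: WJ_def)
    have e1: "\<epsilon>1 \<in> WJ N (int (wdeg wt \<epsilon>1))" and k2: "Poly_Mapping.keys \<epsilon>2 \<subseteq> {..<d + s}"
      and j: "j = int (wdeg wt \<epsilon>2) + int (wdeg wt \<epsilon>1)"
      using \<epsilon> e by (auto simp: WJ_def keys_add_nat wdeg_add)
    have "ev \<epsilon>1 \<in> pv.span (L g (int (wdeg wt \<epsilon>1)))" using r e1 unfolding redn_def T0 by auto
    then have "ev \<epsilon>1 \<in> L g (int (wdeg wt \<epsilon>1))" unfolding spanfam_def pv.span_span .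
    from L_mult[OF g ev_hp[OF k2] this] show ?thesis by (simp add: e(1) mev_add mult.commute j)
  qed
  then show "J n g j \<subseteq> L g j" unfolding J_eq
    by (intro pv.span_minimal subspace_spanfam) auto
qed

end

section \<open>Koszul homology of all powers\<close>

lemma sgs_mult: "sgs a \<tau> ((q :: 'r::comm_ring) * y) = q * sgs a \<tau> y"
  by (simp add: sgs_def)

lemma bd_scale: "bd V Xp (\<lambda>\<sigma>. q * x \<sigma>) = (\<lambda>\<sigma>. q * bd V Xp x \<sigma>)"
  by (rule ext) (simp add: bd_def sum_distrib_left sgs_mult mult.left_commute[of _ q])

lemma cv_span_scale:
  assumes q: "\<And>x. x \<in> A \<Longrightarrow> (\<lambda>\<sigma>. q * x \<sigma>) \<in> cv.span B" and y: "y \<in> cv.span A"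
  shows "(\<lambda>\<sigma>. q * y \<sigma>) \<in> cv.span B"
proof -
  have "cv.subspace {y. (\<lambda>\<sigma>. q * y \<sigma>) \<in> cv.span B}"
  proof (rule cv.subspaceI)
    show "0 \<in> {y. (\<lambda>\<sigma>. q * y \<sigma>) \<in> cv.span B}" using cv.span_zero[of B] by (simp add: zero_fun_def)
    fix x assume x: "x \<in> {y. (\<lambda>\<sigma>. q * y \<sigma>) \<in> cv.span B}"
    show "x + y \<in> {y. (\<lambda>\<sigma>. q * y \<sigma>) \<in> cv.span B}" if "y \<in> {y. (\<lambda>\<sigma>. q * y \<sigma>) \<in> cv.span B}" for y
      using cv.span_add[of "\<lambda>\<sigma>. q * x \<sigma>" B "\<lambda>\<sigma>. q * y \<sigma>"] x that by (simp add: plus_fun_def distrib_left)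
    show "cs c x \<in> {y. (\<lambda>\<sigma>. q * y \<sigma>) \<in> cv.span B}" for c
      using cv.span_scale[of "\<lambda>\<sigma>. q * x \<sigma>" B c] x by (simp add: cs_def mult.left_commute[of q])
  qed
  then have "cv.span A \<subseteq> {y. (\<lambda>\<sigma>. q * y \<sigma>) \<in> cv.span B}" by (rule cv.span_minimal[rotated]) (use q in blast)
  then show ?thesis using y by blast
qed

text \<open>Free of coordinates: some member of \<open>Z\<close> agrees with \<open>x\<close> modulo
  the span of the smaller vectors. This form passes through multiplication.\<close>

lemma lead_iff:
  assumes "finite A"
  shows "(\<exists>c. x + (\<Sum>v\<in>A. cs (c v) (y v)) \<in> Z) \<longleftrightarrow> (\<exists>z\<in>Z. z - x \<in> cv.span (y ` A))"
proof
  assume "\<exists>c. x + (\<Sum>v\<in>A. cs (c v) (y v)) \<in> Z"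
  then obtain c where c: "x + (\<Sum>v\<in>A. cs (c v) (y v)) \<in> Z" ..
  show "\<exists>z\<in>Z. z - x \<in> cv.span (y ` A)"
    by (rule bexI[OF _ c], simp only: cv.span_image_iff[OF assms], rule exI[of _ c]) simp
next
  assume "\<exists>z\<in>Z. z - x \<in> cv.span (y ` A)"
  then obtain z c where "z \<in> Z" "z - x = (\<Sum>v\<in>A. cs (c v) (y v))" unfolding cv.span_image_iff[OF assms] by blast
  then show "\<exists>c. x + (\<Sum>v\<in>A. cs (c v) (y v)) \<in> Z" by (intro exI[of _ c]) (simp add: diff_eq_eq add.commute)
qed

text \<open>Multiplication by \<open>q\<close> carries the ordered family to itself by a monotone
  shift \<open>\<tau>\<close>, so a lead index \<open>w\<close> goes to \<open>\<tau> w\<close>. The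
  second premise of \<open>ZZ\<close> lets \<open>z\<close> be recognized as a chain of the
  module.\<close>

lemma lead_shift:
  fixes y :: "'w::linorder \<Rightarrow> nat set \<Rightarrow> (nat, 'k::field) mpol"
  assumes W: "finite W" "finite W'" and w: "w \<in> W"
    and ym: "\<And>v. v \<in> W \<Longrightarrow> (\<lambda>\<sigma>. q * y v \<sigma>) = y (\<tau> v)"
    and \<tau>: "\<And>v. v \<in> W \<Longrightarrow> v < w \<Longrightarrow> \<tau> v \<in> W' \<and> \<tau> v < \<tau> w"
    and ZZ: "\<And>z. z \<in> Z \<Longrightarrow> z - y w \<in> cv.span (y ` {v \<in> W. v < w}) \<Longrightarrow> (\<lambda>\<sigma>. q * z \<sigma>) \<in> Z'"
    and ld: "\<exists>c. y w + (\<Sum>v\<in>{v \<in> W. v < w}. cs (c v) (y v)) \<in> Z"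
  shows "\<exists>c. y (\<tau> w) + (\<Sum>v\<in>{v \<in> W'. v < \<tau> w}. cs (c v) (y v)) \<in> Z'"
proof -
  have f: "finite {v \<in> W. v < w}" "finite {v \<in> W'. v < \<tau> w}" using W by simp_all
  obtain z where z: "z \<in> Z" "z - y w \<in> cv.span (y ` {v \<in> W. v < w})" using ld unfolding lead_iff[OF f(1)] by blast
  have "(\<lambda>\<sigma>. q * (z - y w) \<sigma>) \<in> cv.span (y ` {v \<in> W'. v < \<tau> w})"
  proof (rule cv_span_scale[OF _ z(2)])
    fix x assume "x \<in> y ` {v \<in> W. v < w}"
    then obtain v where v: "x = y v" "v \<in> W" "v < w" by blast
    show "(\<lambda>\<sigma>. q * x \<sigma>) \<in> cv.span (y ` {v \<in> W'. v < \<tau> w})"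
      unfolding v(1) ym[OF v(2)] by (rule cv.span_base) (use \<tau>[OF v(2,3)] in blast)
  qed
  moreover have "(\<lambda>\<sigma>. q * (z - y w) \<sigma>) = (\<lambda>\<sigma>. q * z \<sigma>) - y (\<tau> w)"
    unfolding ym[OF w, symmetric] by (rule ext) (simp add: right_diff_distrib)
  ultimately show ?thesis unfolding lead_iff[OF f(2)] using ZZ[OF z] by auto
qed

context rees
begin

lemma CS_mult: "g \<in> S \<Longrightarrow> v < d + s \<Longrightarrow> x \<in> CS U (L g) j \<Longrightarrow> (\<lambda>\<sigma>. yv v * x \<sigma>) \<in> CS U (L g) (j + int (wt v))"
proof -
  assume g: "g \<in> S" and v: "v < d + s" and x: "x \<in> CS U (L g) j"
  have "yv v * x \<sigma> \<in> L g (j + int (wt v) - int (card \<sigma>))" for \<sigma>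
  proof -
    have "x \<sigma> \<in> L g (j - int (card \<sigma>))" using x by (simp add: CS_def)
    from L_mult[OF g yv_hp[OF v] this] show ?thesis by (simp add: algebra_simps)
  qed
  moreover have "yv v * x \<sigma> \<noteq> 0 \<Longrightarrow> \<sigma> \<in> U" for \<sigma> using x by (auto simp: CS_def)
  ultimately show ?thesis by (simp add: CS_def)
qed

lemma Zs_mult: "g \<in> S \<Longrightarrow> v < d + s \<Longrightarrow> x \<in> Zs V (L g) j \<Longrightarrow> (\<lambda>\<sigma>. yv v * x \<sigma>) \<in> Zs V (L g) (j + int (wt v))"
  unfolding Zs_def mem_Collect_eq bd_scale by (rule CS_mult)

lemma Kc_mult: "g \<in> S \<Longrightarrow> v < d + s \<Longrightarrow> x \<in> Kc V p (J n g) j \<Longrightarrow> (\<lambda>\<sigma>. yv v * x \<sigma>) \<in> Kc V p (J (n + tw v) g) (j + int (wt v))"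
proof (rule KcI)
  assume g: "g \<in> S" and v: "v < d + s" and x: "x \<in> Kc V p (J n g) j"
  show "yv v * x \<sigma> \<in> J (n + tw v) g (j + int (wt v) - int (card \<sigma>))" for \<sigma>
    using J_mult[OF g v Kc_mem[OF x, of \<sigma>]] by (simp add: algebra_simps)
  show "\<sigma> \<subseteq> V \<and> card \<sigma> = p" if "yv v * x \<sigma> \<noteq> 0" for \<sigma> using that by (intro Kc_support[OF x]) auto
qed

lemma Bs_mult:
  assumes g: "g \<in> S" and v: "v < d + s" and x: "x \<in> Bs V p (J n g) (L g) j"
  shows "(\<lambda>\<sigma>. yv v * x \<sigma>) \<in> Bs V p (J (n + tw v) g) (L g) (j + int (wt v))"
proof -
  obtain u where u: "u \<in> Kc V (Suc p) (J n g) j" "x - bd V Xp u \<in> CS (Pow V) (L g) j" using x by (auto simp: Bs_def)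
  have "(\<lambda>\<sigma>. yv v * x \<sigma>) - bd V Xp (\<lambda>\<sigma>. yv v * u \<sigma>) = (\<lambda>\<sigma>. yv v * (x - bd V Xp u) \<sigma>)"
    unfolding bd_scale by (rule ext) (simp add: right_diff_distrib)
  then have "(\<lambda>\<sigma>. yv v * x \<sigma>) - bd V Xp (\<lambda>\<sigma>. yv v * u \<sigma>) \<in> CS (Pow V) (L g) (j + int (wt v))"
    using CS_mult[OF g v u(2)] by (simp only:)
  then show ?thesis unfolding Bs_def using Kc_mult[OF g v u(1)] by blast
qed

text \<open>The homotopy formula: \<open>x_a z\<close> differs from the boundary of
  \<open>e_a \<and> z\<close> by \<open>e_a \<and> dz\<close>, which lies in \<open>L\<close> when
  \<open>z\<close> is a cycle modulo \<open>L\<close>.\<close>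

lemma var_Zs_Bs:
  assumes g: "g \<in> S" and a: "a < d" and z: "z \<in> Zs {..<d} (L g) j" and zK: "z \<in> Kc {..<d} p (J n g) j"
  shows "(\<lambda>\<sigma>. yv a * z \<sigma>) \<in> Bs {..<d} p (J (n + tw a) g) (L g) (j + int (wt a))"
proof -
  let ?V = "{..<d}"
  have ya: "yv a = mp_var a" "tw a = 0" "wt a = 1" using a by (simp_all add: yv_def tw_def wt_def)
  have card: "int (card (\<sigma> - {a})) = int (card \<sigma>) - 1" if "a \<in> \<sigma>" "\<sigma> \<subseteq> ?V" for \<sigma>
    using card_Suc_Diff1[of \<sigma> a] that finite_subset[OF that(2)] by simp
  have cj: "j - int (card (\<sigma> - {a})) = j + 1 - int (card \<sigma>)" if "a \<in> \<sigma>" "\<sigma> \<subseteq> ?V" for \<sigma>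
    using card[OF that] by simp
  have w: "wedge a z \<in> Kc ?V (Suc p) (J n g) (j + 1)"
  proof (rule KcI)
    show "wedge a z \<sigma> \<in> J n g (j + 1 - int (card \<sigma>))" for \<sigma>
    proof (cases "a \<in> \<sigma> \<and> z (\<sigma> - {a}) \<noteq> 0")
      case True
      then have "\<sigma> \<subseteq> ?V" using Kc_support[OF zK, of "\<sigma> - {a}"] a by auto
      then have "z (\<sigma> - {a}) \<in> J n g (j + 1 - int (card \<sigma>))" using Kc_mem[OF zK, of "\<sigma> - {a}"] cj[of \<sigma>] True by (simp only:)
      then show ?thesis using True gmod_sgs[OF J_gmod[OF g]] by (simp add: wedge_def)
    next
      case False
      then have "wedge a z \<sigma> = 0" by (auto simp: wedge_def)
      then show ?thesis using gmod_zero[OF J_gmod[OF g]] by simp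
    qed
    show "\<sigma> \<subseteq> ?V \<and> card \<sigma> = Suc p" if nz: "wedge a z \<sigma> \<noteq> 0" for \<sigma>
    proof -
      have n: "a \<in> \<sigma>" "z (\<sigma> - {a}) \<noteq> 0" using nz by (auto simp: wedge_def split: if_splits)
      then have "\<sigma> \<subseteq> ?V" "card (\<sigma> - {a}) = p" using Kc_support[OF zK, of "\<sigma> - {a}"] a by auto
      then show ?thesis using card[OF n(1)] card_Suc_Diff1[of \<sigma> a] n(1) finite_subset by fastforce
    qed
  qed
  \<comment> \<open>The homotopy formula concerns subsets of the variable set; elsewhere the left
    side vanishes by the support of \<open>z\<close>.\<close>
  have "(\<lambda>\<sigma>. mp_var a * z \<sigma>) - bd ?V Xp (wedge a z) = (\<lambda>\<sigma>. if \<sigma> \<subseteq> ?V then wedge a (bd ?V Xp z) \<sigma> else 0)"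
  proof
    fix \<sigma>
    show "((\<lambda>\<sigma>. mp_var a * z \<sigma>) - bd ?V Xp (wedge a z)) \<sigma> = (if \<sigma> \<subseteq> ?V then wedge a (bd ?V Xp z) \<sigma> else 0)"
    proof (cases "\<sigma> \<subseteq> ?V")
      case True
      then show ?thesis using kop.bd_wedge[OF kop_Xp, of ?V a \<sigma> z] a by simp
    next
      case False
      then have "z \<sigma> = 0" using Kc_support[OF zK] by blast
      then show ?thesis using False by (simp add: bd_def)
    qed
  qed
  moreover have "(\<lambda>\<sigma>. if \<sigma> \<subseteq> ?V then wedge a (bd ?V Xp z) \<sigma> else 0) \<in> CS (Pow ?V) (L g) (j + 1)"
  proof -
    have bz: "bd ?V Xp z \<tau> \<in> L g (j - int (card \<tau>))" for \<tau> using z by (simp add: Zs_def CS_def)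
    have "(if \<sigma> \<subseteq> ?V then wedge a (bd ?V Xp z) \<sigma> else 0) \<in> L g (j + 1 - int (card \<sigma>))" for \<sigma>
    proof (cases "\<sigma> \<subseteq> ?V \<and> a \<in> \<sigma>")
      case True
      then have "bd ?V Xp z (\<sigma> - {a}) \<in> L g (j + 1 - int (card \<sigma>))" using bz[of "\<sigma> - {a}"] cj[of \<sigma>] by (simp only:)
      then show ?thesis using True gmod_sgs[OF L_gmod[OF g]] by (simp add: wedge_def)
    next
      case False
      then show ?thesis using gmod_zero[OF L_gmod[OF g]] by (auto simp: wedge_def)
    qed
    then show ?thesis by (simp add: CS_def)
  qed
  ultimately show ?thesis unfolding Bs_def mem_Collect_eq ya
    by (intro bexI[of _ "wedge a z"]) (use w in simp_all)
qed

lemma subspace_Kc_J: "cv.subspace (Kc V p (J n g) j)"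
  unfolding Kc_CS by (rule subspace_CS) (rule subspace_spanfam)

text \<open>Over \<open>k[x]\<close> and the variables in \<open>T a\<close> the chains of all large
  powers form a finitely generated bigraded module modulo \<open>L\<close>. The bidegrees of nonzero
  homology are those of generic leads of cycles that are not generic leads of boundaries, a
  difference to which \<open>evlin_difference\<close> applies.\<close>

lemma growth:
  assumes N: "1 \<le> N" and r: "eventually (redn N a) F"
  shows "evlin (wt ` T a) {(j - int p, n) |j n. N - 1 \<le> n \<and> eventually (\<lambda>g. \<not> hzr {..<d} Xp p (J n g) (L g) j) F}"
proof -
  let ?V = "{..<d}"
  \<comment> \<open>Generators of the module: a Koszul basis element \<open>e_\<sigma>\<close> with
    a monomial of \<open>\<Gamma> N\<close>. They get numbered by \<open>h\<close> because lead
    indices need a linear order, which sets do not have.\<close>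
  define C0 where "C0 = {\<sigma>. \<sigma> \<subseteq> ?V \<and> card \<sigma> = p} \<times> \<Gamma> N"
  have fS: "finite {\<sigma>. \<sigma> \<subseteq> ?V \<and> card \<sigma> = p}" by (rule finite_subset[of _ "Pow ?V"]) auto
  have fC0: "finite C0" unfolding C0_def using fS finite_\<Gamma> by (rule finite_cartesian_product)
  obtain h where "bij_betw h {0..<card C0} C0" using ex_bij_betw_nat_finite[OF fC0] ..
  then have h: "h ` {..<card C0} = C0" by (simp add: bij_betw_def atLeast0LessThan)
  define K where "K = card C0"
  have hk: "fst (h k) \<subseteq> ?V" "card (fst (h k)) = p" "snd (h k) \<in> \<Gamma> N" if "k < K" for k
  proof -
    have "h k \<in> h ` {..<card C0}" by (rule imageI) (use that in \<open>simp add: K_def\<close>)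
    then have "h k \<in> C0" by (simp only: h)
    then show "fst (h k) \<subseteq> ?V" "card (fst (h k)) = p" "snd (h k) \<in> \<Gamma> N" by (simp_all add: C0_def mem_Times_iff)
  qed
  \<comment> \<open>An index \<open>w\<close> is a generator number together with a monomial in the
    variables of \<open>k[x]\<close> and \<open>T a\<close>; \<open>jd\<close> and \<open>nd\<close>
    are its internal degree and power, where \<open>p\<close> is the degree of
    \<open>e_\<sigma>\<close>.\<close>
  define Y where "Y w = esing (fst (h (fst w))) (ev (snd (h (fst w)) + snd w))" for w :: "nat \<times> (nat \<Rightarrow>\<^sub>0 nat)"
  define jd where "jd w = int p + int (wdeg wt (snd (h (fst w)) + snd w))" for w :: "nat \<times> (nat \<Rightarrow>\<^sub>0 nat)"
  define nd where "nd w = N - 1 + wdeg tw (snd w)" for w :: "nat \<times> (nat \<Rightarrow>\<^sub>0 nat)"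
  define ok where "ok w \<longleftrightarrow> fst w < K \<and> Poly_Mapping.keys (snd w) \<subseteq> ?V \<union> T a" for w :: "nat \<times> (nat \<Rightarrow>\<^sub>0 nat)"
  define W where "W j n = {w. ok w \<and> jd w = j \<and> nd w = n}" for j n
  have T': "v < d + s" if "v \<in> ?V \<union> T a" for v using that T_sub[of a] by auto
  have mem: "snd (h (fst w)) + snd w \<in> Rd N a n (j - int p)" if w: "w \<in> W j n" for w j n
  proof -
    have w': "ok w" "jd w = j" "nd w = n" using w by (simp_all add: W_def)
    note hh = hk[of "fst w"]
    have "Poly_Mapping.keys (snd (h (fst w)) + snd w) \<subseteq> {..<d + s}"
      using hh(3) w'(1) T' unfolding ok_def keys_add_nat \<Gamma>_def by fastforce
    moreover have "wdeg tw (snd (h (fst w)) + snd w) = n"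
      using hh(3) w'(1,3) by (simp add: ok_def wdeg_add \<Gamma>_def nd_def)
    moreover have "int (wdeg wt (snd (h (fst w)) + snd w)) = j - int p" using w'(2) by (simp add: jd_def)
    ultimately have "snd (h (fst w)) + snd w \<in> WJ n (j - int p)" by (simp add: WJ_def)
    then show ?thesis unfolding Rd_def using hh(3) w'(1) by (auto simp: ok_def)
  qed
  have fW: "finite (W j n)" for j n
  proof (rule finite_subset)
    show "finite ({..<K} \<times> {m :: nat \<Rightarrow>\<^sub>0 nat. Poly_Mapping.keys m \<subseteq> ?V \<union> T a \<and> mono_deg m \<le> nat j})"
      by (intro finite_cartesian_product finite_monos) (simp_all add: finite_T)
    show "W j n \<subseteq> {..<K} \<times> {m. Poly_Mapping.keys m \<subseteq> ?V \<union> T a \<and> mono_deg m \<le> nat j}"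
    proof
      fix w assume w: "w \<in> W j n"
      have "1 * mono_deg (snd w) \<le> wdeg wt (snd w)" by (rule wdeg_ge, rule wt_pos) (use w T' in \<open>auto simp: W_def ok_def\<close>)
      then show "w \<in> {..<K} \<times> {m. Poly_Mapping.keys m \<subseteq> ?V \<union> T a \<and> mono_deg m \<le> nat j}"
        using w by (auto simp: W_def ok_def jd_def wdeg_add mem_Times_iff)
    qed
  qed
  have YK: "Y w \<in> Kc ?V p (J n g) j" if w: "w \<in> W j n" for w j n g
  proof (rule KcI)
    have k: "fst w < K" using w by (simp add: W_def ok_def)
    have "ev (snd (h (fst w)) + snd w) \<in> J n g (j - int p)" by (rule ev_J) (use mem[OF w] in \<open>simp add: Rd_def\<close>)
    then show "Y w \<tau> \<in> J n g (j - int (card \<tau>))" for \<tau> using hk(2)[OF k] by (simp add: Y_def esing_def pv.subspace_0[OF subspace_spanfam])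
    show "\<tau> \<subseteq> ?V \<and> card \<tau> = p" if "Y w \<tau> \<noteq> 0" for \<tau> using that hk[OF k] by (simp add: Y_def esing_def split: if_splits)
  qed
  \<comment> \<open>At points where the reduction holds, the \<open>Y w\<close> span the chains
    modulo \<open>L\<close>; this is where \<open>redn\<close> enters.\<close>
  have Fr: "\<exists>c. v - (\<Sum>w\<in>W j n. cs (c w) (Y w)) \<in> CS (Pow ?V) (L g) j"
    if g: "g \<in> S" "redn N a g" and n: "N - 1 \<le> n" and v: "v \<in> Kc ?V p (J n g) j" for g n j v
  proof -
    define b where "b = case_sum ev (\<lambda>w. bL w g)"
    define B where "B j = Rd N a n j <+> WL j" for j
    have fB: "finite (B j)" for j using finite_WJ[of n j] rL by (simp add: B_def Rd_def regfam_def)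
    have "b ` B j = ev ` Rd N a n j \<union> (\<lambda>w. bL w g) ` WL j" for j
      by (simp add: b_def B_def Plus_def image_Un image_image)
    then have JB: "J n g j = pv.span (b ` B j)" for j
      unfolding J_Rd[OF g N n] by (simp add: spanfam_def span_Un_span)
    note sL = subspace_CS[of "L g" "Pow ?V" j, OF subspace_spanfam]
    let ?U = "{u. \<exists>y\<in>cv.span (Y ` W j n). u - y \<in> CS (Pow ?V) (L g) j}"
    have sU: "cv.subspace ?U"
    proof (rule cv.subspaceI)
      show "0 \<in> ?U" using cv.span_zero[of "Y ` W j n"] cv.subspace_0[OF sL] by force
      fix x assume "x \<in> ?U"
      then obtain y where y: "y \<in> cv.span (Y ` W j n)" "x - y \<in> CS (Pow ?V) (L g) j" by blast
      show "x + x' \<in> ?U" if x': "x' \<in> ?U" for x'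
      proof -
        obtain y' where y': "y' \<in> cv.span (Y ` W j n)" "x' - y' \<in> CS (Pow ?V) (L g) j" using x' by blast
        have "(x + x') - (y + y') \<in> CS (Pow ?V) (L g) j" using cv.subspace_add[OF sL y(2) y'(2)] by (simp add: algebra_simps)
        then show ?thesis using cv.span_add[OF y(1) y'(1)] by blast
      qed
      show "cs c x \<in> ?U" for c
        using cv.subspace_scale[OF sL y(2), of c] cv.span_scale[OF y(1), of c] by (auto simp: cv.scale_right_diff_distrib)
    qed
    have "Kc ?V p (J n g) j \<subseteq> ?U"
      unfolding Kc_CS CS_span[OF fS fB JB]
    proof (rule cv.span_minimal[OF _ sU], rule image_subsetI)
      fix i assume "i \<in> (SIGMA \<sigma>:{\<sigma>. \<sigma> \<subseteq> ?V \<and> card \<sigma> = p}. B (j - int (card \<sigma>)))"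
      then obtain \<sigma> l where i: "i = (\<sigma>, l)" "\<sigma> \<subseteq> ?V" "card \<sigma> = p" "l \<in> B (j - int p)" by blast
      have "esing \<sigma> (b l) \<in> ?U"
        using i(4) unfolding B_def
      proof (rule PlusE)
        fix \<rho> assume l: "l = Inl \<rho>" "\<rho> \<in> Rd N a n (j - int p)"
        then obtain \<gamma> \<epsilon>' where \<rho>: "\<rho> = \<gamma> + \<epsilon>'" "\<gamma> \<in> \<Gamma> N" "Poly_Mapping.keys \<epsilon>' \<subseteq> ?V \<union> T a" "\<rho> \<in> WJ n (j - int p)" by (auto simp: Rd_def)
        have "(\<sigma>, \<gamma>) \<in> C0" using i(2,3) \<rho>(2) by (simp add: C0_def)
        then have "(\<sigma>, \<gamma>) \<in> h ` {..<K}" by (simp only: h K_def)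
        then obtain k where k: "k < K" "h k = (\<sigma>, \<gamma>)" by (elim imageE) simp
        have "(k, \<epsilon>') \<in> W j n" using \<rho> k by (simp add: W_def ok_def jd_def nd_def WJ_def wdeg_add \<Gamma>_def)
        moreover have "esing \<sigma> (b l) = Y (k, \<epsilon>')" by (simp add: Y_def k(2) b_def l(1) \<rho>(1))
        ultimately have "esing \<sigma> (b l) \<in> cv.span (Y ` W j n)" by (intro cv.span_base) auto
        then show ?thesis using cv.subspace_0[OF sL] by force
      next
        fix w assume l: "l = Inr w" "w \<in> WL (j - int p)"
        have "bL w g \<in> L g (j - int p)" unfolding spanfam_def by (rule pv.span_base) (use l in blast)
        then have "esing \<sigma> (b l) \<in> CS (Pow ?V) (L g) j"
          using i(2,3) by (auto simp: CS_def esing_def b_def l(1) pv.subspace_0[OF subspace_spanfam])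
        then show ?thesis using cv.span_zero[of "Y ` W j n"] by force
      qed
      then show "(case i of (\<sigma>, w) \<Rightarrow> esing \<sigma> (b w)) \<in> ?U" by (simp add: i(1))
    qed
    then obtain y where y: "y \<in> cv.span (Y ` W j n)" "v - y \<in> CS (Pow ?V) (L g) j" using v by blast
    obtain c where "y = (\<Sum>w\<in>W j n. cs (c w) (Y w))" using y(1) unfolding cv.span_image_iff[OF fW] by blast
    then show ?thesis using y(2) by blast
  qed
  define ld where "ld w Z \<longleftrightarrow> (\<exists>c. Y w + (\<Sum>v\<in>{v \<in> W (jd w) (nd w). v < w}. cs (c v) (Y v)) \<in> Z)" for w Z
  \<comment> \<open>Generic leads of cycles, and below of boundaries. They do not depend on
    \<open>g\<close>, so Dickson's lemma applies once to all bidegrees.\<close>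
  define LZ where "LZ = {w. ok w \<and> eventually (\<lambda>g. ld w (Zs ?V (L g) (jd w))) F}"
  define LB where "LB = {w. ok w \<and> eventually (\<lambda>g. ld w (Bs ?V p (J (nd w) g) (L g) (jd w))) F}"
  have WW: "w \<in> W (jd w) (nd w)" if "ok w" for w using that by (simp add: W_def)
  have rY: "regc (\<lambda>g. Y w)" for w unfolding Y_def by (intro regc_esing regp_const)
  have decZ: "decided (\<lambda>g. ld w (Zs ?V (L g) (jd w)))" and decB: "decided (\<lambda>g. ld w (Bs ?V p (J (nd w) g) (L g) (jd w)))"
    if "ok w" for w
    using leads_decided[OF finite_lessThan rJ rL fW, where y="\<lambda>w g. Y w", OF rY WW[OF that]] unfolding ld_def by blast+
  define \<tau> where "\<tau> v w = (fst w, Poly_Mapping.single v 1 + snd w)" for v and w :: "nat \<times> (nat \<Rightarrow>\<^sub>0 nat)"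
  have jd\<tau>: "jd (\<tau> v w) = jd w + int (wt v)" and nd\<tau>: "nd (\<tau> v w) = nd w + tw v" for v w
    by (simp_all add: jd_def nd_def \<tau>_def wdeg_add)
  have ok\<tau>: "ok (\<tau> v w)" if "ok w" "v \<in> ?V \<union> T a" for v w
    using that by (auto simp: ok_def \<tau>_def keys_add_nat)
  \<comment> \<open>The shift by a variable keeps the generator number and is monotone in the
    monomial, hence monotone in the lexicographic order, as \<open>lead_shift\<close>
    demands.\<close>
  have shift: "ld (\<tau> v w) Z'" if w: "ok w" and v: "v \<in> ?V \<union> T a" and l: "ld w Z"
      and ZZ: "\<And>z. z \<in> Z \<Longrightarrow> z \<in> Kc ?V p (J (nd w) g) (jd w) \<Longrightarrow> (\<lambda>\<sigma>. yv v * z \<sigma>) \<in> Z'" for w v Z Z' g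
    unfolding ld_def
  proof (rule lead_shift[where q="yv v" and \<tau>="\<tau> v", OF fW fW WW[OF w] _ _ _ l[unfolded ld_def]])
    fix u assume u: "u \<in> W (jd w) (nd w)"
    show "(\<lambda>\<sigma>. yv v * Y u \<sigma>) = Y (\<tau> v u)"
      by (rule ext) (simp add: Y_def \<tau>_def esing_def mev_add mult.left_commute[of "yv v"])
    show "\<tau> v u \<in> W (jd (\<tau> v w)) (nd (\<tau> v w)) \<and> \<tau> v u < \<tau> v w" if "u < w"
    proof
      show "\<tau> v u \<in> W (jd (\<tau> v w)) (nd (\<tau> v w))"
        using u ok\<tau>[of u v] v unfolding W_def mem_Collect_eq jd\<tau> nd\<tau> by simp
      show "\<tau> v u < \<tau> v w" using that by (auto simp: \<tau>_def less_prod_def)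
    qed
  next
    fix z assume z: "z \<in> Z" "z - Y w \<in> cv.span (Y ` {v \<in> W (jd w) (nd w). v < w})"
    have "cv.span (Y ` {v \<in> W (jd w) (nd w). v < w}) \<subseteq> Kc ?V p (J (nd w) g) (jd w)"
      by (rule cv.span_minimal[OF _ subspace_Kc_J]) (use YK in blast)
    then have "(z - Y w) + Y w \<in> Kc ?V p (J (nd w) g) (jd w)"
      by (intro cv.subspace_add[OF subspace_Kc_J] YK WW[OF w]) (use z(2) in blast)
    then show "(\<lambda>\<sigma>. yv v * z \<sigma>) \<in> Z'" by (intro ZZ[OF z(1)]) simp
  qed
  have upZ: "\<tau> v w \<in> LZ" if w: "w \<in> LZ" and v: "v \<in> T a" for v w
  proof -
    have o: "ok w" and e: "eventually (\<lambda>g. ld w (Zs ?V (L g) (jd w))) F" using w by (simp_all add: LZ_def)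
    have v': "v \<in> ?V \<union> T a" using v by simp
    have "eventually (\<lambda>g. ld (\<tau> v w) (Zs ?V (L g) (jd (\<tau> v w)))) F"
      using ev_S e
    proof (rule eventually_elim2)
      fix g assume g: "g \<in> S" and l: "ld w (Zs ?V (L g) (jd w))"
      show "ld (\<tau> v w) (Zs ?V (L g) (jd (\<tau> v w)))" unfolding jd\<tau>
      proof (rule shift[OF o v' l])
        fix z assume z: "z \<in> Zs ?V (L g) (jd w)"
        show "(\<lambda>\<sigma>. yv v * z \<sigma>) \<in> Zs ?V (L g) (jd w + int (wt v))" by (rule Zs_mult[OF g T'[OF v'] z])
      qed
    qed
    then show ?thesis using ok\<tau>[OF o v'] by (simp add: LZ_def)
  qed
  have xZ: "\<tau> v w \<in> LB" if w: "w \<in> LZ" and v: "v \<in> ?V" for v w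
  proof -
    have o: "ok w" and e: "eventually (\<lambda>g. ld w (Zs ?V (L g) (jd w))) F" using w by (simp_all add: LZ_def)
    have v': "v \<in> ?V \<union> T a" "v < d" using v by simp_all
    have "eventually (\<lambda>g. ld (\<tau> v w) (Bs ?V p (J (nd (\<tau> v w)) g) (L g) (jd (\<tau> v w)))) F"
      using ev_S e
    proof (rule eventually_elim2)
      fix g assume g: "g \<in> S" and l: "ld w (Zs ?V (L g) (jd w))"
      show "ld (\<tau> v w) (Bs ?V p (J (nd (\<tau> v w)) g) (L g) (jd (\<tau> v w)))" unfolding jd\<tau> nd\<tau>
      proof (rule shift[OF o v'(1) l])
        fix z assume z: "z \<in> Zs ?V (L g) (jd w)" "z \<in> Kc ?V p (J (nd w) g) (jd w)"
        show "(\<lambda>\<sigma>. yv v * z \<sigma>) \<in> Bs ?V p (J (nd w + tw v) g) (L g) (jd w + int (wt v))" by (rule var_Zs_Bs[OF g v'(2) z])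
      qed
    qed
    then show ?thesis using ok\<tau>[OF o v'(1)] by (simp add: LB_def)
  qed
  have upB: "\<tau> v w \<in> LB" if w: "w \<in> LB" and v: "v \<in> ?V \<union> T a" for v w
  proof -
    have o: "ok w" and e: "eventually (\<lambda>g. ld w (Bs ?V p (J (nd w) g) (L g) (jd w))) F" using w by (simp_all add: LB_def)
    have "eventually (\<lambda>g. ld (\<tau> v w) (Bs ?V p (J (nd (\<tau> v w)) g) (L g) (jd (\<tau> v w)))) F"
      using ev_S e
    proof (rule eventually_elim2)
      fix g assume g: "g \<in> S" and l: "ld w (Bs ?V p (J (nd w) g) (L g) (jd w))"
      show "ld (\<tau> v w) (Bs ?V p (J (nd (\<tau> v w)) g) (L g) (jd (\<tau> v w)))" unfolding jd\<tau> nd\<tau>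
      proof (rule shift[OF o v l])
        fix z assume z: "z \<in> Bs ?V p (J (nd w) g) (L g) (jd w)"
        show "(\<lambda>\<sigma>. yv v * z \<sigma>) \<in> Bs ?V p (J (nd w + tw v) g) (L g) (jd w + int (wt v))" by (rule Bs_mult[OF g T'[OF v] z])
      qed
    qed
    then show ?thesis using ok\<tau>[OF o v] by (simp add: LB_def)
  qed
  have iff: "eventually (\<lambda>g. hzr ?V Xp p (J n g) (L g) j \<longleftrightarrow>
      (\<forall>w\<in>W j n. ld w (Zs ?V (L g) (jd w)) \<longrightarrow> ld w (Bs ?V p (J (nd w) g) (L g) (jd w)))) F" if n: "N - 1 \<le> n" for n j
    using ev_S r
  proof (rule eventually_elim2)
    fix g assume g: "g \<in> S" "redn N a g"
    have "hzr ?V Xp p (J n g) (L g) j \<longleftrightarrow> (\<forall>w\<in>W j n. (\<exists>c. Y w + (\<Sum>v\<in>{v\<in>W j n. v < w}. cs (c v) (Y v)) \<in> Zs ?V (L g) j) \<longrightarrow>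
        (\<exists>c. Y w + (\<Sum>v\<in>{v\<in>W j n. v < w}. cs (c v) (Y v)) \<in> Bs ?V p (J n g) (L g) j))"
      by (rule hzr_iff_leads[OF finite_lessThan L_gmod[OF g(1)] subspace_spanfam subspace_spanfam fW YK Fr[OF g n]])
    then show "hzr ?V Xp p (J n g) (L g) j \<longleftrightarrow>
      (\<forall>w\<in>W j n. ld w (Zs ?V (L g) (jd w)) \<longrightarrow> ld w (Bs ?V p (J (nd w) g) (L g) (jd w)))"
      by (simp add: ld_def W_def)
  qed
  \<comment> \<open>A bidegree has only finitely many indices, each with decided lead conditions, so
    generic nonvanishing there amounts to an index in \<open>LZ - LB\<close>. Subtracting
    \<open>p\<close> cancels the degree of \<open>e_\<sigma>\<close>.\<close>
  have eq: "{(j - int p, n) |j n. N - 1 \<le> n \<and> eventually (\<lambda>g. \<not> hzr ?V Xp p (J n g) (L g) j) F} =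
    {(int (wdeg wt (snd (h c))) + int (wdeg wt m), (N - 1) + wdeg tw m) |c m. (c, m) \<in> LZ - LB}" (is "?l = ?r")
  proof (intro equalityI subsetI)
    fix x assume "x \<in> ?l"
    then obtain j n where x: "x = (j - int p, n)" and n: "N - 1 \<le> n" and e: "eventually (\<lambda>g. \<not> hzr ?V Xp p (J n g) (L g) j) F" by blast
    have "\<exists>w\<in>W j n. w \<in> LZ - LB"
    proof (rule ccontr)
      assume c: "\<not> (\<exists>w\<in>W j n. w \<in> LZ - LB)"
      have "eventually (\<lambda>g. ld w (Zs ?V (L g) (jd w)) \<longrightarrow> ld w (Bs ?V p (J (nd w) g) (L g) (jd w))) F" if w: "w \<in> W j n" for w
      proof (cases "w \<in> LB")
        case True
        then have "eventually (\<lambda>g. ld w (Bs ?V p (J (nd w) g) (L g) (jd w))) F" by (simp add: LB_def)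
        then show ?thesis by (rule eventually_mono) simp
      next
        case False
        then have "w \<notin> LZ" using c w by blast
        moreover have o: "ok w" using w by (simp add: W_def)
        ultimately have "\<not> eventually (\<lambda>g. ld w (Zs ?V (L g) (jd w))) F" by (simp add: LZ_def)
        from decided_not_ev[OF decZ[OF o] this] show ?thesis by (rule eventually_mono) simp
      qed
      then have "eventually (\<lambda>g. \<forall>w\<in>W j n. ld w (Zs ?V (L g) (jd w)) \<longrightarrow> ld w (Bs ?V p (J (nd w) g) (L g) (jd w))) F"
        by (intro eventually_ball_finite fW) blast
      from eventually_conj[OF this eventually_conj[OF iff[OF n, of j] e]] have "eventually (\<lambda>g. False) F"
        by (rule eventually_mono) (elim conjE, erule notE, erule iffD2, assumption)
      then show False using F_nb by simp
    qed
    then obtain w where w: "w \<in> W j n" "w \<in> LZ - LB" by blast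
    have "x = (int (wdeg wt (snd (h (fst w)))) + int (wdeg wt (snd w)), (N - 1) + wdeg tw (snd w))"
      using w(1) unfolding x W_def jd_def nd_def by (auto simp: wdeg_add)
    then show "x \<in> ?r" using w(2) by (intro CollectI exI[of _ "fst w"] exI[of _ "snd w"]) simp
  next
    fix x assume "x \<in> ?r"
    then obtain c m where x: "x = (int (wdeg wt (snd (h c))) + int (wdeg wt m), (N - 1) + wdeg tw m)" and w: "(c, m) \<in> LZ" "(c, m) \<notin> LB" by blast
    let ?w = "(c, m)"
    have o: "ok ?w" and eZ: "eventually (\<lambda>g. ld ?w (Zs ?V (L g) (jd ?w))) F" using w(1) by (simp_all add: LZ_def)
    have "\<not> eventually (\<lambda>g. ld ?w (Bs ?V p (J (nd ?w) g) (L g) (jd ?w))) F" using w(2) o by (simp add: LB_def)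
    note eB = decided_not_ev[OF decB[OF o] this]
    have n: "N - 1 \<le> nd ?w" by (simp add: nd_def)
    have "eventually (\<lambda>g. \<not> hzr ?V Xp p (J (nd ?w) g) (L g) (jd ?w)) F"
    proof (rule eventually_mono[OF eventually_conj[OF eZ eventually_conj[OF eB iff[OF n, of "jd ?w"]]]], rule notI)
      fix g assume A: "ld ?w (Zs ?V (L g) (jd ?w)) \<and> \<not> ld ?w (Bs ?V p (J (nd ?w) g) (L g) (jd ?w)) \<and>
          (hzr ?V Xp p (J (nd ?w) g) (L g) (jd ?w) \<longleftrightarrow>
          (\<forall>w\<in>W (jd ?w) (nd ?w). ld w (Zs ?V (L g) (jd w)) \<longrightarrow> ld w (Bs ?V p (J (nd w) g) (L g) (jd w))))"
        and hz: "hzr ?V Xp p (J (nd ?w) g) (L g) (jd ?w)"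
      note Z = conjunct1[OF A] and B = conjunct1[OF conjunct2[OF A]] and i = conjunct2[OF conjunct2[OF A]]
      have "\<forall>w\<in>W (jd ?w) (nd ?w). ld w (Zs ?V (L g) (jd w)) \<longrightarrow> ld w (Bs ?V p (J (nd w) g) (L g) (jd w))"
        by (rule iffD1[OF i hz])
      from bspec[OF this WW[OF o]] Z B show False by simp
    qed
    moreover have "x = (jd ?w - int p, nd ?w)" by (simp add: x jd_def nd_def wdeg_add)
    ultimately show "x \<in> ?l" by (intro CollectI exI[of _ "jd ?w"] exI[of _ "nd ?w"] conjI n)
  qed
  have "evlin (wt ` T a) ?r"
  proof (rule evlin_difference[where C="{..<K}" and Vx="?V" and VT="T a" and cv="\<lambda>_. N - 1"])
    show "c \<in> {..<K} \<and> Poly_Mapping.keys m \<subseteq> ?V \<union> T a" if "(c, m) \<in> LZ" for c m using that by (simp add: LZ_def ok_def)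
    show "tw v = 1" if "v \<in> T a" for v using T_sub[of a] that by (auto simp: tw_def)
    show "(c, Poly_Mapping.single v 1 + m) \<in> LZ" if "(c, m) \<in> LZ" "v \<in> T a" for c m v using upZ[OF that] by (simp add: \<tau>_def)
    show "(c, Poly_Mapping.single v 1 + m) \<in> LB" if "(c, m) \<in> LZ" "v \<in> ?V" for c m v using xZ[OF that] by (simp add: \<tau>_def)
    show "(c, Poly_Mapping.single v 1 + m) \<in> LB" if "(c, m) \<in> LB" "v \<in> ?V \<union> T a" for c m v using upB[OF that] by (simp add: \<tau>_def)
  qed (simp_all add: finite_T)
  then show ?thesis unfolding eq .
qed

end

section \<open>Generic regularity of all powers\<close>

lemma hz_of_trivial:
  assumes M: "gmod {..<d} Xp M" and v: "\<And>v. v \<in> Kc {..<d} p M j \<Longrightarrow> v = (\<lambda>_. 0)"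
  shows "hz {..<d} Xp p M j"
  unfolding hzr_def
proof (intro ballI impI)
  fix v assume "v \<in> Kc {..<d} p M j"
  then have "v = (\<lambda>_. 0)" by (rule v)
  moreover have "(\<lambda>_. 0) \<in> Kc {..<d} (Suc p) M j" by (rule KcI) (simp_all add: gmod_zero[OF M])
  ultimately show "\<exists>u\<in>Kc {..<d} (Suc p) M j. \<forall>\<sigma>. v \<sigma> - bd {..<d} Xp u \<sigma> \<in> {0}"
    by (intro bexI[of _ "\<lambda>_. 0"]) (simp_all add: bd_def)
qed

lemma hz_outside:
  assumes M: "gmod {..<d} Xp M" and s: "\<And>j. M j \<subseteq> hp d j" and pj: "\<not> (p \<le> d \<and> int p \<le> j)"
  shows "hz {..<d} Xp p M j"
proof (rule hz_of_trivial[OF M])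
  fix v assume v: "v \<in> Kc {..<d} p M j"
  show "v = (\<lambda>_. 0)"
  proof (rule ext, rule ccontr)
    fix \<sigma> assume nz: "v \<sigma> \<noteq> 0"
    have \<sigma>: "\<sigma> \<subseteq> {..<d}" "card \<sigma> = p" using Kc_support[OF v nz] by simp_all
    have "p \<le> d" using card_mono[OF _ \<sigma>(1)] \<sigma>(2) by simp
    then have "j - int (card \<sigma>) < 0" using pj \<sigma>(2) by simp
    moreover have "v \<sigma> \<in> hp d (j - int (card \<sigma>))" using Kc_mem[OF v, of \<sigma>] s by blast
    ultimately show False using hp_neg nz by blast
  qed
qed

definition maxz :: "int set \<Rightarrow> int" where "maxz D = (if D = {} then 0 else Max D)"

context generic
begin

text \<open>Beyond the bound of \<open>uniform_bound\<close>, and unless \<open>p \<le> d\<close>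
  and \<open>int p \<le> j\<close>, there is no homology. This leaves a finite box of pairs, each of
  them decided.\<close>

lemma generic_hz:
  assumes rM: "regfam WM bM"
    and sub: "\<And>g j. g \<in> S \<Longrightarrow> spanfam WM bM g j \<subseteq> hp d j"
    and gM: "\<And>g. g \<in> S \<Longrightarrow> gmod {..<d} Xp (spanfam WM bM g)"
  defines "E \<equiv> \<lambda>p j. eventually (\<lambda>g. \<not> hz {..<d} Xp p (spanfam WM bM g) j) F"
  shows "(\<exists>c. \<forall>p j. E p j \<longrightarrow> p \<le> d \<and> int p \<le> j \<and> j \<le> c) \<and>
    eventually (\<lambda>g. \<forall>p j. \<not> hz {..<d} Xp p (spanfam WM bM g) j \<longleftrightarrow> E p j) F"
proof -
  let ?M = "spanfam WM bM"
  obtain c where c: "eventually (\<lambda>g. \<forall>p j. j > c \<longrightarrow> hz {..<d} Xp p (?M g) j) F"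
    using uniform_bound[OF rM sub gM] by blast
  have out: "eventually (\<lambda>g. \<forall>p j. \<not> (p \<le> d \<and> int p \<le> j \<and> j \<le> c) \<longrightarrow> hz {..<d} Xp p (?M g) j) F"
    using eventually_conj[OF ev_S c]
  proof (rule eventually_mono, intro allI impI)
    fix g p j assume g: "g \<in> S \<and> (\<forall>p j. j > c \<longrightarrow> hz {..<d} Xp p (?M g) j)" and n: "\<not> (p \<le> d \<and> int p \<le> j \<and> j \<le> c)"
    show "hz {..<d} Xp p (?M g) j"
    proof (cases "j > c")
      case True
      then show ?thesis using g by blast
    next
      case False
      show ?thesis by (rule hz_outside[OF gM sub]) (use g n False in auto)
    qed
  qed
  have E: "p \<le> d \<and> int p \<le> j \<and> j \<le> c" if e: "E p j" for p j
  proof (rule ccontr)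
    assume n: "\<not> (p \<le> d \<and> int p \<le> j \<and> j \<le> c)"
    have "eventually (\<lambda>g. False) F"
      by (rule eventually_mono[OF eventually_conj[OF out e[unfolded E_def]]]) (use n in blast)
    then show False using F_nb by simp
  qed
  \<comment> \<open>Ordinary homology is homology relative to the zero family, so that
    \<open>hzr_decided\<close> applies.\<close>
  have r0: "regfam (\<lambda>_. {} :: nat set) (\<lambda>_ _. 0)" by (simp add: regfam_def)
  have s0: "spanfam (\<lambda>_. {} :: nat set) (\<lambda>_ _. 0) g = (\<lambda>_. {0})" for g :: 'g
    by (rule ext) (simp add: spanfam_def pv.span_empty)
  have dec: "decided (\<lambda>g. hz {..<d} Xp p (?M g) j)" for p j
    using hzr_decided[OF finite_lessThan rM r0, of d p j] unfolding s0 by (simp add: gmod_def)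
  let ?B = "{..d} \<times> {0..c}"
  have one: "eventually (\<lambda>g. \<not> hz {..<d} Xp (fst b) (?M g) (snd b) \<longleftrightarrow> E (fst b) (snd b)) F" for b
  proof (cases "E (fst b) (snd b)")
    case True
    from True[unfolded E_def] show ?thesis by (rule eventually_mono) (use True in blast)
  next
    case False
    then have "eventually (\<lambda>g. hz {..<d} Xp (fst b) (?M g) (snd b)) F" using dec[of "fst b" "snd b"] unfolding decided_def E_def by blast
    then show ?thesis by (rule eventually_mono) (use False in blast)
  qed
  have "eventually (\<lambda>g. \<forall>b\<in>?B. \<not> hz {..<d} Xp (fst b) (?M g) (snd b) \<longleftrightarrow> E (fst b) (snd b)) F"
    by (rule eventually_ball_finite) (simp_all add: one del: split_paired_Ball_Sigma)
  from eventually_conj[OF this out] have "eventually (\<lambda>g. \<forall>p j. \<not> hz {..<d} Xp p (?M g) j \<longleftrightarrow> E p j) F"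
  proof (rule eventually_mono, intro allI)
    fix g p j assume A: "(\<forall>b\<in>?B. \<not> hz {..<d} Xp (fst b) (?M g) (snd b) \<longleftrightarrow> E (fst b) (snd b)) \<and>
      (\<forall>p j. \<not> (p \<le> d \<and> int p \<le> j \<and> j \<le> c) \<longrightarrow> hz {..<d} Xp p (?M g) j)"
    show "\<not> hz {..<d} Xp p (?M g) j \<longleftrightarrow> E p j"
    proof (cases "p \<le> d \<and> int p \<le> j \<and> j \<le> c")
      case True
      then have "(p, j) \<in> ?B" by auto
      from bspec[OF conjunct1[OF A] this] show ?thesis by simp
    next
      case False
      then have "hz {..<d} Xp p (?M g) j" using conjunct2[OF A] by blast
      then show ?thesis using False E by blast
    qed
  qed
  then show ?thesis using E by blast
qed

text \<open>Nonnegativity comes from \<open>int p \<le> j\<close>: the coefficients of a nonzero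
  chain have degree at least 0.\<close>

lemma generic_hD:
  assumes "regfam WM bM" "\<And>g j. g \<in> S \<Longrightarrow> spanfam WM bM g j \<subseteq> hp d j"
    "\<And>g. g \<in> S \<Longrightarrow> gmod {..<d} Xp (spanfam WM bM g)"
  defines "D \<equiv> {j - int p |p j. eventually (\<lambda>g. \<not> hz {..<d} Xp p (spanfam WM bM g) j) F}"
  shows "finite D \<and> D \<subseteq> {0..} \<and> eventually (\<lambda>g. hD d (spanfam WM bM g) = D) F"
proof -
  note g = generic_hz[OF assms(1-3)]
  obtain c where c: "\<And>p j. eventually (\<lambda>g. \<not> hz {..<d} Xp p (spanfam WM bM g) j) F \<Longrightarrow> p \<le> d \<and> int p \<le> j \<and> j \<le> c"
    using conjunct1[OF g] by blast
  have "D \<subseteq> {0..c}" unfolding D_def using c by fastforce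
  moreover have "eventually (\<lambda>g. hD d (spanfam WM bM g) = D) F"
  proof (rule eventually_mono[OF conjunct2[OF g]])
    fix g assume "\<forall>p j. (\<not> hz {..<d} Xp p (spanfam WM bM g) j) = eventually (\<lambda>g. \<not> hz {..<d} Xp p (spanfam WM bM g) j) F"
    then show "hD d (spanfam WM bM g) = D" unfolding hD_def D_def by (intro Collect_cong ex_cong1 conj_cong refl) blast
  qed
  ultimately show ?thesis using finite_subset[of D "{0..c}"] by auto
qed

end

context rees
begin

text \<open>Without minimal generators of degree at least \<open>\<delta> n\<close> modulo
  \<open>L\<close>, a product of \<open>n\<close> generators of degrees at least
  \<open>\<delta>\<close> lies in the maximal ideal times the power, plus \<open>L\<close>, and is
  rewritten by induction on the degree. Any other product of \<open>n\<close> generators has a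
  factor of degree below \<open>\<delta>\<close>.\<close>

lemma redn_of_hzr:
  assumes g: "g \<in> S" and \<delta>: "1 \<le> \<delta>" and D: "\<And>l. l < s \<Longrightarrow> dl l \<le> D"
    and hz: "\<And>i. int \<delta> * int n \<le> i \<Longrightarrow> i \<le> int D * int n \<Longrightarrow> hzr {..<d} Xp 0 (J n g) (L g) i"
  shows "redn n (\<delta> - 1) g"
proof -
  let ?T = "T (\<delta> - 1)"
  define Sp where "Sp j = pv.span (ev ` {\<epsilon> \<in> WJ n j. Poly_Mapping.keys \<epsilon> \<inter> ?T \<noteq> {}} \<union> L g j)" for j
  have LSp: "x \<in> Sp j" if "x \<in> L g j" for x j unfolding Sp_def by (rule pv.span_base) (simp add: that)
  have var: "mp_var a * x \<in> Sp j" if a: "a < d" and x: "x \<in> Sp (j - 1)" for a x j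
  proof -
    have "mp_var a * z \<in> Sp j" if z: "z \<in> ev ` {\<epsilon> \<in> WJ n (j - 1). Poly_Mapping.keys \<epsilon> \<inter> ?T \<noteq> {}} \<union> L g (j - 1)" for z
      using z
    proof
      assume "z \<in> L g (j - 1)"
      from L_mult[OF g hp_var[OF a] this] show ?thesis by (intro LSp) simp
    next
      assume "z \<in> ev ` {\<epsilon> \<in> WJ n (j - 1). Poly_Mapping.keys \<epsilon> \<inter> ?T \<noteq> {}}"
      then obtain \<epsilon> where e: "z = ev \<epsilon>" "\<epsilon> \<in> WJ n (j - 1)" "Poly_Mapping.keys \<epsilon> \<inter> ?T \<noteq> {}" by blast
      have "Poly_Mapping.single a 1 + \<epsilon> \<in> WJ n j" using WJ_mult[OF _ e(2), of a] a by (simp add: tw_def wt_def)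
      then have "ev (Poly_Mapping.single a 1 + \<epsilon>) \<in> Sp j" unfolding Sp_def using e(3)
        by (intro pv.span_base UnI1 imageI) (auto simp: keys_add_nat)
      then show ?thesis using a by (simp add: e(1) mev_add yv_def)
    qed
    then show ?thesis using x unfolding Sp_def by (rule span_mult)
  qed
  have main: "ev \<epsilon> \<in> Sp j" if "\<epsilon> \<in> WJ n j" for \<epsilon> j
    using that
  proof (induction "nat j" arbitrary: j \<epsilon> rule: less_induct)
    case less
    \<comment> \<open>The induction on \<open>nat j\<close> is legitimate: a monomial in
      \<open>WJ n (j - 1)\<close> has nonnegative degree, so \<open>j \<ge> 1\<close>.\<close>
    have H: "ev \<epsilon>' \<in> Sp (j - 1)" if e: "\<epsilon>' \<in> WJ n (j - 1)" for \<epsilon>'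
      by (rule less.hyps[OF _ e]) (use e in \<open>auto simp: WJ_def\<close>)
    consider "Poly_Mapping.keys \<epsilon> \<inter> ?T \<noteq> {}" | v where "v \<in> Poly_Mapping.keys \<epsilon>" "v < d" |
      "Poly_Mapping.keys \<epsilon> \<inter> ?T = {}" "Poly_Mapping.keys \<epsilon> \<subseteq> {d..}" by (metis atLeast_iff not_le subsetI)
    then show ?case
    proof cases
      case 1
      then show ?thesis unfolding Sp_def using less.prems by (intro pv.span_base) blast
    next
      case 2
      obtain \<nu> where \<nu>: "\<epsilon> = Poly_Mapping.single v 1 + \<nu>" using mono_remove[OF 2(1)] by blast
      have "\<nu> \<in> WJ n (j - 1)" using less.prems 2(2) by (auto simp: \<nu> WJ_def keys_add_nat wdeg_add tw_def wt_def)
      from var[OF 2(2) H[OF this]] show ?thesis using 2(2) by (simp add: \<nu> mev_add yv_def)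
    next
      case 3
      have m: "mono_deg \<epsilon> = n" using wdeg_tw_ge[OF 3(2)] less.prems by (simp add: WJ_def)
      \<comment> \<open>No generator of degree below \<open>\<delta>\<close> occurs, so the degree
        of \<open>\<epsilon>\<close> lies between \<open>\<delta> n\<close> and \<open>D n\<close>.
        The upper bound confines the hypothesis to finitely many degrees.\<close>
      have w: "\<delta> \<le> wt v \<and> wt v \<le> D" if v: "v \<in> Poly_Mapping.keys \<epsilon>" for v
      proof -
        have v': "d \<le> v" "v < d + s" using 3(2) v less.prems by (auto simp: WJ_def)
        have "v \<in> T (\<delta> - 1)" if "dl (v - d) \<le> \<delta> - 1" unfolding T_def using v' that
          by (intro CollectI exI[of _ "v - d"]) auto
        then have "\<not> dl (v - d) \<le> \<delta> - 1" using 3(1) v by blast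
        then show ?thesis using v' D[of "v - d"] by (simp add: wt_def)
      qed
      have "\<delta> * n \<le> wdeg wt \<epsilon>" using wdeg_ge[of \<epsilon> \<delta> wt] w m by simp
      then have l: "int \<delta> * int n \<le> j" using less.prems by (simp add: WJ_def flip: of_nat_mult)
      have "wdeg wt \<epsilon> \<le> D * n" using wdeg_le[of \<epsilon> wt D] w m by simp
      then have u: "j \<le> int D * int n" using less.prems by (auto simp: WJ_def simp flip: of_nat_mult)
      have c: "chain0 (ev \<epsilon>) \<in> Kc {..<d} 0 (J n g) j" by (rule chain0_Kc[OF J_gmod[OF g] ev_J[OF less.prems]])
      have "\<forall>\<tau>. bd {..<d} Xp (chain0 (ev \<epsilon>)) \<tau> \<in> L g (j - int (card \<tau>))"
        using Kc_0_bd[OF c kop_Xp] gmod_zero[OF L_gmod[OF g]] by simp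
      with hz[OF l u, unfolded hzr_def] c obtain b where b: "b \<in> Kc {..<d} (Suc 0) (J n g) j"
        "\<forall>\<sigma>. chain0 (ev \<epsilon>) \<sigma> - bd {..<d} Xp b \<sigma> \<in> L g (j - int (card \<sigma>))" by blast
      have "ev \<epsilon> - bd {..<d} Xp b {} \<in> Sp j" using b(2)[rule_format, of "{}"] by (intro LSp) (simp add: chain0_def)
      moreover have "bd {..<d} Xp b {} \<in> Sp j"
      proof -
        have JSp: "J n g (j - 1) \<subseteq> Sp (j - 1)" unfolding J_eq
          by (rule pv.span_minimal) (use H LSp in \<open>auto simp: Sp_def\<close>)
        have "mp_var a * b {a} \<in> Sp j" if "a < d" for a
          by (rule var[OF that]) (use Kc_mem[OF b(1), of "{a}"] JSp in auto)
        then have "(\<Sum>a<d. mp_var a * b {a}) \<in> Sp j" unfolding Sp_def by (intro pv.span_sum) simp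
        then show ?thesis by (simp add: bd_def)
      qed
      ultimately have "(ev \<epsilon> - bd {..<d} Xp b {}) + bd {..<d} Xp b {} \<in> Sp j" unfolding Sp_def by (rule pv.span_add)
      then show ?thesis by simp
    qed
  qed
  then show ?thesis unfolding redn_def Sp_def[symmetric] by blast
qed

theorem rees_linear:
  "\<exists>\<delta> e n0. \<forall>n\<ge>n0. eventually (\<lambda>g. maxz (hD d (J n g)) = int \<delta> * int n + int e) F"
proof -
  let ?V = "{..<d}"
  define D where "D = (\<Sum>l<s. dl l)"
  have D: "dl l \<le> D" if "l < s" for l unfolding D_def by (rule member_le_sum) (use that in simp_all)
  define P where "P a \<longleftrightarrow> (\<exists>N\<ge>1. eventually (redn N a) F)" for a
  \<comment> \<open>\<open>D\<close> bounds all generator degrees, so \<open>T D\<close> contains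
    every Rees variable and the condition is trivial for \<open>N = 1\<close>.\<close>
  have "redn 1 D g" for g
    unfolding redn_def
  proof (intro allI image_subsetI)
    fix j \<epsilon> assume e: "\<epsilon> \<in> WJ 1 j"
    then have "wdeg tw \<epsilon> \<noteq> 0" by (simp add: WJ_def)
    then obtain v where v: "v \<in> Poly_Mapping.keys \<epsilon>" "tw v \<noteq> 0" unfolding wdeg_def by (auto elim: sum.not_neutral_contains_not_neutral)
    have v': "d \<le> v" "v < d + s" using v e by (auto simp: tw_def WJ_def split: if_splits)
    have "v \<in> T D" unfolding T_def using v' D[of "v - d"] by (intro CollectI exI[of _ "v - d"]) auto
    then show "ev \<epsilon> \<in> pv.span (ev ` {\<epsilon> \<in> WJ 1 j. Poly_Mapping.keys \<epsilon> \<inter> T D \<noteq> {}} \<union> L g j)"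
      using v(1) e by (intro pv.span_base) blast
  qed
  then have "eventually (redn 1 D) F" by (intro always_eventually allI)
  then have PD: "P D" unfolding P_def by (intro exI[of _ 1]) simp
  define \<delta> where "\<delta> = (LEAST a. P a)"
  have P\<delta>: "P \<delta>" unfolding \<delta>_def by (rule LeastI[of P, OF PD])
  have min: "\<not> P a" if "a < \<delta>" for a using that unfolding \<delta>_def by (rule not_less_Least)
  obtain N where N: "1 \<le> N" "eventually (redn N \<delta>) F" using P\<delta> unfolding P_def by blast
  show ?thesis
  proof (cases "\<delta> = 0")
    \<comment> \<open>A generic reduction by no generators at all: large powers lie in
      \<open>L\<close>, so the maximum is eventually that of \<open>L\<close>.\<close>
    case True
    define E where "E = {j - int p |p j. eventually (\<lambda>g. \<not> hz ?V Xp p (L g) j) F}"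
    have E: "finite E" "E \<subseteq> {0..}" "eventually (\<lambda>g. hD d (L g) = E) F"
      using generic_hD[OF rL L_hp L_gmod] by (simp_all add: E_def)
    have "0 \<le> maxz E"
    proof (cases "E = {}")
      case False
      have "Max E \<in> {0..}" using Max_in[OF E(1) False] E(2) by blast
      then show ?thesis using False by (simp add: maxz_def)
    qed (simp add: maxz_def)
    have "eventually (\<lambda>g. maxz (hD d (J n g)) = int 0 * int n + int (nat (maxz E))) F" if n: "N \<le> n" for n
      using eventually_conj[OF ev_S eventually_conj[OF N(2) E(3)]]
    proof (rule eventually_mono)
      fix g assume g: "g \<in> S \<and> redn N \<delta> g \<and> hD d (L g) = E"
      have "J n g = L g" by (rule ext, rule J_stable[OF _ _ n]) (use g True in auto)
      then show "maxz (hD d (J n g)) = int 0 * int n + int (nat (maxz E))" using g \<open>0 \<le> maxz E\<close> by simp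
    qed
    then show ?thesis by blast
  next
    case False
    define R where "R p = {(j - int p, n) |j n. N - 1 \<le> n \<and> eventually (\<lambda>g. \<not> hzr ?V Xp p (J n g) (L g) j) F}" for p
    define Q where "Q = (\<Union>p\<in>{..d}. R p)"
    have ev: "evlin (wt ` T \<delta>) Q" unfolding Q_def
      by (rule evlin_UN) (simp_all add: R_def growth[OF N])
    \<comment> \<open>Otherwise homology of degree 0 would vanish generically in finitely many
      degrees at once, and \<open>\<delta> - 1\<close> would admit a reduction too, against
      minimality.\<close>
    have low: "\<exists>i\<ge>int \<delta> * int n. (i, n) \<in> Q" if n: "N \<le> n" for n
    proof (rule ccontr)
      assume c: "\<not> (\<exists>i\<ge>int \<delta> * int n. (i, n) \<in> Q)"
      have "eventually (\<lambda>g. hzr ?V Xp 0 (J n g) (L g) i) F" if i: "i \<in> {int \<delta> * int n..int D * int n}" for i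
      proof (rule ccontr)
        assume c': "\<not> eventually (\<lambda>g. hzr ?V Xp 0 (J n g) (L g) i) F"
        have "decided (\<lambda>g. hzr ?V Xp 0 (J n g) (L g) i)"
          by (rule hzr_decided[OF finite_lessThan rJ rL]) (rule L_gmod)
        then have "eventually (\<lambda>g. \<not> hzr ?V Xp 0 (J n g) (L g) i) F"
          by (rule decided_not_ev[OF _ c'])
        then have "(i - int 0, n) \<in> R 0" unfolding R_def using n by (intro CollectI exI[of _ i] exI[of _ n]) simp
        then have "(i, n) \<in> Q" unfolding Q_def by (intro UN_I[of 0]) simp_all
        then show False using c i by simp
      qed
      then have "eventually (\<lambda>g. \<forall>i\<in>{int \<delta> * int n..int D * int n}. hzr ?V Xp 0 (J n g) (L g) i) F"
        by (intro eventually_ball_finite) simp_all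
      with ev_S have "eventually (redn n (\<delta> - 1)) F"
      proof (rule eventually_elim2)
        fix g assume g: "g \<in> S" and h: "\<forall>i\<in>{int \<delta> * int n..int D * int n}. hzr ?V Xp 0 (J n g) (L g) i"
        show "redn n (\<delta> - 1) g" by (rule redn_of_hzr[OF g _ D]) (use False h in auto)
      qed
      then have "P (\<delta> - 1)" unfolding P_def using n N(1) by (intro exI[of _ n]) simp
      then show False using min[of "\<delta> - 1"] False by simp
    qed
    have "\<not> (\<exists>n0. \<forall>n\<ge>n0. \<forall>y. (y, n) \<notin> Q)"
    proof
      assume "\<exists>n0. \<forall>n\<ge>n0. \<forall>y. (y, n) \<notin> Q"
      then obtain n0 where n0: "\<forall>n\<ge>n0. \<forall>y. (y, n) \<notin> Q" ..
      show False using low[of "max n0 N"] n0 by auto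
    qed
    with ev obtain \<delta>' b n1 where \<delta>': "\<delta>' \<in> wt ` T \<delta>"
      and top: "\<forall>n\<ge>n1. (int \<delta>' * int n + b, n) \<in> Q \<and> (\<forall>y. (y, n) \<in> Q \<longrightarrow> y \<le> int \<delta>' * int n + b)"
      unfolding evlin_def by blast
    have le: "\<delta>' \<le> \<delta>" using \<delta>' by (auto simp: T_def wt_def)
    have lo: "int \<delta> * int n \<le> int \<delta>' * int n + b" if n: "max N n1 \<le> n" for n
    proof -
      obtain i where i: "int \<delta> * int n \<le> i" "(i, n) \<in> Q" using low[of n] n by auto
      moreover have "i \<le> int \<delta>' * int n + b" using top i(2) n by simp
      ultimately show ?thesis by simp
    qed
    have eq: "\<delta>' = \<delta>"
    proof (rule ccontr)
      assume "\<delta>' \<noteq> \<delta>"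
      then have l: "int \<delta>' + 1 \<le> int \<delta>" using le by simp
      \<comment> \<open>Large enough that an excess of 1 in the slope outweighs the constant
        \<open>b\<close>.\<close>
      let ?n = "max (max N n1) (nat (b + 1))"
      have "(int \<delta>' + 1) * int ?n \<le> int \<delta> * int ?n" by (rule mult_right_mono[OF l]) simp
      also have "\<dots> \<le> int \<delta>' * int ?n + b" by (rule lo) simp
      finally have "int ?n \<le> b" by (simp add: distrib_right)
      then show False by linarith
    qed
    have b0: "0 \<le> b" using lo[of "max N n1"] by (simp add: eq)
    \<comment> \<open>Beyond \<open>cL\<close> the homology of \<open>L\<close> vanishes
      generically, so there the homology of the power plus \<open>L\<close> agrees with that modulo
      \<open>L\<close>. Lower degrees are harmless because \<open>n2\<close> makes
      \<open>\<delta> n\<close> exceed \<open>cL\<close>.\<close>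
    obtain cL where cL: "eventually (\<lambda>g. \<forall>p j. j > cL \<longrightarrow> hz ?V Xp p (L g) j) F"
      using uniform_bound[OF rL L_hp L_gmod] by blast
    have rel: "eventually (\<lambda>g. \<not> hz ?V Xp p (J n g) j) F \<longleftrightarrow> eventually (\<lambda>g. \<not> hzr ?V Xp p (J n g) (L g) j) F"
      if j: "j > cL" for p n j
    proof (rule eventually_subst)
      show "eventually (\<lambda>g. (\<not> hz ?V Xp p (J n g) j) = (\<not> hzr ?V Xp p (J n g) (L g) j)) F"
        using ev_S cL
      proof (rule eventually_elim2)
        fix g assume g: "g \<in> S" and h: "\<forall>p j. j > cL \<longrightarrow> hz ?V Xp p (L g) j"
        have "hz ?V Xp p (J n g) j \<longleftrightarrow> hzr ?V Xp p (J n g) (L g) j"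
          by (rule hz_iff_hzr[OF kop_Xp[OF finite_lessThan] J_gmod[OF g] L_gmod[OF g] L_J]) (use h j in simp_all)
        then show "(\<not> hz ?V Xp p (J n g) j) = (\<not> hzr ?V Xp p (J n g) (L g) j)" by simp
      qed
    qed
    define n2 where "n2 = max (max N n1) (nat (cL + 1))"
    have "eventually (\<lambda>g. maxz (hD d (J n g)) = int \<delta> * int n + int (nat b)) F" if n: "n2 \<le> n" for n
    proof -
      define E where "E = {j - int p |p j. eventually (\<lambda>g. \<not> hz ?V Xp p (J n g) j) F}"
      have E: "finite E" "E \<subseteq> {0..}" "eventually (\<lambda>g. hD d (J n g) = E) F"
        using generic_hD[OF rJ J_hp J_gmod] by (simp_all add: E_def)
      have big: "cL < int \<delta> * int n"
      proof -
        have "cL < int n" using n by (simp add: n2_def) linarith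
        also have "\<dots> \<le> int \<delta> * int n" using False by (simp add: mult_le_cancel_right1)
        finally show ?thesis .
      qed
      have nn: "n1 \<le> n" "N - 1 \<le> n" using n by (auto simp: n2_def)
      have "Max E = int \<delta> * int n + b"
      proof (rule Max_eqI[OF E(1)])
        have "(int \<delta> * int n + b, n) \<in> Q" using top nn(1) by (simp add: eq)
        then obtain p j where pj: "int \<delta> * int n + b = j - int p" "eventually (\<lambda>g. \<not> hzr ?V Xp p (J n g) (L g) j) F"
          by (auto simp: Q_def R_def)
        have "eventually (\<lambda>g. \<not> hz ?V Xp p (J n g) j) F" using pj big b0 by (subst rel) auto
        then show "int \<delta> * int n + b \<in> E" unfolding E_def using pj(1) by blast
        fix y assume "y \<in> E"
        then obtain p j where y: "y = j - int p" "eventually (\<lambda>g. \<not> hz ?V Xp p (J n g) j) F" unfolding E_def by blast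
        have pd: "p \<le> d"
          using conjunct1[OF generic_hz[OF rJ J_hp J_gmod]] y(2) by blast
        show "y \<le> int \<delta> * int n + b"
        proof (cases "j > cL")
          case True
          then have "eventually (\<lambda>g. \<not> hzr ?V Xp p (J n g) (L g) j) F" using y(2) rel by blast
          then have "(y, n) \<in> R p" unfolding R_def y(1) using nn(2) by (intro CollectI exI[of _ j] exI[of _ n]) simp
          then have "(y, n) \<in> Q" unfolding Q_def using pd by (intro UN_I[of p]) simp_all
          then show ?thesis using top nn(1) by (simp add: eq)
        next
          case False
          then show ?thesis using y(1) big b0 by simp
        qed
      qed
      moreover have "E \<noteq> {}"
      proof -
        have "(int \<delta> * int n + b, n) \<in> Q" using top nn(1) by (simp add: eq)
        then obtain p j where pj: "int \<delta> * int n + b = j - int p" "eventually (\<lambda>g. \<not> hzr ?V Xp p (J n g) (L g) j) F"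
          by (auto simp: Q_def R_def)
        have "eventually (\<lambda>g. \<not> hz ?V Xp p (J n g) j) F" using pj big b0 by (subst rel) auto
        then show ?thesis unfolding E_def by blast
      qed
      ultimately have "maxz E = int \<delta> * int n + int (nat b)" using b0 by (simp add: maxz_def)
      then show ?thesis using E(3) by (auto elim: eventually_mono)
    qed
    then show ?thesis by blast
  qed
qed

end

section \<open>Ideals of the polynomial ring\<close>

lemma mpr_sel [simp]: "mult (mpr d) = (*)" "one (mpr d) = 1" "zero (mpr d) = 0" "add (mpr d) = (+)"
  by (simp_all add: mpr_def)

lemma Pd_1 [simp]: "1 \<in> Pd d" using hp_Pd[OF hp_const[of 1 d]] by simp

lemma Pd_const: "mp_const c \<in> Pd d" by (rule hp_Pd[OF hp_const])

lemma cring_mpr: "cring (mpr d :: (nat, 'k::field) mpol ring)"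
proof (rule cringI)
  show "abelian_group (mpr d :: (nat, 'k) mpol ring)"
  proof (rule abelian_groupI)
    fix x :: "(nat, 'k) mpol" assume "x \<in> carrier (mpr d)"
    then show "\<exists>y\<in>carrier (mpr d). y \<oplus>\<^bsub>mpr d\<^esub> x = \<zero>\<^bsub>mpr d\<^esub>"
      by (intro bexI[of _ "- x"]) (simp_all add: Pd_uminus)
  qed (simp_all add: Pd_add ac_simps)
  show "Group.comm_monoid (mpr d :: (nat, 'k) mpol ring)"
    by (rule comm_monoidI) (simp_all add: Pd_mult ac_simps)
qed (simp add: distrib_right)

lemma ideal_mprI:
  assumes M: "M \<subseteq> Pd d" "0 \<in> M" "\<And>x y. x \<in> M \<Longrightarrow> y \<in> M \<Longrightarrow> x + y \<in> M"
    "\<And>p x. p \<in> Pd d \<Longrightarrow> x \<in> M \<Longrightarrow> p * x \<in> M"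
  shows "ideal M (mpr d :: (nat, 'k::field) mpol ring)"
proof (rule idealI)
  interpret R: cring "mpr d :: (nat, 'k) mpol ring" by (rule cring_mpr)
  show "ring (mpr d :: (nat, 'k) mpol ring)" by (rule R.ring_axioms)
  show "subgroup M (add_monoid (mpr d))"
  proof (rule subgroup.intro)
    fix x assume x: "x \<in> M"
    have "inv\<^bsub>add_monoid (mpr d)\<^esub> x = - x"
      by (rule group.inv_equality[OF R.a_group]) (use x M(1) in \<open>auto simp: Pd_uminus\<close>)
    moreover have "- x \<in> M" using M(4)[OF Pd_uminus[OF Pd_1] x] by simp
    ultimately show "inv\<^bsub>add_monoid (mpr d)\<^esub> x \<in> M" by simp
  qed (use M in auto)
  show "x \<otimes>\<^bsub>mpr d\<^esub> a \<in> M" "a \<otimes>\<^bsub>mpr d\<^esub> x \<in> M" if "a \<in> M" "x \<in> carrier (mpr d)" for a x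
    using M(4)[of x a] that by (simp_all add: mult.commute)
qed

lemma ideal_mprD:
  assumes "ideal M (mpr d :: (nat, 'k::field) mpol ring)"
  shows "pv.subspace M" "p \<in> Pd d \<Longrightarrow> x \<in> M \<Longrightarrow> p * x \<in> M"
proof -
  interpret I: ideal M "mpr d :: (nat, 'k) mpol ring" by (rule assms)
  show m: "p * x \<in> M" if "p \<in> Pd d" "x \<in> M" for p x using I.I_l_closed[of x p] that by simp
  have z: "0 \<in> M" using additive_subgroup.zero_closed[OF I.additive_subgroup_axioms] by simp
  have a: "x + y \<in> M" if "x \<in> M" "y \<in> M" for x y using additive_subgroup.a_closed[OF I.additive_subgroup_axioms that] by simp
  show "pv.subspace M" by (rule pv.subspaceI[OF z a m[OF Pd_const]])
qed

lemma Pd_span_mult: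
  assumes B: "\<And>\<alpha> b. Poly_Mapping.keys \<alpha> \<subseteq> {..<d} \<Longrightarrow> b \<in> B \<Longrightarrow> mp_mono \<alpha> * b \<in> pv.span B"
    and p: "p \<in> Pd d" and x: "x \<in> pv.span B"
  shows "p * x \<in> pv.span B"
proof -
  have "Poly_Mapping.single m (lk p m) * x \<in> pv.span B" if m: "m \<in> Poly_Mapping.keys p" for m
  proof -
    have "Poly_Mapping.keys m \<subseteq> {..<d}" using p m by (auto simp: Pd_iff in_keys_iff)
    then have "sp (lk p m) (mp_mono m * x) \<in> pv.span B" by (intro pv.span_scale span_mult[OF _ x] B)
    then show ?thesis by (simp add: mult.assoc[symmetric] mult_single)
  qed
  then have "(\<Sum>m\<in>Poly_Mapping.keys p. Poly_Mapping.single m (lk p m) * x) \<in> pv.span B" by (rule pv.span_sum)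
  then show ?thesis by (subst poly_sum_monomials[of p]) (simp add: sum_distrib_right)
qed

definition mults :: "nat \<Rightarrow> (nat, 'k::field) mpol set \<Rightarrow> (nat, 'k) mpol set" where
  "mults d A = {mp_mono \<alpha> * a |\<alpha> a. Poly_Mapping.keys \<alpha> \<subseteq> {..<d} \<and> a \<in> A}"

lemma mults_mult: "Poly_Mapping.keys \<alpha> \<subseteq> {..<d} \<Longrightarrow> b \<in> mults d A \<Longrightarrow> mp_mono \<alpha> * b \<in> pv.span (mults d A)"
proof -
  assume \<alpha>: "Poly_Mapping.keys \<alpha> \<subseteq> {..<d}" and "b \<in> mults d A"
  then obtain \<beta> a where b: "b = mp_mono \<beta> * a" "Poly_Mapping.keys \<beta> \<subseteq> {..<d}" "a \<in> A" by (auto simp: mults_def)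
  have "mp_mono \<alpha> * b = mp_mono (\<alpha> + \<beta>) * a" by (simp add: b(1) mult.assoc[symmetric] mult_single)
  moreover have "mp_mono (\<alpha> + \<beta>) * a \<in> mults d A" unfolding mults_def using \<alpha> b(2,3)
    by (intro CollectI exI[of _ "\<alpha> + \<beta>"] exI[of _ a]) (simp add: keys_add_nat)
  ultimately show ?thesis by (simp add: pv.span_base)
qed

lemma mults_hp:
  assumes "\<And>a. a \<in> A \<Longrightarrow> \<exists>j. a \<in> hp d j" "b \<in> mults d A"
  shows "\<exists>j. b \<in> hp d j"
proof -
  obtain \<beta> a where b: "b = mp_mono \<beta> * a" "Poly_Mapping.keys \<beta> \<subseteq> {..<d}" "a \<in> A" using assms(2) by (auto simp: mults_def)
  obtain j where "a \<in> hp d j" using assms(1)[OF b(3)] ..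
  from hp_mult[OF hp_single[OF b(2) refl] this] show ?thesis unfolding b(1) ..
qed

lemma subspace_Pd: "pv.subspace (Pd d)"
  by (rule pv.subspaceI) (auto intro: Pd_add Pd_mult Pd_const)

lemma Idl_span:
  assumes A: "A \<subseteq> Pd d"
  shows "Idl\<^bsub>mpr d\<^esub> A = pv.span (mults d A :: (nat, 'k::field) mpol set)"
proof (rule subset_antisym)
  interpret R: cring "mpr d :: (nat, 'k) mpol ring" by (rule cring_mpr)
  have Pm: "mp_mono \<alpha> \<in> Pd d" if "Poly_Mapping.keys \<alpha> \<subseteq> {..<d}" for \<alpha> :: "nat \<Rightarrow>\<^sub>0 nat"
    by (rule hp_Pd[OF hp_single[OF that refl]])
  have "ideal (pv.span (mults d A)) (mpr d)"
  proof (rule ideal_mprI)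
    show "pv.span (mults d A) \<subseteq> Pd d"
      by (rule pv.span_minimal[OF _ subspace_Pd]) (use A Pm in \<open>auto simp: mults_def intro!: Pd_mult\<close>)
  qed (auto intro: pv.span_zero pv.span_add Pd_span_mult mults_mult)
  moreover have "A \<subseteq> pv.span (mults d A)"
  proof
    fix a assume "a \<in> A"
    then have "mp_mono 0 * a \<in> mults d A" unfolding mults_def by (intro CollectI exI[of _ 0] exI[of _ a]) simp
    then show "a \<in> pv.span (mults d A)" by (intro pv.span_base) simp
  qed
  ultimately show "Idl\<^bsub>mpr d\<^esub> A \<subseteq> pv.span (mults d A)" by (rule R.genideal_minimal)
  have i: "ideal (Idl\<^bsub>mpr d\<^esub> A) (mpr d)" by (rule R.genideal_ideal) (simp add: A)
  have s: "A \<subseteq> Idl\<^bsub>mpr d\<^esub> A" by (rule R.genideal_self) (simp add: A)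
  show "pv.span (mults d A) \<subseteq> Idl\<^bsub>mpr d\<^esub> A"
    by (rule pv.span_minimal[OF _ ideal_mprD(1)[OF i]]) (use s Pm in \<open>auto simp: mults_def intro!: ideal_mprD(2)[OF i]\<close>)
qed

lemma hc_scale: "hc j (sp c p) = sp c (hc j p)"
  by (rule poly_mapping_eqI) (simp add: lookup_hc lookup_const_mult)

text \<open>A homogeneous element has at most one nonzero component, so taking components maps the
  span of \<open>B\<close> into the span of its members of the given degree.\<close>

lemma hid_span:
  assumes h: "\<And>b. b \<in> B \<Longrightarrow> \<exists>j. b \<in> hp d j"
    and m: "\<And>\<alpha> b. Poly_Mapping.keys \<alpha> \<subseteq> {..<d} \<Longrightarrow> b \<in> B \<Longrightarrow> mp_mono \<alpha> * b \<in> pv.span B"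
  shows "hid d (pv.span B)" "pv.span B \<inter> hp d j = pv.span (B \<inter> hp d j)"
proof -
  have hcs: "hc j x \<in> pv.span (B \<inter> hp d j)" if x: "x \<in> pv.span B" for x j
  proof -
    have "pv.subspace {x. hc j x \<in> pv.span (B \<inter> hp d j)}"
      by (rule pv.subspaceI) (auto simp: pv.span_zero hc_add hc_scale intro: pv.span_add pv.span_scale)
    then have "pv.span B \<subseteq> {x. hc j x \<in> pv.span (B \<inter> hp d j)}"
    proof (rule pv.span_minimal[rotated], intro subsetI CollectI)
      fix b assume b: "b \<in> B"
      obtain i where i: "b \<in> hp d i" using h[OF b] ..
      show "hc j b \<in> pv.span (B \<inter> hp d j)"
        by (cases "i = j") (use b i in \<open>auto simp: hc_of_hp[OF i] pv.span_zero intro: pv.span_base\<close>)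
    qed
    then show ?thesis using x by blast
  qed
  have Pd: "pv.span B \<subseteq> Pd d" by (rule pv.span_minimal[OF _ subspace_Pd]) (use h hp_Pd in blast)
  have mono: "pv.span (B \<inter> hp d j) \<subseteq> pv.span B" for j by (rule pv.span_mono) simp
  show "hid d (pv.span B)"
    unfolding hid_def
  proof (intro conjI ballI allI Pd pv.span_zero pv.span_add)
    show "p * x \<in> pv.span B" if p: "p \<in> Pd d" and x: "x \<in> pv.span B" for p x
      by (rule Pd_span_mult[OF _ p x]) (rule m)
    show "hc j x \<in> pv.span B" if "x \<in> pv.span B" for j x using hcs[OF that] mono by (rule subsetD[rotated])
  qed
  have "pv.span (B \<inter> hp d j) \<subseteq> hp d j"
    by (rule pv.span_minimal) (auto intro: pv.subspaceI hp_add hp_mult[OF hp_const, simplified])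
  moreover have "x \<in> pv.span (B \<inter> hp d j)" if "x \<in> pv.span B" "x \<in> hp d j" for x
    using hcs[OF that(1), of j] by (simp add: hc_of_hp[OF that(2)])
  ultimately show "pv.span B \<inter> hp d j = pv.span (B \<inter> hp d j)" using mono[of j] by blast
qed

text \<open>The zero polynomial is homogeneous of every degree, so generators sorted by nominal
  degree and by membership in \<open>hp d j\<close> agree only up to 0.\<close>

lemma span_up_to_0:
  assumes "X \<subseteq> insert 0 Y" "Y \<subseteq> insert 0 X"
  shows "pv.span X = pv.span Y"
  using pv.span_mono[OF assms(1)] pv.span_mono[OF assms(2)] by simp

lemma hp_unique: "x \<in> hp d i \<Longrightarrow> x \<in> hp d j \<Longrightarrow> x \<noteq> 0 \<Longrightarrow> i = j"
  using hc_of_hp[of x d i j] hc_of_hp[of x d j j] by (simp split: if_splits)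

text \<open>A generator of degree 0 in a proper ideal is a constant and hence 0, as is one of
  negative degree; such generators may be assigned degree 1.\<close>

lemma hid_finite_gens:
  fixes I :: "(nat, 'k::field) mpol set"
  assumes I: "hid d I" and ne: "I \<noteq> Pd d"
  shows "\<exists>(s :: nat) f dl. (\<forall>l<s. f l \<in> hp d (int (dl l)) \<and> 1 \<le> dl l \<and> f l \<in> I) \<and>
    (\<forall>x\<in>I. \<exists>c. (\<forall>l<s. c l \<in> Pd d) \<and> x = (\<Sum>l<s. c l * f l))"
proof -
  have I0: "0 \<in> I" and Ia: "x + y \<in> I" and Im: "p * x \<in> I" and Ih: "hc j x \<in> I" and IP: "x \<in> Pd d"
    if "x \<in> I" "y \<in> I" "p \<in> Pd d" for x y p j
    using I that unfolding hid_def by blast+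
  have z: "0 \<in> I" using I by (simp add: hid_def)
  have Id: "x - y \<in> I" if "x \<in> I" "y \<in> I" for x y
    using Ia[OF that(1) Im[OF that(2,2) Pd_uminus[OF Pd_1]] Pd_1] by simp
  define N where "N j = {y :: nat \<Rightarrow> (nat, 'k) mpol. y 0 \<in> I \<inter> hp d j \<and> (\<forall>b\<ge>1. y b = 0)}" for j :: int
  have "\<exists>r' e' G. gens d N r' e' G"
  proof (rule noether[where r=1 and e="\<lambda>_. 0"])
    show "gmod {..<d} XF N"
      unfolding gmod_def
    proof (intro allI conjI ballI)
      fix j a and y :: "nat \<Rightarrow> (nat, 'k) mpol" assume a: "a \<in> {..<d}" and y: "y \<in> N j"
      have "mp_var a * y 0 \<in> I" using y a by (intro Im[OF _ z] hp_Pd[OF hp_var]) (simp_all add: N_def)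
      moreover have "mp_var a * y 0 \<in> hp d (j + 1)" using y a hp_mult[OF hp_var[of a d], of "y 0" j] by (simp add: N_def add.commute)
      ultimately show "(\<lambda>b. mp_var a * y b) \<in> N (j + 1)" using y by (simp add: N_def)
    qed (auto simp: N_def z Id hp_diff)
    show "(\<lambda>b. mp_const c * y b) \<in> N j" if "y \<in> N j" for j c y
      using that Im[OF _ z Pd_const] hp_mult[OF hp_const[of c d], of "y 0" j] by (simp add: N_def)
    show "N j \<subseteq> Fm d 1 (\<lambda>_. 0) j" for j by (auto simp: N_def Fm_def)
  qed
  then obtain s e G where G: "gens d N s e G" by blast
  have Gb: "G b 0 \<in> I" "G b 0 \<in> hp d (e b)" if "b < s" for b using G that by (auto simp: gens_def N_def)
  have Gy: "\<exists>c\<in>Fm d s e j. \<forall>i. y i = (\<Sum>b<s. c b * G b i)" if "y \<in> N j" for y j using G that by (simp add: gens_def)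
  define f where "f b = G b 0" for b
  define dl where "dl b = max 1 (nat (e b))" for b
  have f: "f b \<in> hp d (int (dl b))" if b: "b < s" for b
  proof (cases "e b \<ge> 1")
    case True
    then show ?thesis using Gb(2)[OF b] by (simp add: f_def dl_def)
  next
    case False
    have "G b 0 = 0"
    proof (cases "e b = 0")
      case True
      have g0: "G b 0 \<in> hp d 0" using Gb(2)[OF b] True by simp
      define c where "c = lk (G b 0) 0"
      have Gc: "G b 0 = mp_const c"
      proof (rule poly_mapping_eqI)
        fix m show "lk (G b 0) m = lk (mp_const c) m"
          using hpD[OF g0, of m] by (cases "m = 0") (auto simp: c_def lookup_single when_def mono_deg_eq_0)
      qed
      have "c = 0"
      proof (rule ccontr)
        assume c: "c \<noteq> 0"
        have "mp_const (inverse c) * G b 0 \<in> I" by (rule Im[OF Gb(1)[OF b] z Pd_const])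
        then have "1 \<in> I" using c by (simp add: Gc mult_single)
        then have "p \<in> I" if "p \<in> Pd d" for p using Im[OF _ z that, of 1] by simp
        then show False using ne IP[OF _ z Pd_1] by blast
      qed
      then show ?thesis by (simp add: Gc)
    next
      case False
      then show ?thesis using hp_neg[OF _ Gb(2)[OF b]] \<open>\<not> e b \<ge> 1\<close> by simp
    qed
    then show ?thesis by (simp add: f_def)
  qed
  have rep: "\<exists>c. (\<forall>l<s. c l \<in> Pd d) \<and> x = (\<Sum>l<s. c l * f l)" if x: "x \<in> I" for x
  proof -
    have "\<forall>j. \<exists>c. c \<in> Fm d s e j \<and> hc j x = (\<Sum>b<s. c b * f b)"
    proof
      fix j
      have "(\<lambda>b. if b = 0 then hc j x else 0) \<in> N j"
        using Ih[OF x z Pd_1] hc_hp[OF IP[OF x z Pd_1]] by (simp add: N_def)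
      from Gy[OF this] obtain c where c: "c \<in> Fm d s e j" "\<forall>i. (if i = 0 then hc j x else 0) = (\<Sum>b<s. c b * G b i)" ..
      then show "\<exists>c. c \<in> Fm d s e j \<and> hc j x = (\<Sum>b<s. c b * f b)" unfolding f_def using c(2)[rule_format, of 0] by (intro exI[of _ c]) simp
    qed
    from choice[OF this] obtain c where c: "\<forall>j. c j \<in> Fm d s e j \<and> hc j x = (\<Sum>b<s. c j b * f b)" ..
    have "x = (\<Sum>j\<in>hdegs x. hc j x)" by (rule sum_hc[symmetric]) simp_all
    also have "\<dots> = (\<Sum>j\<in>hdegs x. \<Sum>b<s. c j b * f b)" using c by simp
    also have "\<dots> = (\<Sum>b<s. (\<Sum>j\<in>hdegs x. c j b) * f b)" by (subst sum.swap) (simp add: sum_distrib_right)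
    finally have "x = (\<Sum>b<s. (\<Sum>j\<in>hdegs x. c j b) * f b)" .
    moreover have "(\<Sum>j\<in>hdegs x. c j b) \<in> Pd d" if "b < s" for b
    proof (rule Pd_sum)
      fix j show "c j b \<in> Pd d" using c that by (auto simp: Fm_def intro: hp_Pd)
    qed
    ultimately show ?thesis by (intro exI[of _ "\<lambda>b. \<Sum>j\<in>hdegs x. c j b"]) simp
  qed
  show ?thesis
    by (rule exI[of _ s], rule exI[of _ f], rule exI[of _ dl]) (use f Gb(1) rep in \<open>auto simp: f_def dl_def\<close>)
qed

context rees
begin

section \<open>Powers as spans of monomials in the generators\<close>

definition PB :: "nat \<Rightarrow> (nat, 'k) mpol set" where
  "PB n = ev ` {\<epsilon>. Poly_Mapping.keys \<epsilon> \<subseteq> {..<d + s} \<and> wdeg tw \<epsilon> = n}"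

lemma PB_I: "Poly_Mapping.keys \<epsilon> \<subseteq> {..<d + s} \<Longrightarrow> wdeg tw \<epsilon> = n \<Longrightarrow> ev \<epsilon> \<in> PB n"
  by (auto simp: PB_def)

lemma ev_mono:
  assumes "Poly_Mapping.keys \<alpha> \<subseteq> {..<d}"
  shows "ev \<alpha> = mp_mono \<alpha>"
proof (rule mono_induct_keys[OF assms])
  fix v \<epsilon> assume "v \<in> {..<d}" "ev \<epsilon> = mp_mono \<epsilon>"
  then show "ev (Poly_Mapping.single v 1 + \<epsilon>) = mp_mono (Poly_Mapping.single v 1 + \<epsilon>)"
    by (simp add: mev_add yv_def mult_single)
qed simp

lemma PB_mult: "Poly_Mapping.keys \<alpha> \<subseteq> {..<d} \<Longrightarrow> b \<in> PB n \<Longrightarrow> mp_mono \<alpha> * b \<in> PB n"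
proof -
  assume \<alpha>: "Poly_Mapping.keys \<alpha> \<subseteq> {..<d}" and "b \<in> PB n"
  then obtain \<epsilon> where e: "b = ev \<epsilon>" "Poly_Mapping.keys \<epsilon> \<subseteq> {..<d + s}" "wdeg tw \<epsilon> = n" by (auto simp: PB_def)
  have "ev (\<alpha> + \<epsilon>) \<in> PB n" by (rule PB_I) (use \<alpha> e wdeg_tw_less[OF \<alpha>] in \<open>auto simp: keys_add_nat wdeg_add\<close>)
  then show ?thesis by (simp add: e(1) mev_add ev_mono[OF \<alpha>])
qed

lemma PB_hp: "b \<in> PB n \<Longrightarrow> \<exists>j. b \<in> hp d j"
  using ev_hp by (auto simp: PB_def)

lemma span_PB_0: "pv.span (PB 0) = Pd d"
proof (rule subset_antisym)
  show "pv.span (PB 0) \<subseteq> Pd d" by (rule pv.span_minimal[OF _ subspace_Pd]) (use PB_hp hp_Pd in blast)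
  have one: "1 \<in> pv.span (PB 0)" using PB_I[of 0 0] by (intro pv.span_base) simp
  have "p * 1 \<in> pv.span (PB 0)" if "p \<in> Pd d" for p
    by (rule Pd_span_mult[OF _ that one]) (rule pv.span_base[OF PB_mult])
  then show "Pd d \<subseteq> pv.span (PB 0)" by auto
qed

lemma span_PB_Suc: "pv.span (PB n) \<cdot>\<^bsub>mpr d\<^esub> pv.span (PB 1) = pv.span (PB (Suc n))"
proof (intro subset_antisym subsetI)
  fix x assume "x \<in> pv.span (PB n) \<cdot>\<^bsub>mpr d\<^esub> pv.span (PB 1)"
  then show "x \<in> pv.span (PB (Suc n))"
  proof (induction rule: ideal_prod.induct)
    case (prod i j)
    have "i * j \<in> pv.span (PB (Suc n))"
    proof (rule span_mult[OF _ prod(2)])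
      fix b assume "b \<in> PB 1"
      then obtain \<epsilon> where e: "b = ev \<epsilon>" "Poly_Mapping.keys \<epsilon> \<subseteq> {..<d + s}" "wdeg tw \<epsilon> = 1" by (auto simp: PB_def)
      have "b * i \<in> pv.span (PB (Suc n))"
      proof (rule span_mult[OF _ prod(1)])
        fix c assume "c \<in> PB n"
        then obtain \<epsilon>' where e': "c = ev \<epsilon>'" "Poly_Mapping.keys \<epsilon>' \<subseteq> {..<d + s}" "wdeg tw \<epsilon>' = n" by (auto simp: PB_def)
        have "ev (\<epsilon> + \<epsilon>') \<in> PB (Suc n)" by (rule PB_I) (use e e' in \<open>auto simp: keys_add_nat wdeg_add\<close>)
        then show "b * c \<in> pv.span (PB (Suc n))" by (simp add: e(1) e'(1) mev_add pv.span_base)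
      qed
      then show "i * b \<in> pv.span (PB (Suc n))" by (simp add: mult.commute)
    qed
    then show ?case by simp
  next
    case (sum a b)
    then show ?case by (simp add: pv.span_add)
  qed
next
  let ?P = "pv.span (PB n) \<cdot>\<^bsub>mpr d\<^esub> pv.span (PB 1)"
  have pr: "i * j \<in> ?P" if "i \<in> pv.span (PB n)" "j \<in> pv.span (PB 1)" for i j
    using ideal_prod.prod[OF that, of "mpr d"] by simp
  have sm: "a + b \<in> ?P" if "a \<in> ?P" "b \<in> ?P" for a b
    using ideal_prod.sum[OF that] by simp
  have sc: "sp c a \<in> ?P" if "a \<in> ?P" for a c
    using that
  proof (induction rule: ideal_prod.induct)
    case (prod i j)
    have "sp c i * j \<in> ?P" by (rule pr[OF pv.span_scale[OF prod(1)] prod(2)])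
    then show ?case by (simp add: mult.assoc)
  next
    case (sum a b)
    then show ?case using sm by (simp add: distrib_left)
  qed
  have "pv.subspace ?P"
    by (rule pv.subspaceI) (use pr[OF pv.span_zero pv.span_zero] sm sc in auto)
  moreover have "PB (Suc n) \<subseteq> ?P"
  proof
    fix b assume "b \<in> PB (Suc n)"
    then obtain \<epsilon> where e: "b = ev \<epsilon>" "Poly_Mapping.keys \<epsilon> \<subseteq> {..<d + s}" "wdeg tw \<epsilon> = Suc n" by (auto simp: PB_def)
    have "tw v \<le> 1" for v by (simp add: tw_def)
    from mono_split_wdeg[of tw n \<epsilon>, OF this] e(3) obtain \<epsilon>1 \<epsilon>2 where s: "\<epsilon> = \<epsilon>1 + \<epsilon>2" "wdeg tw \<epsilon>1 = n" by auto
    have "ev \<epsilon>1 \<in> PB n" "ev \<epsilon>2 \<in> PB 1" using e s by (auto intro!: PB_I simp: keys_add_nat wdeg_add)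
    then show "b \<in> ?P" unfolding e(1) s(1) mev_add by (intro pr pv.span_base)
  qed
  ultimately have "pv.span (PB (Suc n)) \<subseteq> ?P" by (intro pv.span_minimal)
  then show "x \<in> ?P" if "x \<in> pv.span (PB (Suc n))" for x using that by blast
qed

lemma ideal_power_PB: "ideal_power d (pv.span (PB 1)) n = pv.span (PB n)"
proof -
  interpret M: Group.comm_monoid "ideals_set (mpr d :: (nat, 'k) mpol ring)"
    by (rule cring.ideals_set_is_comm_monoid[OF cring_mpr])
  have m: "a \<otimes>\<^bsub>ideals_set (mpr d)\<^esub> b = a \<cdot>\<^bsub>mpr d\<^esub> b" for a b :: "(nat, 'k) mpol set" by (simp add: ideals_set_def)
  show ?thesis
  proof (induction n)
    case 0
    show ?case using M.nat_pow_0 by (simp add: ideals_set_def span_PB_0)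
  next
    case (Suc n)
    show ?case by (simp only: M.nat_pow_Suc m Suc span_PB_Suc)
  qed
qed

lemma span_PB_1:
  assumes I: "hid d I" and f: "\<And>l. l < s \<Longrightarrow> f l \<in> I"
    and r: "\<And>x. x \<in> I \<Longrightarrow> \<exists>c. (\<forall>l<s. c l \<in> Pd d) \<and> x = (\<Sum>l<s. c l * f l)"
  shows "pv.span (PB 1) = I"
proof (intro subset_antisym subsetI)
  have Im: "p * x \<in> I" if "p \<in> Pd d" "x \<in> I" for p x using I that by (simp add: hid_def)
  have "pv.subspace I" by (rule pv.subspaceI) (use I Im[OF Pd_const] in \<open>auto simp: hid_def\<close>)
  moreover have "PB 1 \<subseteq> I"
  proof
    fix b assume "b \<in> PB 1"
    then obtain \<epsilon> where e: "b = ev \<epsilon>" "Poly_Mapping.keys \<epsilon> \<subseteq> {..<d + s}" "wdeg tw \<epsilon> = 1" by (auto simp: PB_def)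
    then have "wdeg tw \<epsilon> \<noteq> 0" by simp
    then obtain v where v: "v \<in> Poly_Mapping.keys \<epsilon>" "tw v \<noteq> 0" unfolding wdeg_def by (auto elim: sum.not_neutral_contains_not_neutral)
    obtain \<nu> where \<nu>: "\<epsilon> = Poly_Mapping.single v 1 + \<nu>" using mono_remove[OF v(1)] by blast
    have v': "\<not> v < d" "v - d < s" using v e(2) by (auto simp: tw_def split: if_splits)
    have "ev \<nu> * f (v - d) \<in> I" by (rule Im[OF hp_Pd[OF ev_hp] f[OF v'(2)]]) (use e(2) in \<open>auto simp: \<nu> keys_add_nat\<close>)
    then show "b \<in> I" using v'(1) by (simp add: e(1) \<nu> mev_add yv_def mult.commute)
  qed
  ultimately have "pv.span (PB 1) \<subseteq> I" by (intro pv.span_minimal)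
  then show "x \<in> I" if "x \<in> pv.span (PB 1)" for x using that by blast
  fix x assume "x \<in> I"
  then obtain c where c: "\<forall>l<s. c l \<in> Pd d" "x = (\<Sum>l<s. c l * f l)" using r by blast
  have "c l * f l \<in> pv.span (PB 1)" if l: "l < s" for l
  proof (rule Pd_span_mult[OF pv.span_base[OF PB_mult]])
    have "ev (Poly_Mapping.single (d + l) 1) \<in> PB 1" by (rule PB_I) (use l in \<open>auto simp: tw_def\<close>)
    then show "f l \<in> pv.span (PB 1)" by (intro pv.span_base) (simp add: yv_def)
  qed (use c(1) l in auto)
  then show "x \<in> pv.span (PB 1)" unfolding c(2) by (intro pv.span_sum) simp
qed

text \<open>\<open>LB g\<close> spans the ideal in all degrees at once, while \<open>L g\<close>
  knows only its pieces; comparing pieces identifies the actual ideal with \<open>J n g\<close> and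
  transfers \<open>rees_linear\<close> to \<open>reg\<close>.\<close>

lemma rees_reg:
  assumes L: "\<And>g j. g \<in> S \<Longrightarrow> L g j = pv.span (LB g \<inter> hp d j)"
    and Lh: "\<And>g b. g \<in> S \<Longrightarrow> b \<in> LB g \<Longrightarrow> \<exists>j. b \<in> hp d j"
    and Lm: "\<And>g \<alpha> b. g \<in> S \<Longrightarrow> Poly_Mapping.keys \<alpha> \<subseteq> {..<d} \<Longrightarrow> b \<in> LB g \<Longrightarrow> mp_mono \<alpha> * b \<in> pv.span (LB g)"
  shows "\<exists>\<delta> e n0. \<forall>n\<ge>n0. eventually (\<lambda>g. reg d (pv.span (PB n \<union> LB g)) = int \<delta> * int n + int e) F"
proof -
  have eq: "reg d (pv.span (PB n \<union> LB g)) = maxz (hD d (J n g))" if g: "g \<in> S" for g n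
  proof -
    let ?B = "PB n \<union> LB g"
    have h: "\<exists>j. b \<in> hp d j" if "b \<in> ?B" for b using that PB_hp Lh[OF g] by blast
    have m: "mp_mono \<alpha> * b \<in> pv.span ?B" if \<alpha>: "Poly_Mapping.keys \<alpha> \<subseteq> {..<d}" and b: "b \<in> ?B" for \<alpha> b
    proof (cases "b \<in> PB n")
      case True
      from PB_mult[OF \<alpha> this] show ?thesis by (intro pv.span_base) simp
    next
      case False
      then have "mp_mono \<alpha> * b \<in> pv.span (LB g)" using Lm[OF g \<alpha>] b by blast
      moreover have "pv.span (LB g) \<subseteq> pv.span ?B" by (rule pv.span_mono) simp
      ultimately show ?thesis by blast
    qed
    have hd: "hid d (pv.span ?B)" by (rule hid_span(1)) (fact h, rule m)
    have "pv.span ?B \<inter> hp d j = J n g j" for j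
    proof -
      have "pv.span ?B \<inter> hp d j = pv.span (?B \<inter> hp d j)" by (rule hid_span(2)[OF h m])
      also have "\<dots> = pv.span (ev ` WJ n j \<union> (LB g \<inter> hp d j))"
      proof (rule span_up_to_0)
        show "ev ` WJ n j \<union> LB g \<inter> hp d j \<subseteq> insert 0 (?B \<inter> hp d j)" using WJ_hp by (auto simp: WJ_def intro: PB_I)
        show "?B \<inter> hp d j \<subseteq> insert 0 (ev ` WJ n j \<union> LB g \<inter> hp d j)"
        proof
          fix b assume b: "b \<in> ?B \<inter> hp d j"
          show "b \<in> insert 0 (ev ` WJ n j \<union> LB g \<inter> hp d j)"
          proof (cases "b \<in> PB n \<and> b \<noteq> 0")
            case True
            then obtain \<epsilon> where e: "b = ev \<epsilon>" "Poly_Mapping.keys \<epsilon> \<subseteq> {..<d + s}" "wdeg tw \<epsilon> = n" by (auto simp: PB_def)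
            have "int (wdeg wt \<epsilon>) = j" using hp_unique[OF ev_hp[OF e(2)], of j] b True by (simp add: e(1))
            then have "\<epsilon> \<in> WJ n j" using e by (simp add: WJ_def)
            then show ?thesis by (simp add: e(1))
          qed (use b in auto)
        qed
      qed
      also have "\<dots> = J n g j" unfolding J_eq L[OF g] span_Un_span ..
      finally show ?thesis .
    qed
    then have "(\<lambda>j. pv.span ?B \<inter> hp d j) = J n g" by (rule ext)
    then show ?thesis unfolding reg_eq[OF hd] maxz_def by (simp only:)
  qed
  obtain \<delta> e n0 where r: "\<forall>n\<ge>n0. eventually (\<lambda>g. maxz (hD d (J n g)) = int \<delta> * int n + int e) F"
    using rees_linear by blast
  have "eventually (\<lambda>g. reg d (pv.span (PB n \<union> LB g)) = int \<delta> * int n + int e) F" if "n0 \<le> n" for n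
    using ev_S r[rule_format, OF that] by (rule eventually_elim2) (simp add: eq)
  then show ?thesis by blast
qed

end

section \<open>The Zariski topology of the general linear group\<close>

abbreviation (input) pe :: "('v, 'k::field) mpol \<Rightarrow> ('v \<Rightarrow> 'k) \<Rightarrow> 'k" where
  "pe p a \<equiv> mp_subst (\<lambda>c. c) a p"

lemma pe_eq: "pe p a = (\<Sum>m\<in>Poly_Mapping.keys p. lk p m * mev a m)"
  by (simp add: mp_subst_def mev_def)

lemma pe_superset: "finite A \<Longrightarrow> Poly_Mapping.keys p \<subseteq> A \<Longrightarrow> pe p a = (\<Sum>m\<in>A. lk p m * mev a m)"
  unfolding pe_eq by (rule sum.mono_neutral_left) (auto simp: in_keys_iff)

lemma pe_0 [simp]: "pe 0 a = 0" by (simp add: pe_eq)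

lemma pe_add: "pe (p + q) a = pe p a + pe q a"
  using pe_superset[of "Poly_Mapping.keys p \<union> Poly_Mapping.keys q" p a]
    pe_superset[of "Poly_Mapping.keys p \<union> Poly_Mapping.keys q" q a]
    pe_superset[of "Poly_Mapping.keys p \<union> Poly_Mapping.keys q" "p + q" a] keys_add[of p q]
  by (simp add: lookup_add distrib_right sum.distrib)

lemma pe_sum: "pe (sum f A) a = (\<Sum>i\<in>A. pe (f i) a)"
  by (induction A rule: infinite_finite_induct) (simp_all add: pe_add)

lemma pe_single: "pe (Poly_Mapping.single m c) a = c * mev a m"
  by (simp add: pe_eq)

lemma pe_mult: "pe (p * q) a = pe p a * pe q a"
proof -
  have "p * q = (\<Sum>m\<in>Poly_Mapping.keys p. Poly_Mapping.single m (lk p m)) * (\<Sum>n\<in>Poly_Mapping.keys q. Poly_Mapping.single n (lk q n))"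
    by (rule arg_cong2[where f="(*)", OF poly_sum_monomials poly_sum_monomials])
  also have "\<dots> = (\<Sum>m\<in>Poly_Mapping.keys p. \<Sum>n\<in>Poly_Mapping.keys q. Poly_Mapping.single (m + n) (lk p m * lk q n))"
    by (simp add: sum_product mult_single)
  finally have "p * q = (\<Sum>m\<in>Poly_Mapping.keys p. \<Sum>n\<in>Poly_Mapping.keys q. Poly_Mapping.single (m + n) (lk p m * lk q n))" .
  then show ?thesis by (simp add: pe_sum pe_single mev_add pe_eq[where p=p] pe_eq[where p=q] sum_product ac_simps)
qed

lemma mp_vars_add: "mp_vars (p + q) \<subseteq> mp_vars p \<union> mp_vars q"
  using keys_add[of p q] by (auto simp: mp_vars_def)

lemma mp_vars_mult: "mp_vars (p * q :: ('v, 'k::field) mpol) \<subseteq> mp_vars p \<union> mp_vars q"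
  using keys_mult[of p q] by (fastforce simp: mp_vars_def keys_add_nat)

lemma mp_vars_const: "mp_vars (mp_const c) = {}" by (simp add: mp_vars_def)

lemma GL_iff: "g \<in> GL d \<longleftrightarrow> g \<in> carrier_mat d d \<and> det g \<noteq> (0 :: 'k::field)"
proof (intro iffI conjI)
  assume g: "g \<in> GL d"
  then show c: "g \<in> carrier_mat d d" by (simp add: GL_def)
  obtain B where B: "inverts_mat g B" "inverts_mat B g" using g by (auto simp: GL_def invertible_mat_def)
  have gB: "g * B = 1\<^sub>m d" and Bg: "B * g = 1\<^sub>m (dim_row B)" using B c by (auto simp: inverts_mat_def)
  have "dim_col B = d" using arg_cong[OF gB, of dim_col] by simp
  moreover have "dim_row B = d" using arg_cong[OF Bg, of dim_col] c by simp
  ultimately have "B \<in> carrier_mat d d" by auto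
  then have "det g * det B = 1" using det_mult[OF c, of B] gB by simp
  then show "det g \<noteq> 0" by auto
next
  assume g: "g \<in> carrier_mat d d \<and> det g \<noteq> 0"
  have "g \<in> Units (ring_mat TYPE('k) d ())" by (rule det_non_zero_imp_unit) (use g in auto)
  then obtain B where "B \<in> carrier_mat d d" "B * g = 1\<^sub>m d" "g * B = 1\<^sub>m d" by (auto simp: Units_def ring_mat_def)
  then show "g \<in> GL d" using g by (auto simp: GL_def invertible_mat_def inverts_mat_def)
qed

definition polyfun :: "('k::comm_ring_1 \<Rightarrow> 'k) \<Rightarrow> bool" where "polyfun h \<longleftrightarrow> (\<exists>q. \<forall>t. h t = poly q t)"

lemma polyfun_const: "polyfun (\<lambda>_. c)" unfolding polyfun_def by (rule exI[of _ "[:c:]"]) simp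
lemma polyfun_line: "polyfun (\<lambda>t. a + t * b)" unfolding polyfun_def by (rule exI[of _ "[:a, b:]"]) simp
lemma polyfun_add: "polyfun h \<Longrightarrow> polyfun h' \<Longrightarrow> polyfun (\<lambda>t. h t + h' t)"
  unfolding polyfun_def by (metis poly_add)
lemma polyfun_mult: "polyfun h \<Longrightarrow> polyfun h' \<Longrightarrow> polyfun (\<lambda>t. h t * h' t)"
  unfolding polyfun_def by (metis poly_mult)
lemma polyfun_power: "polyfun h \<Longrightarrow> polyfun (\<lambda>t. h t ^ n)"
  by (induction n) (simp_all add: polyfun_const polyfun_mult)
lemma polyfun_sum: "(\<And>i. i \<in> A \<Longrightarrow> polyfun (h i)) \<Longrightarrow> polyfun (\<lambda>t. \<Sum>i\<in>A. h i t)"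
  by (induction A rule: infinite_finite_induct) (simp_all add: polyfun_const polyfun_add)
lemma polyfun_prod: "(\<And>i. i \<in> A \<Longrightarrow> polyfun (h i)) \<Longrightarrow> polyfun (\<lambda>t. \<Prod>i\<in>A. h i t)"
  by (induction A rule: infinite_finite_induct) (simp_all add: polyfun_const polyfun_mult)

text \<open>Two nonempty principal open sets are joined by a line, on which both polynomials and the
  determinant restrict to nonzero univariate polynomials.\<close>

lemma GL_irreducible:
  fixes f1 f2 :: "(nat \<times> nat, 'k::field) mpol"
  assumes inf: "infinite (UNIV :: 'k set)" and v: "mp_vars f1 \<subseteq> {..<d} \<times> {..<d}" "mp_vars f2 \<subseteq> {..<d} \<times> {..<d}"
    and g1: "g1 \<in> GL d" "pe f1 (\<lambda>ij. g1 $$ ij) \<noteq> 0" and g2: "g2 \<in> GL d" "pe f2 (\<lambda>ij. g2 $$ ij) \<noteq> 0"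
  shows "\<exists>g\<in>GL d. pe f1 (\<lambda>ij. g $$ ij) \<noteq> 0 \<and> pe f2 (\<lambda>ij. g $$ ij) \<noteq> 0"
proof -
  define l where "l t = mat d d (\<lambda>ij. g1 $$ ij + t * (g2 $$ ij - g1 $$ ij))" for t
  have c: "g1 \<in> carrier_mat d d" "g2 \<in> carrier_mat d d" using g1(1) g2(1) by (simp_all add: GL_iff)
  have l0: "l 0 = g1" by (rule eq_matI) (use c in \<open>auto simp: l_def\<close>)
  have l1: "l 1 = g2" by (rule eq_matI) (use c in \<open>auto simp: l_def\<close>)
  have le: "polyfun (\<lambda>t. l t $$ ij)" if "ij \<in> {..<d} \<times> {..<d}" for ij
    using that by (auto simp: l_def polyfun_line)
  have pf: "polyfun (\<lambda>t. pe f (\<lambda>ij. l t $$ ij))" if f: "mp_vars f \<subseteq> {..<d} \<times> {..<d}" for f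
    unfolding mp_subst_def
  proof (intro polyfun_sum polyfun_mult polyfun_const polyfun_prod polyfun_power le)
    fix m v assume "m \<in> Poly_Mapping.keys f" "v \<in> Poly_Mapping.keys m"
    then show "v \<in> {..<d} \<times> {..<d}" using f by (auto simp: mp_vars_def)
  qed
  have lc: "l t \<in> carrier_mat d d" for t by (simp add: l_def)
  have dt: "polyfun (\<lambda>t. det (l t))"
    unfolding det_def'[OF lc]
  proof (intro polyfun_sum polyfun_mult polyfun_const polyfun_prod le)
    fix p i assume "p \<in> {p. p permutes {0..<d}}" "i \<in> {0..<d}"
    then show "(i, p i) \<in> {..<d} \<times> {..<d}" using permutes_in_image[of p "{0..<d}" i] by auto
  qed
  obtain q1 where q1: "\<And>t. pe f1 (\<lambda>ij. l t $$ ij) = poly q1 t" using pf[OF v(1)] by (auto simp: polyfun_def)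
  obtain q2 where q2: "\<And>t. pe f2 (\<lambda>ij. l t $$ ij) = poly q2 t" using pf[OF v(2)] by (auto simp: polyfun_def)
  obtain q3 where q3: "\<And>t. det (l t) = poly q3 t" using dt by (auto simp: polyfun_def)
  have "poly q1 0 \<noteq> 0" "poly q2 1 \<noteq> 0" "poly q3 0 \<noteq> 0"
    unfolding q1[symmetric] q2[symmetric] q3[symmetric] l0 l1 using g1 g2 by (simp_all add: GL_iff)
  \<comment> \<open>Each factor is nonzero at 0 or at 1, where the line passes through
    \<open>g1\<close> and \<open>g2\<close>; the product has finitely many roots in an infinite
    field.\<close>
  then have "q1 * q2 * q3 \<noteq> 0" by auto
  then have "finite {t. poly (q1 * q2 * q3) t = 0}" by (rule poly_roots_finite)
  then obtain t where "poly (q1 * q2 * q3) t \<noteq> 0" using inf by (metis (mono_tags, lifting) UNIV_eq_I mem_Collect_eq)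
  then have "pe f1 (\<lambda>ij. l t $$ ij) \<noteq> 0" "pe f2 (\<lambda>ij. l t $$ ij) \<noteq> 0" "l t \<in> GL d"
    by (simp_all add: GL_iff q1 q2 q3 lc)
  then show ?thesis by blast
qed

text \<open>Principal open sets suffice as a base. That two nonempty ones meet is
  \<open>GL_irreducible\<close>, so the filter is only unfolded over an infinite field.\<close>

definition Fz :: "nat \<Rightarrow> 'k::field mat filter" where
  "Fz d = Abs_filter (\<lambda>P. \<exists>f. mp_vars f \<subseteq> {..<d} \<times> {..<d} \<and> (\<exists>g\<in>GL d. pe f (\<lambda>ij. g $$ ij) \<noteq> 0) \<and>
     (\<forall>g\<in>GL d. pe f (\<lambda>ij. g $$ ij) \<noteq> 0 \<longrightarrow> P g))"

lemma one_GL: "1\<^sub>m d \<in> GL d" by (simp add: GL_iff)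

lemma eventually_Fz:
  assumes inf: "infinite (UNIV :: 'k::field set)"
  shows "eventually P (Fz d :: 'k mat filter) \<longleftrightarrow> (\<exists>f. mp_vars f \<subseteq> {..<d} \<times> {..<d} \<and>
    (\<exists>g\<in>GL d. pe f (\<lambda>ij. g $$ ij) \<noteq> 0) \<and> (\<forall>g\<in>GL d. pe f (\<lambda>ij. g $$ ij) \<noteq> 0 \<longrightarrow> P g))"
  unfolding Fz_def
proof (rule eventually_Abs_filter, rule is_filter.intro)
  show "\<exists>f. mp_vars f \<subseteq> {..<d} \<times> {..<d} \<and> (\<exists>g\<in>GL d. pe f (\<lambda>ij. (g :: 'k mat) $$ ij) \<noteq> 0) \<and>
     (\<forall>g\<in>GL d. pe f (\<lambda>ij. (g :: 'k mat) $$ ij) \<noteq> 0 \<longrightarrow> True)"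
    by (rule exI[of _ "mp_const 1"]) (use one_GL in \<open>auto simp: mp_vars_const pe_single simp del: single_one\<close>)
next
  fix P Q :: "'k mat \<Rightarrow> bool"
  assume "\<exists>f. mp_vars f \<subseteq> {..<d} \<times> {..<d} \<and> (\<exists>g\<in>GL d. pe f (\<lambda>ij. g $$ ij) \<noteq> 0) \<and> (\<forall>g\<in>GL d. pe f (\<lambda>ij. g $$ ij) \<noteq> 0 \<longrightarrow> P g)"
  then obtain f1 where f1: "mp_vars f1 \<subseteq> {..<d} \<times> {..<d}" "\<exists>g\<in>GL d. pe f1 (\<lambda>ij. g $$ ij) \<noteq> 0"
    "\<forall>g\<in>GL d. pe f1 (\<lambda>ij. g $$ ij) \<noteq> 0 \<longrightarrow> P g" by (elim exE conjE)
  obtain g1 where g1: "g1 \<in> GL d" "pe f1 (\<lambda>ij. g1 $$ ij) \<noteq> 0" using f1(2) ..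
  assume "\<exists>f. mp_vars f \<subseteq> {..<d} \<times> {..<d} \<and> (\<exists>g\<in>GL d. pe f (\<lambda>ij. g $$ ij) \<noteq> 0) \<and> (\<forall>g\<in>GL d. pe f (\<lambda>ij. g $$ ij) \<noteq> 0 \<longrightarrow> Q g)"
  then obtain f2 where f2: "mp_vars f2 \<subseteq> {..<d} \<times> {..<d}" "\<exists>g\<in>GL d. pe f2 (\<lambda>ij. g $$ ij) \<noteq> 0"
    "\<forall>g\<in>GL d. pe f2 (\<lambda>ij. g $$ ij) \<noteq> 0 \<longrightarrow> Q g" by (elim exE conjE)
  obtain g2 where g2: "g2 \<in> GL d" "pe f2 (\<lambda>ij. g2 $$ ij) \<noteq> 0" using f2(2) ..
  show "\<exists>f. mp_vars f \<subseteq> {..<d} \<times> {..<d} \<and> (\<exists>g\<in>GL d. pe f (\<lambda>ij. g $$ ij) \<noteq> 0) \<and>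
     (\<forall>g\<in>GL d. pe f (\<lambda>ij. g $$ ij) \<noteq> 0 \<longrightarrow> P g \<and> Q g)"
  proof (rule exI[of _ "f1 * f2"], intro conjI ballI impI)
    show "mp_vars (f1 * f2) \<subseteq> {..<d} \<times> {..<d}" using mp_vars_mult[of f1 f2] f1(1) f2(1) by blast
    show "\<exists>g\<in>GL d. pe (f1 * f2) (\<lambda>ij. g $$ ij) \<noteq> 0"
      using GL_irreducible[OF inf f1(1) f2(1) g1 g2] by (simp add: pe_mult)
    show "P g" "Q g" if "g \<in> GL d" "pe (f1 * f2) (\<lambda>ij. g $$ ij) \<noteq> 0" for g
      using that f1(3) f2(3) by (simp_all add: pe_mult)
  qed
next
  fix P Q :: "'k mat \<Rightarrow> bool" assume PQ: "\<forall>x. P x \<longrightarrow> Q x"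
    and "\<exists>f. mp_vars f \<subseteq> {..<d} \<times> {..<d} \<and> (\<exists>g\<in>GL d. pe f (\<lambda>ij. g $$ ij) \<noteq> 0) \<and> (\<forall>g\<in>GL d. pe f (\<lambda>ij. g $$ ij) \<noteq> 0 \<longrightarrow> P g)"
  then obtain f where f: "mp_vars f \<subseteq> {..<d} \<times> {..<d}" "\<exists>g\<in>GL d. pe f (\<lambda>ij. g $$ ij) \<noteq> 0"
    "\<forall>g\<in>GL d. pe f (\<lambda>ij. g $$ ij) \<noteq> 0 \<longrightarrow> P g" by (elim exE conjE)
  show "\<exists>f. mp_vars f \<subseteq> {..<d} \<times> {..<d} \<and> (\<exists>g\<in>GL d. pe f (\<lambda>ij. g $$ ij) \<noteq> 0) \<and> (\<forall>g\<in>GL d. pe f (\<lambda>ij. g $$ ij) \<noteq> 0 \<longrightarrow> Q g)"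
    by (rule exI[of _ f], intro conjI f(1,2)) (use f(3) PQ in simp)
qed

lemma Fz_nb: "infinite (UNIV :: 'k::field set) \<Longrightarrow> (Fz d :: 'k mat filter) \<noteq> bot"
  by (auto simp: trivial_limit_def eventually_Fz)

definition RFz :: "nat \<Rightarrow> ('k::field mat \<Rightarrow> 'k) set" where
  "RFz d = {a. \<exists>f. mp_vars f \<subseteq> {..<d} \<times> {..<d} \<and> a = (\<lambda>g. pe f (\<lambda>ij. g $$ ij))}"

lemma generic_Fz:
  assumes inf: "infinite (UNIV :: 'k::field set)"
  shows "generic (Fz d :: 'k mat filter) (GL d) (RFz d)"
proof
  show "(Fz d :: 'k mat filter) \<noteq> bot" by (rule Fz_nb[OF inf])
  show "eventually (\<lambda>g. g \<in> GL d) (Fz d :: 'k mat filter)"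
    unfolding eventually_Fz[OF inf]
    by (rule exI[of _ "mp_const 1"]) (use one_GL in \<open>auto simp: mp_vars_const pe_single simp del: single_one\<close>)
  show "(\<lambda>_. c) \<in> RFz d" for c :: 'k
    unfolding RFz_def by (intro CollectI exI[of _ "mp_const c"]) (simp add: mp_vars_const pe_single)
  fix a b :: "'k mat \<Rightarrow> 'k" assume "a \<in> RFz d"
  then obtain f where f: "mp_vars f \<subseteq> {..<d} \<times> {..<d}" "a = (\<lambda>g. pe f (\<lambda>ij. g $$ ij))" by (auto simp: RFz_def)
  show "(\<forall>g\<in>GL d. a g = 0) \<or> eventually (\<lambda>g. a g \<noteq> 0) (Fz d)"
    unfolding eventually_Fz[OF inf] using f by auto
  assume "b \<in> RFz d"
  then obtain h where h: "mp_vars h \<subseteq> {..<d} \<times> {..<d}" "b = (\<lambda>g. pe h (\<lambda>ij. g $$ ij))" by (auto simp: RFz_def)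
  show "(\<lambda>g. a g + b g) \<in> RFz d" unfolding RFz_def
    by (intro CollectI exI[of _ "f + h"]) (use f h mp_vars_add[of f h] in \<open>auto simp: pe_add\<close>)
  show "(\<lambda>g. a g * b g) \<in> RFz d" unfolding RFz_def
    by (intro CollectI exI[of _ "f * h"]) (use f h mp_vars_mult[of f h] in \<open>auto simp: pe_mult\<close>)
qed

lemma entry_RFz: "m < d \<Longrightarrow> j < d \<Longrightarrow> (\<lambda>g. g $$ (m, j)) \<in> RFz d"
  unfolding RFz_def by (intro CollectI exI[of _ "mp_var (m, j)"]) (simp add: pe_single mp_vars_def)

text \<open>A nonempty Zariski open set contains a nonempty principal one, so any competing value
  also holds generically, and a proper filter admits only one value.\<close>

lemma generic_value_eq:
  assumes inf: "infinite (UNIV :: 'k::field set)" and e: "eventually (\<lambda>g. f g = v) (Fz d :: 'k mat filter)"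
  shows "generic_value d f = v"
  unfolding generic_value_def
proof (rule the_equality)
  obtain q where q: "mp_vars q \<subseteq> {..<d} \<times> {..<d}" "\<exists>g\<in>GL d. pe q (\<lambda>ij. (g :: 'k mat) $$ ij) \<noteq> 0"
    "\<forall>g\<in>GL d. pe q (\<lambda>ij. g $$ ij) \<noteq> 0 \<longrightarrow> f g = v" using e unfolding eventually_Fz[OF inf] by (elim exE conjE)
  let ?U = "{g \<in> GL d. \<exists>f\<in>{q}. pe f (\<lambda>ij. g $$ ij) \<noteq> 0}"
  have "zariski_open_GL d ?U" unfolding zariski_open_GL_def by (rule exI[of _ "{q}"]) (use q(1) in simp)
  then show "\<exists>U. zariski_open_GL d U \<and> U \<noteq> {} \<and> (\<forall>g\<in>U. f g = v)"
    by (intro exI[of _ ?U]) (use q in auto)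
  fix w assume "\<exists>U. zariski_open_GL d U \<and> U \<noteq> {} \<and> (\<forall>g\<in>U. f g = w)"
  then obtain U where U: "zariski_open_GL d U" "U \<noteq> {}" "\<forall>g\<in>U. f g = w" by (elim exE conjE)
  obtain Q where Q: "\<forall>q\<in>Q. mp_vars q \<subseteq> {..<d} \<times> {..<d}" "U = {g \<in> GL d. \<exists>q\<in>Q. pe q (\<lambda>ij. g $$ ij) \<noteq> 0}"
    using U(1) unfolding zariski_open_GL_def by (elim exE conjE)
  obtain g q where gq: "g \<in> GL d" "q \<in> Q" "pe q (\<lambda>ij. g $$ ij) \<noteq> 0" using U(2) Q(2) by blast
  have "eventually (\<lambda>g. f g = w) (Fz d)" unfolding eventually_Fz[OF inf]
    by (rule exI[of _ q]) (use gq Q U(3) in auto)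
  from eventually_conj[OF e this] have "eventually (\<lambda>g. v = w) (Fz d :: 'k mat filter)" by (rule eventually_mono) auto
  then show "w = v" using Fz_nb[OF inf, of d] by (simp add: eventually_const_iff)
qed

section \<open>Powers of a homogeneous ideal modulo general linear forms\<close>

lemma hid_gmod:
  assumes M: "hid d M"
  shows "gmod {..<d} Xp (\<lambda>j. M \<inter> hp d j)"
  unfolding gmod_def
proof (intro allI conjI ballI)
  fix j x y
  have Mm: "p * x \<in> M" if "p \<in> Pd d" "x \<in> M" for p x using M that by (simp add: hid_def)
  have Ma: "u + v \<in> M" if "u \<in> M" "v \<in> M" for u v using M that by (simp add: hid_def)
  show "0 \<in> M \<inter> hp d j" using M by (simp add: hid_def)
  assume x: "x \<in> M \<inter> hp d j"
  show "x - y \<in> M \<inter> hp d j" if y: "y \<in> M \<inter> hp d j"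
  proof -
    have "- y \<in> M" using Mm[OF Pd_uminus[OF Pd_1], of y] y by simp
    then show ?thesis using Ma[of x "- y"] x y by (simp add: hp_diff)
  qed
  show "mp_var a * x \<in> M \<inter> hp d (j + 1)" if a: "a \<in> {..<d}" for a
    using Mm[OF hp_Pd[OF hp_var[of a d]], of x] hp_mult[OF hp_var[of a d], of x j] a x by (simp add: add.commute)
qed

lemma span_set_add: "pv.span A <+>\<^bsub>mpr d\<^esub> pv.span B = pv.span (A \<union> B)"
  unfolding pv.span_Un set_add_def' by auto

lemma homog_ideal_hid:
  assumes "homog_ideal d (I :: (nat, 'k::field) mpol set)"
  shows "hid d I"
proof -
  obtain A where A: "A \<subseteq> Pd d" "\<forall>p\<in>A. \<exists>j. homog_of_deg j p" "I = Idl\<^bsub>mpr d\<^esub> A"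
    using assms by (auto simp: homog_ideal_def)
  have h: "\<exists>j. a \<in> hp d j" if a: "a \<in> A" for a
  proof -
    obtain j where "homog_of_deg j a" using A(2) a by blast
    then have "a \<in> hp d j" using A(1) a by (auto simp: homog_of_deg_def hp_def Pd_def mp_vars_def)
    then show ?thesis ..
  qed
  show ?thesis unfolding A(3) Idl_span[OF A(1)]
  proof (rule hid_span(1))
    show "\<exists>j. b \<in> hp d j" if "b \<in> mults d A" for b by (rule mults_hp[OF h that])
  qed (rule mults_mult)
qed

lemma mono_span_hp: "pv.span (mp_mono ` {\<alpha>. Poly_Mapping.keys \<alpha> \<subseteq> {..<d} \<and> int (mono_deg \<alpha>) = j}) = hp d j"
proof (rule subset_antisym)
  let ?A = "{\<alpha>. Poly_Mapping.keys \<alpha> \<subseteq> {..<d} \<and> int (mono_deg \<alpha>) = j}"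
  show "pv.span (mp_mono ` ?A) \<subseteq> hp d j"
    by (rule pv.span_minimal) (auto intro: pv.subspaceI hp_single hp_add hp_mult[OF hp_const, simplified])
  show "hp d j \<subseteq> pv.span (mp_mono ` ?A)"
  proof
    fix p assume p: "p \<in> hp d j"
    have "Poly_Mapping.single m (lk p m) \<in> pv.span (mp_mono ` ?A)" if "m \<in> Poly_Mapping.keys p" for m
    proof -
      have "mp_mono m \<in> pv.span (mp_mono ` ?A)" using p that by (intro pv.span_base) (auto simp: hp_def)
      from pv.span_scale[OF this, of "lk p m"] show ?thesis by (simp add: mult_single)
    qed
    then have "(\<Sum>m\<in>Poly_Mapping.keys p. Poly_Mapping.single m (lk p m)) \<in> pv.span (mp_mono ` ?A)" by (rule pv.span_sum)
    then show "p \<in> pv.span (mp_mono ` ?A)" by (simp flip: poly_sum_monomials)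
  qed
qed

lemma finite_monos_deg: "finite {\<alpha> :: nat \<Rightarrow>\<^sub>0 nat. Poly_Mapping.keys \<alpha> \<subseteq> {..<d} \<and> int (mono_deg \<alpha>) = j}"
  by (rule finite_subset[OF _ finite_monos[OF finite_lessThan, of d "nat j"]]) auto

lemma row_form_hp: "row_form d g m \<in> hp d 1"
  unfolding row_form_def using hp_mult[OF hp_const hp_var] by (intro hp_sum) simp

text \<open>The polynomial ring is a constant family: as the filter is proper, a condition
  independent of \<open>g\<close> holds generically iff it holds, and \<open>generic_hD\<close>
  gives nonnegativity.\<close>

lemma reg_Pd_nonneg:
  assumes inf: "infinite (UNIV :: 'k::field set)"
  shows "0 \<le> reg d (Pd d :: (nat, 'k) mpol set)"
proof -
  interpret generic "Fz d :: 'k mat filter" "GL d" "RFz d" by (rule generic_Fz[OF inf])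
  define WM where "WM j = {\<alpha> :: nat \<Rightarrow>\<^sub>0 nat. Poly_Mapping.keys \<alpha> \<subseteq> {..<d} \<and> int (mono_deg \<alpha>) = j}" for j
  define bM where "bM \<alpha> g = (mp_mono \<alpha> :: (nat, 'k) mpol)" for \<alpha> and g :: "'k mat"
  have M: "spanfam WM bM g = hp d" for g
    by (rule ext) (simp add: spanfam_def WM_def bM_def mono_span_hp)
  have "regfam WM bM" unfolding regfam_def bM_def[abs_def] WM_def using finite_monos_deg regp_const by blast
  then have D: "finite {j - int p |p j. eventually (\<lambda>g. \<not> hz {..<d} Xp p (spanfam WM bM g) j) (Fz d)} \<and>
      {j - int p |p j. eventually (\<lambda>g. \<not> hz {..<d} Xp p (spanfam WM bM g) j) (Fz d)} \<subseteq> {0..}"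
    using generic_hD[of WM bM d] by (simp add: M gmod_hp)
  have hD: "{j - int p |p j. eventually (\<lambda>g. \<not> hz {..<d} Xp p (spanfam WM bM g) j) (Fz d)} = hD d (hp d :: int \<Rightarrow> (nat, 'k) mpol set)"
    using Fz_nb[OF inf, of d] by (simp add: M hD_def eventually_const_iff)
  have "hid d (Pd d :: (nat, 'k) mpol set)" by (auto simp: hid_def Pd_add Pd_mult intro: hp_Pd[OF hc_hp])
  moreover have "(\<lambda>j. Pd d \<inter> hp d j) = (hp d :: int \<Rightarrow> (nat, 'k) mpol set)" by (rule ext) (auto dest: hp_Pd)
  ultimately have "reg d (Pd d :: (nat, 'k) mpol set) = maxz (hD d (hp d :: int \<Rightarrow> (nat, 'k) mpol set))" by (simp add: reg_eq maxz_def)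
  moreover have "0 \<le> maxz (hD d (hp d :: int \<Rightarrow> (nat, 'k) mpol set))"
  proof (cases "hD d (hp d :: int \<Rightarrow> (nat, 'k) mpol set) = {}")
    case False
    from D have "finite (hD d (hp d :: int \<Rightarrow> (nat, 'k) mpol set))" "hD d (hp d :: int \<Rightarrow> (nat, 'k) mpol set) \<subseteq> {0..}"
      unfolding hD by simp_all
    from subsetD[OF this(2) Max_in[OF this(1) False]] show ?thesis using False by (simp add: maxz_def)
  qed (simp add: maxz_def)
  ultimately show ?thesis by simp
qed

theorem theorem5p1:
  fixes d i :: nat and I :: "(nat, 'k::field) mpol set"
  assumes "infinite (UNIV :: 'k set)"
    and "homog_ideal d I"
    and "CHAR('k) = 0 \<or>
         (\<forall>m \<in> mono_min_gens (gin_rev d I). \<forall>v. Poly_Mapping.lookup m v < CHAR('k))"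
    and "i \<le> d"
  shows "\<exists>\<delta> e :: nat. \<forall>\<^sub>F n in sequentially. sreg d i (ideal_power d I n) = int \<delta> * int n + int e"
proof -
  note inf = assms(1)
  have hI: "hid d I" by (rule homog_ideal_hid[OF assms(2)])
  let ?A = "\<lambda>g. row_form d g ` {i..<d}"
  have A: "?A g \<subseteq> Pd d" for g :: "'k mat" using row_form_hp hp_Pd by blast
  note Idl = Idl_span[OF A]
  show ?thesis
  proof (cases "I = Pd d")
    \<comment> \<open>The unit ideal is not generated in positive degrees. Its powers and their sums
      with linear forms are the whole ring, so the value is constant and the slope 0.\<close>
    case True
    interpret M: Group.comm_monoid "ideals_set (mpr d :: (nat, 'k) mpol ring)"
      by (rule cring.ideals_set_is_comm_monoid[OF cring_mpr])
    have "ideal_power d I n = Pd d" for n using M.nat_pow_one[of n] by (simp add: ideals_set_def True)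
    moreover have "Pd d <+>\<^bsub>mpr d\<^esub> Idl\<^bsub>mpr d\<^esub> ?A g = Pd d" for g :: "'k mat"
    proof -
      have m: "pv.span (mults d (?A g)) \<subseteq> Pd d"
        by (rule pv.span_minimal[OF _ subspace_Pd]) (use A in \<open>auto simp: mults_def intro!: Pd_mult hp_Pd[OF hp_single[OF _ refl]]\<close>)
      show ?thesis unfolding Idl set_add_def'
      proof (intro subset_antisym subsetI)
        fix x assume "x \<in> (\<Union>h\<in>Pd d. \<Union>k\<in>pv.span (mults d (?A g)). {h \<oplus>\<^bsub>mpr d\<^esub> k})"
        then show "x \<in> Pd d" using m by (auto intro!: Pd_add)
      next
        fix x :: "(nat, 'k) mpol" assume "x \<in> Pd d"
        then show "x \<in> (\<Union>h\<in>Pd d. \<Union>k\<in>pv.span (mults d (?A g)). {h \<oplus>\<^bsub>mpr d\<^esub> k})"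
          by (intro UN_I[of x] UN_I[of 0]) (simp_all add: pv.span_zero)
      qed
    qed
    ultimately have "sreg d i (ideal_power d I n) = reg d (Pd d :: (nat, 'k) mpol set)" for n
      unfolding sreg_def by (intro generic_value_eq[OF inf]) simp
    then show ?thesis using reg_Pd_nonneg[OF inf, of d]
      by (intro exI[of _ 0] exI[of _ "nat (reg d (Pd d :: (nat, 'k) mpol set))"]) simp
  next
    case False
    obtain s :: nat and f dl where f: "\<forall>l<s. f l \<in> hp d (int (dl l)) \<and> 1 \<le> dl l \<and> f l \<in> I"
      and rep: "\<forall>x\<in>I. \<exists>c. (\<forall>l<s. c l \<in> Pd d) \<and> x = (\<Sum>l<s. c l * f l)"
      using hid_finite_gens[OF hI False] by (elim exE conjE)
    interpret G: generic "Fz d :: 'k mat filter" "GL d" "RFz d" by (rule generic_Fz[OF inf])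
    \<comment> \<open>The pair \<open>(m, \<alpha>)\<close> stands for the monomial of
      \<open>\<alpha>\<close> times the linear form of row \<open>m\<close>, of degree one more than
      that of \<open>\<alpha>\<close>; its coefficients are entries of \<open>g\<close> or
      0.\<close>
    define WL where "WL j = {i..<d} \<times> {\<alpha> :: nat \<Rightarrow>\<^sub>0 nat. Poly_Mapping.keys \<alpha> \<subseteq> {..<d} \<and> int (mono_deg \<alpha>) = j - 1}" for j
    define bL where "bL w g = mp_mono (snd w) * row_form d g (fst w)" for w :: "nat \<times> (nat \<Rightarrow>\<^sub>0 nat)" and g :: "'k mat"
    define LB where "LB g = mults d (?A g)" for g :: "'k mat"
    have Lh: "\<exists>j. b \<in> hp d j" if "b \<in> LB g" for b g
      using that unfolding LB_def by (rule mults_hp[rotated]) (use row_form_hp in blast)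
    have Lm: "mp_mono \<alpha> * b \<in> pv.span (LB g)" if "Poly_Mapping.keys \<alpha> \<subseteq> {..<d}" "b \<in> LB g" for \<alpha> b g
      using that unfolding LB_def by (rule mults_mult)
    have b_hp: "mp_mono \<alpha> * row_form d g m \<in> hp d (int (mono_deg \<alpha>) + 1)" if "Poly_Mapping.keys \<alpha> \<subseteq> {..<d}" for \<alpha> m and g :: "'k mat"
      by (rule hp_mult[OF hp_single[OF that refl] row_form_hp])
    have L: "G.spanfam WL bL g j = pv.span (LB g \<inter> hp d j)" for g j
      unfolding G.spanfam_def
    proof (rule span_up_to_0)
      show "(\<lambda>w. bL w g) ` WL j \<subseteq> insert 0 (LB g \<inter> hp d j)"
      proof (rule image_subsetI)
        fix w assume w: "w \<in> WL j"
        have "bL w g \<in> hp d j" using b_hp[of "snd w" g "fst w"] w by (auto simp: WL_def bL_def)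
        moreover have "bL w g \<in> LB g" using w unfolding bL_def LB_def mults_def
          by (intro CollectI exI[of _ "snd w"] exI[of _ "row_form d g (fst w)"]) (auto simp: WL_def)
        ultimately show "bL w g \<in> insert 0 (LB g \<inter> hp d j)" by simp
      qed
      show "LB g \<inter> hp d j \<subseteq> insert 0 ((\<lambda>w. bL w g) ` WL j)"
      proof
        fix b assume b: "b \<in> LB g \<inter> hp d j"
        then obtain \<alpha> m where m: "b = mp_mono \<alpha> * row_form d g m" "Poly_Mapping.keys \<alpha> \<subseteq> {..<d}" "m \<in> {i..<d}"
          by (auto simp: LB_def mults_def)
        show "b \<in> insert 0 ((\<lambda>w. bL w g) ` WL j)"
        proof (cases "b = 0")
          case False
          have "int (mono_deg \<alpha>) + 1 = j" using hp_unique[OF b_hp[OF m(2), of g m], of j] b False by (simp add: m(1))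
          then have "(m, \<alpha>) \<in> WL j" using m by (simp add: WL_def)
          then have "bL (m, \<alpha>) g \<in> (\<lambda>w. bL w g) ` WL j" by (rule imageI)
          then show ?thesis by (simp add: bL_def m(1))
        qed simp
      qed
    qed
    have hL: "hid d (pv.span (LB g))" and LL: "pv.span (LB g) \<inter> hp d j = pv.span (LB g \<inter> hp d j)" for g j
      by (rule hid_span, erule Lh, erule (1) Lm)+
    have L': "G.spanfam WL bL g = (\<lambda>j. pv.span (LB g) \<inter> hp d j)" for g
      by (rule ext) (simp only: L LL)
    interpret X: rees "Fz d :: 'k mat filter" "GL d" "RFz d" d s f dl WL bL
    proof
      show "f l \<in> hp d (int (dl l))" "1 \<le> dl l" if "l < s" for l using f that by simp_all
      have "G.regp (bL w)" if w: "w \<in> WL j" for w j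
        unfolding bL_def[abs_def] row_form_def
        by (intro G.regp_mono G.regp_sum G.regp_scale G.regp_const entry_RFz) (use w in \<open>auto simp: WL_def\<close>)
      moreover have "finite (WL j)" for j unfolding WL_def by (intro finite_cartesian_product finite_monos_deg) simp
      ultimately show "G.regfam WL bL" by (simp add: G.regfam_def)
      show "G.spanfam WL bL g j \<subseteq> hp d j" for g j by (simp add: L')
      show "gmod {..<d} Xp (G.spanfam WL bL g)" for g unfolding L' by (rule hid_gmod[OF hL])
    qed
    have I1: "pv.span (X.PB 1) = I" by (rule X.span_PB_1[OF hI]) (use f rep in simp_all)
    have "\<exists>\<delta> e n0. \<forall>n\<ge>n0. eventually (\<lambda>g. reg d (pv.span (X.PB n \<union> LB g)) = int \<delta> * int n + int e) (Fz d)"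
      by (rule X.rees_reg[OF L]) (erule Lh, erule (1) Lm)
    then obtain \<delta> e n0 where r: "\<forall>n\<ge>n0. eventually (\<lambda>g. reg d (pv.span (X.PB n \<union> LB g)) = int \<delta> * int n + int e) (Fz d)"
      by (elim exE)
    \<comment> \<open>The open set on which the value is attained may depend on \<open>n\<close>, as
      \<open>generic_value\<close> is taken for each \<open>n\<close> separately.\<close>
    have "sreg d i (ideal_power d I n) = int \<delta> * int n + int e" if "n0 \<le> n" for n
      unfolding sreg_def
    proof (rule generic_value_eq[OF inf])
      have "ideal_power d I n <+>\<^bsub>mpr d\<^esub> Idl\<^bsub>mpr d\<^esub> ?A g = pv.span (X.PB n \<union> LB g)" for g
        using X.ideal_power_PB[of n] unfolding I1 Idl LB_def by (simp add: span_set_add)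
      then show "eventually (\<lambda>g. reg d (ideal_power d I n <+>\<^bsub>mpr d\<^esub> Idl\<^bsub>mpr d\<^esub> ?A g) = int \<delta> * int n + int e) (Fz d)"
        using r that by simp
    qed
    then show ?thesis unfolding eventually_sequentially by blast
  qed
qed

end
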